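(* Let $\mathbb{G}$ be a stratified group of homogeneous dimension $Q$, equipped with a homogeneous distance $d$. Let $\Sigma\subset\mathbb{G}$ be a parametrized $\mathbb{G}$-regular hypersurface with associated perimeter measure $\sigma_\Sigma$ and horizontal normal $\nu_\Sigma$, and let $x\in\Sigma$. Then $$\theta^{Q-1}(\sigma_\Sigma,x)=\beta\big(d,\nu_\Sigma(x)\big).$$
   Context: **Stratified group.** $\mathbb{G}=V_1\oplus\cdots\oplus V_\iota$ is a graded finite-dimensional real vector space of dimension $n$, with a simply connected nilpotent Lie group structure given by the Baker-Campbell-Hausdorff product (the group is identified with its Lie algebra through the exponential map, with unit $0$). Its Lie algebra of left invariant vector fields is graded, $\mathcal{G}=\mathcal{V}_1\oplus\cdots\oplus\mathcal{V}_\iota$, where $\mathcal{V}_j$ consists of the left invariant fields whose value at $0$ lies in $V_j$. It satisfies $[\mathcal{V}_1,\mathcal{V}_j]=\mathcal{V}_{j+1}$ for all $j\ge1$, with $\mathcal{V}_i=\{0\}$ for $i>\iota$ and $V_\iota\ne\{0\}$. The dilations are $\delta_r(v)=r^jv$ for $v\in V_j$, $r>0$, extended linearly. $Q=\sum_j j\dim V_j$ is the homogeneous (Hausdorff) dimension. The horizontal fiber at $x$ is $H_x\mathbb{G}=\{X(x):X\in\mathcal{V}_1\}$, and $H\mathbb{G}$ is the horizontal subbundle. **Homogeneous distance.** A continuous left invariant distance $d$ on $\mathbb{G}$ with $d(\delta_rx,\delta_ry)=r\,d(x,y)$ for all $x,y\in\mathbb{G}$, $r>0$. Closed balls are $\mathbb{B}(y,r)=\{z:d(z,y)\le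 r\}$, $r>0$. Such a $d$ is fixed. **Basis, scalar product, measure.** A basis $(e_1,\dots,e_n)$ of $\mathbb{G}$ adapted to the grading (consecutive blocks are bases of $V_1,\dots,V_\iota$) is fixed, together with the scalar product making it orthonormal, with norm $|\cdot|$. Its restriction to $V_1$ defines by left translation a scalar product on every $H_x\mathbb{G}$, and $H_x\mathbb{G}$ is identified with $V_1$ by left invariance. $\mu$ is the Haar measure equal to the Lebesgue measure $\mathcal{L}^n$ in the coordinates of this basis. $\mathrm{div}$ is the divergence with respect to $\mu$, i.e. the standard divergence in these coordinates. **$\mathbb{G}$-regular hypersurfaces.** For $\Omega\subset\mathbb{G}$ open, $\mathcal{C}^1_h(\Omega)$ is the space of functions $f:\Omega\to\mathbb{R}$ such that for every $X\in\mathcal{V}_1$ the derivative $Xf(x)=\lim_{t\to0}\frac{f(\Phi^X_t(x))-f(x)}{t}$ ($\Phi^X$ the flow of $X$) exists at all $x\in\Omega$ and is continuous in $\Omega$. The horizontal differential $d_hf(x):H_x\mathbb{G}\to\mathbb{R}$ is $d_hf(x)(X(x))=Xf(x)$ for $X\in\mathcal{V}_1$. A parametrized $\mathbb{G}$-regular hypersurface is a set $\Sigma=f^{-1}(0)$ with $f\in\mathcal{C}^1_h(\Omega)$, $\Omega\subset\mathbb{G}$ open, and $d_hf$ everywhere nonvanishing; $f$ is called its defining function. Its perimeter measure is the Borel measure on $\Omega$ determined on open sets $O\subset\Omega$ by $$\sigma_\Sigma(O)=\sup\Big\{\int_{E_f}\mathrm{div}X\,d\mu: X\in C^1_c(O,H\mathbb{G}),\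 |X|\le1\Big\},\qquad E_f=\{x\in\Omega:f(x)<0\}.$$ Its horizontal normal, at $y\in\Sigma$, is $\nu_\Sigma(y)=\nabla_Hf(y)/|\nabla_Hf(y)|$, where $\nabla_Hf=(X_1f,\dots,X_mf)$ for an orthonormal basis $(X_1,\dots,X_m)$ of $\mathcal{V}_1$, regarded as the vector $\sum_jX_jf(y)\,X_j(0)$ of $V_1$ (its sign is immaterial). **Spherical Federer density.** With $\mathcal{F}_b$ the family of all closed balls of positive radius with respect to $d$, $$\theta^{Q-1}(\sigma_\Sigma,x)=\inf_{\varepsilon>0}\sup\Big\{\frac{\sigma_\Sigma(\mathbb{B})}{2^{-(Q-1)}\mathrm{diam}(\mathbb{B})^{Q-1}}: x\in\mathbb{B}\in\mathcal{F}_b,\ \mathrm{diam}(\mathbb{B})<\varepsilon\Big\},$$ where only $\varepsilon$ small enough that these balls lie in $\Omega$ matter. **The function $\beta$.** $\mathcal{H}^{n-1}$ is the $(n-1)$-dimensional Hausdorff measure with respect to the Euclidean distance of the fixed scalar product, normalized to agree with Lebesgue measure on $(n-1)$-dimensional linear subspaces. For $\nu\in V_1\setminus\{0\}$ let $N(\nu)=\nu^\bot\oplus V_2\oplus\cdots\oplus V_\iota$, where $\nu^\bot$ is the orthogonal complement of $\nu$ in $V_1$, and $$\beta(d,\nu)=\max_{z\in\mathbb{B}(0,1)}\mathcal{H}^{n-1}\big(\mathbb{B}(z,1)\cap N(\nu)\big).$$ *)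

theory Defs
  imports "HOL-Analysis.Analysis"
begin

section \<open>Left invariant fields on a vector space with a group operation\<close>

text \<open>
  The underlying vector space is a type \<open>'a :: euclidean_space\<close>. Its \<open>Basis\<close> is the fixed
  (adapted) basis, its inner product is the scalar product making this basis orthonormal, and
  \<open>lborel\<close> is Lebesgue measure in the corresponding coordinates. Vector fields are identified
  with maps \<open>'a \<Rightarrow> 'a\<close> through these linear coordinates. The group operation is an arbitrary
  function \<open>gmul\<close>; its properties are collected in the locale \<open>stratified_group\<close> below.
\<close>

definition left_invariant :: "('a \<Rightarrow> 'a \<Rightarrow> 'a) \<Rightarrow> ('a \<Rightarrow> 'a::euclidean_space) \<Rightarrow> bool" where
  "left_invariant gmul X \<longleftrightarrow>
     (\<forall>x y. X (gmul x y) = frechet_derivative (gmul x) (at y) (X y))"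

text \<open>The left invariant field with value \<open>v\<close> at the unit \<open>0\<close>.\<close>
definition left_field :: "('a \<Rightarrow> 'a \<Rightarrow> 'a) \<Rightarrow> 'a \<Rightarrow> 'a \<Rightarrow> 'a::euclidean_space" where
  "left_field gmul v x = frechet_derivative (gmul x) (at 0) v"

definition lie_bracket :: "('a \<Rightarrow> 'a) \<Rightarrow> ('a \<Rightarrow> 'a) \<Rightarrow> 'a \<Rightarrow> 'a::euclidean_space" where
  "lie_bracket X Y x = frechet_derivative Y (at x) (X x) - frechet_derivative X (at x) (Y x)"

text \<open>The bracket of the Lie algebra of left invariant fields, transported to the underlying
  vector space by evaluating fields at \<open>0\<close>.\<close>
definition group_bracket :: "('a \<Rightarrow> 'a \<Rightarrow> 'a) \<Rightarrow> 'a \<Rightarrow> 'a \<Rightarrow> 'a::euclidean_space" where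
  "group_bracket gmul v w = lie_bracket (left_field gmul v) (left_field gmul w) 0"

text \<open>The space of left invariant fields whose value at \<open>0\<close> lies in \<open>W\<close>.\<close>
definition fields :: "('a \<Rightarrow> 'a \<Rightarrow> 'a) \<Rightarrow> 'a set \<Rightarrow> ('a \<Rightarrow> 'a::euclidean_space) set" where
  "fields gmul W = {X. left_invariant gmul X \<and> X 0 \<in> W}"

text \<open>The linear span of the brackets \<open>[X, Y]\<close>. Finite sums suffice, because the sets
  \<open>\<X>\<close> to which this is applied are closed under scalar multiplication.\<close>
definition bracket_span ::
  "('a \<Rightarrow> 'a) set \<Rightarrow> ('a \<Rightarrow> 'a) set \<Rightarrow> ('a \<Rightarrow> 'a::euclidean_space) set" where
  "bracket_span \<X> \<Y> = {(\<lambda>x. \<Sum>i<k. lie_bracket (X i) (Y i) x) | (k::nat) X Y.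
     \<forall>i<k. X i \<in> \<X> \<and> Y i \<in> \<Y>}"


section \<open>The Baker-Campbell-Hausdorff product\<close>

text \<open>\<open>[a\<^sub>1, [a\<^sub>2, \<dots> [a\<^sub>k\<^sub>-\<^sub>1, a\<^sub>k] \<dots>]]\<close>\<close>
fun nested_bracket :: "('a \<Rightarrow> 'a \<Rightarrow> 'a) \<Rightarrow> 'a list \<Rightarrow> 'a::zero" where
  "nested_bracket br [] = 0"
| "nested_bracket br [a] = a"
| "nested_bracket br (a # b # as) = br a (nested_bracket br (b # as))"

definition dynkin_degree :: "(nat \<times> nat) list \<Rightarrow> nat" where
  "dynkin_degree ps = (\<Sum>(r, s)\<leftarrow>ps. r + s)"

definition dynkin_indices :: "nat \<Rightarrow> (nat \<times> nat) list set" where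
  "dynkin_indices N =
     {ps. ps \<noteq> [] \<and> (\<forall>(r, s)\<in>set ps. 0 < r + s) \<and> dynkin_degree ps \<le> N}"

lemma finite_dynkin_indices: "finite (dynkin_indices N)"
proof (rule finite_subset)
  have *: "(\<forall>(r, s)\<in>set ps. 0 < r + s) \<Longrightarrow>
      length ps \<le> dynkin_degree ps \<and> (\<forall>(r, s)\<in>set ps. r \<le> dynkin_degree ps \<and> s \<le> dynkin_degree ps)"
    for ps by (induction ps) (fastforce simp: dynkin_degree_def)+
  show "dynkin_indices N \<subseteq> {ps. set ps \<subseteq> {..N} \<times> {..N} \<and> length ps \<le> N}"
    unfolding dynkin_indices_def using * by fastforce
  show "finite {ps. set ps \<subseteq> {..N} \<times> {..N} \<and> length ps \<le> N}"
    by (rule finite_lists_length_le) simp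
qed

text \<open>
  Dynkin's form of the Baker-Campbell-Hausdorff series: the sum over \<open>k \<ge> 1\<close> and
  \<open>(r\<^sub>1, s\<^sub>1), \<dots>, (r\<^sub>k, s\<^sub>k)\<close> with \<open>r\<^sub>i + s\<^sub>i > 0\<close> of
  \<open>(-1)\<^sup>k\<^sup>+\<^sup>1 / (k (\<Sum>\<^sub>i r\<^sub>i + s\<^sub>i) \<Prod>\<^sub>i r\<^sub>i! s\<^sub>i!) [x\<^sup>r\<^sup>1 y\<^sup>s\<^sup>1 \<dots> x\<^sup>r\<^sup>k y\<^sup>s\<^sup>k]\<close>.
  In a nilpotent Lie algebra of step \<open>N\<close> the terms of degree greater than \<open>N\<close> vanish.
\<close>
definition bch :: "('a \<Rightarrow> 'a \<Rightarrow> 'a) \<Rightarrow> nat \<Rightarrow> 'a \<Rightarrow> 'a \<Rightarrow> 'a::real_vector" where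
  "bch br N x y = (\<Sum>ps\<in>dynkin_indices N.
     ((-1) ^ (length ps + 1) /
       (real (length ps) * real (dynkin_degree ps) * (\<Prod>(r, s)\<leftarrow>ps. fact r * fact s))) *\<^sub>R
     nested_bracket br (concat (map (\<lambda>(r, s). replicate r x @ replicate s y) ps)))"


section \<open>Stratified groups and homogeneous distances\<close>

text \<open>
  \<open>V j\<close> is the layer of degree \<open>j \<ge> 1\<close> (\<open>V 0\<close> is unused), \<open>\<iota>\<close> is the step. The group laws are a
  consequence of the remaining axioms; they are listed because \<open>gmul\<close> is required to be a group
  operation to begin with. Smoothness of the group is not listed: by \<open>bracket_bilinear\<close> and
  \<open>gmul_bch\<close> the operation is a polynomial map.
\<close>
locale stratified_group =
  fixes V :: "nat \<Rightarrow> 'a::euclidean_space set"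
    and \<iota> :: nat
    and gmul :: "'a \<Rightarrow> 'a \<Rightarrow> 'a"
  assumes layer_subspace: "\<And>j. 1 \<le> j \<Longrightarrow> subspace (V j)"
    and direct_sum: "\<And>x. \<exists>!u. u \<in> (\<Pi>\<^sub>E j\<in>{1..\<iota>}. V j) \<and> (\<Sum>j=1..\<iota>. u j) = x"
    and top_layer: "1 \<le> \<iota>" "V \<iota> \<noteq> {0}"
    and layer_beyond: "\<And>j. \<iota> < j \<Longrightarrow> V j = {0}"
    and adapted_basis: "Basis \<subseteq> (\<Union>j\<in>{1..\<iota>}. V j)"
    and group_gmul: "group gmul 0 uminus"
    and bracket_bilinear: "bilinear (group_bracket gmul)"
    and bracket_alternating: "\<And>v. group_bracket gmul v v = 0"
    and bracket_jacobi: "\<And>u v w. group_bracket gmul u (group_bracket gmul v w)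
        + group_bracket gmul v (group_bracket gmul w u)
        + group_bracket gmul w (group_bracket gmul u v) = 0"
    and gmul_bch: "\<And>x y. gmul x y = bch (group_bracket gmul) \<iota> x y"
    and stratified: "\<And>j. 1 \<le> j \<Longrightarrow>
        bracket_span (fields gmul (V 1)) (fields gmul (V j)) = fields gmul (V (j + 1))"

definition hom_dim :: "(nat \<Rightarrow> 'a::euclidean_space set) \<Rightarrow> nat \<Rightarrow> nat" where
  "hom_dim V \<iota> = (\<Sum>j=1..\<iota>. j * dim (V j))"

definition dilation :: "(nat \<Rightarrow> 'a::euclidean_space set) \<Rightarrow> nat \<Rightarrow> real \<Rightarrow> 'a \<Rightarrow> 'a" where
  "dilation V \<iota> r = (THE L. linear L \<and> (\<forall>j\<in>{1..\<iota>}. \<forall>v\<in>V j. L v = r ^ j *\<^sub>R v))"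

locale homogeneous_distance =
  fixes V :: "nat \<Rightarrow> 'a::euclidean_space set"
    and \<iota> :: nat
    and gmul :: "'a \<Rightarrow> 'a \<Rightarrow> 'a"
    and d :: "'a \<Rightarrow> 'a \<Rightarrow> real"
  assumes metric: "Metric_space UNIV d"
    and dist_continuous: "continuous_on UNIV (\<lambda>(x, y). d x y)"
    and dist_left_invariant: "\<And>x y z. d (gmul z x) (gmul z y) = d x y"
    and dist_homogeneous:
      "\<And>x y r. 0 < r \<Longrightarrow> d (dilation V \<iota> r x) (dilation V \<iota> r y) = r * d x y"

abbreviation dball :: "('a \<Rightarrow> 'a \<Rightarrow> real) \<Rightarrow> 'a \<Rightarrow> real \<Rightarrow> 'a set" where
  "dball d \<equiv> Metric_space.mcball UNIV d"

definition ddiam :: "('a \<Rightarrow> 'a \<Rightarrow> real) \<Rightarrow> 'a set \<Rightarrow> real" where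
  "ddiam d S = (SUP (x, y)\<in>S \<times> S. d x y)"


section \<open>Regular hypersurfaces\<close>

text \<open>In the definitions below the argument \<open>W\<close> stands for the first layer \<open>V 1\<close>. Functions
  \<open>f\<close> defined on an open set \<open>\<Omega>\<close> are total functions of which only the values on \<open>\<Omega>\<close> matter.\<close>

definition flow :: "('a \<Rightarrow> 'a) \<Rightarrow> real \<Rightarrow> 'a \<Rightarrow> 'a::euclidean_space" where
  "flow X t x =
     (THE c. c 0 = x \<and> (\<forall>s. (c has_vector_derivative X (c s)) (at s))) t"

definition deriv_along :: "('a \<Rightarrow> 'a) \<Rightarrow> ('a \<Rightarrow> real) \<Rightarrow> 'a::euclidean_space \<Rightarrow> real" where
  "deriv_along X f x = Lim (at 0) (\<lambda>t. (f (flow X t x) - f x) / t)"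

definition C1h :: "('a \<Rightarrow> 'a \<Rightarrow> 'a) \<Rightarrow> 'a set \<Rightarrow> 'a set \<Rightarrow> ('a::euclidean_space \<Rightarrow> real) set" where
  "C1h gmul W \<Omega> = {f. \<forall>X\<in>fields gmul W.
     (\<forall>x\<in>\<Omega>. \<exists>l. ((\<lambda>t. (f (flow X t x) - f x) / t) \<longlongrightarrow> l) (at 0)) \<and>
     continuous_on \<Omega> (deriv_along X f)}"

definition horizontal_fiber :: "('a \<Rightarrow> 'a \<Rightarrow> 'a) \<Rightarrow> 'a set \<Rightarrow> 'a \<Rightarrow> 'a::euclidean_space set" where
  "horizontal_fiber gmul W x = {X x | X. X \<in> fields gmul W}"

definition horizontal_differential ::
  "('a \<Rightarrow> 'a \<Rightarrow> 'a) \<Rightarrow> 'a set \<Rightarrow> ('a \<Rightarrow> real) \<Rightarrow> 'a \<Rightarrow> 'a::euclidean_space \<Rightarrow> real" where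
  "horizontal_differential gmul W f x w =
     deriv_along (THE X. X \<in> fields gmul W \<and> X x = w) f x"

definition regular_hypersurface ::
  "('a \<Rightarrow> 'a \<Rightarrow> 'a) \<Rightarrow> 'a set \<Rightarrow> 'a set \<Rightarrow> ('a \<Rightarrow> real) \<Rightarrow> 'a::euclidean_space set \<Rightarrow> bool" where
  "regular_hypersurface gmul W \<Omega> f S \<longleftrightarrow>
     open \<Omega> \<and> f \<in> C1h gmul W \<Omega> \<and>
     (\<forall>x\<in>\<Omega>. \<exists>w\<in>horizontal_fiber gmul W x. horizontal_differential gmul W f x w \<noteq> 0) \<and>
     S = {x \<in> \<Omega>. f x = 0}"

text \<open>For an adapted basis, \<open>Basis \<inter> W\<close> is an orthonormal basis of the first layer \<open>W\<close>.\<close>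
definition horizontal_gradient ::
  "('a \<Rightarrow> 'a \<Rightarrow> 'a) \<Rightarrow> 'a set \<Rightarrow> ('a \<Rightarrow> real) \<Rightarrow> 'a \<Rightarrow> 'a::euclidean_space" where
  "horizontal_gradient gmul W f x =
     (\<Sum>b\<in>Basis \<inter> W. deriv_along (left_field gmul b) f x *\<^sub>R b)"

definition horizontal_normal ::
  "('a \<Rightarrow> 'a \<Rightarrow> 'a) \<Rightarrow> 'a set \<Rightarrow> ('a \<Rightarrow> real) \<Rightarrow> 'a \<Rightarrow> 'a::euclidean_space" where
  "horizontal_normal gmul W f x =
     horizontal_gradient gmul W f x /\<^sub>R norm (horizontal_gradient gmul W f x)"


section \<open>Perimeter measure and spherical Federer density\<close>

text \<open>The norm on the fiber at \<open>x\<close> obtained from the norm on \<open>W\<close> by left translation.\<close>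
definition horizontal_norm :: "('a \<Rightarrow> 'a \<Rightarrow> 'a) \<Rightarrow> 'a set \<Rightarrow> 'a \<Rightarrow> 'a::euclidean_space \<Rightarrow> real" where
  "horizontal_norm gmul W x w = norm (THE v. v \<in> W \<and> left_field gmul v x = w)"

definition C1_map :: "('a \<Rightarrow> 'a::euclidean_space) \<Rightarrow> bool" where
  "C1_map X \<longleftrightarrow> (\<exists>D :: 'a \<Rightarrow> 'a \<Rightarrow>\<^sub>L 'a.
     (\<forall>x. (X has_derivative blinfun_apply (D x)) (at x)) \<and> continuous_on UNIV D)"

text \<open>Compactly supported horizontal \<open>C\<^sup>1\<close> fields on the open set \<open>U\<close>, extended by zero.\<close>
definition C1c_horizontal ::
  "('a \<Rightarrow> 'a \<Rightarrow> 'a) \<Rightarrow> 'a set \<Rightarrow> 'a set \<Rightarrow> ('a \<Rightarrow> 'a::euclidean_space) set" where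
  "C1c_horizontal gmul W U = {X. C1_map X \<and> (\<forall>x. X x \<in> horizontal_fiber gmul W x) \<and>
     compact (closure {x. X x \<noteq> 0}) \<and> closure {x. X x \<noteq> 0} \<subseteq> U}"

definition divergence :: "('a \<Rightarrow> 'a) \<Rightarrow> 'a::euclidean_space \<Rightarrow> real" where
  "divergence X x = (\<Sum>b\<in>Basis. frechet_derivative X (at x) b \<bullet> b)"

text \<open>The truncation of negative values by \<open>ennreal\<close> is harmless, as \<open>X = 0\<close> is admissible.\<close>
definition perimeter ::
  "('a \<Rightarrow> 'a \<Rightarrow> 'a) \<Rightarrow> 'a set \<Rightarrow> 'a set \<Rightarrow> 'a::euclidean_space set \<Rightarrow> ennreal" where
  "perimeter gmul W E U =
     (SUP X\<in>{X \<in> C1c_horizontal gmul W U. \<forall>x. horizontal_norm gmul W x (X x) \<le> 1}.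
        ennreal (set_lebesgue_integral lborel E (divergence X)))"

definition perimeter_measure ::
  "('a \<Rightarrow> 'a \<Rightarrow> 'a) \<Rightarrow> 'a set \<Rightarrow> 'a set \<Rightarrow> ('a \<Rightarrow> real) \<Rightarrow> 'a::euclidean_space measure \<Rightarrow> bool" where
  "perimeter_measure gmul W \<Omega> f \<sigma> \<longleftrightarrow>
     sets \<sigma> = sets (restrict_space borel \<Omega>) \<and>
     (\<forall>U. open U \<and> U \<subseteq> \<Omega> \<longrightarrow> emeasure \<sigma> U = perimeter gmul W {x \<in> \<Omega>. f x < 0} U)"

text \<open>Intersecting with \<open>space \<sigma>\<close> (here \<open>\<Omega>\<close>) is irrelevant for balls contained in \<open>\<Omega>\<close>, hence
  for the infimum.\<close>
definition spherical_density ::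
  "('a \<Rightarrow> 'a \<Rightarrow> real) \<Rightarrow> nat \<Rightarrow> 'a measure \<Rightarrow> 'a \<Rightarrow> ennreal" where
  "spherical_density d k \<sigma> x =
     (INF \<epsilon>\<in>{0<..}. SUP B\<in>{B. x \<in> B \<and> (\<exists>y r. 0 < r \<and> B = dball d y r) \<and> ddiam d B < \<epsilon>}.
        emeasure \<sigma> (B \<inter> space \<sigma>) / ennreal (ddiam d B ^ k / 2 ^ k))"


section \<open>Hausdorff measure and the function \<open>\<beta>\<close>\<close>

text \<open>Hausdorff measure of dimension \<open>m\<close> with gauge \<open>diam\<^sup>m\<close>, where the empty set has gauge \<open>0\<close>
  and nonempty sets have gauge \<open>1\<close> if \<open>m = 0\<close>.\<close>

definition hausdorff_gauge :: "nat \<Rightarrow> 'a::euclidean_space set \<Rightarrow> ennreal" where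
  "hausdorff_gauge m A = (if A = {} then 0 else ennreal (diameter A ^ m))"

definition hausdorff_unnormalized :: "nat \<Rightarrow> 'a::euclidean_space set \<Rightarrow> ennreal" where
  "hausdorff_unnormalized m S =
     (SUP \<delta>\<in>{0<..}. INF A\<in>{A :: nat \<Rightarrow> 'a set.
          S \<subseteq> (\<Union>i. A i) \<and> (\<forall>i. bounded (A i) \<and> diameter (A i) \<le> \<delta>)}.
        \<Sum>i. hausdorff_gauge m (A i))"

definition unit_cube :: "'a set \<Rightarrow> 'a::euclidean_space set" where
  "unit_cube B = {x \<in> span B. \<forall>b\<in>B. 0 \<le> x \<bullet> b \<and> x \<bullet> b \<le> 1}"

text \<open>On an \<open>m\<close>-dimensional subspace the unnormalized measure is translation invariant, so the
  normalization agreeing with Lebesgue measure is the one giving measure \<open>1\<close> to an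
  \<open>m\<close>-dimensional cube spanned by orthonormal vectors. By invariance under isometries the choice
  of the cube does not matter.\<close>
definition hausdorff :: "nat \<Rightarrow> 'a::euclidean_space set \<Rightarrow> ennreal" where
  "hausdorff m S = hausdorff_unnormalized m S /
     hausdorff_unnormalized m (unit_cube (SOME B :: 'a set. B \<subseteq> Basis \<and> card B = m))"

definition vertical_subgroup ::
  "(nat \<Rightarrow> 'a::euclidean_space set) \<Rightarrow> nat \<Rightarrow> 'a \<Rightarrow> 'a set" where
  "vertical_subgroup V \<iota> \<nu> = span ({v \<in> V 1. v \<bullet> \<nu> = 0} \<union> (\<Union>j\<in>{2..\<iota>}. V j))"

definition beta ::
  "(nat \<Rightarrow> 'a::euclidean_space set) \<Rightarrow> nat \<Rightarrow> ('a \<Rightarrow> 'a \<Rightarrow> real) \<Rightarrow> 'a \<Rightarrow> ennreal" where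
  "beta V \<iota> d \<nu> = (GREATEST m. \<exists>z\<in>dball d 0 1.
     m = hausdorff (DIM('a) - 1) (dball d z 1 \<inter> vertical_subgroup V \<iota> \<nu>))"

end

theory Submission
  imports Defs
begin

text \<open>
  Write points near \<open>x\<close> as \<open>x n (t \<nu>)\<close> with \<open>n \<in> N(\<nu>)\<close> and \<open>t\<close> real, where \<open>\<nu>\<close> is the horizontal normal
  at \<open>x\<close>. The product is triangular with respect to the grading, so Haar measure is \<open>dn dt\<close> in these
  coordinates, and \<open>t \<mapsto> x n (t \<nu>)\<close> is an integral curve of a left invariant field.

  By a quantitative form of Chow's theorem, \<open>f(x \<delta>\<^sub>r p) = r \<langle>\<nabla>\<^sub>H f(x), p\<rangle> + o(r)\<close> uniformly on bounded sets.
  For an upper bound of the perimeter near \<open>x\<close>, replace the indicator of \<open>{f < 0}\<close> by \<open>h(f)\<close> with \<open>h\<close> a smooth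
  monotone step and integrate by parts: there remains \<open>\<integral> |h'(f)| |\<nabla>\<^sub>H f|\<close>, and along each line in \<open>t\<close> the
  function \<open>f\<close> is monotone with derivative close to \<open>|\<nabla>\<^sub>H f|\<close>. For a lower bound, test with a rescaled
  multiple of the field of \<open>\<nu>\<close> and pass to the limit half space. Together they show that
  \<open>r\<^sup>1\<^sup>-\<^sup>Q \<sigma>(B(x \<delta>\<^sub>r z, r))\<close> is asymptotically between the \<open>(n-1)\<close>-measures of the sections by \<open>N(\<nu>)\<close> of the
  open and of slightly enlarged closed unit balls at \<open>z\<close>. Compactness in \<open>z\<close> gives the upper estimate of the
  density; balls of radius \<open>(1 + \<eta>) r\<close>, \<open>\<eta> \<rightarrow> 0\<close>, centred at a maximizing \<open>z\<close> give the lower one, without any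
  information on the boundary of the section.
\<close>

subsection \<open>Lebesgue measure and hyperplanes\<close>

text \<open>A function in \<open>C1h\<close> need not be differentiable in the Euclidean sense, so
  Euclidean Gauss-Green and area formulas do not apply to its level set. What can be differentiated
  is the restriction of \<open>f\<close> to integral curves of left invariant horizontal fields.
  This decides the shape of the argument: each integration by parts concerns one left invariant
  field and is carried out curve by curve with the fundamental theorem of calculus, while continuity
  of \<open>f\<close>, linearity of its horizontal derivative and its first order expansion are
  extracted from Chow's theorem instead of a chain rule. For sections of balls the available
  regularity is semicontinuity: a closed ball is the intersection of larger ones. This yields the
  maximum in \<open>beta\<close> and the covering argument of the upper bound; in the lower bound
  the loss is a factor (1 + \<eta>)^(Q-1), which tends to 1. Hausdorff measure enters through its
  proportionality to Lebesgue measure on a hyperplane, where one and the same cube fixes both the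
  factor and the normalization.\<close>

lemma nn_integral_lborel_translate:
  fixes F :: "'a::euclidean_space \<Rightarrow> ennreal"
  assumes [measurable]: "F \<in> borel_measurable borel"
  shows "(\<integral>\<^sup>+p. F (p + c) \<partial>lborel) = (\<integral>\<^sup>+p. F p \<partial>lborel)"
proof -
  have "(\<integral>\<^sup>+p. F p \<partial>lborel) = (\<integral>\<^sup>+p. F p \<partial>distr lborel borel ((+) c))"
    by (simp add: lborel_distr_plus)
  also have "\<dots> = (\<integral>\<^sup>+p. F (c + p) \<partial>lborel)"
    by (subst nn_integral_distr) auto
  finally show ?thesis by (simp add: add.commute)
qed

text \<open>Averaging over \<open>t \<in> [0, 1]\<close> and Tonelli's theorem replace the choice of coordinates adapted
  to the direction \<open>b\<close>.\<close>

lemma nn_integral_shear: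
  fixes F :: "'a::euclidean_space \<Rightarrow> ennreal" and g :: "'a \<Rightarrow> real"
  assumes [measurable]: "F \<in> borel_measurable borel" "g \<in> borel_measurable borel"
    and g: "\<And>p t. g (p + t *\<^sub>R b) = g p"
  shows "(\<integral>\<^sup>+p. F (p + g p *\<^sub>R b) \<partial>lborel) = (\<integral>\<^sup>+p. F p \<partial>lborel)"
proof -
  let ?I = "\<lambda>s. indicator {0..1::real} s :: ennreal"
  have I1: "(\<integral>\<^sup>+t. ?I t \<partial>lborel) = 1" by simp
  have "(\<integral>\<^sup>+p. F (p + g p *\<^sub>R b) \<partial>lborel) =
      (\<integral>\<^sup>+t. ?I t * (\<integral>\<^sup>+p. F (p + g p *\<^sub>R b) \<partial>lborel) \<partial>lborel)"
    by (simp add: nn_integral_multc)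
  also have "\<dots> = (\<integral>\<^sup>+t. (\<integral>\<^sup>+p. ?I t * F ((p + t *\<^sub>R b) + g (p + t *\<^sub>R b) *\<^sub>R b) \<partial>lborel) \<partial>lborel)"
  proof (rule nn_integral_cong)
    fix t
    have "(\<integral>\<^sup>+p. F ((p + t *\<^sub>R b) + g (p + t *\<^sub>R b) *\<^sub>R b) \<partial>lborel) = (\<integral>\<^sup>+p. F (p + g p *\<^sub>R b) \<partial>lborel)"
      by (rule nn_integral_lborel_translate) measurable
    then show "?I t * (\<integral>\<^sup>+p. F (p + g p *\<^sub>R b) \<partial>lborel) =
      (\<integral>\<^sup>+p. ?I t * F ((p + t *\<^sub>R b) + g (p + t *\<^sub>R b) *\<^sub>R b) \<partial>lborel)"
      by (subst nn_integral_cmult) auto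
  qed
  also have "\<dots> = (\<integral>\<^sup>+p. (\<integral>\<^sup>+t. ?I t * F (p + (t + g p) *\<^sub>R b) \<partial>lborel) \<partial>lborel)"
    by (subst lborel_pair.Fubini') (auto simp: g algebra_simps)
  also have "\<dots> = (\<integral>\<^sup>+p. (\<integral>\<^sup>+t. ?I (t - g p) * F (p + t *\<^sub>R b) \<partial>lborel) \<partial>lborel)"
  proof (rule nn_integral_cong)
    fix p
    have "(\<integral>\<^sup>+t. (\<lambda>t. ?I (t - g p) * F (p + t *\<^sub>R b)) (t + g p) \<partial>lborel) =
       (\<integral>\<^sup>+t. (\<lambda>t. ?I (t - g p) * F (p + t *\<^sub>R b)) t \<partial>lborel)"
      by (rule nn_integral_lborel_translate) measurable
    then show "(\<integral>\<^sup>+t. ?I t * F (p + (t + g p) *\<^sub>R b) \<partial>lborel) =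
      (\<integral>\<^sup>+t. ?I (t - g p) * F (p + t *\<^sub>R b) \<partial>lborel)"
      by simp
  qed
  also have "\<dots> = (\<integral>\<^sup>+t. (\<integral>\<^sup>+p. ?I (t - g (p + t *\<^sub>R b)) * F (p + t *\<^sub>R b) \<partial>lborel) \<partial>lborel)"
    by (subst lborel_pair.Fubini') (auto simp: g)
  also have "\<dots> = (\<integral>\<^sup>+t. (\<integral>\<^sup>+p. ?I (t - g p) * F p \<partial>lborel) \<partial>lborel)"
  proof (rule nn_integral_cong)
    fix t :: real
    show "(\<integral>\<^sup>+p. ?I (t - g (p + t *\<^sub>R b)) * F (p + t *\<^sub>R b) \<partial>lborel) = (\<integral>\<^sup>+p. ?I (t - g p) * F p \<partial>lborel)"
      by (rule nn_integral_lborel_translate[where F="\<lambda>p. ?I (t - g p) * F p"]) measurable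
  qed
  also have "\<dots> = (\<integral>\<^sup>+p. (\<integral>\<^sup>+t. ?I (t - g p) * F p \<partial>lborel) \<partial>lborel)"
    by (subst lborel_pair.Fubini') auto
  also have "\<dots> = (\<integral>\<^sup>+p. F p \<partial>lborel)"
  proof (rule nn_integral_cong)
    fix p
    have "(\<integral>\<^sup>+t. ?I (t + - g p) \<partial>lborel) = 1"
      by (subst nn_integral_lborel_translate[where F="?I"]) auto
    then show "(\<integral>\<^sup>+t. ?I (t - g p) * F p \<partial>lborel) = F p"
      by (subst nn_integral_multc) auto
  qed
  finally show ?thesis .
qed

text \<open>The map is a composition of shears, one for each basis vector. The induction runs over
  sets \<open>A\<close> that are upwards closed for \<open>deg\<close>; the vector \<open>b\<close>
  of least degree is split off, and its shear does not notice the displacements in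
  \<open>A'\<close>, since these leave all coordinates of degree below \<open>deg b\<close>
  alone.\<close>

lemma nn_integral_triangular:
  fixes F :: "'a::euclidean_space \<Rightarrow> ennreal" and G :: "'a \<Rightarrow> 'a" and deg :: "'a \<Rightarrow> nat"
  assumes [measurable]: "F \<in> borel_measurable borel" "G \<in> borel_measurable borel"
    and G: "\<And>p q b. b \<in> Basis \<Longrightarrow> (\<And>c. c \<in> Basis \<Longrightarrow> deg c < deg b \<Longrightarrow> p \<bullet> c = q \<bullet> c) \<Longrightarrow>
      G p \<bullet> b = G q \<bullet> b"
  shows "(\<integral>\<^sup>+p. F (p + G p) \<partial>lborel) = (\<integral>\<^sup>+p. F p \<partial>lborel)"
proof -
  have fin: "finite (Basis::'a set)" by simp
  have "A \<subseteq> Basis \<longrightarrow> (\<forall>p\<in>Basis - A. \<forall>q\<in>A. deg p \<le> deg q) \<longrightarrow>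
    (\<forall>F\<in>borel_measurable borel.
      (\<integral>\<^sup>+p. F (p + (\<Sum>b\<in>A. (G p \<bullet> b) *\<^sub>R b)) \<partial>lborel) = (\<integral>\<^sup>+p. F p \<partial>lborel))" if "finite A" for A
    using that
  proof (induction "card A" arbitrary: A)
    case 0 then show ?case by simp
  next
    case (Suc n)
    show ?case
    proof (intro impI ballI)
      fix F :: "'a \<Rightarrow> ennreal"
      assume A: "A \<subseteq> Basis" "\<forall>p\<in>Basis - A. \<forall>q\<in>A. deg p \<le> deg q" and F[measurable]: "F \<in> borel_measurable borel"
      have "A \<noteq> {}" using Suc by auto
      then obtain b where b: "b \<in> A" "\<And>c. c \<in> A \<Longrightarrow> deg b \<le> deg c"
        using arg_min_if_finite[OF \<open>finite A\<close>, of deg] by (metis linorder_not_le)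
      define A' where "A' = A - {b}"
      have A': "finite A'" "b \<notin> A'" "A = insert b A'" "A' \<subseteq> Basis" "b \<in> Basis"
        using A b Suc by (auto simp: A'_def)
      have IH: "(\<integral>\<^sup>+p. F (p + (\<Sum>b\<in>A'. (G p \<bullet> b) *\<^sub>R b)) \<partial>lborel) = (\<integral>\<^sup>+p. F p \<partial>lborel)"
        if "F \<in> borel_measurable borel" for F
      proof -
        have "n = card A'" using Suc.hyps(2) A'(1-3) by simp
        moreover have "\<forall>p\<in>Basis - A'. \<forall>q\<in>A'. deg p \<le> deg q"
          using A(2) b by (auto simp: A'_def)
        ultimately show ?thesis using Suc.hyps(1)[of A'] A' that by blast
      qed
      let ?T = "\<lambda>p. p + (\<Sum>b\<in>A'. (G p \<bullet> b) *\<^sub>R b)"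
      have eq: "G (?T p) \<bullet> b = G p \<bullet> b" for p
      proof (rule G[OF A'(5)])
        fix c :: 'a assume c: "c \<in> Basis" "deg c < deg b"
        then have "c \<notin> A'" using b A' by force
        then have "(\<Sum>b\<in>A'. (G p \<bullet> b) *\<^sub>R b) \<bullet> c = 0"
          using A'(4) c(1) by (auto simp: inner_sum_left inner_Basis intro!: sum.neutral)
        then show "?T p \<bullet> c = p \<bullet> c" by (simp add: inner_add_left)
      qed
      have "(\<integral>\<^sup>+p. F (p + (\<Sum>b\<in>A. (G p \<bullet> b) *\<^sub>R b)) \<partial>lborel) =
          (\<integral>\<^sup>+p. F (?T p + (G (?T p) \<bullet> b) *\<^sub>R b) \<partial>lborel)"
        unfolding eq by (simp add: A' algebra_simps)
      also have "\<dots> = (\<integral>\<^sup>+p. F (p + (G p \<bullet> b) *\<^sub>R b) \<partial>lborel)"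
        by (rule IH[where F="\<lambda>p. F (p + (G p \<bullet> b) *\<^sub>R b)"]) measurable
      also have "\<dots> = (\<integral>\<^sup>+p. F p \<partial>lborel)"
      proof (rule nn_integral_shear)
        show "G (p + t *\<^sub>R b) \<bullet> b = G p \<bullet> b" for p t
          by (rule G[OF A'(5)]) (use A'(5) in \<open>auto simp: inner_add_left inner_Basis\<close>)
      qed measurable
      finally show "(\<integral>\<^sup>+p. F (p + (\<Sum>b\<in>A. (G p \<bullet> b) *\<^sub>R b)) \<partial>lborel) = (\<integral>\<^sup>+p. F p \<partial>lborel)" .
    qed
  qed
  from this[OF fin] show ?thesis by (simp add: euclidean_representation)
qed

text \<open>For a unit vector \<open>\<nu>\<close> this is \<open>(n-1)\<close>-dimensional Lebesgue measure on \<open>\<nu>\<^sup>\<bottom>\<close>, realized as the \<open>n\<close>-dimensional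
  measure of the cylinder of height \<open>1\<close> over a subset of \<open>\<nu>\<^sup>\<bottom>\<close>.\<close>

definition hyperplane_measure :: "'a::euclidean_space \<Rightarrow> 'a measure" where
  "hyperplane_measure \<nu> =
     distr (density lborel (indicator {p. 0 \<le> p \<bullet> \<nu> \<and> p \<bullet> \<nu> \<le> 1})) borel (\<lambda>p. p - (p \<bullet> \<nu>) *\<^sub>R \<nu>)"

lemma sets_hyperplane_measure [measurable_cong, simp]: "sets (hyperplane_measure \<nu>) = sets borel"
  by (simp add: hyperplane_measure_def)

lemma space_hyperplane_measure [simp]: "space (hyperplane_measure \<nu>) = UNIV"
  by (simp add: hyperplane_measure_def)

lemma slab_measurable [measurable]:
  "{p. 0 \<le> p \<bullet> \<nu> \<and> p \<bullet> \<nu> \<le> 1} \<in> sets (borel :: 'a::euclidean_space measure)"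
  by measurable

lemma nn_integral_hyperplane_measure:
  fixes F :: "'a::euclidean_space \<Rightarrow> ennreal"
  assumes [measurable]: "F \<in> borel_measurable borel"
  shows "(\<integral>\<^sup>+n. F n \<partial>hyperplane_measure \<nu>) =
    (\<integral>\<^sup>+p. indicator {p. 0 \<le> p \<bullet> \<nu> \<and> p \<bullet> \<nu> \<le> 1} p * F (p - (p \<bullet> \<nu>) *\<^sub>R \<nu>) \<partial>lborel)"
  unfolding hyperplane_measure_def
  by (simp add: nn_integral_distr nn_integral_density)

lemma emeasure_hyperplane_measure:
  fixes A :: "'a::euclidean_space set"
  assumes [measurable]: "A \<in> sets borel"
  shows "emeasure (hyperplane_measure \<nu>) A =
    emeasure lborel {p. 0 \<le> p \<bullet> \<nu> \<and> p \<bullet> \<nu> \<le> 1 \<and> p - (p \<bullet> \<nu>) *\<^sub>R \<nu> \<in> A}"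
proof -
  have "emeasure (hyperplane_measure \<nu>) A = (\<integral>\<^sup>+n. indicator A n \<partial>hyperplane_measure \<nu>)"
    by simp
  also have "\<dots> = (\<integral>\<^sup>+p. indicator {p. 0 \<le> p \<bullet> \<nu> \<and> p \<bullet> \<nu> \<le> 1 \<and> p - (p \<bullet> \<nu>) *\<^sub>R \<nu> \<in> A} p \<partial>lborel)"
    by (subst nn_integral_hyperplane_measure, measurable) (rule nn_integral_cong, simp split: split_indicator)
  also have "\<dots> = emeasure lborel {p. 0 \<le> p \<bullet> \<nu> \<and> p \<bullet> \<nu> \<le> 1 \<and> p - (p \<bullet> \<nu>) *\<^sub>R \<nu> \<in> A}"
    by (rule nn_integral_indicator) simp
  finally show ?thesis .
qed

lemma AE_hyperplane_measure:
  fixes \<nu> :: "'a::euclidean_space"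
  assumes "norm \<nu> = 1"
  shows "AE n in hyperplane_measure \<nu>. n \<bullet> \<nu> = 0"
proof -
  have "emeasure (hyperplane_measure \<nu>) {n. n \<bullet> \<nu> \<noteq> 0} = emeasure lborel ({} :: 'a set)"
    using assms by (subst emeasure_hyperplane_measure) (auto simp: inner_diff_left norm_eq_1)
  then show ?thesis
    by (intro AE_I[where N="{n. n \<bullet> \<nu> \<noteq> 0}"]) auto
qed

lemma emeasure_hyperplane_measure_bounded:
  fixes A :: "'a::euclidean_space set"
  assumes "bounded A" "A \<in> sets borel"
  shows "emeasure (hyperplane_measure \<nu>) A < \<infinity>"
proof -
  obtain R where R: "\<And>a. a \<in> A \<Longrightarrow> norm a \<le> R" using \<open>bounded A\<close> by (auto simp: bounded_iff)
  have "{p. 0 \<le> p \<bullet> \<nu> \<and> p \<bullet> \<nu> \<le> 1 \<and> p - (p \<bullet> \<nu>) *\<^sub>R \<nu> \<in> A} \<subseteq> cball 0 (R + norm \<nu>)"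
  proof safe
    fix p assume p: "0 \<le> p \<bullet> \<nu>" "p \<bullet> \<nu> \<le> 1" "p - (p \<bullet> \<nu>) *\<^sub>R \<nu> \<in> A"
    have "norm p \<le> norm (p - (p \<bullet> \<nu>) *\<^sub>R \<nu>) + norm ((p \<bullet> \<nu>) *\<^sub>R \<nu>)"
      by (metis add.commute diff_add_cancel norm_triangle_ineq)
    also have "\<dots> \<le> R + norm \<nu>"
      using R[OF p(3)] p by (intro add_mono) (auto simp: mult_left_le_one_le)
    finally show "p \<in> cball 0 (R + norm \<nu>)" by simp
  qed
  then have "bounded {p. 0 \<le> p \<bullet> \<nu> \<and> p \<bullet> \<nu> \<le> 1 \<and> p - (p \<bullet> \<nu>) *\<^sub>R \<nu> \<in> A}"
    using bounded_cball bounded_subset by blast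
  then show ?thesis
    by (subst emeasure_hyperplane_measure) (use assms emeasure_bounded_finite in auto)
qed

lemma sigma_finite_hyperplane_measure: "sigma_finite_measure (hyperplane_measure (\<nu>::'a::euclidean_space))"
proof
  have "emeasure (hyperplane_measure \<nu>) (cball 0 (real i)) \<noteq> \<infinity>" for i
    using emeasure_hyperplane_measure_bounded[of "cball 0 (real i)" \<nu>] by auto
  moreover have "(\<Union>i. cball (0::'a) (real i)) = UNIV"
    by (auto simp: real_arch_simple)
  ultimately show "\<exists>A. countable A \<and> A \<subseteq> sets (hyperplane_measure \<nu>) \<and> \<Union> A = space (hyperplane_measure \<nu>) \<and>
     (\<forall>a\<in>A. emeasure (hyperplane_measure \<nu>) a \<noteq> \<infinity>)"
    by (intro exI[of _ "range (\<lambda>i. cball 0 (real i))"]) auto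
qed

text \<open>With the cylinder description this reduces to translations: after exchanging the
  integrals and shifting by t \<nu>, the slab condition restricts t, for a fixed point, to an
  interval of length 1.\<close>

lemma nn_integral_hyperplane_fubini:
  fixes F :: "'a::euclidean_space \<Rightarrow> ennreal"
  assumes [measurable]: "F \<in> borel_measurable borel" and \<nu>: "norm \<nu> = 1"
  shows "(\<integral>\<^sup>+n. (\<integral>\<^sup>+t. F (n + t *\<^sub>R \<nu>) \<partial>lborel) \<partial>hyperplane_measure \<nu>) = (\<integral>\<^sup>+p. F p \<partial>lborel)"
proof -
  let ?S = "\<lambda>p::'a. indicator {p. 0 \<le> p \<bullet> \<nu> \<and> p \<bullet> \<nu> \<le> 1} p :: ennreal"
  have \<nu>1: "\<nu> \<bullet> \<nu> = 1" using \<nu> by (simp add: norm_eq_1)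
  have "(\<integral>\<^sup>+n. (\<integral>\<^sup>+t. F (n + t *\<^sub>R \<nu>) \<partial>lborel) \<partial>hyperplane_measure \<nu>) =
      (\<integral>\<^sup>+p. ?S p * (\<integral>\<^sup>+t. F (p - (p \<bullet> \<nu>) *\<^sub>R \<nu> + t *\<^sub>R \<nu>) \<partial>lborel) \<partial>lborel)"
    by (subst nn_integral_hyperplane_measure) auto
  also have "\<dots> = (\<integral>\<^sup>+p. (\<integral>\<^sup>+t. ?S p * F (p + t *\<^sub>R \<nu>) \<partial>lborel) \<partial>lborel)"
  proof (rule nn_integral_cong)
    fix p :: 'a
    have "(\<integral>\<^sup>+t. (\<lambda>t. F (p + t *\<^sub>R \<nu>)) (t + - (p \<bullet> \<nu>)) \<partial>lborel) = (\<integral>\<^sup>+t. F (p + t *\<^sub>R \<nu>) \<partial>lborel)"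
      by (rule nn_integral_lborel_translate) measurable
    then show "?S p * (\<integral>\<^sup>+t. F (p - (p \<bullet> \<nu>) *\<^sub>R \<nu> + t *\<^sub>R \<nu>) \<partial>lborel) = (\<integral>\<^sup>+t. ?S p * F (p + t *\<^sub>R \<nu>) \<partial>lborel)"
      by (subst nn_integral_cmult) (auto simp: algebra_simps)
  qed
  also have "\<dots> = (\<integral>\<^sup>+t. (\<integral>\<^sup>+p. ?S p * F (p + t *\<^sub>R \<nu>) \<partial>lborel) \<partial>lborel)"
    by (subst lborel_pair.Fubini') auto
  also have "\<dots> = (\<integral>\<^sup>+t. (\<integral>\<^sup>+p. ?S (p - t *\<^sub>R \<nu>) * F p \<partial>lborel) \<partial>lborel)"
  proof (rule nn_integral_cong)
    fix t :: real
    show "(\<integral>\<^sup>+p. ?S p * F (p + t *\<^sub>R \<nu>) \<partial>lborel) = (\<integral>\<^sup>+p. ?S (p - t *\<^sub>R \<nu>) * F p \<partial>lborel)"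
      using nn_integral_lborel_translate[where F="\<lambda>p. ?S (p - t *\<^sub>R \<nu>) * F p" and c="t *\<^sub>R \<nu>"] by simp
  qed
  also have "\<dots> = (\<integral>\<^sup>+p. (\<integral>\<^sup>+t. ?S (p - t *\<^sub>R \<nu>) * F p \<partial>lborel) \<partial>lborel)"
    by (subst lborel_pair.Fubini') auto
  also have "\<dots> = (\<integral>\<^sup>+p. F p \<partial>lborel)"
  proof (rule nn_integral_cong)
    fix p
    have "(\<integral>\<^sup>+t. ?S (p - t *\<^sub>R \<nu>) \<partial>lborel) = (\<integral>\<^sup>+t. indicator {p \<bullet> \<nu> - 1..p \<bullet> \<nu>} t \<partial>lborel)"
      by (intro nn_integral_cong) (auto simp: inner_diff_left \<nu>1 split: split_indicator)
    also have "\<dots> = 1" by simp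
    finally show "(\<integral>\<^sup>+t. ?S (p - t *\<^sub>R \<nu>) * F p \<partial>lborel) = F p"
      by (subst nn_integral_multc) auto
  qed
  finally show ?thesis .
qed

text \<open>Uniqueness of translation invariant measures, using that a ball centred at \<open>0\<close> is both symmetric and
  invariant under \<open>T\<close>.\<close>

lemma emeasure_lborel_orthogonal:
  fixes T :: "'a::euclidean_space \<Rightarrow> 'a"
  assumes T: "linear T" "\<And>x. norm (T x) = norm x" "\<And>x. T (T x) = x"
    and [measurable]: "A \<in> sets borel"
  shows "emeasure lborel (T -` A) = emeasure lborel A"
proof -
  interpret T: linear T by fact
  have Tm[measurable]: "T \<in> borel_measurable borel"
    using T(1) by (intro borel_measurable_continuous_onI linear_continuous_on) (simp add: linear_conv_bounded_linear)
  let ?B = "ball (0::'a) 1"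
  have [measurable]: "?B \<in> sets borel" by simp
  let ?b = "indicator ?B :: 'a \<Rightarrow> ennreal" and ?a = "indicator A :: 'a \<Rightarrow> ennreal"
  have "emeasure lborel (T -` A) * emeasure lborel ?B =
     (\<integral>\<^sup>+y. ?b y * (\<integral>\<^sup>+x. ?a (T x) \<partial>lborel) \<partial>lborel)"
  proof -
    have "(\<integral>\<^sup>+x. ?a (T x) \<partial>lborel) = (\<integral>\<^sup>+x. indicator (T -` A) x \<partial>lborel)"
      by (intro nn_integral_cong) (auto split: split_indicator)
    also have "\<dots> = emeasure lborel (T -` A)"
      by (rule nn_integral_indicator) (use measurable_sets[OF Tm, of A] in auto)
    finally have 1: "(\<integral>\<^sup>+x. ?a (T x) \<partial>lborel) = emeasure lborel (T -` A)" .
    have 2: "(\<integral>\<^sup>+y. ?b y * c \<partial>lborel) = (\<integral>\<^sup>+y. ?b y \<partial>lborel) * c" for c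
      by (rule nn_integral_multc) measurable
    show ?thesis unfolding 1 2 by (simp add: mult.commute)
  qed
  also have "\<dots> = (\<integral>\<^sup>+y. (\<integral>\<^sup>+x. ?b y * ?a (T x + y) \<partial>lborel) \<partial>lborel)"
  proof (rule nn_integral_cong)
    fix y
    have "(\<integral>\<^sup>+x. ?a (T (x + T y)) \<partial>lborel) = (\<integral>\<^sup>+x. ?a (T x) \<partial>lborel)"
      by (rule nn_integral_lborel_translate) measurable
    then show "?b y * (\<integral>\<^sup>+x. ?a (T x) \<partial>lborel) = (\<integral>\<^sup>+x. ?b y * ?a (T x + y) \<partial>lborel)"
      by (subst nn_integral_cmult) (auto simp: T.add T)
  qed
  also have "\<dots> = (\<integral>\<^sup>+x. (\<integral>\<^sup>+y. ?b y * ?a (T x + y) \<partial>lborel) \<partial>lborel)"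
    by (subst lborel_pair.Fubini') auto
  also have "\<dots> = (\<integral>\<^sup>+x. (\<integral>\<^sup>+y. ?b (y - T x) * ?a y \<partial>lborel) \<partial>lborel)"
  proof (rule nn_integral_cong)
    fix x
    show "(\<integral>\<^sup>+y. ?b y * ?a (T x + y) \<partial>lborel) = (\<integral>\<^sup>+y. ?b (y - T x) * ?a y \<partial>lborel)"
      using nn_integral_lborel_translate[where F="\<lambda>y. ?b (y - T x) * ?a y" and c="T x"]
      by (simp add: add.commute)
  qed
  also have "\<dots> = (\<integral>\<^sup>+y. (\<integral>\<^sup>+x. ?b (y - T x) * ?a y \<partial>lborel) \<partial>lborel)"
    by (subst lborel_pair.Fubini') auto
  also have "\<dots> = (\<integral>\<^sup>+y. emeasure lborel ?B * ?a y \<partial>lborel)"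
  proof (rule nn_integral_cong)
    fix y
    \<comment> \<open>An isometric involution can be moved to the other point; this turns the
      integral over x into the volume of a ball centred at \<open>T y\<close>.\<close>
    have "norm (y - T x) = norm (x - T y)" for x
      using T(2)[of "y - T x"] by (simp add: T.diff T(3) norm_minus_commute)
    then have "(\<integral>\<^sup>+x. ?b (y - T x) \<partial>lborel) = (\<integral>\<^sup>+x. ?b (x + - T y) \<partial>lborel)"
      by (intro nn_integral_cong) (auto split: split_indicator)
    also have "\<dots> = emeasure lborel ?B"
      by (subst nn_integral_lborel_translate) auto
    finally show "(\<integral>\<^sup>+x. ?b (y - T x) * ?a y \<partial>lborel) = emeasure lborel ?B * ?a y"
      by (subst nn_integral_multc) auto
  qed
  also have "\<dots> = emeasure lborel A * emeasure lborel ?B"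
    by (subst nn_integral_cmult) (auto simp: mult.commute)
  finally have eq: "emeasure lborel (T -` A) * emeasure lborel ?B = emeasure lborel A * emeasure lborel ?B" .
  have "emeasure lborel ?B \<noteq> top"
    using emeasure_bounded_finite[OF bounded_ball, of "0::'a" 1] by simp
  moreover have "emeasure lborel ?B \<noteq> 0"
    using content_ball_pos[of 1 "0::'a"] by (auto simp: measure_def)
  ultimately show ?thesis
    using eq ennreal_mult_cancel_left by (metis mult.commute)
qed

subsection \<open>Hausdorff measure on hyperplanes\<close>

definition hausdorff_delta :: "nat \<Rightarrow> real \<Rightarrow> 'a::euclidean_space set \<Rightarrow> ennreal" where
  "hausdorff_delta m \<delta> S = (INF A\<in>{A :: nat \<Rightarrow> 'a set.
     S \<subseteq> (\<Union>i. A i) \<and> (\<forall>i. bounded (A i) \<and> diameter (A i) \<le> \<delta>)}. \<Sum>i. hausdorff_gauge m (A i))"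

lemma hausdorff_unnormalized_eq_SUP:
  "hausdorff_unnormalized m S = (SUP \<delta>\<in>{0<..}. hausdorff_delta m \<delta> S)"
  by (simp add: hausdorff_unnormalized_def hausdorff_delta_def)

lemma hausdorff_delta_le: "0 < \<delta> \<Longrightarrow> hausdorff_delta m \<delta> S \<le> hausdorff_unnormalized m S"
  unfolding hausdorff_unnormalized_eq_SUP by (rule SUP_upper) simp

lemma hausdorff_delta_le_cover:
  assumes "S \<subseteq> (\<Union>i. A i)" "\<And>i. bounded (A i)" "\<And>i. diameter (A i) \<le> \<delta>"
  shows "hausdorff_delta m \<delta> S \<le> (\<Sum>i::nat. hausdorff_gauge m (A i))"
  unfolding hausdorff_delta_def by (rule INF_lower) (use assms in auto)

lemma hausdorff_delta_mono: "S \<subseteq> T \<Longrightarrow> hausdorff_delta m \<delta> S \<le> hausdorff_delta m \<delta> T"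
  unfolding hausdorff_delta_def by (rule INF_superset_mono) auto

lemma hausdorff_delta_le_single:
  assumes "bounded S" "diameter S \<le> \<delta>" "0 \<le> \<delta>"
  shows "hausdorff_delta m \<delta> S \<le> hausdorff_gauge m S"
proof -
  have "hausdorff_delta m \<delta> S \<le> (\<Sum>i::nat. hausdorff_gauge m (if i = 0 then S else {}))"
    using assms by (intro hausdorff_delta_le_cover) auto
  also have "\<dots> = (\<Sum>i\<in>{0::nat}. hausdorff_gauge m (if i = 0 then S else {}))"
    by (rule suminf_finite) (auto simp: hausdorff_gauge_def)
  finally show ?thesis by simp
qed

lemma hausdorff_delta_empty [simp]: "0 \<le> \<delta> \<Longrightarrow> hausdorff_delta m \<delta> {} = 0"
  using hausdorff_delta_le_single[of "{}" \<delta> m] by (auto simp: hausdorff_gauge_def)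

lemma hausdorff_delta_subadditive:
  "hausdorff_delta m \<delta> (\<Union>i::nat. S i) \<le> (\<Sum>i. hausdorff_delta m \<delta> (S i))"
proof (rule ennreal_le_epsilon)
  fix e :: real assume fin: "(\<Sum>i. hausdorff_delta m \<delta> (S i)) < top" and e: "0 < e"
  have "\<exists>A. S i \<subseteq> (\<Union>j::nat. A j) \<and> (\<forall>j. bounded (A j) \<and> diameter (A j) \<le> \<delta>) \<and>
     (\<Sum>j. hausdorff_gauge m (A j)) \<le> hausdorff_delta m \<delta> (S i) + ennreal (e * (1/2) ^ Suc i)" for i
  proof -
    have "hausdorff_delta m \<delta> (S i) < top"
      using fin by (metis ennreal_suminf_lessD infinity_ennreal_def)
    then have "hausdorff_delta m \<delta> (S i) < hausdorff_delta m \<delta> (S i) + ennreal (e * (1/2) ^ Suc i)"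
      using e by (simp add: ennreal_lessI)
    then show ?thesis
      unfolding hausdorff_delta_def[of m \<delta> "S i"] INF_less_iff by (auto intro: less_imp_le)
  qed
  then obtain A where A: "\<And>i. S i \<subseteq> (\<Union>j::nat. A i j)" "\<And>i j. bounded (A i j)"
     "\<And>i j. diameter (A i j) \<le> \<delta>"
     "\<And>i. (\<Sum>j. hausdorff_gauge m (A i j)) \<le> hausdorff_delta m \<delta> (S i) + ennreal (e * (1/2) ^ Suc i)"
    by metis
  let ?B = "\<lambda>k. case prod_decode k of (i, j) \<Rightarrow> A i j"
  have "hausdorff_delta m \<delta> (\<Union>i. S i) \<le> (\<Sum>k. hausdorff_gauge m (?B k))"
  proof (rule hausdorff_delta_le_cover)
    show "(\<Union>i. S i) \<subseteq> (\<Union>k. ?B k)"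
    proof
      fix x assume "x \<in> (\<Union>i. S i)"
      then obtain i j where "x \<in> A i j" using A(1) by blast
      then have "x \<in> ?B (prod_encode (i, j))" by simp
      then show "x \<in> (\<Union>k. ?B k)" by (rule UN_I[OF UNIV_I])
    qed
    show "bounded (?B k)" "diameter (?B k) \<le> \<delta>" for k
      using A(2,3) by (simp_all split: prod.split)
  qed
  also have "\<dots> = (\<Sum>k. (\<lambda>(i, j). hausdorff_gauge m (A i j)) (prod_decode k))"
    by (intro suminf_cong) (auto split: prod.splits)
  also have "\<dots> = (\<Sum>i. \<Sum>j. hausdorff_gauge m (A i j))"
    by (rule suminf_ennreal_2dimen) simp
  also have "\<dots> \<le> (\<Sum>i. hausdorff_delta m \<delta> (S i) + ennreal (e * (1/2) ^ Suc i))"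
    by (intro suminf_le) (use A in auto)
  also have "\<dots> = (\<Sum>i. hausdorff_delta m \<delta> (S i)) + (\<Sum>i. ennreal (e * (1/2) ^ Suc i))"
    by (rule suminf_add[symmetric]) auto
  also have "(\<Sum>i. ennreal (e * (1/2) ^ Suc i)) = ennreal e"
    using sums_mult[OF power_half_series, of e] e by (intro suminf_ennreal_eq) auto
  finally show "hausdorff_delta m \<delta> (\<Union>i. S i) \<le> (\<Sum>i. hausdorff_delta m \<delta> (S i)) + ennreal e" .
qed

lemma hausdorff_unnormalized_mono:
  "S \<subseteq> T \<Longrightarrow> hausdorff_unnormalized m S \<le> hausdorff_unnormalized m T"
  unfolding hausdorff_unnormalized_eq_SUP by (intro SUP_mono) (auto intro: hausdorff_delta_mono)

lemma hausdorff_unnormalized_empty [simp]: "hausdorff_unnormalized m {} = 0"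
  unfolding hausdorff_unnormalized_eq_SUP by simp

lemma hausdorff_unnormalized_subadditive:
  "hausdorff_unnormalized m (\<Union>i::nat. S i) \<le> (\<Sum>i. hausdorff_unnormalized m (S i))"
  unfolding hausdorff_unnormalized_eq_SUP[of m "\<Union>i. S i"]
proof (rule SUP_least)
  fix \<delta> :: real assume "\<delta> \<in> {0<..}"
  then show "hausdorff_delta m \<delta> (\<Union>i. S i) \<le> (\<Sum>i. hausdorff_unnormalized m (S i))"
    by (intro order_trans[OF hausdorff_delta_subadditive] suminf_le hausdorff_delta_le) auto
qed

lemma hausdorff_unnormalized_Un:
  "hausdorff_unnormalized m (S \<union> T) \<le> hausdorff_unnormalized m S + hausdorff_unnormalized m T"
proof -
  let ?X = "\<lambda>i::nat. if i = 0 then S else if i = 1 then T else {}"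
  have "hausdorff_unnormalized m (S \<union> T) \<le> hausdorff_unnormalized m (\<Union>i. ?X i)"
  proof (intro hausdorff_unnormalized_mono Un_least)
    show "S \<subseteq> (\<Union>i. ?X i)" using UN_upper[of 0 UNIV ?X] by simp
    show "T \<subseteq> (\<Union>i. ?X i)" using UN_upper[of 1 UNIV ?X] by simp
  qed
  also have "\<dots> \<le> (\<Sum>i. hausdorff_unnormalized m (?X i))"
    by (rule hausdorff_unnormalized_subadditive)
  also have "\<dots> = (\<Sum>i\<in>{0,1::nat}. hausdorff_unnormalized m (?X i))"
    by (rule suminf_finite) auto
  finally show ?thesis by simp
qed

lemma hausdorff_unnormalized_similarity:
  fixes T :: "'a::euclidean_space \<Rightarrow> 'a"
  assumes s: "0 < s" and T: "\<And>x y. dist (T x) (T y) = s * dist x y"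
  shows "hausdorff_unnormalized m (T ` S) \<le> ennreal (s ^ m) * hausdorff_unnormalized m S"
  unfolding hausdorff_unnormalized_eq_SUP[of m "T ` S"]
proof (rule SUP_least)
  fix \<delta> :: real assume "\<delta> \<in> {0<..}"
  then have \<delta>: "0 < \<delta> / s" using s by simp
  have "ennreal (1 / s ^ m) * hausdorff_delta m \<delta> (T ` S) \<le> hausdorff_delta m (\<delta> / s) S"
    unfolding hausdorff_delta_def[of m "\<delta> / s"]
  proof (rule INF_greatest, clarify)
      fix A :: "nat \<Rightarrow> 'a set"
      assume A: "S \<subseteq> (\<Union>i. A i)" "\<forall>i. bounded (A i) \<and> diameter (A i) \<le> \<delta> / s"
      have diam: "diameter (T ` A i) \<le> s * diameter (A i)" for i
      proof (rule diameter_le)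
        show "T ` A i \<noteq> {} \<or> 0 \<le> s * diameter (A i)" using s A by (auto intro: diameter_ge_0)
        fix x y assume "x \<in> T ` A i" "y \<in> T ` A i"
        then show "norm (x - y) \<le> s * diameter (A i)"
          using T s A diameter_bounded_bound by (fastforce simp: dist_norm)
      qed
      have bdd: "bounded (T ` A i)" for i
      proof -
        obtain a e where e: "\<forall>y\<in>A i. dist a y \<le> e" using A(2) unfolding bounded_def by blast
        show ?thesis unfolding bounded_def
          by (rule exI[of _ "T a"], rule exI[of _ "s * e"]) (use e s T in auto)
      qed
      have "hausdorff_delta m \<delta> (T ` S) \<le> (\<Sum>i. hausdorff_gauge m (T ` A i))"
      proof (rule hausdorff_delta_le_cover)
        show "T ` S \<subseteq> (\<Union>i. T ` A i)" using A by blast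
        show "diameter (T ` A i) \<le> \<delta>" for i
          using diam[of i] A(2)[rule_format, of i] s by (simp add: pos_le_divide_eq mult.commute)
      qed (rule bdd)
      also have "\<dots> \<le> (\<Sum>i. ennreal (s ^ m) * hausdorff_gauge m (A i))"
      proof (intro suminf_le)
        fix i
        have "diameter (T ` A i) ^ m \<le> s ^ m * diameter (A i) ^ m"
          using diam[of i] diameter_ge_0[OF bdd[of i]] by (metis power_mono power_mult_distrib)
        then show "hausdorff_gauge m (T ` A i) \<le> ennreal (s ^ m) * hausdorff_gauge m (A i)"
          using s A by (auto simp: hausdorff_gauge_def ennreal_mult[symmetric] diameter_ge_0 intro!: ennreal_leI)
      qed auto
      also have "\<dots> = ennreal (s ^ m) * (\<Sum>i. hausdorff_gauge m (A i))" by simp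
      finally have "ennreal (1 / s ^ m) * hausdorff_delta m \<delta> (T ` S) \<le>
          ennreal (1 / s ^ m) * (ennreal (s ^ m) * (\<Sum>i. hausdorff_gauge m (A i)))"
        by (rule mult_left_mono) simp
      also have "\<dots> = (\<Sum>i. hausdorff_gauge m (A i))"
        using s by (simp add: mult.assoc[symmetric] ennreal_mult[symmetric])
      finally show "ennreal (1 / s ^ m) * hausdorff_delta m \<delta> (T ` S) \<le> (\<Sum>i. hausdorff_gauge m (A i))" .
  qed
  also have "\<dots> \<le> hausdorff_unnormalized m S"
    using \<delta> by (rule hausdorff_delta_le)
  finally have "ennreal (s ^ m) * (ennreal (1 / s ^ m) * hausdorff_delta m \<delta> (T ` S)) \<le>
      ennreal (s ^ m) * hausdorff_unnormalized m S"
    by (rule mult_left_mono) simp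
  then show "hausdorff_delta m \<delta> (T ` S) \<le> ennreal (s ^ m) * hausdorff_unnormalized m S"
    using s by (simp add: mult.assoc[symmetric] ennreal_mult[symmetric])
qed

lemma countable_enumeration:
  assumes "countable D"
  obtains K :: "nat \<Rightarrow> 'a set" where "\<And>i. K i \<in> D \<or> K i = {}" "D \<subseteq> range K"
    "\<And>i j. i \<noteq> j \<Longrightarrow> K i = K j \<Longrightarrow> K i = {}"
proof
  let ?K = "\<lambda>i. if i \<in> to_nat_on D ` D then from_nat_into D i else {}"
  show "?K i \<in> D \<or> ?K i = {}" for i
    using assms by auto
  show "D \<subseteq> range ?K"
  proof
    fix d assume d: "d \<in> D"
    then have "d = ?K (to_nat_on D d)" using assms by simp
    then show "d \<in> range ?K" by blast
  qed
  show "?K i = {}" if "i \<noteq> j" "?K i = ?K j" for i j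
    using that assms by (auto split: if_splits)
qed

text \<open>Cover \<open>A \<times> [0, 1]\<close> by almost disjoint cubes. The slices at height \<open>t\<close> cover \<open>A\<close>, and integration
  over \<open>t\<close> turns the sum of the \<open>(n-1)\<close>-volumes of these slices into the volume of the cubes.\<close>

lemma slice_cover_bound:
  fixes h :: "'a::euclidean_space set \<Rightarrow> ennreal"
  assumes b: "b \<in> Basis" and \<rho>: "0 < \<rho>" and \<kappa>: "\<kappa> < top"
    and sub: "\<And>S::nat \<Rightarrow> 'a set. h (\<Union>i. S i) \<le> (\<Sum>i. h (S i))"
    and mono: "\<And>S T. S \<subseteq> T \<Longrightarrow> h S \<le> h T" and empty: "h {} = 0"
    and trans: "\<And>t. h A \<le> h ((\<lambda>x. x + t *\<^sub>R b) ` A)"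
    and cube: "\<And>u s t. 0 < s \<Longrightarrow> s < \<rho> \<Longrightarrow>
      h {x. x \<bullet> b = t \<and> (\<forall>c\<in>Basis - {b}. u \<bullet> c \<le> x \<bullet> c \<and> x \<bullet> c \<le> u \<bullet> c + s)} \<le> \<kappa> * ennreal (s ^ (DIM('a) - 1))"
    and A: "bounded A" "A \<in> sets borel" "\<And>x. x \<in> A \<Longrightarrow> x \<bullet> b = 0"
  shows "h A \<le> \<kappa> * emeasure (hyperplane_measure b) A"
proof (rule ennreal_le_epsilon)
  fix e :: real assume fin: "\<kappa> * emeasure (hyperplane_measure b) A < top" and e: "0 < e"
  define A' where "A' = {p. 0 \<le> p \<bullet> b \<and> p \<bullet> b \<le> 1 \<and> p - (p \<bullet> b) *\<^sub>R b \<in> A}"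
  have [measurable]: "A \<in> sets borel" by fact
  have A'm[measurable]: "A' \<in> sets borel" unfolding A'_def by measurable
  have MA: "emeasure (hyperplane_measure b) A = emeasure lborel A'"
    unfolding A'_def by (rule emeasure_hyperplane_measure) fact
  have b1: "b \<bullet> b = 1" using b by simp
  obtain R0 where R0: "\<And>a. a \<in> A \<Longrightarrow> norm a \<le> R0" using \<open>bounded A\<close> by (auto simp: bounded_iff)
  define R where "R = \<bar>R0\<bar> + 1"
  have A'R: "A' \<subseteq> cbox (- R *\<^sub>R One) (R *\<^sub>R One)"
  proof
    fix p assume p: "p \<in> A'"
    have "norm p \<le> norm (p - (p \<bullet> b) *\<^sub>R b) + norm ((p \<bullet> b) *\<^sub>R b)"
      by (metis add.commute diff_add_cancel norm_triangle_ineq)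
    also have "\<dots> \<le> R" using R0[of "p - (p \<bullet> b) *\<^sub>R b"] p b by (auto simp: A'_def R_def)
    finally have "\<bar>p \<bullet> c\<bar> \<le> R" if "c \<in> Basis" for c using that by (meson Basis_le_norm order_trans)
    then show "p \<in> cbox (- R *\<^sub>R One) (R *\<^sub>R One)" by (fastforce simp: mem_box abs_le_iff)
  qed
  define \<kappa>' where "\<kappa>' = enn2real \<kappa>"
  have \<kappa>': "\<kappa> = ennreal \<kappa>'" "0 \<le> \<kappa>'" using \<kappa> by (auto simp: \<kappa>'_def)
  obtain U where U: "open U" "A' \<subseteq> U" "emeasure lborel (U - A') < ennreal (e / (\<kappa>' + 1))"
    using outer_regular_lborel[OF A'm, of "e / (\<kappa>' + 1)"] e \<kappa>' by auto
  \<comment> \<open>Each cube of the covering lies in \<open>?g x\<close> for some x in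
    \<open>A'\<close>, hence inside \<open>U\<close> and inside a ball of radius \<rho> / 2, which
    forces its side below \<rho>. The value off \<open>U\<close> merely completes \<open>?g\<close>
    to a gauge.\<close>
  let ?g = "\<lambda>x. if x \<in> U then U \<inter> ball x (\<rho> / 2) else ball x 1"
  have ga: "gauge ?g" using U \<rho> by (auto simp: gauge_def)
  have bx: "box (- R *\<^sub>R One) (R *\<^sub>R One :: 'a) \<noteq> {}"
    by (auto simp: box_ne_empty R_def)
  obtain D where D: "countable D" "\<Union>D \<subseteq> cbox (- R *\<^sub>R One) (R *\<^sub>R One)"
    "\<And>K. K \<in> D \<Longrightarrow> interior K \<noteq> {} \<and> (\<exists>c d. K = cbox c d)"
    "pairwise (\<lambda>A B. interior A \<inter> interior B = {}) D"
    "\<And>K. K \<in> D \<Longrightarrow> \<exists>x \<in> A' \<inter> K. K \<subseteq> ?g x"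
    "\<And>u v. cbox u v \<in> D \<Longrightarrow> \<exists>n. \<forall>i \<in> Basis. v \<bullet> i - u \<bullet> i = ((R *\<^sub>R One) \<bullet> i - (- R *\<^sub>R One) \<bullet> i) / 2^n"
    "A' \<subseteq> \<Union>D"
    by (fact covering_lemma[OF A'R bx ga])
  have cubes: "\<exists>l s. K = cbox l (l + s *\<^sub>R One) \<and> 0 < s \<and> s < \<rho> \<and> K \<subseteq> U" if K: "K \<in> D" for K
  proof -
    obtain u v where uv: "K = cbox u v" using D(3)[OF K] by auto
    obtain n where n: "\<And>i. i \<in> Basis \<Longrightarrow> v \<bullet> i - u \<bullet> i = (R + R) / 2^n"
      using D(6)[of u v] K uv by auto
    define s where "s = (R + R) / 2^n"
    have s: "0 < s" by (simp add: s_def R_def)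
    have v: "v = u + s *\<^sub>R One"
    proof (rule euclidean_eqI)
      fix i :: 'a assume i: "i \<in> Basis"
      then show "v \<bullet> i = (u + s *\<^sub>R One) \<bullet> i"
        using n[OF i] unfolding s_def[symmetric] by (simp add: inner_add_left)
    qed
    obtain x where x: "x \<in> A'" "x \<in> K" "K \<subseteq> ?g x" using D(5)[OF K] by auto
    moreover from this have "x \<in> U" using U(2) by blast
    ultimately have "K \<subseteq> U \<inter> ball x (\<rho> / 2)" by simp
    moreover have "u \<in> K" "u + s *\<^sub>R b \<in> K"
      using s b by (auto simp: uv v mem_box inner_add_left inner_Basis)
    ultimately have "dist x u < \<rho> / 2" "dist x (u + s *\<^sub>R b) < \<rho> / 2" "K \<subseteq> U" by auto
    then have "dist u (u + s *\<^sub>R b) < \<rho>" by (metis dist_commute dist_triangle_half_l)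
    then have "s < \<rho>" using s b by (simp add: dist_norm)
    then show ?thesis using s v uv \<open>K \<subseteq> U\<close> by blast
  qed
  obtain K where K: "\<And>i::nat. K i \<in> D \<or> K i = {}" "D \<subseteq> range K"
    "\<And>i j. i \<noteq> j \<Longrightarrow> K i = K j \<Longrightarrow> K i = {}"
    using countable_enumeration[OF D(1)] by metis
  \<comment> \<open>Side 0 for empty members makes their terms vanish, so that all sums can run over
    every index.\<close>
  have "\<forall>i. \<exists>l s. (K i \<noteq> {} \<longrightarrow> K i = cbox l (l + s *\<^sub>R One) \<and> 0 < s \<and> s < \<rho> \<and> K i \<subseteq> U) \<and> (K i = {} \<longrightarrow> s = 0)"
    using cubes K(1) by metis
  then obtain l s where ls: "\<And>i. K i \<noteq> {} \<Longrightarrow> K i = cbox (l i) (l i + s i *\<^sub>R One) \<and> 0 < s i \<and> s i < \<rho> \<and> K i \<subseteq> U"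
    "\<And>i. K i = {} \<Longrightarrow> s i = 0" by metis
  have s0: "0 \<le> s i" for i using ls[of i] by (cases "K i = {}") auto
  define m where m: "m = DIM('a) - 1"
  have Sm: "DIM('a) = Suc m" by (simp add: m)
  let ?J = "\<lambda>i. {l i \<bullet> b .. l i \<bullet> b + s i}"
  have slice: "h A \<le> (\<Sum>i. \<kappa> * ennreal (s i ^ m) * indicator (?J i) t)" if t: "0 \<le> t" "t \<le> 1" for t
  proof -
    have "(\<lambda>x. x + t *\<^sub>R b) ` A \<subseteq> (\<Union>i. K i \<inter> {x. x \<bullet> b = t})"
    proof clarify
      fix x assume x: "x \<in> A"
      then have "(x + t *\<^sub>R b) \<bullet> b = t" using A(3) b1 by (simp add: inner_add_left)
      moreover from this have "x + t *\<^sub>R b \<in> A'" using x t by (simp add: A'_def)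
      ultimately show "x + t *\<^sub>R b \<in> (\<Union>i. K i \<inter> {x. x \<bullet> b = t})" using D(7) K(2) by fastforce
    qed
    then have "h A \<le> h (\<Union>i. K i \<inter> {x. x \<bullet> b = t})"
      using trans mono order_trans by blast
    also have "\<dots> \<le> (\<Sum>i. h (K i \<inter> {x. x \<bullet> b = t}))" by (rule sub)
    also have "\<dots> \<le> (\<Sum>i. \<kappa> * ennreal (s i ^ m) * indicator (?J i) t)"
    proof (intro suminf_le)
      fix i
      show "h (K i \<inter> {x. x \<bullet> b = t}) \<le> \<kappa> * ennreal (s i ^ m) * indicator (?J i) t"
      proof (cases "K i \<noteq> {} \<and> t \<in> ?J i")
        case True
        have "h (K i \<inter> {x. x \<bullet> b = t}) \<le> h {x. x \<bullet> b = t \<and> (\<forall>c\<in>Basis - {b}. l i \<bullet> c \<le> x \<bullet> c \<and> x \<bullet> c \<le> l i \<bullet> c + s i)}"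
          using True ls(1)[of i] by (intro mono) (auto simp: mem_box inner_add_left)
        also have "\<dots> \<le> \<kappa> * ennreal (s i ^ m)" using True ls(1)[of i] by (intro cube[folded m]) auto
        finally show ?thesis using True by simp
      next
        case False
        then have "K i \<inter> {x. x \<bullet> b = t} = {}"
        proof (cases "K i = {}")
          case ne: False
          then have "K i = cbox (l i) (l i + s i *\<^sub>R One)" using ls(1) by blast
          then show ?thesis using False ne b by (fastforce simp: mem_box inner_add_left)
        qed simp
        then show ?thesis by (simp add: empty)
      qed
    qed auto
    finally show ?thesis .
  qed
  have "h A = (\<integral>\<^sup>+t. h A * indicator {0..1::real} t \<partial>lborel)"
    by (simp add: nn_integral_cmult)
  also have "\<dots> \<le> (\<integral>\<^sup>+t. (\<Sum>i. \<kappa> * ennreal (s i ^ m) * indicator (?J i) t) \<partial>lborel)"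
    by (intro nn_integral_mono) (auto split: split_indicator intro: slice)
  also have "\<dots> = (\<Sum>i. \<integral>\<^sup>+t. \<kappa> * ennreal (s i ^ m) * indicator (?J i) t \<partial>lborel)"
    by (rule nn_integral_suminf) measurable
  also have "\<dots> = (\<Sum>i. \<kappa> * emeasure lborel (interior (K i)))"
  proof (intro suminf_cong)
    fix i
    have "(\<integral>\<^sup>+t. \<kappa> * ennreal (s i ^ m) * indicator (?J i) t \<partial>lborel) = \<kappa> * (ennreal (s i ^ m) * ennreal (s i))"
      using s0[of i] by (simp add: nn_integral_cmult mult.assoc)
    also have "ennreal (s i ^ m) * ennreal (s i) = ennreal (s i ^ DIM('a))"
      using s0[of i] by (simp add: ennreal_mult[symmetric] Sm mult.commute)
    also have "ennreal (s i ^ DIM('a)) = emeasure lborel (interior (K i))"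
    proof (cases "K i = {}")
      case True then show ?thesis using ls(2)[of i] by simp
    next
      case False
      then have "interior (K i) = box (l i) (l i + s i *\<^sub>R One)" using ls(1)[of i] by (simp add: interior_cbox)
      then show ?thesis using s0[of i] by (simp add: emeasure_lborel_box_eq inner_add_left inner_diff_left)
    qed
    finally show "(\<integral>\<^sup>+t. \<kappa> * ennreal (s i ^ m) * indicator (?J i) t \<partial>lborel) = \<kappa> * emeasure lborel (interior (K i))" .
  qed
  also have "\<dots> = \<kappa> * (\<Sum>i. emeasure lborel (interior (K i)))" by simp
  also have "(\<Sum>i. emeasure lborel (interior (K i))) = emeasure lborel (\<Union>i. interior (K i))"
  proof (rule suminf_emeasure)
    show "disjoint_family (\<lambda>i. interior (K i))"
      unfolding disjoint_family_on_def
    proof (intro ballI impI)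
      fix i j :: nat assume "i \<noteq> j"
      show "interior (K i) \<inter> interior (K j) = {}"
      proof (cases "K i = {} \<or> K j = {}")
        case False
        then have "K i \<in> D" "K j \<in> D" "K i \<noteq> K j" using K(1)[of i] K(1)[of j] K(3)[OF \<open>i \<noteq> j\<close>] by blast+
        then show ?thesis using D(4) unfolding pairwise_def by blast
      qed auto
    qed
  qed auto
  also have "emeasure lborel (\<Union>i. interior (K i)) \<le> emeasure lborel U"
  proof (intro emeasure_mono)
    show "(\<Union>i. interior (K i)) \<subseteq> U"
    proof (rule UN_least)
      fix i show "interior (K i) \<subseteq> U"
        using ls(1)[of i] interior_subset[of "K i"] by (cases "K i = {}") blast+
    qed
  qed (use U in auto)
  also have "emeasure lborel U = emeasure lborel A' + emeasure lborel (U - A')"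
    using U by (subst plus_emeasure) (auto simp: Un_absorb1)
  also have "\<dots> \<le> emeasure lborel A' + ennreal (e / (\<kappa>' + 1))"
    using U by (intro add_left_mono) auto
  also have "\<kappa> * (emeasure lborel A' + ennreal (e / (\<kappa>' + 1))) =
     \<kappa> * emeasure (hyperplane_measure b) A + ennreal (\<kappa>' * (e / (\<kappa>' + 1)))"
  proof -
    have "\<kappa> * ennreal (e / (\<kappa>' + 1)) = ennreal (\<kappa>' * (e / (\<kappa>' + 1)))"
      unfolding \<kappa>'(1) by (rule ennreal_mult[symmetric]) (use \<kappa>' e in auto)
    then show ?thesis by (simp only: MA distrib_left)
  qed
  also have "\<dots> \<le> \<kappa> * emeasure (hyperplane_measure b) A + ennreal e"
    using \<kappa>' e by (intro add_left_mono ennreal_leI) (auto simp: field_simps)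
  finally show "h A \<le> \<kappa> * emeasure (hyperplane_measure b) A + ennreal e"
    by (simp add: mult_left_mono)
qed

section \<open>Coordinate cubes and the proportionality factor between Hausdorff and Lebesgue
  measure\<close>

lemma unit_cube_eq:
  assumes b: "b \<in> Basis"
  shows "unit_cube (Basis - {b}) = {x. x \<bullet> b = 0 \<and> (\<forall>c\<in>Basis - {b}. 0 \<le> x \<bullet> c \<and> x \<bullet> c \<le> 1)}"
  using b by (auto simp: unit_cube_def span_substd_basis)

lemma emeasure_hyperplane_box:
  fixes b :: "'a::euclidean_space"
  assumes b: "b \<in> Basis" and r: "0 \<le> r"
  shows "emeasure (hyperplane_measure b) {x. x \<bullet> b = 0 \<and> (\<forall>c\<in>Basis - {b}. u \<bullet> c \<le> x \<bullet> c \<and> x \<bullet> c \<le> u \<bullet> c + r)} =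
    ennreal (r ^ (DIM('a) - 1))"
proof -
  \<comment> \<open>The corners have \<open>b\<close>-coordinates 0 and r + (1 - r) = 1, which is
    the height of the slab in \<open>hyperplane_measure\<close>.\<close>
  let ?l = "u - (u \<bullet> b) *\<^sub>R b" and ?v = "u - (u \<bullet> b) *\<^sub>R b + r *\<^sub>R One + (1 - r) *\<^sub>R b"
  have "{x. x \<bullet> b = 0 \<and> (\<forall>c\<in>Basis - {b}. u \<bullet> c \<le> x \<bullet> c \<and> x \<bullet> c \<le> u \<bullet> c + r)} =
     {x. x \<bullet> b = 0} \<inter> (\<Inter>c\<in>Basis - {b}. {x. u \<bullet> c \<le> x \<bullet> c \<and> x \<bullet> c \<le> u \<bullet> c + r})" by auto
  also have "\<dots> \<in> sets borel"
    by (intro borel_closed closed_Int closed_INT ballI closed_Collect_conj closed_Collect_eq closed_Collect_le)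
       (auto intro!: continuous_intros)
  finally have m: "{x. x \<bullet> b = 0 \<and> (\<forall>c\<in>Basis - {b}. u \<bullet> c \<le> x \<bullet> c \<and> x \<bullet> c \<le> u \<bullet> c + r)} \<in> sets borel" .
  have eq: "{p. 0 \<le> p \<bullet> b \<and> p \<bullet> b \<le> 1 \<and> p - (p \<bullet> b) *\<^sub>R b \<in>
      {x. x \<bullet> b = 0 \<and> (\<forall>c\<in>Basis - {b}. u \<bullet> c \<le> x \<bullet> c \<and> x \<bullet> c \<le> u \<bullet> c + r)}} = cbox ?l ?v" (is "?L = ?R")
  proof (intro set_eqI)
    fix p
    have "p \<in> ?R \<longleftrightarrow> (\<forall>c\<in>insert b (Basis - {b}). ?l \<bullet> c \<le> p \<bullet> c \<and> p \<bullet> c \<le> ?v \<bullet> c)"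
      using b by (simp add: mem_box insert_absorb)
    also have "\<dots> \<longleftrightarrow> (?l \<bullet> b \<le> p \<bullet> b \<and> p \<bullet> b \<le> ?v \<bullet> b) \<and> (\<forall>c\<in>Basis - {b}. u \<bullet> c \<le> p \<bullet> c \<and> p \<bullet> c \<le> u \<bullet> c + r)"
      using b by (auto simp: inner_add_left inner_diff_left inner_Basis)
    also have "\<dots> \<longleftrightarrow> p \<in> ?L"
      using b by (auto simp: inner_add_left inner_diff_left inner_Basis)
    finally show "p \<in> ?L \<longleftrightarrow> p \<in> ?R" ..
  qed
  have le: "?l \<bullet> c \<le> ?v \<bullet> c" if "c \<in> Basis" for c
    using b r that by (auto simp: inner_add_left inner_diff_left inner_Basis)
  have "(\<Prod>c\<in>Basis. (?v - ?l) \<bullet> c) = (\<Prod>c\<in>insert b (Basis - {b}). (?v - ?l) \<bullet> c)"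
    using b by (simp add: insert_absorb)
  also have "\<dots> = (\<Prod>c\<in>Basis - {b}. (?v - ?l) \<bullet> c)"
    using b by (subst prod.insert) (auto simp: inner_add_left inner_diff_left inner_Basis)
  also have "\<dots> = (\<Prod>c\<in>Basis - {b}. r)"
    using b by (intro prod.cong) (auto simp: inner_add_left inner_diff_left inner_Basis)
  also have "\<dots> = r ^ (DIM('a) - 1)" using b by simp
  finally show ?thesis
    by (simp only: emeasure_hyperplane_measure[OF m] eq emeasure_lborel_cbox_eq) (use le in auto)
qed

lemma norm_le_sum_Basis_diff:
  assumes "b \<in> Basis" "x \<bullet> b = 0" "\<And>c. c \<in> Basis - {b} \<Longrightarrow> \<bar>x \<bullet> c\<bar> \<le> s"
  shows "norm (x::'a::euclidean_space) \<le> real (DIM('a) - 1) * s"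
proof -
  have "norm x \<le> (\<Sum>c\<in>Basis. \<bar>x \<bullet> c\<bar>)" by (rule norm_le_l1)
  also have "\<dots> = (\<Sum>c\<in>Basis - {b}. \<bar>x \<bullet> c\<bar>)"
    using assms by (intro sum.mono_neutral_right) auto
  also have "\<dots> \<le> (\<Sum>c\<in>Basis - {b}. s)" by (intro sum_mono assms)
  finally show ?thesis using assms by simp
qed

lemma hausdorff_unnormalized_translate:
  "hausdorff_unnormalized m ((\<lambda>x. x + v) ` A) = hausdorff_unnormalized m A"
proof (rule antisym)
  show "hausdorff_unnormalized m ((\<lambda>x. x + v) ` A) \<le> hausdorff_unnormalized m A"
    using hausdorff_unnormalized_similarity[of 1 "\<lambda>x. x + v" m A] by simp
  show "hausdorff_unnormalized m A \<le> hausdorff_unnormalized m ((\<lambda>x. x + v) ` A)"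
    using hausdorff_unnormalized_similarity[of 1 "\<lambda>x. x - v" m "(\<lambda>x. x + v) ` A"] by (simp add: image_image dist_norm)
qed

lemma hausdorff_delta_translate:
  assumes "0 \<le> \<delta>"
  shows "hausdorff_delta m \<delta> A \<le> hausdorff_delta m \<delta> ((\<lambda>x. x + v) ` A)"
  unfolding hausdorff_delta_def[of m \<delta> "(\<lambda>x. x + v) ` A"]
proof (rule INF_greatest, clarify)
  fix B :: "nat \<Rightarrow> 'a set"
  assume B: "(\<lambda>x. x + v) ` A \<subseteq> (\<Union>i. B i)" "\<forall>i. bounded (B i) \<and> diameter (B i) \<le> \<delta>"
  have diam: "diameter ((\<lambda>x. x - v) ` B i) = diameter (B i)" for i
  proof -
    have *: "diameter ((\<lambda>x. x + w) ` C) \<le> diameter C" if "bounded C" for C :: "'a set" and w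
      using that by (intro diameter_le) (auto simp: diameter_ge_0 dist_norm[symmetric] intro: diameter_bounded_bound)
    have "bounded ((\<lambda>x. x - v) ` B i)"
      using B(2) bounded_translation_minus by blast
    then show ?thesis
      using *[of "B i" "- v"] *[of "(\<lambda>x. x - v) ` B i" v] B(2) by (intro antisym) (simp_all add: image_image)
  qed
  have "hausdorff_delta m \<delta> A \<le> (\<Sum>i. hausdorff_gauge m ((\<lambda>x. x - v) ` B i))"
  proof (rule hausdorff_delta_le_cover)
    show "A \<subseteq> (\<Union>i. (\<lambda>x. x - v) ` B i)"
    proof
      fix a assume "a \<in> A"
      then obtain i where "a + v \<in> B i" using B(1) by blast
      then show "a \<in> (\<Union>i. (\<lambda>x. x - v) ` B i)" by (intro UN_I[OF UNIV_I] image_eqI[of _ _ "a + v"]) auto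
    qed
    show "bounded ((\<lambda>x. x - v) ` B i)" for i
      using B(2) bounded_translation_minus by blast
  qed (use B diam in auto)
  also have "\<dots> = (\<Sum>i. hausdorff_gauge m (B i))"
    unfolding hausdorff_gauge_def diam by simp
  finally show "hausdorff_delta m \<delta> A \<le> (\<Sum>i. hausdorff_gauge m (B i))" .
qed

text \<open>Here \<open>slice_cover_bound\<close> is applied at a fixed scale \<delta>: a cube of
  side s below \<delta> / n is an admissible covering set of diameter at most n s. The resulting
  bound does not depend on \<delta>. It makes the measure of the unit cube finite, so that this
  measure can later serve as \<kappa>.\<close>

lemma hausdorff_coordinate_finite:
  fixes b :: "'a::euclidean_space"
  assumes b: "b \<in> Basis" and A: "bounded A" "A \<in> sets borel" "\<And>x. x \<in> A \<Longrightarrow> x \<bullet> b = 0"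
  shows "hausdorff_unnormalized (DIM('a) - 1) A < top"
proof -
  let ?m = "DIM('a) - 1"
  have "hausdorff_unnormalized ?m A \<le> ennreal (real DIM('a) ^ ?m) * emeasure (hyperplane_measure b) A"
    unfolding hausdorff_unnormalized_eq_SUP
  proof (rule SUP_least)
    fix \<delta> :: real assume "\<delta> \<in> {0<..}"
    then have \<delta>: "0 < \<delta>" by simp
    show "hausdorff_delta ?m \<delta> A \<le> ennreal (real DIM('a) ^ ?m) * emeasure (hyperplane_measure b) A"
    proof (rule slice_cover_bound[where \<rho>="\<delta> / DIM('a)", OF b _ _ hausdorff_delta_subadditive hausdorff_delta_mono])
      fix u :: 'a and s t :: real assume s: "0 < s" "s < \<delta> / DIM('a)"
      let ?S = "{x. x \<bullet> b = t \<and> (\<forall>c\<in>Basis - {b}. u \<bullet> c \<le> x \<bullet> c \<and> x \<bullet> c \<le> u \<bullet> c + s)}"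
      have d: "norm (x - y) \<le> DIM('a) * s" if "x \<in> ?S" "y \<in> ?S" for x y
      proof -
        have "norm (x - y) \<le> real (DIM('a) - 1) * s"
          using that by (intro norm_le_sum_Basis_diff[OF b]) (auto simp: inner_diff_left abs_le_iff dest!: bspec)
        also have "\<dots> \<le> DIM('a) * s" using s by (intro mult_right_mono) auto
        finally show ?thesis .
      qed
      have bd: "bounded ?S"
        unfolding bounded_two_points by (rule exI[of _ "DIM('a) * s"]) (use d in \<open>auto simp: dist_norm\<close>)
      have dm: "diameter ?S \<le> DIM('a) * s"
        using d s by (intro diameter_le) auto
      have "hausdorff_delta ?m \<delta> ?S \<le> hausdorff_gauge ?m ?S"
        using bd dm \<delta> s by (intro hausdorff_delta_le_single) (auto simp: pos_less_divide_eq mult.commute)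
      also have "\<dots> \<le> ennreal (diameter ?S ^ ?m)" by (simp add: hausdorff_gauge_def)
      also have "\<dots> \<le> ennreal ((DIM('a) * s) ^ ?m)"
        using dm diameter_ge_0[OF bd] by (intro ennreal_leI power_mono) auto
      also have "\<dots> = ennreal (real DIM('a) ^ ?m) * ennreal (s ^ ?m)"
        using s by (simp add: power_mult_distrib ennreal_mult)
      finally show "hausdorff_delta ?m \<delta> ?S \<le> ennreal (real DIM('a) ^ ?m) * ennreal (s ^ ?m)" .
    next
      show "hausdorff_delta ?m \<delta> A \<le> hausdorff_delta ?m \<delta> ((\<lambda>x. x + t *\<^sub>R b) ` A)" for t
        using \<delta> by (intro hausdorff_delta_translate) simp
    qed (use \<delta> A in auto)
  qed
  also have "\<dots> < top"
    using emeasure_hyperplane_measure_bounded[OF A(1,2)] by (simp add: ennreal_mult_less_top)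
  finally show ?thesis .
qed

lemma closed_unit_cube:
  assumes "b \<in> Basis"
  shows "closed (unit_cube (Basis - {b}))"
proof -
  have "unit_cube (Basis - {b}) = {x. x \<bullet> b = 0} \<inter> (\<Inter>c\<in>Basis - {b}. {x. 0 \<le> x \<bullet> c \<and> x \<bullet> c \<le> 1})"
    by (auto simp: unit_cube_eq[OF assms])
  also have "closed \<dots>"
    by (intro closed_Int closed_INT ballI closed_Collect_conj closed_Collect_eq closed_Collect_le)
       (auto intro!: continuous_intros)
  finally show ?thesis .
qed

lemma bounded_unit_cube:
  fixes b :: "'a::euclidean_space"
  assumes b: "b \<in> Basis"
  shows "bounded (unit_cube (Basis - {b}))"
  unfolding bounded_iff
proof (intro exI ballI)
  fix x assume "x \<in> unit_cube (Basis - {b})"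
  then show "norm x \<le> real (DIM('a) - 1) * 1"
    by (intro norm_le_sum_Basis_diff[OF b]) (auto simp: unit_cube_eq[OF b])
qed

text \<open>The part in the hyperplane of a set of diameter d is contained in a coordinate cube of
  side 2 d. Hence the gauges of any cover sum to at least 2^-(n-1) times the Lebesgue measure 1 of
  the unit cube. The single scale 1 suffices because the Hausdorff measure is a supremum over
  scales.\<close>

lemma hausdorff_unit_cube_pos:
  fixes b :: "'a::euclidean_space"
  assumes b: "b \<in> Basis"
  shows "0 < hausdorff_unnormalized (DIM('a) - 1) (unit_cube (Basis - {b}))"
proof -
  let ?m = "DIM('a) - 1" and ?C = "unit_cube (Basis - {b})"
  have C1: "emeasure (hyperplane_measure b) ?C = 1"
    using emeasure_hyperplane_box[OF b, of 1 0] by (simp add: unit_cube_eq[OF b])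
  have "1 \<le> ennreal (2 ^ ?m) * hausdorff_delta ?m 1 ?C"
  proof -
    have "ennreal (1 / 2 ^ ?m) \<le> hausdorff_delta ?m 1 ?C"
      unfolding hausdorff_delta_def
    proof (rule INF_greatest, clarify)
      fix A :: "nat \<Rightarrow> 'a set"
      assume A: "?C \<subseteq> (\<Union>i. A i)" "\<forall>i. bounded (A i) \<and> diameter (A i) \<le> 1"
      define a where "a i = (SOME x. x \<in> A i)" for i
      define d where "d i = diameter (A i)" for i
      have d0: "0 \<le> d i" for i using A(2) by (simp add: d_def diameter_ge_0)
      \<comment> \<open>The case distinction matters in dimension 0, where a cube of side 0 has
        measure 1 but the empty set has gauge 0.\<close>
      define B where "B i = (if A i = {} then {} else {x. x \<bullet> b = 0 \<and> (\<forall>c\<in>Basis - {b}. (a i - d i *\<^sub>R One) \<bullet> c \<le> x \<bullet> c \<and> x \<bullet> c \<le> (a i - d i *\<^sub>R One) \<bullet> c + 2 * d i)})" for i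
      have Bc: "closed (B i)" for i
      proof (cases "A i = {}")
        case False
        then have "B i = {x. x \<bullet> b = 0} \<inter> (\<Inter>c\<in>Basis - {b}. {x. (a i - d i *\<^sub>R One) \<bullet> c \<le> x \<bullet> c \<and> x \<bullet> c \<le> (a i - d i *\<^sub>R One) \<bullet> c + 2 * d i})"
          by (auto simp: B_def)
        also have "closed \<dots>"
          by (intro closed_Int closed_INT ballI closed_Collect_conj closed_Collect_eq closed_Collect_le)
             (auto intro!: continuous_intros)
        finally show ?thesis .
      qed (simp add: B_def)
      have "?C \<subseteq> (\<Union>i. B i)"
      proof
        fix x assume x: "x \<in> ?C"
        then obtain i where i: "x \<in> A i" using A(1) by auto
        then have ai: "a i \<in> A i" unfolding a_def by (rule someI)
        have "norm (x - a i) \<le> d i"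
          unfolding d_def using diameter_bounded_bound[OF _ i ai] A(2) by (simp add: dist_norm)
        then have "\<bar>(x - a i) \<bullet> c\<bar> \<le> d i" if "c \<in> Basis" for c
          using Basis_le_norm[OF that, of "x - a i"] by linarith
        then have "x \<in> B i"
          using x i by (fastforce simp: B_def unit_cube_eq[OF b] inner_diff_left abs_le_iff)
        then show "x \<in> (\<Union>i. B i)" by blast
      qed
      then have "1 \<le> emeasure (hyperplane_measure b) (\<Union>i. B i)"
        unfolding C1[symmetric] by (intro emeasure_mono) (use Bc in auto)
      also have "\<dots> \<le> (\<Sum>i. emeasure (hyperplane_measure b) (B i))"
        by (rule emeasure_subadditive_countably) (use Bc in auto)
      also have "\<dots> \<le> (\<Sum>i. ennreal (2 ^ ?m) * hausdorff_gauge ?m (A i))"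
      proof (intro suminf_le)
        fix i
        show "emeasure (hyperplane_measure b) (B i) \<le> ennreal (2 ^ ?m) * hausdorff_gauge ?m (A i)"
        proof (cases "A i = {}")
          case False
          then have "emeasure (hyperplane_measure b) (B i) = ennreal ((2 * d i) ^ ?m)"
            using emeasure_hyperplane_box[OF b, of "2 * d i" "a i - d i *\<^sub>R One"] d0[of i] by (simp add: B_def)
          then show ?thesis
            using False d0[of i] by (simp add: hausdorff_gauge_def d_def power_mult_distrib ennreal_mult)
        qed (simp add: B_def)
      qed auto
      also have "\<dots> = ennreal (2 ^ ?m) * (\<Sum>i. hausdorff_gauge ?m (A i))" by simp
      finally have "ennreal (1 / 2 ^ ?m) * 1 \<le> ennreal (1 / 2 ^ ?m) * (ennreal (2 ^ ?m) * (\<Sum>i. hausdorff_gauge ?m (A i)))"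
        by (rule mult_left_mono) simp
      then show "ennreal (1 / 2 ^ ?m) \<le> (\<Sum>i. hausdorff_gauge ?m (A i))"
        by (simp add: mult.assoc[symmetric] ennreal_mult[symmetric])
    qed
    then have "ennreal (2 ^ ?m) * ennreal (1 / 2 ^ ?m) \<le> ennreal (2 ^ ?m) * hausdorff_delta ?m 1 ?C"
      by (rule mult_left_mono) simp
    then show ?thesis by (simp add: ennreal_mult[symmetric])
  qed
  then have "0 < hausdorff_delta ?m 1 ?C"
    by (metis ennreal_zero_less_one leD mult_zero_right not_gr_zero)
  also have "\<dots> \<le> hausdorff_unnormalized ?m ?C" by (rule hausdorff_delta_le) simp
  finally show ?thesis .
qed

text \<open>The upper estimate comes from \<open>slice_cover_bound\<close>, with the scaled unit
  cube as model. Applied to the complement of \<open>A\<close> in a large cube \<open>Q\<close>,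
  whose measure is bounded below by scaling, it gives the lower estimate for \<open>A\<close> by
  subadditivity.\<close>

lemma hausdorff_coordinate_hyperplane:
  fixes b :: "'a::euclidean_space"
  assumes b: "b \<in> Basis" and A: "bounded A" "A \<in> sets borel" "\<And>x. x \<in> A \<Longrightarrow> x \<bullet> b = 0"
  shows "hausdorff_unnormalized (DIM('a) - 1) A =
    hausdorff_unnormalized (DIM('a) - 1) (unit_cube (Basis - {b})) * emeasure (hyperplane_measure b) A"
proof -
  let ?m = "DIM('a) - 1" and ?C = "unit_cube (Basis - {b})" and ?M = "hyperplane_measure b"
  let ?h = "hausdorff_unnormalized ?m"
  have C0: "x \<bullet> b = 0" if "x \<in> ?C" for x using that by (simp add: unit_cube_eq[OF b])
  have \<kappa>: "?h ?C < top"
    using hausdorff_coordinate_finite[OF b bounded_unit_cube[OF b] _ C0] closed_unit_cube[OF b] by auto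
  have upper: "?h A \<le> ?h ?C * emeasure ?M A"
    if A: "bounded A" "A \<in> sets borel" "\<And>x. x \<in> A \<Longrightarrow> x \<bullet> b = 0" for A
  proof (rule slice_cover_bound[where \<rho>=1, OF b _ \<kappa> hausdorff_unnormalized_subadditive hausdorff_unnormalized_mono])
    fix u :: 'a and s t :: real assume s: "0 < s" "s < 1"
    let ?S = "{x. x \<bullet> b = t \<and> (\<forall>c\<in>Basis - {b}. u \<bullet> c \<le> x \<bullet> c \<and> x \<bullet> c \<le> u \<bullet> c + s)}"
    let ?w = "u + (t - u \<bullet> b) *\<^sub>R b"
    have "?S \<subseteq> (\<lambda>x. ?w + s *\<^sub>R x) ` ?C"
    proof
      fix x assume x: "x \<in> ?S"
      have "0 \<le> (1 / s) * (x \<bullet> c - u \<bullet> c) \<and> (1 / s) * (x \<bullet> c - u \<bullet> c) \<le> 1" if "c \<in> Basis - {b}" for c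
      proof -
        have "u \<bullet> c \<le> x \<bullet> c \<and> x \<bullet> c \<le> u \<bullet> c + s" using x that by blast
        then show ?thesis using s by (simp add: pos_divide_le_eq)
      qed
      then have "(1 / s) *\<^sub>R (x - ?w) \<in> ?C"
        unfolding unit_cube_eq[OF b] using x b by (auto simp: inner_diff_left inner_add_left inner_Basis)
      moreover have "x = ?w + s *\<^sub>R ((1 / s) *\<^sub>R (x - ?w))" using s by simp
      ultimately show "x \<in> (\<lambda>x. ?w + s *\<^sub>R x) ` ?C" by (rule rev_image_eqI)
    qed
    then have "?h ?S \<le> ?h ((\<lambda>x. ?w + s *\<^sub>R x) ` ?C)" by (rule hausdorff_unnormalized_mono)
    also have "\<dots> \<le> ennreal (s ^ ?m) * ?h ?C"
      using s by (intro hausdorff_unnormalized_similarity) (auto simp: dist_norm scaleR_diff_right[symmetric])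
    finally show "?h ?S \<le> ?h ?C * ennreal (s ^ ?m)" by (simp add: mult.commute)
  qed (use A in \<open>auto simp: hausdorff_unnormalized_translate\<close>)
  obtain R0 where R0: "\<And>a. a \<in> A \<Longrightarrow> norm a \<le> R0" using \<open>bounded A\<close> by (auto simp: bounded_iff)
  define R where "R = \<bar>R0\<bar> + 1"
  have R: "0 < R" by (simp add: R_def)
  define Q where "Q = {x::'a. x \<bullet> b = 0 \<and> (\<forall>c\<in>Basis - {b}. (- R *\<^sub>R One) \<bullet> c \<le> x \<bullet> c \<and> x \<bullet> c \<le> (- R *\<^sub>R One) \<bullet> c + 2 * R)}"
  have MQ: "emeasure ?M Q = ennreal ((2 * R) ^ ?m)"
    unfolding Q_def using R by (intro emeasure_hyperplane_box[OF b]) simp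
  have Qc: "closed Q"
  proof -
    have "Q = {x. x \<bullet> b = 0} \<inter> (\<Inter>c\<in>Basis - {b}. {x. (- R *\<^sub>R One) \<bullet> c \<le> x \<bullet> c \<and> x \<bullet> c \<le> (- R *\<^sub>R One) \<bullet> c + 2 * R})"
      by (auto simp: Q_def)
    also have "closed \<dots>"
      by (intro closed_Int closed_INT ballI closed_Collect_conj closed_Collect_eq closed_Collect_le)
         (auto intro!: continuous_intros)
    finally show ?thesis .
  qed
  have Qb: "bounded Q"
    unfolding bounded_iff
  proof (intro exI ballI)
    fix x assume x: "x \<in> Q"
    show "norm x \<le> real (DIM('a) - 1) * R"
    proof (rule norm_le_sum_Basis_diff[OF b])
      fix c assume "c \<in> Basis - {b}"
      then have "(- R *\<^sub>R One) \<bullet> c \<le> x \<bullet> c \<and> x \<bullet> c \<le> (- R *\<^sub>R One) \<bullet> c + 2 * R" "c \<in> Basis"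
        using x by (auto simp: Q_def)
      then show "\<bar>x \<bullet> c\<bar> \<le> R" by (simp add: abs_le_iff)
    qed (use x in \<open>simp add: Q_def\<close>)
  qed
  have AQ: "A \<subseteq> Q"
  proof
    fix a assume a: "a \<in> A"
    have "\<bar>a \<bullet> c\<bar> \<le> R" if "c \<in> Basis" for c
      using Basis_le_norm[OF that, of a] R0[OF a] by (simp add: R_def)
    then show "a \<in> Q" using A(3)[OF a] by (fastforce simp: Q_def abs_le_iff)
  qed
  \<comment> \<open>The similarity of ratio 1 / (2 R) takes the cube \<open>Q\<close> of side 2 R to
    the unit cube; since similarities are only known to satisfy an inequality, this direction bounds
    the measure of \<open>Q\<close> from below.\<close>
  have "?C \<subseteq> (\<lambda>x. (1/2) *\<^sub>R (One - b) + (1 / (2 * R)) *\<^sub>R x) ` Q"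
  proof
    fix x assume x: "x \<in> ?C"
    let ?y = "(2 * R) *\<^sub>R x - R *\<^sub>R (One - b)"
    have "?y \<in> Q"
      unfolding Q_def using x b R
      by (auto simp: unit_cube_eq[OF b] inner_diff_left inner_add_left inner_Basis)
    moreover have "x = (1/2) *\<^sub>R (One - b) + (1 / (2 * R)) *\<^sub>R ?y"
      using R by (simp add: scaleR_diff_right)
    ultimately show "x \<in> (\<lambda>x. (1/2) *\<^sub>R (One - b) + (1 / (2 * R)) *\<^sub>R x) ` Q" by (rule rev_image_eqI)
  qed
  then have "?h ?C \<le> ?h ((\<lambda>x. (1/2) *\<^sub>R (One - b) + (1 / (2 * R)) *\<^sub>R x) ` Q)"
    by (rule hausdorff_unnormalized_mono)
  also have "\<dots> \<le> ennreal ((1 / (2 * R)) ^ ?m) * ?h Q"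
    using R by (intro hausdorff_unnormalized_similarity) (auto simp: dist_norm scaleR_diff_right[symmetric] real_vector.scale_right_diff_distrib[symmetric])
  finally have "ennreal ((2 * R) ^ ?m) * ?h ?C \<le> ennreal ((2 * R) ^ ?m) * (ennreal ((1 / (2 * R)) ^ ?m) * ?h Q)"
    by (rule mult_left_mono) simp
  also have "\<dots> = ?h Q"
  proof -
    have "(2 * R) ^ ?m * (1 / (2 * R)) ^ ?m = (2 * R * (1 / (2 * R))) ^ ?m"
      by (rule power_mult_distrib[symmetric])
    also have "\<dots> = 1" using R by simp
    finally have "ennreal ((2 * R) ^ ?m) * ennreal ((1 / (2 * R)) ^ ?m) = 1"
      using R by (subst ennreal_mult[symmetric]) auto
    then show ?thesis unfolding mult.assoc[symmetric] by simp
  qed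
  finally have "?h ?C * emeasure ?M Q \<le> ?h Q" by (simp add: MQ mult.commute)
  also have "\<dots> = ?h (A \<union> (Q - A))" using AQ by (simp add: Un_absorb1)
  also have "\<dots> \<le> ?h A + ?h (Q - A)" by (rule hausdorff_unnormalized_Un)
  also have "\<dots> \<le> ?h A + ?h ?C * emeasure ?M (Q - A)"
    using Qb Qc A bounded_subset[OF Qb Diff_subset] by (intro add_left_mono upper) (auto simp: Q_def)
  finally have le: "?h ?C * emeasure ?M Q \<le> ?h A + ?h ?C * emeasure ?M (Q - A)" .
  have "emeasure ?M Q = emeasure ?M A + emeasure ?M (Q - A)"
    using AQ Qc A by (subst plus_emeasure) (auto simp: Un_absorb1)
  then have "?h ?C * emeasure ?M A + ?h ?C * emeasure ?M (Q - A) \<le> ?h A + ?h ?C * emeasure ?M (Q - A)"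
    using le by (simp add: distrib_left)
  moreover have "emeasure ?M (Q - A) < top"
    using emeasure_hyperplane_measure_bounded[OF bounded_subset[OF Qb Diff_subset], of A b] Qc A by auto
  then have "?h ?C * emeasure ?M (Q - A) \<noteq> top" using \<kappa> by (auto simp: ennreal_mult_eq_top_iff less_top)
  ultimately have "?h ?C * emeasure ?M A \<le> ?h A"
    unfolding add.commute[of _ "?h ?C * emeasure ?M (Q - A)"] ennreal_add_left_cancel_le by simp
  then show ?thesis using upper[OF A] by (rule antisym[rotated])
qed

text \<open>The reflection in the hyperplane orthogonal to \<nu> - b exchanges the two unit
  vectors.\<close>

lemma orthogonal_involution_exists:
  fixes \<nu> b :: "'a::euclidean_space"
  assumes \<nu>: "norm \<nu> = 1" and b: "norm b = 1"
  obtains T :: "'a \<Rightarrow> 'a" where "linear T" "\<And>x y. T x \<bullet> T y = x \<bullet> y" "\<And>x. T (T x) = x" "T \<nu> = b"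
proof (cases "\<nu> = b")
  case True
  show thesis by (rule that[of "\<lambda>x. x"]) (use True in \<open>auto simp: linear_iff\<close>)
next
  case False
  define u where "u = \<nu> - b"
  define k where "k = 2 / (u \<bullet> u)"
  have u: "u \<bullet> u \<noteq> 0" using False by (simp add: u_def)
  have k: "k * (u \<bullet> u) = 2" using u by (simp add: k_def)
  define T where "T x = x - (k * (x \<bullet> u)) *\<^sub>R u" for x
  have Tu: "T x \<bullet> u = - (x \<bullet> u)" for x
  proof -
    have "T x \<bullet> u = x \<bullet> u - (k * (u \<bullet> u)) * (x \<bullet> u)" by (simp add: T_def inner_diff_left)
    then show ?thesis by (simp add: k)
  qed
  show thesis
  proof (rule that[of T])
    show "linear T" by (rule linearI) (auto simp: T_def inner_add_left algebra_simps)
    show inv: "T (T x) = x" for x unfolding T_def[of "T x"] Tu by (simp add: T_def)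
    show "T x \<bullet> T y = x \<bullet> y" for x y
    proof -
      have "T x \<bullet> T y = T x \<bullet> y - (k * (y \<bullet> u)) * (T x \<bullet> u)"
        by (simp add: T_def[of y] inner_diff_right)
      also have "\<dots> = x \<bullet> y - (k * (x \<bullet> u)) * (u \<bullet> y) + (k * (y \<bullet> u)) * (x \<bullet> u)"
        by (simp only: Tu) (simp add: T_def[of x] inner_diff_left)
      also have "\<dots> = x \<bullet> y" by (simp add: inner_commute)
      finally show ?thesis .
    qed
    have "\<nu> \<bullet> \<nu> = 1" "b \<bullet> b = 1" using \<nu> b by (simp_all add: norm_eq_1)
    then have "u \<bullet> u = 2 * (\<nu> \<bullet> u)"
      by (simp add: u_def inner_diff_left inner_diff_right inner_commute)
    then have "k * (\<nu> \<bullet> u) = 1" using k by simp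
    then show "T \<nu> = b" by (simp add: T_def u_def)
  qed
qed

text \<open>A reflection carries the hyperplane of \<nu> to a coordinate hyperplane and preserves
  both measures. It is aimed at the hyperplane containing the cube selected in
  \<open>hausdorff\<close>, so that the proportionality factor is exactly the normalizing constant
  and cancels.\<close>

theorem hausdorff_eq_hyperplane_measure:
  fixes \<nu> :: "'a::euclidean_space"
  assumes \<nu>: "norm \<nu> = 1" and A: "bounded A" "A \<in> sets borel" "\<And>x. x \<in> A \<Longrightarrow> x \<bullet> \<nu> = 0"
  shows "hausdorff (DIM('a) - 1) A = emeasure (hyperplane_measure \<nu>) A"
proof -
  let ?m = "DIM('a) - 1"
  let ?h = "hausdorff_unnormalized ?m :: 'a set \<Rightarrow> ennreal"
  define B where "B = (SOME B :: 'a set. B \<subseteq> Basis \<and> card B = ?m)"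
  obtain b0 :: 'a where "b0 \<in> Basis" using nonempty_Basis by blast
  then have "Basis - {b0} \<subseteq> (Basis::'a set) \<and> card (Basis - {b0}) = ?m" by auto
  then have B: "B \<subseteq> Basis" "card B = ?m" unfolding B_def by (rule someI2; blast)+
  \<comment> \<open>Whatever n - 1 basis vectors are selected, exactly one is left over; it becomes
    the image of \<nu> under the reflection.\<close>
  have "card (Basis - B) = 1" using B by (subst card_Diff_subset) (auto intro: finite_subset)
  then obtain b where b': "Basis - B = {b}" by (rule card_1_singletonE)
  then have b: "b \<in> Basis" and Bb: "B = Basis - {b}" using B(1) by auto
  obtain T where T: "linear T" "\<And>x y. T x \<bullet> T y = x \<bullet> y" "\<And>x. T (T x) = x" "T \<nu> = b"
    using orthogonal_involution_exists[OF \<nu>, of b] b by auto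
  interpret T: linear T by fact
  have Tn: "norm (T x) = norm x" for x by (simp add: norm_eq_sqrt_inner T)
  have Tb: "T b = \<nu>" using T(3,4) by metis
  have Tin: "T x \<bullet> b = x \<bullet> \<nu>" "T x \<bullet> \<nu> = x \<bullet> b" for x using T(2)[of x \<nu>] T(2)[of x b] T(4) Tb by auto
  have TA: "T ` A = T -` A" using T(3) by (auto simp: image_iff) (metis T(3))
  have Tm: "T \<in> borel_measurable borel"
    using T(1) by (intro borel_measurable_continuous_onI linear_continuous_on) (simp add: linear_conv_bounded_linear)
  have A': "bounded (T ` A)" "T ` A \<in> sets borel" "\<And>x. x \<in> T ` A \<Longrightarrow> x \<bullet> b = 0"
    using A T(1) bounded_linear_image[OF A(1), of T] measurable_sets[OF Tm A(2)] Tin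
    by (auto simp: linear_conv_bounded_linear TA[symmetric])
  have dist: "dist (T x) (T y) = 1 * dist x y" for x y
    by (simp add: dist_norm T.diff[symmetric] Tn)
  have "?h A = ?h (T ` A)"
    using hausdorff_unnormalized_similarity[OF _ dist, of ?m A] hausdorff_unnormalized_similarity[OF _ dist, of ?m "T ` A"]
    by (simp add: image_image T)
  also have "\<dots> = ?h (unit_cube B) * emeasure (hyperplane_measure b) (T ` A)"
    unfolding Bb by (rule hausdorff_coordinate_hyperplane[OF b A'])
  also have "emeasure (hyperplane_measure b) (T ` A) = emeasure (hyperplane_measure \<nu>) A"
  proof -
    let ?S = "{p. 0 \<le> p \<bullet> \<nu> \<and> p \<bullet> \<nu> \<le> 1 \<and> p - (p \<bullet> \<nu>) *\<^sub>R \<nu> \<in> A}"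
    have eq: "{p. 0 \<le> p \<bullet> b \<and> p \<bullet> b \<le> 1 \<and> p - (p \<bullet> b) *\<^sub>R b \<in> T ` A} = T -` ?S"
      unfolding TA by (auto simp: Tin T.diff T.scale Tb)
    have S: "?S \<in> sets borel" using A(2) by measurable
    show ?thesis
      unfolding emeasure_hyperplane_measure[OF A(2)] emeasure_hyperplane_measure[OF A'(2)] eq
      by (rule emeasure_lborel_orthogonal[OF T(1) Tn T(3) S])
  qed
  finally have eq: "?h A = emeasure (hyperplane_measure \<nu>) A * ?h (unit_cube B)" by (simp add: mult.commute)
  have "?h (unit_cube B) \<noteq> 0" using hausdorff_unit_cube_pos[OF b] unfolding Bb by simp
  moreover have "?h (unit_cube B) \<noteq> top"
  proof -
    have "x \<bullet> b = 0" if "x \<in> unit_cube (Basis - {b})" for x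
      using that by (simp add: unit_cube_eq[OF b])
    then show ?thesis
      unfolding Bb
      using hausdorff_coordinate_finite[OF b bounded_unit_cube[OF b] borel_closed[OF closed_unit_cube[OF b]]]
      by (simp add: less_top)
  qed
  ultimately show ?thesis
    unfolding hausdorff_def B_def[symmetric] eq by (rule mult_divide_eq_ennreal)
qed

subsection \<open>Continuously differentiable functions\<close>

definition C1_real :: "('a::euclidean_space \<Rightarrow> real) \<Rightarrow> bool" where
  "C1_real f \<longleftrightarrow> (\<exists>D. (\<forall>x. (f has_derivative (\<lambda>h. D x \<bullet> h)) (at x)) \<and> continuous_on UNIV D)"

lemma C1_realI:
  "(\<And>x. (f has_derivative (\<lambda>h. D x \<bullet> h)) (at x)) \<Longrightarrow> continuous_on UNIV D \<Longrightarrow> C1_real f"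
  by (auto simp: C1_real_def)

lemma C1_realE:
  assumes "C1_real f"
  obtains D where "\<And>x. (f has_derivative (\<lambda>h. D x \<bullet> h)) (at x)" "continuous_on UNIV D"
  using assms by (auto simp: C1_real_def)

lemma C1_real_continuous: "C1_real f \<Longrightarrow> continuous_on UNIV f"
  unfolding C1_real_def by (metis has_derivative_continuous continuous_at_imp_continuous_on)

lemma C1_real_const [simp]: "C1_real (\<lambda>x. c)"
  by (rule C1_realI[where D="\<lambda>x. 0"]) auto

lemma C1_real_add:
  assumes "C1_real f" "C1_real g" shows "C1_real (\<lambda>x. f x + g x)"
proof -
  obtain D E where "\<And>x. (f has_derivative (\<lambda>h. D x \<bullet> h)) (at x)" "continuous_on UNIV D"
    "\<And>x. (g has_derivative (\<lambda>h. E x \<bullet> h)) (at x)" "continuous_on UNIV E"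
    using assms by (metis C1_realE)
  then show ?thesis
    by (intro C1_realI[where D="\<lambda>x. D x + E x"])
       (auto intro!: derivative_eq_intros continuous_intros simp: inner_add_left)
qed

lemma C1_real_mult:
  assumes "C1_real f" "C1_real g" shows "C1_real (\<lambda>x. f x * g x)"
proof -
  obtain D E where DE: "\<And>x. (f has_derivative (\<lambda>h. D x \<bullet> h)) (at x)" "continuous_on UNIV D"
    "\<And>x. (g has_derivative (\<lambda>h. E x \<bullet> h)) (at x)" "continuous_on UNIV E"
    using assms by (metis C1_realE)
  note [continuous_intros] = C1_real_continuous[OF assms(1)] C1_real_continuous[OF assms(2)]
  show ?thesis
  proof (intro C1_realI[where D="\<lambda>x. f x *\<^sub>R E x + g x *\<^sub>R D x"])
    fix x
    show "((\<lambda>x. f x * g x) has_derivative (\<lambda>h. (f x *\<^sub>R E x + g x *\<^sub>R D x) \<bullet> h)) (at x)"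
      using has_derivative_mult[OF DE(1)[of x] DE(3)[of x]] by (simp add: inner_add_left mult.commute)
  qed (use DE in \<open>intro continuous_intros\<close>)
qed

lemma C1_real_sum: "(\<And>i. i \<in> I \<Longrightarrow> C1_real (f i)) \<Longrightarrow> C1_real (\<lambda>x. \<Sum>i\<in>I. f i x)"
  by (induction I rule: infinite_finite_induct) (auto intro: C1_real_add)

lemma C1_real_compose:
  fixes \<phi> \<phi>' :: "real \<Rightarrow> real"
  assumes "C1_real f" and \<phi>: "\<And>x. (\<phi> has_real_derivative \<phi>' (f x)) (at (f x))"
    and c: "continuous_on (range f) \<phi>'"
  shows "C1_real (\<lambda>x. \<phi> (f x))"
proof -
  obtain D where D: "\<And>x. (f has_derivative (\<lambda>h. D x \<bullet> h)) (at x)" "continuous_on UNIV D"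
    using assms by (metis C1_realE)
  show ?thesis
  proof (rule C1_realI[where D="\<lambda>x. \<phi>' (f x) *\<^sub>R D x"])
    fix x
    show "((\<lambda>x. \<phi> (f x)) has_derivative (\<lambda>h. (\<phi>' (f x) *\<^sub>R D x) \<bullet> h)) (at x)"
      using diff_chain_at[OF D(1)[of x] \<phi>[of x, unfolded has_field_derivative_def]]
      by (simp add: o_def mult.commute)
    show "continuous_on UNIV (\<lambda>x. \<phi>' (f x) *\<^sub>R D x)"
      using D(2) C1_real_continuous[OF assms(1)] continuous_on_compose2[OF c, of UNIV f]
      by (intro continuous_on_scaleR) auto
  qed
qed

text \<open>Brings a nonnegative function below 1 while keeping its regularity and its zero
  set.\<close>

lemma C1_real_saturate:
  assumes "C1_real f" "\<And>x. 0 \<le> f x"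
  shows "C1_real (\<lambda>x. f x / (1 + f x))"
proof (rule C1_real_compose[OF assms(1), where \<phi>="\<lambda>s. s / (1 + s)" and \<phi>'="\<lambda>s. 1 / (1 + s)\<^sup>2"])
  fix x
  have "1 + f x \<noteq> 0" using assms(2)[of x] by linarith
  then show "((\<lambda>s. s / (1 + s)) has_real_derivative 1 / (1 + f x)\<^sup>2) (at (f x))"
    by (auto intro!: derivative_eq_intros simp: power2_eq_square)
next
  have "1 + f x \<noteq> 0" for x using assms(2)[of x] by linarith
  then show "continuous_on (range f) (\<lambda>s. 1 / (1 + s)\<^sup>2)"
    by (intro continuous_intros) auto
qed

text \<open>The square of the positive part is a truncation with continuous derivative; both the
  bumps and \<open>smooth_step\<close> are made from it.\<close>

lemma has_derivative_max_square:
  "((\<lambda>s::real. (max 0 s)\<^sup>2) has_real_derivative 2 * max 0 s) (at s)"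
proof (cases "s = 0")
  case True
  have "((\<lambda>h. (max 0 h)\<^sup>2 / h) \<longlongrightarrow> 0) (at (0::real))"
  proof (rule Lim_null_comparison)
    show "\<forall>\<^sub>F h in at 0. norm ((max 0 h)\<^sup>2 / h) \<le> \<bar>h\<bar>"
      by (auto simp: eventually_at max_def power2_eq_square intro!: exI[of _ 1])
    show "((\<lambda>h. \<bar>h\<bar>) \<longlongrightarrow> 0) (at (0::real))"
      using tendsto_rabs[of "\<lambda>h. h" 0 "at 0"] by simp
  qed
  then show ?thesis using True by (simp add: DERIV_def)
next
  case False
  then consider "s < 0" | "s > 0" by linarith
  then show ?thesis
  proof cases
    case 1
    have "((\<lambda>s::real. 0) has_real_derivative 0) (at s)" by simp
    then show ?thesis using 1
      by (subst DERIV_cong_ev[OF refl _ refl, of _ "\<lambda>s. 0"])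
         (auto simp: eventually_nhds intro!: exI[of _ "{..<0}"])
  next
    case 2
    have "((\<lambda>s::real. s\<^sup>2) has_real_derivative 2 * s) (at s)" by (auto intro!: derivative_eq_intros)
    then show ?thesis using 2
      by (subst DERIV_cong_ev[OF refl _ refl, of _ "\<lambda>s. s\<^sup>2"])
         (auto simp: eventually_nhds intro!: exI[of _ "{0<..}"])
  qed
qed

section \<open>Compactly supported cut-off functions\<close>

lemma C1_real_bump: "C1_real (\<lambda>x::'a::euclidean_space. (max 0 (r\<^sup>2 - (norm (x - c))\<^sup>2))\<^sup>2)"
proof (rule C1_real_compose[where f="\<lambda>x. r\<^sup>2 - (norm (x - c))\<^sup>2", OF _ has_derivative_max_square])
  show "C1_real (\<lambda>x::'a. r\<^sup>2 - (norm (x - c))\<^sup>2)"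
    unfolding power2_norm_eq_inner
    by (rule C1_realI[where D="\<lambda>x. - 2 *\<^sub>R (x - c)"])
       (auto intro!: derivative_eq_intros continuous_intros simp: inner_commute algebra_simps inner_diff_left)
qed (auto intro!: continuous_intros)

text \<open>Lindeloef's theorem writes the open set as a countable union of balls whose closures it
  contains. The sum of the first k bumps multiplied by k is supported in k closed balls and tends to
  infinity at every point of the set; s / (1 + s) turns this into convergence to 1.\<close>

lemma C1_exhausting_functions:
  fixes U :: "'a::euclidean_space set"
  assumes "open U"
  obtains \<psi> :: "nat \<Rightarrow> 'a \<Rightarrow> real" where
    "\<And>k. C1_real (\<psi> k)" "\<And>k x. 0 \<le> \<psi> k x" "\<And>k x. \<psi> k x \<le> 1"
    "\<And>k. \<exists>K. compact K \<and> K \<subseteq> U \<and> (\<forall>x. x \<notin> K \<longrightarrow> \<psi> k x = 0)"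
    "\<And>x. x \<in> U \<Longrightarrow> (\<lambda>k. \<psi> k x) \<longlonglongrightarrow> 1"
proof (cases "U = {}")
  case True
  show thesis by (rule that[of "\<lambda>k x. 0"]) (use True in auto)
next
  case False
  define F where "F = {ball x r | x r. 0 < r \<and> cball x r \<subseteq> U}"
  have "\<Union>F = U"
  proof
    show "U \<subseteq> \<Union>F"
    proof
      fix x assume "x \<in> U"
      then obtain r where "0 < r" "cball x r \<subseteq> U" using \<open>open U\<close> open_contains_cball by blast
      then have "x \<in> ball x r" "ball x r \<in> F" unfolding F_def by auto
      then show "x \<in> \<Union>F" by blast
    qed
  qed (auto simp: F_def subset_iff)
  moreover obtain F' where F': "F' \<subseteq> F" "countable F'" "\<Union>F' = \<Union>F"
    by (rule Lindelof[of F]) (auto simp: F_def)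
  ultimately have UF: "\<Union>F' = U" by simp
  then have ne: "F' \<noteq> {}" using False by auto
  have "\<forall>i. \<exists>c r. from_nat_into F' i = ball c r \<and> 0 < r \<and> cball c r \<subseteq> U"
    using from_nat_into[OF ne] F'(1) unfolding F_def by blast
  then obtain c r where cr: "\<And>i. from_nat_into F' i = ball (c i) (r i)" "\<And>i. 0 < r i" "\<And>i. cball (c i) (r i) \<subseteq> U"
    by metis
  have Uball: "U = (\<Union>i. ball (c i) (r i))"
    using range_from_nat_into[OF ne F'(2)] UF by (simp add: cr(1)[symmetric])
  define \<beta> where "\<beta> i x = (max 0 ((r i)\<^sup>2 - (norm (x - c i))\<^sup>2))\<^sup>2" for i x
  define \<Psi> where "\<Psi> k x = real k * (\<Sum>i<k. \<beta> i x)" for k x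
  have \<beta>0: "0 \<le> \<beta> i x" for i x by (simp add: \<beta>_def)
  have \<Psi>0: "0 \<le> \<Psi> k x" for k x by (auto simp: \<Psi>_def \<beta>0 intro!: mult_nonneg_nonneg sum_nonneg)
  have \<Psi>1: "1 + \<Psi> k x > 0" for k x using \<Psi>0[of k x] by linarith
  show thesis
  proof (rule that[of "\<lambda>k x. \<Psi> k x / (1 + \<Psi> k x)"])
    show "C1_real (\<lambda>x. \<Psi> k x / (1 + \<Psi> k x))" for k
      by (rule C1_real_saturate[OF _ \<Psi>0], unfold \<Psi>_def \<beta>_def)
         (intro C1_real_mult C1_real_sum C1_real_bump C1_real_const)
    show "0 \<le> \<Psi> k x / (1 + \<Psi> k x)" "\<Psi> k x / (1 + \<Psi> k x) \<le> 1" for k x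
      using \<Psi>0[of k x] \<Psi>1[of k x] by (auto simp: divide_le_eq_1)
    show "\<exists>K. compact K \<and> K \<subseteq> U \<and> (\<forall>x. x \<notin> K \<longrightarrow> \<Psi> k x / (1 + \<Psi> k x) = 0)" for k
    proof (intro exI conjI allI impI)
      show "compact (\<Union>i<k. cball (c i) (r i))" by (intro compact_UN) auto
      show "(\<Union>i<k. cball (c i) (r i)) \<subseteq> U" using cr(3) by blast
      fix x assume x: "x \<notin> (\<Union>i<k. cball (c i) (r i))"
      have "\<beta> i x = 0" if "i < k" for i
      proof -
        have "r i < norm (x - c i)" 
        proof -
          have "x \<notin> cball (c i) (r i)" using x that by blast
          then show ?thesis by (simp add: dist_norm norm_minus_commute)
        qed
        then have "(r i)\<^sup>2 \<le> (norm (x - c i))\<^sup>2" using cr(2)[of i] by (intro power_mono) auto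
        then show ?thesis by (simp add: \<beta>_def)
      qed
      then show "\<Psi> k x / (1 + \<Psi> k x) = 0" by (simp add: \<Psi>_def)
    qed
    fix x assume "x \<in> U"
    then obtain j where j: "x \<in> ball (c j) (r j)" using Uball by blast
    then have "(norm (x - c j))\<^sup>2 < (r j)\<^sup>2"
      using cr(2)[of j] by (intro power_strict_mono) (auto simp: dist_norm norm_minus_commute)
    then have b: "0 < \<beta> j x" by (simp add: \<beta>_def)
    show "(\<lambda>k. \<Psi> k x / (1 + \<Psi> k x)) \<longlonglongrightarrow> 1"
    proof (rule tendsto_sandwich[of "\<lambda>k. 1 - inverse (1 + real k * \<beta> j x)" _ _ "\<lambda>k. 1"])
      have "\<beta> j x \<le> (\<Sum>i<k. \<beta> i x)" if "k > j" for k
        using that \<beta>0 by (intro member_le_sum) auto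
      then have "real k * \<beta> j x \<le> \<Psi> k x" if "k > j" for k
        using that by (auto simp: \<Psi>_def intro!: mult_left_mono)
      moreover have "\<Psi> k x / (1 + \<Psi> k x) = 1 - inverse (1 + \<Psi> k x)" for k
        using \<Psi>1[of k x] by (simp add: field_simps)
      moreover have "inverse (1 + \<Psi> k x) \<le> inverse (1 + real k * \<beta> j x)" if "real k * \<beta> j x \<le> \<Psi> k x" for k
        using that b by (intro le_imp_inverse_le) (auto intro: add_pos_nonneg)
      ultimately have "1 - inverse (1 + real k * \<beta> j x) \<le> \<Psi> k x / (1 + \<Psi> k x)" if "k > j" for k
        using that by (metis diff_left_mono)
      then show "\<forall>\<^sub>F k in sequentially. 1 - inverse (1 + real k * \<beta> j x) \<le> \<Psi> k x / (1 + \<Psi> k x)"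
        by (intro eventually_sequentiallyI[of "Suc j"]) simp
      show "\<forall>\<^sub>F k in sequentially. \<Psi> k x / (1 + \<Psi> k x) \<le> 1"
        using \<Psi>0 \<Psi>1 by (auto simp: divide_le_eq_1)
      have "filterlim (\<lambda>k. 1 + real k * \<beta> j x) at_top sequentially"
        using b by (intro filterlim_tendsto_add_at_top[OF tendsto_const]
            filterlim_at_top_mult_tendsto_pos[OF tendsto_const] filterlim_real_sequentially)
      then have "(\<lambda>k. inverse (1 + real k * \<beta> j x)) \<longlonglongrightarrow> 0"
        by (rule tendsto_inverse_0_at_top)
      then show "(\<lambda>k. 1 - inverse (1 + real k * \<beta> j x)) \<longlonglongrightarrow> 1"
        using tendsto_diff[OF tendsto_const, of _ 0 sequentially 1] by simp
    qed simp
  qed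
qed

lemma C1_map_components:
  fixes X :: "'a::euclidean_space \<Rightarrow> 'a"
  assumes "\<And>b. b \<in> Basis \<Longrightarrow> C1_real (\<lambda>x. X x \<bullet> b)"
  shows "C1_map X"
proof -
  have "\<forall>b\<in>Basis. \<exists>D. (\<forall>x. ((\<lambda>x. X x \<bullet> b) has_derivative (\<lambda>h. D x \<bullet> h)) (at x)) \<and> continuous_on UNIV D"
    using assms by (simp add: C1_real_def)
  then obtain D where D: "\<And>b x. b \<in> Basis \<Longrightarrow> ((\<lambda>x. X x \<bullet> b) has_derivative (\<lambda>h. D b x \<bullet> h)) (at x)"
    "\<And>b. b \<in> Basis \<Longrightarrow> continuous_on UNIV (D b)" by metis
  let ?E = "\<lambda>x. \<Sum>b\<in>Basis. blinfun_scaleR_left b o\<^sub>L blinfun_inner_left (D b x)"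
  have E: "blinfun_apply (?E x) h = (\<Sum>b\<in>Basis. (D b x \<bullet> h) *\<^sub>R b)" for x h
    by (simp add: blinfun.sum_left inner_commute)
  show ?thesis unfolding C1_map_def
  proof (intro exI[of _ ?E] conjI allI)
    fix x
    show "(X has_derivative blinfun_apply (?E x)) (at x)"
      by (rule has_derivative_componentwise_within[THEN iffD2])
         (use D(1) in \<open>auto simp: E inner_sum_left inner_Basis if_distrib cong: if_cong\<close>)
  next
    show "continuous_on UNIV ?E"
      using D(2) by (intro continuous_on_sum bounded_bilinear.continuous_on[OF bounded_bilinear_blinfun_compose]
         bounded_linear.continuous_on[OF bounded_linear_blinfun_inner_left] continuous_on_const) auto
  qed
qed

lemma C1_map_inner:
  fixes X :: "'a::euclidean_space \<Rightarrow> 'a"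
  assumes "C1_map X"
  shows "C1_real (\<lambda>x. X x \<bullet> b)"
proof -
  obtain D :: "'a \<Rightarrow> 'a \<Rightarrow>\<^sub>L 'a" where D: "\<And>x. (X has_derivative blinfun_apply (D x)) (at x)" "continuous_on UNIV D"
    using assms by (auto simp: C1_map_def)
  let ?E = "\<lambda>x. \<Sum>c\<in>Basis. (blinfun_apply (D x) c \<bullet> b) *\<^sub>R c"
  have E: "?E x \<bullet> h = blinfun_apply (D x) h \<bullet> b" for x h
  proof -
    have "blinfun_apply (D x) h \<bullet> b = blinfun_apply (D x) (\<Sum>c\<in>Basis. (h \<bullet> c) *\<^sub>R c) \<bullet> b"
      by (simp add: euclidean_representation)
    also have "\<dots> = ?E x \<bullet> h"
      by (simp add: blinfun.sum_right blinfun.scaleR_right inner_sum_left inner_commute[of h] mult.commute)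
    finally show ?thesis ..
  qed
  show ?thesis
  proof (rule C1_realI[where D="?E"])
    show "((\<lambda>x. X x \<bullet> b) has_derivative (\<lambda>h. ?E x \<bullet> h)) (at x)" for x
      unfolding E using D(1) by (intro has_derivative_inner_left)
    show "continuous_on UNIV ?E" using D(2) by (intro continuous_intros)
  qed
qed

subsection \<open>Polynomial maps\<close>

lemma real_polynomial_gradient:
  fixes p :: "'a::euclidean_space \<Rightarrow> real"
  assumes "real_polynomial_function p"
  shows "\<exists>D. (\<forall>x. (p has_derivative (\<lambda>h. D x \<bullet> h)) (at x)) \<and> polynomial_function D"
  using assms
proof (induction rule: real_polynomial_function.induct)
  case (linear f)
  have "f h = (\<Sum>b\<in>Basis. f b *\<^sub>R b) \<bullet> h" for h
  proof -
    have "f h = f (\<Sum>b\<in>Basis. (h \<bullet> b) *\<^sub>R b)" by (simp add: euclidean_representation)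
    also have "\<dots> = (\<Sum>b\<in>Basis. f b *\<^sub>R b) \<bullet> h"
      using bounded_linear.linear[OF linear]
      by (simp add: linear_sum linear_scale inner_sum_left inner_commute[of h] mult.commute)
    finally show ?thesis .
  qed
  then have "f = (\<lambda>h. (\<Sum>b\<in>Basis. f b *\<^sub>R b) \<bullet> h)" by blast
  then have "(f has_derivative (\<lambda>h. (\<Sum>b\<in>Basis. f b *\<^sub>R b) \<bullet> h)) (at x)" for x
    using bounded_linear_imp_has_derivative[OF linear] by metis
  then show ?case by (intro exI[of _ "\<lambda>x. \<Sum>b\<in>Basis. f b *\<^sub>R b"]) auto
next
  case (const c) show ?case by (intro exI[of _ "\<lambda>x. 0"]) auto
next
  case (add f g)
  then obtain D E where "\<And>x. (f has_derivative (\<lambda>h. D x \<bullet> h)) (at x)" "polynomial_function D"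
    "\<And>x. (g has_derivative (\<lambda>h. E x \<bullet> h)) (at x)" "polynomial_function E" by blast
  then show ?case
    by (intro exI[of _ "\<lambda>x. D x + E x"]) (auto intro!: derivative_eq_intros simp: inner_add_left)
next
  case (mult f g)
  then obtain D E where DE: "\<And>x. (f has_derivative (\<lambda>h. D x \<bullet> h)) (at x)" "polynomial_function D"
    "\<And>x. (g has_derivative (\<lambda>h. E x \<bullet> h)) (at x)" "polynomial_function E" by blast
  show ?case
  proof (intro exI[of _ "\<lambda>x. f x *\<^sub>R E x + g x *\<^sub>R D x"] conjI allI)
    fix x
    show "((\<lambda>x. f x * g x) has_derivative (\<lambda>h. (f x *\<^sub>R E x + g x *\<^sub>R D x) \<bullet> h)) (at x)"
      using has_derivative_mult[OF DE(1)[of x] DE(3)[of x]] by (simp add: inner_add_left mult.commute)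
    show "polynomial_function (\<lambda>x. f x *\<^sub>R E x + g x *\<^sub>R D x)"
      using mult.hyps DE by (intro polynomial_function_add polynomial_function_mult) (simp_all add: real_polynomial_function_eq)
  qed
qed

lemma polynomial_function_derivative:
  fixes p :: "'a::euclidean_space \<Rightarrow> 'b::euclidean_space"
  assumes "polynomial_function p"
  obtains D where "\<And>x. (p has_derivative D x) (at x)" "\<And>h. polynomial_function (\<lambda>x. D x h)"
proof -
  have "\<forall>b\<in>Basis. \<exists>D. (\<forall>x. ((\<lambda>x. p x \<bullet> b) has_derivative (\<lambda>h. D x \<bullet> h)) (at x)) \<and> polynomial_function D"
    using assms by (intro ballI real_polynomial_gradient) (auto simp: polynomial_function_iff_Basis_inner)
  then obtain D where D: "\<And>b x. b \<in> Basis \<Longrightarrow> ((\<lambda>x. p x \<bullet> b) has_derivative (\<lambda>h. D b x \<bullet> h)) (at x)"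
    "\<And>b. b \<in> Basis \<Longrightarrow> polynomial_function (D b)" by metis
  show thesis
  proof (rule that[of "\<lambda>x h. \<Sum>b\<in>Basis. (D b x \<bullet> h) *\<^sub>R b"])
    show "(p has_derivative (\<lambda>h. \<Sum>b\<in>Basis. (D b x \<bullet> h) *\<^sub>R b)) (at x)" for x
      by (rule has_derivative_componentwise_within[THEN iffD2])
         (use D(1) in \<open>auto simp: inner_sum_left inner_Basis if_distrib cong: if_cong\<close>)
    fix h
    have "polynomial_function (\<lambda>x. D b x \<bullet> h)" if "b \<in> Basis" for b
    proof -
      have "real_polynomial_function ((\<lambda>a. a \<bullet> h) \<circ> D b)"
        using D(2)[OF that] bounded_linear_inner_left unfolding polynomial_function_def by blast
      then show ?thesis by (simp add: o_def real_polynomial_function_eq)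
    qed
    then show "polynomial_function (\<lambda>x. \<Sum>b\<in>Basis. (D b x \<bullet> h) *\<^sub>R b)"
      by (intro polynomial_function_sum polynomial_function_mult) auto
  qed
qed

lemma C1_real_polynomial: "real_polynomial_function p \<Longrightarrow> C1_real p"
  using real_polynomial_gradient[of p] continuous_on_polymonial_function unfolding C1_real_def by blast

subsection \<open>The Dynkin series\<close>

lemma polynomial_function_bilinear:
  fixes f :: "'a::real_normed_vector \<Rightarrow> 'b::euclidean_space" and g :: "'a \<Rightarrow> 'c::euclidean_space"
    and B :: "'b \<Rightarrow> 'c \<Rightarrow> 'd::real_normed_vector"
  assumes B: "bilinear B" and f: "polynomial_function f" and g: "polynomial_function g"
  shows "polynomial_function (\<lambda>p. B (f p) (g p))"
proof -
  have "B (f p) (g p) = (\<Sum>i\<in>Basis. \<Sum>j\<in>Basis. ((f p \<bullet> i) * (g p \<bullet> j)) *\<^sub>R B i j)" for p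
  proof -
    have "B (f p) (g p) = B (\<Sum>i\<in>Basis. (f p \<bullet> i) *\<^sub>R i) (\<Sum>j\<in>Basis. (g p \<bullet> j) *\<^sub>R j)"
      by (simp add: euclidean_representation)
    also have "\<dots> = (\<Sum>(i, j)\<in>Basis \<times> Basis. B ((f p \<bullet> i) *\<^sub>R i) ((g p \<bullet> j) *\<^sub>R j))"
      by (rule bilinear_sum[OF B])
    also have "\<dots> = (\<Sum>i\<in>Basis. \<Sum>j\<in>Basis. ((f p \<bullet> i) * (g p \<bullet> j)) *\<^sub>R B i j)"
      unfolding sum.cartesian_product[symmetric]
      by (simp add: bilinear_lmul[OF B] bilinear_rmul[OF B] mult.commute)
    finally show ?thesis .
  qed
  moreover have "polynomial_function (\<lambda>p. (f p \<bullet> i) * (g p \<bullet> j))" if "i \<in> Basis" "j \<in> Basis" for i j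
  proof -
    have "real_polynomial_function (\<lambda>p. f p \<bullet> i)" "real_polynomial_function (\<lambda>p. g p \<bullet> j)"
    proof -
      have "real_polynomial_function ((\<lambda>a. a \<bullet> i) \<circ> f)" "real_polynomial_function ((\<lambda>a. a \<bullet> j) \<circ> g)"
        using f g bounded_linear_inner_left unfolding polynomial_function_def by blast+
      then show "real_polynomial_function (\<lambda>p. f p \<bullet> i)" "real_polynomial_function (\<lambda>p. g p \<bullet> j)"
        by (simp_all add: o_def)
    qed
    then show ?thesis unfolding real_polynomial_function_eq[symmetric] by (rule real_polynomial_function.intros(4))
  qed
  then have "polynomial_function (\<lambda>p. \<Sum>i\<in>Basis. \<Sum>j\<in>Basis. ((f p \<bullet> i) * (g p \<bullet> j)) *\<^sub>R B i j)"
    by (intro polynomial_function_sum polynomial_function_mult polynomial_function_const finite_Basis)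
  ultimately show ?thesis by simp
qed

lemma dynkin_degree_ge_length:
  "(\<forall>(r, s)\<in>set ps. 0 < r + s) \<Longrightarrow> length ps \<le> dynkin_degree ps"
  by (induction ps) (fastforce simp: dynkin_degree_def)+

lemma dynkin_degree_Cons: "dynkin_degree ((r, s) # ps) = r + s + dynkin_degree ps"
  by (simp add: dynkin_degree_def)

lemma dynkin_degree_1:
  assumes "ps \<noteq> []" "\<forall>(r, s)\<in>set ps. 0 < r + s" "dynkin_degree ps = 1"
  shows "ps = [(1, 0)] \<or> ps = [(0, 1)]"
proof -
  obtain r s qs where ps: "ps = (r, s) # qs" using assms(1) by (metis list.exhaust surj_pair)
  have "length ps \<le> 1" using dynkin_degree_ge_length[OF assms(2)] assms(3) by simp
  then have "qs = []" using ps by simp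
  then have "r + s = 1" using assms(3) ps by (simp add: dynkin_degree_def)
  then show ?thesis using ps \<open>qs = []\<close> by (cases r) auto
qed

text \<open>The complete list is used to read off the coefficient 1/2 of the bracket in the product;
  four of its members give brackets of an element with itself.\<close>

lemma dynkin_degree_2:
  assumes "ps \<noteq> []" "\<forall>(r, s)\<in>set ps. 0 < r + s" "dynkin_degree ps = 2"
  shows "ps \<in> {[(2, 0)], [(1, 1)], [(0, 2)], [(1, 0), (1, 0)], [(1, 0), (0, 1)], [(0, 1), (1, 0)], [(0, 1), (0, 1)]}"
proof -
  obtain r s qs where ps: "ps = (r, s) # qs" using assms(1) by (metis list.exhaust surj_pair)
  show ?thesis
  proof (cases "qs = []")
    case True
    then have "r + s = 2" using assms(3) ps by (simp add: dynkin_degree_def)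
    then have "(r = 0 \<and> s = 2) \<or> (r = 1 \<and> s = 1) \<or> (r = 2 \<and> s = 0)" by linarith
    then show ?thesis using ps True by auto
  next
    case False
    have q: "\<forall>(r, s)\<in>set qs. 0 < r + s" and rs: "0 < r + s" using assms(2) ps by auto
    have "1 \<le> dynkin_degree qs"
      using dynkin_degree_ge_length[OF q] False by (cases qs) auto
    then have "dynkin_degree qs = 1" "r + s = 1"
      using assms(3) rs by (auto simp: ps dynkin_degree_Cons)
    moreover from this have "(r = 0 \<and> s = 1) \<or> (r = 1 \<and> s = 0)" by linarith
    ultimately show ?thesis using dynkin_degree_1[OF False q] ps by auto
  qed
qed

definition dynkin_word :: "(nat \<times> nat) list \<Rightarrow> 'a \<Rightarrow> 'a \<Rightarrow> 'a list" where
  "dynkin_word ps x y = concat (map (\<lambda>(r, s). replicate r x @ replicate s y) ps)"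

definition dynkin_coeff :: "(nat \<times> nat) list \<Rightarrow> real" where
  "dynkin_coeff ps = (-1) ^ (length ps + 1) /
     (real (length ps) * real (dynkin_degree ps) * (\<Prod>(r, s)\<leftarrow>ps. fact r * fact s))"

lemma bch_eq: "bch br N x y = (\<Sum>ps\<in>dynkin_indices N. dynkin_coeff ps *\<^sub>R nested_bracket br (dynkin_word ps x y))"
  by (simp add: bch_def dynkin_coeff_def dynkin_word_def)

lemma length_dynkin_word [simp]: "length (dynkin_word ps x y) = dynkin_degree ps"
  by (induction ps) (auto simp: dynkin_word_def dynkin_degree_def)

lemma set_dynkin_word: "set (dynkin_word ps x y) \<subseteq> {x, y}"
proof (induction ps)
  case (Cons p ps)
  obtain r s where p: "p = (r, s)" by (cases p)
  have "set (replicate n z) \<subseteq> {z}" for n and z :: 'a by (induction n) simp_all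
  then have "set (replicate r x @ replicate s y) \<subseteq> {x, y}" by fastforce
  moreover have "dynkin_word (p # ps) x y = (replicate r x @ replicate s y) @ dynkin_word ps x y"
    by (simp add: p dynkin_word_def)
  ultimately show ?case using Cons.IH by (metis Un_least set_append)
qed (simp add: dynkin_word_def)

lemma map_dynkin_word: "map h (dynkin_word ps x y) = dynkin_word ps (h x) (h y)"
  by (simp add: dynkin_word_def map_concat comp_def case_prod_unfold)

lemma list_all2_dynkin_word:
  assumes "P x x'" "P y y'"
  shows "list_all2 P (dynkin_word ps x y) (dynkin_word ps x' y')"
proof -
  have "list_all2 P (replicate n a) (replicate n b)" if "P a b" for n a b
    using that by (induction n) auto
  then show ?thesis
    using assms by (induction ps) (auto simp: dynkin_word_def intro!: list_all2_appendI)
qed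

lemma nested_bracket_Cons: "xs \<noteq> [] \<Longrightarrow> nested_bracket br (x # xs) = br x (nested_bracket br xs)"
  by (cases xs) auto

lemma nested_bracket_map_linear:
  assumes "linear h" "\<And>x y. br (h x) (h y) = h (br x y)"
  shows "nested_bracket br (map h xs) = h (nested_bracket br xs)"
proof (induction xs)
  case Nil show ?case using linear_0[OF assms(1)] by simp
next
  case (Cons a xs) then show ?case by (cases "xs = []") (auto simp: nested_bracket_Cons assms)
qed

definition higher_indices :: "nat \<Rightarrow> (nat \<times> nat) list set" where
  "higher_indices N = {ps \<in> dynkin_indices N. 2 \<le> dynkin_degree ps}"

lemma finite_higher_indices [simp]: "finite (higher_indices N)"
  unfolding higher_indices_def using finite_dynkin_indices by simp

lemma bch_decompose:
  assumes "1 \<le> N"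
  shows "bch br N x y = x + y + (\<Sum>ps\<in>higher_indices N. dynkin_coeff ps *\<^sub>R nested_bracket br (dynkin_word ps x y))"
proof -
  have eq: "dynkin_indices N = {[(1, 0)], [(0, 1)]} \<union> higher_indices N"
  proof
    show "dynkin_indices N \<subseteq> {[(1, 0)], [(0, 1)]} \<union> higher_indices N"
    proof
      fix ps assume ps: "ps \<in> dynkin_indices N"
      then have p: "ps \<noteq> []" "\<forall>(r, s)\<in>set ps. 0 < r + s" by (auto simp: dynkin_indices_def)
      then have "1 \<le> dynkin_degree ps"
        using dynkin_degree_ge_length[OF p(2)] by (cases ps) auto
      then show "ps \<in> {[(1, 0)], [(0, 1)]} \<union> higher_indices N"
        using dynkin_degree_1[OF p] ps by (force simp: higher_indices_def)
    qed
    show "{[(1, 0)], [(0, 1)]} \<union> higher_indices N \<subseteq> dynkin_indices N"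
      using assms by (auto simp: dynkin_indices_def dynkin_degree_def higher_indices_def)
  qed
  have "{[(1, 0)], [(0, 1)]} \<inter> higher_indices N = {}"
    by (auto simp: higher_indices_def dynkin_degree_def)
  then have "bch br N x y = (\<Sum>ps\<in>{[(1, 0)], [(0, 1)]}. dynkin_coeff ps *\<^sub>R nested_bracket br (dynkin_word ps x y)) +
     (\<Sum>ps\<in>higher_indices N. dynkin_coeff ps *\<^sub>R nested_bracket br (dynkin_word ps x y))"
    unfolding bch_eq eq by (intro sum.union_disjoint) auto
  then show ?thesis
    by (simp add: dynkin_coeff_def dynkin_degree_def dynkin_word_def)
qed

context stratified_group
begin

abbreviation br :: "'a \<Rightarrow> 'a \<Rightarrow> 'a" where "br \<equiv> group_bracket gmul"

sublocale grp: group gmul 0 uminus by (rule group_gmul)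

subsection \<open>Layers and degrees\<close>

text \<open>The choice is in fact unique, because a nonzero vector lies in at most one layer of a
  direct sum; see \<open>Basis_layer_iff\<close>.\<close>

definition deg :: "'a \<Rightarrow> nat" where
  "deg b = (SOME j. j \<in> {1..\<iota>} \<and> b \<in> V j)"

lemma deg: assumes "b \<in> Basis" shows "deg b \<in> {1..\<iota>}" "b \<in> V (deg b)" "1 \<le> deg b" "deg b \<le> \<iota>"
proof -
  have "\<exists>j. j \<in> {1..\<iota>} \<and> b \<in> V j" using adapted_basis assms by blast
  from someI_ex[OF this] show "deg b \<in> {1..\<iota>}" "b \<in> V (deg b)" "1 \<le> deg b" "deg b \<le> \<iota>"
    unfolding deg_def by auto
qed

text \<open>This makes the layers mutually orthogonal. A vector of one layer has two decompositions,
  the trivial one and its basis expansion grouped by degree; uniqueness in \<open>direct_sum\<close>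
  identifies them.\<close>

lemma layer_inner:
  assumes v: "v \<in> V j" "1 \<le> j" and b: "b \<in> Basis" "deg b \<noteq> j"
  shows "v \<bullet> b = 0"
proof (cases "j \<le> \<iota>")
  case False then show ?thesis using layer_beyond[of j] v by auto
next
  case True
  let ?u = "\<lambda>i\<in>{1..\<iota>}. \<Sum>c\<in>{c\<in>Basis. deg c = i}. (v \<bullet> c) *\<^sub>R c"
  let ?w = "\<lambda>i\<in>{1..\<iota>}. if i = j then v else 0"
  have sub: "subspace (V i)" if "i \<in> {1..\<iota>}" for i using layer_subspace that by simp
  have "?u \<in> (\<Pi>\<^sub>E j\<in>{1..\<iota>}. V j)"
    using sub deg by (auto intro!: subspace_sum subspace_scale)
  moreover have "?w \<in> (\<Pi>\<^sub>E j\<in>{1..\<iota>}. V j)"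
    using sub[THEN subspace_0] v by auto
  moreover have "(\<Sum>i=1..\<iota>. ?u i) = v"
  proof -
    have "(\<Sum>i=1..\<iota>. ?u i) = (\<Sum>i=1..\<iota>. \<Sum>c\<in>{c\<in>Basis. deg c = i}. (v \<bullet> c) *\<^sub>R c)" by simp
    also have "\<dots> = (\<Sum>c\<in>Basis. (v \<bullet> c) *\<^sub>R c)"
      by (rule sum.group) (use deg in auto)
    finally show ?thesis by (simp add: euclidean_representation)
  qed
  moreover have "(\<Sum>i=1..\<iota>. ?w i) = v" using True v by simp
  ultimately have "?u = ?w" using direct_sum[of v] by blast
  then have "?u (deg b) = ?w (deg b)" by simp
  then have 0: "(\<Sum>c\<in>{c\<in>Basis. deg c = deg b}. (v \<bullet> c) *\<^sub>R c) = 0" using deg(1)[OF b(1)] b(2) by simp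
  have "(\<Sum>c\<in>{c\<in>Basis. deg c = deg b}. (v \<bullet> c) *\<^sub>R c) \<bullet> b = (\<Sum>c\<in>{c\<in>Basis. deg c = deg b}. if c = b then v \<bullet> c else 0)"
    unfolding inner_sum_left using b by (intro sum.cong) (auto simp: inner_Basis)
  also have "\<dots> = v \<bullet> b" using b by simp
  finally show ?thesis using 0 by simp
qed

lemma layer_iff:
  assumes "1 \<le> j" "j \<le> \<iota>"
  shows "v \<in> V j \<longleftrightarrow> (\<forall>b\<in>Basis. deg b \<noteq> j \<longrightarrow> v \<bullet> b = 0)"
proof
  assume 0: "\<forall>b\<in>Basis. deg b \<noteq> j \<longrightarrow> v \<bullet> b = 0"
  have "(\<Sum>b\<in>Basis. (v \<bullet> b) *\<^sub>R b) \<in> V j"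
  proof (rule subspace_sum[OF layer_subspace[OF assms(1)]])
    fix b :: 'a assume "b \<in> Basis"
    then show "(v \<bullet> b) *\<^sub>R b \<in> V j"
      using 0 deg(2)[of b] subspace_scale[OF layer_subspace[OF assms(1)]] subspace_0[OF layer_subspace[OF assms(1)]]
      by (cases "deg b = j") auto
  qed
  then show "v \<in> V j" by (simp add: euclidean_representation)
qed (use layer_inner assms in blast)

lemma Basis_layer_iff: "b \<in> Basis \<Longrightarrow> 1 \<le> j \<Longrightarrow> b \<in> V j \<longleftrightarrow> deg b = j"
  using layer_inner[of b j b] deg(2)[of b] by (cases "deg b = j") auto

lemma dim_layer:
  assumes "1 \<le> j" "j \<le> \<iota>"
  shows "dim (V j) = card {b\<in>Basis. deg b = j}"
proof -
  have "V j = span {b\<in>Basis. deg b = j}"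
    by (subst span_substd_basis) (auto simp: layer_iff[OF assms])
  then show ?thesis
    using dim_span_eq_card_independent[OF independent_mono[OF independent_Basis, of "{b\<in>Basis. deg b = j}"]]
    by auto
qed

lemma hom_dim_eq: "hom_dim V \<iota> = (\<Sum>b\<in>Basis. deg b)"
proof -
  have "hom_dim V \<iota> = (\<Sum>j=1..\<iota>. \<Sum>b\<in>{b\<in>Basis. deg b = j}. deg b)"
    unfolding hom_dim_def by (intro sum.cong) (auto simp: dim_layer)
  also have "\<dots> = (\<Sum>b\<in>Basis. deg b)" by (rule sum.group) (use deg in auto)
  finally show ?thesis .
qed

text \<open>\<open>tail k\<close> is the sum of the layers \<open>V j\<close> with \<open>j \<ge> k\<close>.\<close>

definition tail :: "nat \<Rightarrow> 'a set" where
  "tail k = {x. \<forall>b\<in>Basis. deg b < k \<longrightarrow> x \<bullet> b = 0}"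

lemma subspace_tail: "subspace (tail k)"
  by (auto simp: subspace_def tail_def inner_add_left)

lemma tail_0 [simp]: "0 \<in> tail k" by (simp add: tail_def)
lemma tail_add: "x \<in> tail k \<Longrightarrow> y \<in> tail k \<Longrightarrow> x + y \<in> tail k" by (simp add: tail_def inner_add_left)
lemma tail_diff: "x \<in> tail k \<Longrightarrow> y \<in> tail k \<Longrightarrow> x - y \<in> tail k" by (simp add: tail_def inner_diff_left)
lemma tail_scale: "x \<in> tail k \<Longrightarrow> c *\<^sub>R x \<in> tail k" by (simp add: tail_def)
lemma tail_sum: "(\<And>i. i \<in> I \<Longrightarrow> f i \<in> tail k) \<Longrightarrow> sum f I \<in> tail k"
  by (rule subspace_sum[OF subspace_tail])
lemma tail_mono: "x \<in> tail l \<Longrightarrow> k \<le> l \<Longrightarrow> x \<in> tail k" by (auto simp: tail_def)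
lemma tail_1 [simp]: "x \<in> tail (Suc 0)" using deg(3) by (fastforce simp: tail_def)
lemma tail_beyond: "x \<in> tail (Suc \<iota>) \<longleftrightarrow> x = 0"
proof
  assume "x \<in> tail (Suc \<iota>)"
  then have "x \<bullet> b = 0" if "b \<in> Basis" for b
    using deg(4)[OF that] that unfolding tail_def by (auto simp: less_Suc_eq_le)
  then show "x = 0" by (simp add: euclidean_eq_iff[of x])
qed simp
lemma layer_tail: "v \<in> V j \<Longrightarrow> 1 \<le> j \<Longrightarrow> k \<le> j \<Longrightarrow> v \<in> tail k"
  using layer_inner by (fastforce simp: tail_def)

subsection \<open>The product is a polynomial map\<close>

lemma polynomial_nested_bracket:
  fixes fs :: "('b::euclidean_space \<Rightarrow> 'a) list"
  assumes "\<And>f. f \<in> set fs \<Longrightarrow> polynomial_function f"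
  shows "polynomial_function (\<lambda>p. nested_bracket br (map (\<lambda>f. f p) fs))"
  using assms
proof (induction fs)
  case (Cons f fs)
  then show ?case
    by (cases "fs = []") (auto simp: nested_bracket_Cons intro!: polynomial_function_bilinear[OF bracket_bilinear])
qed simp

lemma polynomial_gmul: "polynomial_function (\<lambda>p. gmul (fst p) (snd p))"
proof -
  \<comment> \<open>The word in two group elements is the pointwise value of a word in the
    projections, to which closure of polynomial maps under brackets applies.\<close>
  have eq: "dynkin_word ps (fst p) (snd p) = map (\<lambda>f. f p) (dynkin_word ps fst snd)"
    for ps and p :: "'a \<times> 'a"
    using map_dynkin_word[of "\<lambda>f. f p" ps fst snd] by simp
  have "polynomial_function f" if "f \<in> set (dynkin_word ps fst snd)" for ps and f :: "'a \<times> 'a \<Rightarrow> 'a"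
  proof -
    have "f = fst \<or> f = snd" using that set_dynkin_word[of ps fst snd] by blast
    then show ?thesis by (auto intro: polynomial_function_bounded_linear bounded_linear_fst bounded_linear_snd)
  qed
  moreover have "(\<lambda>p. gmul (fst p) (snd p)) = (\<lambda>p. \<Sum>ps\<in>dynkin_indices \<iota>.
      dynkin_coeff ps *\<^sub>R nested_bracket br (map (\<lambda>f. f p) (dynkin_word ps fst snd)))"
    by (simp only: gmul_bch bch_eq eq)
  ultimately show ?thesis
    by (simp only:) (intro polynomial_function_sum finite_dynkin_indices polynomial_function_cmul polynomial_nested_bracket)
qed

lemma gmul_derivative_exists:
  "\<exists>D. (\<forall>p. ((\<lambda>q. gmul (fst q) (snd q)) has_derivative D p) (at p)) \<and> (\<forall>h. polynomial_function (\<lambda>p. D p h))"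
  using polynomial_function_derivative[OF polynomial_gmul] by metis

text \<open>The derivative in both factors jointly, with polynomial dependence on the base point;
  left invariant fields inherit their smoothness from it.\<close>

definition gmul_deriv :: "'a \<times> 'a \<Rightarrow> 'a \<times> 'a \<Rightarrow> 'a" where
  "gmul_deriv = (SOME D. (\<forall>p. ((\<lambda>q. gmul (fst q) (snd q)) has_derivative D p) (at p)) \<and>
     (\<forall>h. polynomial_function (\<lambda>p. D p h)))"

lemma gmul_deriv: "((\<lambda>q. gmul (fst q) (snd q)) has_derivative gmul_deriv p) (at p)"
  and polynomial_gmul_deriv: "polynomial_function (\<lambda>p. gmul_deriv p h)"
  using someI_ex[OF gmul_derivative_exists] unfolding gmul_deriv_def[symmetric] by blast+

lemma linear_gmul_deriv: "linear (gmul_deriv p)"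
  using gmul_deriv has_derivative_linear by blast

lemma gmul_has_derivative_right: "(gmul x has_derivative (\<lambda>h. gmul_deriv (x, y) (0, h))) (at y)"
proof -
  have "((\<lambda>y. (x, y)) has_derivative (\<lambda>h. (0, h))) (at y)" by (auto intro!: derivative_eq_intros)
  from diff_chain_at[OF this, of "\<lambda>q. gmul (fst q) (snd q)"] gmul_deriv[of "(x, y)"] show ?thesis
    by (simp add: o_def)
qed

lemma continuous_on_gmul [continuous_intros]:
  assumes "continuous_on S f" "continuous_on S g"
  shows "continuous_on S (\<lambda>x. gmul (f x) (g x))"
proof -
  have "continuous_on UNIV (\<lambda>p. gmul (fst p) (snd p))"
    using polynomial_gmul by (rule continuous_on_polymonial_function)
  from continuous_on_compose2[OF this continuous_on_Pair[OF assms]] show ?thesis by simp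
qed

lemma borel_measurable_gmul [measurable]:
  assumes "f \<in> borel_measurable M" "g \<in> borel_measurable M"
  shows "(\<lambda>x. gmul (f x) (g x)) \<in> borel_measurable M"
  using assms by (rule borel_measurable_continuous_Pair) (auto intro!: continuous_intros)

lemma left_field_eq: "left_field gmul v x = gmul_deriv (x, 0) (0, v)"
  unfolding left_field_def using frechet_derivative_at[OF gmul_has_derivative_right] by metis

lemma left_field_at_0 [simp]: "left_field gmul v 0 = v"
proof -
  have "gmul 0 = (\<lambda>y. y)" by (rule ext) simp
  then show ?thesis by (simp add: left_field_def frechet_derivative_ident)
qed

lemma left_field_linear: "linear (\<lambda>v. left_field gmul v x)"
  unfolding left_field_eq
  by (rule linearI) (use linear_add[OF linear_gmul_deriv, of "(x,0)" "(0,_)" "(0,_)"] linear_scale[OF linear_gmul_deriv, of "(x,0)" _ "(0,_)"] in auto)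

lemma left_field_gmul:
  "left_field gmul v (gmul x y) = frechet_derivative (gmul x) (at y) (left_field gmul v y)"
proof -
  have "((\<lambda>z. gmul x (gmul y z)) has_derivative (\<lambda>h. gmul_deriv (x, y) (0, gmul_deriv (y, 0) (0, h)))) (at 0)"
    using diff_chain_at[OF gmul_has_derivative_right[of y 0], of "gmul x"] gmul_has_derivative_right[of x y]
    by (simp add: o_def)
  moreover have "(\<lambda>z. gmul x (gmul y z)) = gmul (gmul x y)" by (rule ext) (simp add: grp.assoc)
  ultimately have "frechet_derivative (gmul (gmul x y)) (at 0) = (\<lambda>h. gmul_deriv (x, y) (0, gmul_deriv (y, 0) (0, h)))"
    using frechet_derivative_at by metis
  moreover have "frechet_derivative (gmul x) (at y) = (\<lambda>h. gmul_deriv (x, y) (0, h))"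
    using frechet_derivative_at[OF gmul_has_derivative_right] by metis
  ultimately show ?thesis unfolding left_field_eq[of v y] by (simp add: left_field_def)
qed

text \<open>Putting y = 0 in the invariance shows that a left invariant field is determined by its
  value at the unit.\<close>

lemma fields_eq: "fields gmul W = left_field gmul ` W"
proof
  show "left_field gmul ` W \<subseteq> fields gmul W"
    by (auto simp: fields_def left_invariant_def left_field_gmul)
  show "fields gmul W \<subseteq> left_field gmul ` W"
  proof
    fix X assume X: "X \<in> fields gmul W"
    from X have inv: "\<forall>x y. X (gmul x y) = frechet_derivative (gmul x) (at y) (X y)"
      unfolding fields_def left_invariant_def mem_Collect_eq by (rule conjunct1)
    have "X x = left_field gmul (X 0) x" for x
      using inv[rule_format, of x 0] by (simp add: left_field_def)
    then have "X = left_field gmul (X 0)" by (rule ext)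
    then show "X \<in> left_field gmul ` W" using X by (auto simp: fields_def)
  qed
qed

lemma polynomial_left_field: "polynomial_function (left_field gmul v)"
proof -
  have "polynomial_function ((\<lambda>p. gmul_deriv p (0, v)) \<circ> (\<lambda>x. (x, 0)))"
    by (intro polynomial_function_compose polynomial_gmul_deriv polynomial_function_bounded_linear)
       (auto intro!: bounded_linear_Pair bounded_linear_ident)
  then show ?thesis by (simp add: o_def left_field_eq[abs_def])
qed

subsection \<open>The bracket respects the grading\<close>

lemma bracket_add_left: "br (x + y) z = br x z + br y z"
  and bracket_add_right: "br x (y + z) = br x y + br x z"
  and bracket_diff_left: "br (x - y) z = br x z - br y z"
  and bracket_diff_right: "br x (y - z) = br x y - br x z"
  and bracket_scale_left: "br (c *\<^sub>R x) y = c *\<^sub>R br x y"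
  and bracket_scale_right: "br x (c *\<^sub>R y) = c *\<^sub>R br x y"
  using bilinear_ladd[OF bracket_bilinear] bilinear_radd[OF bracket_bilinear]
    bilinear_lsub[OF bracket_bilinear] bilinear_rsub[OF bracket_bilinear]
    bilinear_lmul[OF bracket_bilinear] bilinear_rmul[OF bracket_bilinear] by auto

lemma bracket_zero [simp]: "br 0 x = 0" "br x 0 = 0"
  using bilinear_lzero[OF bracket_bilinear] bilinear_rzero[OF bracket_bilinear] by auto

lemma bracket_minus_right: "br x (- y) = - br x y"
  using bracket_scale_right[of x "-1" y] by simp

lemma bracket_antisym: "br y x = - br x y"
proof -
  have "0 = br (x + y) (x + y)" by (simp only: bracket_alternating)
  also have "\<dots> = br x y + br y x"
    by (simp only: bracket_add_left bracket_add_right) (simp add: bracket_alternating)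
  finally have "br x y + br y x = 0" ..
  then show ?thesis by (simp add: eq_neg_iff_add_eq_0 add.commute)
qed

lemma bracket_layer_1:
  assumes "v \<in> V 1" "w \<in> V j" "1 \<le> j"
  shows "br v w \<in> V (j + 1)"
proof -
  let ?L = "lie_bracket (left_field gmul v) (left_field gmul w)"
  have "(\<lambda>x. \<Sum>i<1::nat. ?L x) \<in> bracket_span (fields gmul (V 1)) (fields gmul (V j))"
    unfolding bracket_span_def fields_eq using assms
    by (intro CollectI exI[of _ 1] exI[of _ "\<lambda>i. left_field gmul v"] exI[of _ "\<lambda>i. left_field gmul w"]) auto
  then have "?L \<in> fields gmul (V (j + 1))" using stratified[OF assms(3)] by simp
  then show ?thesis by (auto simp: fields_def group_bracket_def)
qed

lemma layer_Suc_brackets: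
  assumes "w \<in> V (j + 1)" "1 \<le> j"
  obtains k :: nat and a c where "\<And>i. i < k \<Longrightarrow> a i \<in> V 1" "\<And>i. i < k \<Longrightarrow> c i \<in> V j"
    "w = (\<Sum>i<k. br (a i) (c i))"
proof -
  have "left_field gmul w \<in> bracket_span (fields gmul (V 1)) (fields gmul (V j))"
    using stratified[OF assms(2)] assms(1) fields_eq by auto
  then obtain k X Y where k: "left_field gmul w = (\<lambda>x. \<Sum>i<k::nat. lie_bracket (X i) (Y i) x)"
    "\<And>i. i < k \<Longrightarrow> X i \<in> fields gmul (V 1) \<and> Y i \<in> fields gmul (V j)"
    unfolding bracket_span_def by blast
  have XY: "X i = left_field gmul (X i 0)" "Y i = left_field gmul (Y i 0)" "X i 0 \<in> V 1" "Y i 0 \<in> V j" if "i < k" for i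
    using k(2)[OF that] by (auto simp: fields_eq)
  have "w = (\<Sum>i<k. lie_bracket (X i) (Y i) 0)" using fun_cong[OF k(1), of 0] by simp
  also have "\<dots> = (\<Sum>i<k. br (X i 0) (Y i 0))"
    using XY by (intro sum.cong refl) (metis group_bracket_def lessThan_iff)
  finally show thesis using XY by (intro that[of k "\<lambda>i. X i 0" "\<lambda>i. Y i 0"]) auto
qed

lemma bracket_sum_left: "br (sum f I) w = (\<Sum>i\<in>I. br (f i) w)"
  by (induction I rule: infinite_finite_induct) (auto simp: bracket_add_left)

lemma bracket_sum_right: "br w (sum f I) = (\<Sum>i\<in>I. br w (f i))"
  by (induction I rule: infinite_finite_induct) (auto simp: bracket_add_right)

text \<open>The stratification speaks about brackets with the first layer only. For higher i, write
  \<open>v\<close> as a sum of brackets from V 1 and V i and distribute the outer bracket by the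
  Jacobi identity; one of the resulting terms needs the claim for i and j + 1, so \<open>j\<close>
  is generalized.\<close>

lemma bracket_layer:
  assumes "1 \<le> i" "1 \<le> j" "v \<in> V i" "w \<in> V j"
  shows "br v w \<in> V (i + j)"
  using assms
proof (induction i arbitrary: v w j rule: nat_induct_at_least)
  case base then show ?case using bracket_layer_1[of v w j] by simp
next
  case (Suc i)
  have sub: "subspace (V (Suc i + j))" by (rule layer_subspace) simp
  obtain k :: nat and a c where ac: "\<And>l. l < k \<Longrightarrow> a l \<in> V 1" "\<And>l. l < k \<Longrightarrow> c l \<in> V i"
    "v = (\<Sum>l<k. br (a l) (c l))"
    using layer_Suc_brackets[of v i] Suc.prems Suc.hyps by auto
  have "br (br (a l) (c l)) w \<in> V (Suc i + j)" if l: "l < k" for l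
  proof -
    have "br (a l) (br (c l) w) + br (c l) (br w (a l)) + br w (br (a l) (c l)) = 0"
      by (rule bracket_jacobi)
    then have eq: "br (br (a l) (c l)) w = br (a l) (br (c l) w) - br (c l) (br (a l) w)"
      using bracket_antisym[of w "br (a l) (c l)"] bracket_antisym[of w "a l"]
      by (simp add: bracket_minus_right algebra_simps add_eq_0_iff)
    have "br (a l) (br (c l) w) \<in> V ((i + j) + 1)"
      using Suc.IH[of j "c l" w] Suc.prems Suc.hyps ac l by (intro bracket_layer_1) auto
    moreover have "br (c l) (br (a l) w) \<in> V (i + (j + 1))"
      using Suc.prems Suc.hyps ac l by (intro Suc.IH bracket_layer_1) auto
    ultimately show ?thesis unfolding eq using sub by (auto intro: subspace_diff)
  qed
  then show ?case unfolding ac(3) bracket_sum_left using sub by (intro subspace_sum) auto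
qed

lemma bracket_expand: "br x y = (\<Sum>b\<in>Basis. \<Sum>c\<in>Basis. ((x \<bullet> b) * (y \<bullet> c)) *\<^sub>R br b c)"
proof -
  have "br x y = br (\<Sum>b\<in>Basis. (x \<bullet> b) *\<^sub>R b) (\<Sum>c\<in>Basis. (y \<bullet> c) *\<^sub>R c)"
    by (simp add: euclidean_representation)
  then show ?thesis
    by (simp only: bracket_sum_left) (simp add: bracket_sum_right bracket_scale_left bracket_scale_right scaleR_sum_right mult.commute)
qed

lemma bracket_tail:
  assumes "1 \<le> i" "1 \<le> j" "x \<in> tail i" "y \<in> tail j"
  shows "br x y \<in> tail (i + j)"
  unfolding bracket_expand[of x y]
proof (intro tail_sum)
  fix b c :: 'a assume bc: "b \<in> Basis" "c \<in> Basis"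
  show "((x \<bullet> b) * (y \<bullet> c)) *\<^sub>R br b c \<in> tail (i + j)"
  proof (cases "deg b < i \<or> deg c < j")
    case True then show ?thesis using assms bc by (auto simp: tail_def)
  next
    case False
    have "br b c \<in> V (deg b + deg c)" using bc deg by (intro bracket_layer) auto
    then have "br b c \<in> tail (i + j)" using False deg(3)[OF bc(1)]
      by (intro layer_tail[of "br b c" "deg b + deg c" "i + j"]) auto
    then show ?thesis by (rule tail_scale)
  qed
qed

lemma bracket_tail_Suc: "y \<in> tail j \<Longrightarrow> 1 \<le> j \<Longrightarrow> br x y \<in> tail (Suc j)"
  using bracket_tail[of 1 j x y] by simp

lemma bracket_tail_Suc': "x \<in> tail j \<Longrightarrow> 1 \<le> j \<Longrightarrow> br x y \<in> tail (Suc j)"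
  using bracket_tail[of j 1 x y] by simp

subsection \<open>The triangular structure of the product\<close>

definition bch_rest :: "'a \<Rightarrow> 'a \<Rightarrow> 'a" where
  "bch_rest x y = (\<Sum>ps\<in>higher_indices \<iota>. dynkin_coeff ps *\<^sub>R nested_bracket br (dynkin_word ps x y))"

lemma gmul_eq: "gmul x y = x + y + bch_rest x y"
  unfolding bch_rest_def using bch_decompose[OF top_layer(1), of br x y] by (simp only: gmul_bch)

text \<open>Telescoping: exchange the first letter, then the remaining ones, and note that each
  bracket raises the degree by at least 1. The weaker first half covers words of length 1 and
  carries the induction.\<close>

lemma nested_bracket_tail_diff:
  assumes "list_all2 (\<lambda>a a'. a - a' \<in> tail j) xs ys" "1 \<le> j"
  shows "nested_bracket br xs - nested_bracket br ys \<in> tail j \<and>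
    (2 \<le> length xs \<longrightarrow> nested_bracket br xs - nested_bracket br ys \<in> tail (Suc j))"
  using assms(1)
proof (induction rule: list_all2_induct)
  case (Cons a xs a' ys)
  show ?case
  proof (cases "xs = []")
    case True then show ?thesis using Cons by simp
  next
    case False
    then have "ys \<noteq> []" using Cons.hyps by auto
    then have "nested_bracket br (a # xs) - nested_bracket br (a' # ys) =
       br (a - a') (nested_bracket br xs) + br a' (nested_bracket br xs - nested_bracket br ys)"
      using False by (simp add: nested_bracket_Cons bracket_diff_left bracket_diff_right)
    moreover have "\<dots> \<in> tail (Suc j)"
      using Cons assms(2) by (intro tail_add bracket_tail_Suc bracket_tail_Suc') auto
    ultimately show ?thesis using tail_mono[of _ "Suc j" j] by auto
  qed
qed simp

lemma bch_rest_tail_diff: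
  assumes "1 \<le> j" "x - x' \<in> tail j" "y - y' \<in> tail j"
  shows "bch_rest x y - bch_rest x' y' \<in> tail (Suc j)"
proof -
  have "bch_rest x y - bch_rest x' y' = (\<Sum>ps\<in>higher_indices \<iota>.
     dynkin_coeff ps *\<^sub>R (nested_bracket br (dynkin_word ps x y) - nested_bracket br (dynkin_word ps x' y')))"
    by (simp add: bch_rest_def sum_subtractf scaleR_diff_right)
  also have "\<dots> \<in> tail (Suc j)"
  proof (intro tail_sum tail_scale)
    fix ps assume "ps \<in> higher_indices \<iota>"
    then have "2 \<le> length (dynkin_word ps x y)" by (simp add: higher_indices_def)
    then show "nested_bracket br (dynkin_word ps x y) - nested_bracket br (dynkin_word ps x' y') \<in> tail (Suc j)"
      using nested_bracket_tail_diff[OF list_all2_dynkin_word assms(1)] assms(2,3) by blast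
  qed
  finally show ?thesis .
qed

text \<open>The triangularity of the product: to leading order increments simply add up. Taking some
  of the increments to be 0 yields the invariance of Lebesgue measure, the form of the left
  invariant fields and the control of remainders in Chow's theorem.\<close>

lemma gmul_tail_diff:
  assumes "1 \<le> j" "x - x' \<in> tail j" "y - y' \<in> tail j"
  shows "gmul x y - gmul x' y' - (x - x') - (y - y') \<in> tail (Suc j)"
  using bch_rest_tail_diff[OF assms] by (simp add: gmul_eq)

lemma nested_bracket_multiples:
  assumes "\<And>x. x \<in> set xs \<Longrightarrow> \<exists>c. x = c *\<^sub>R v"
  shows "(\<exists>c. nested_bracket br xs = c *\<^sub>R v) \<and> (2 \<le> length xs \<longrightarrow> nested_bracket br xs = 0)"
  using assms
proof (induction xs)
  case Nil show ?case by (auto intro: exI[of _ 0])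
next
  case (Cons a xs)
  show ?case
  proof (cases "xs = []")
    case False
    obtain c where c: "a = c *\<^sub>R v" using Cons.prems by auto
    obtain c' where "nested_bracket br xs = c' *\<^sub>R v" using Cons by auto
    then have "nested_bracket br (a # xs) = 0"
      using False c by (simp add: nested_bracket_Cons bracket_scale_left bracket_scale_right bracket_alternating)
    then show ?thesis by (auto intro: exI[of _ 0])
  qed (use Cons.prems in auto)
qed

text \<open>All brackets of multiples of one vector vanish, so that lines through 0 are
  one-parameter subgroups.\<close>

lemma gmul_multiples: "gmul (s *\<^sub>R v) (t *\<^sub>R v) = (s + t) *\<^sub>R v"
proof -
  have "bch_rest (s *\<^sub>R v) (t *\<^sub>R v) = 0"
    unfolding bch_rest_def
  proof (rule sum.neutral, rule ballI)
    fix ps assume "ps \<in> higher_indices \<iota>"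
    then have "2 \<le> length (dynkin_word ps (s *\<^sub>R v) (t *\<^sub>R v))" by (simp add: higher_indices_def)
    then show "dynkin_coeff ps *\<^sub>R nested_bracket br (dynkin_word ps (s *\<^sub>R v) (t *\<^sub>R v)) = 0"
      using nested_bracket_multiples[of "dynkin_word ps (s *\<^sub>R v) (t *\<^sub>R v)" v]
        set_dynkin_word[of ps "s *\<^sub>R v" "t *\<^sub>R v"] by auto
  qed
  then show ?thesis by (simp add: gmul_eq scaleR_add_left)
qed

text \<open>The innermost bracket either has equal entries and vanishes, or contains both x and y
  and hence lies in \<open>tail (Suc k)\<close>; every further letter adds 1 to the degree.\<close>

lemma nested_bracket_tail_length:
  assumes "set xs \<subseteq> {x, y}" "2 \<le> length xs" "1 \<le> k" "x \<in> tail k \<or> y \<in> tail k"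
  shows "nested_bracket br xs \<in> tail (k + length xs - 1)"
  using assms(1,2)
proof (induction xs)
  case (Cons a xs)
  show ?case
  proof (cases "length xs = 1")
    case True
    then obtain b where "xs = [b]" by (cases xs) auto
    moreover have "br a b \<in> tail (Suc k)"
      using Cons.prems \<open>xs = [b]\<close> assms(3,4) bracket_tail_Suc bracket_tail_Suc' bracket_alternating by fastforce
    ultimately show ?thesis by simp
  next
    case False
    then have "nested_bracket br xs \<in> tail (k + length xs - 1)" "xs \<noteq> []" using Cons by auto
    moreover from this(2) have "1 \<le> k + length xs - 1" "Suc (k + length xs - 1) = k + length (a # xs) - 1"
      using assms(3) by (cases xs; simp)+
    ultimately show ?thesis using bracket_tail_Suc[of "nested_bracket br xs" "k + length xs - 1" a]
      by (simp only: nested_bracket_Cons[OF \<open>xs \<noteq> []\<close>])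
  qed
qed simp

text \<open>Only the Dynkin terms of degree 2 have to be computed: longer words already belong to
  the remainder by \<open>nested_bracket_tail_length\<close>.\<close>

lemma gmul_second_order:
  assumes k: "1 \<le> k" "x \<in> tail k \<or> y \<in> tail k"
  shows "gmul x y - x - y - (1/2) *\<^sub>R br x y \<in> tail (Suc (Suc k))"
proof -
  let ?f = "\<lambda>ps. dynkin_coeff ps *\<^sub>R nested_bracket br (dynkin_word ps x y)"
  let ?T = "{[(2, 0)], [(1, 1)], [(0, 2)], [(1, 0), (1, 0)], [(1, 0), (0, 1)], [(0, 1), (1, 0)], [(0, 1), (0, 1)]} :: (nat \<times> nat) list set"
  let ?H2 = "{ps \<in> higher_indices \<iota>. dynkin_degree ps = 2}"
  let ?H3 = "{ps \<in> higher_indices \<iota>. dynkin_degree ps \<noteq> 2}"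
  have "bch_rest x y = sum ?f ?H2 + sum ?f ?H3"
    unfolding bch_rest_def by (subst sum.union_disjoint[symmetric]) (auto intro!: sum.cong)
  moreover have "sum ?f ?H3 \<in> tail (Suc (Suc k))"
  proof (intro tail_sum tail_scale)
    fix ps assume "ps \<in> ?H3"
    then have l: "3 \<le> length (dynkin_word ps x y)" by (simp add: higher_indices_def)
    then have "nested_bracket br (dynkin_word ps x y) \<in> tail (k + length (dynkin_word ps x y) - 1)"
      by (intro nested_bracket_tail_length[OF set_dynkin_word _ k]) linarith
    then show "nested_bracket br (dynkin_word ps x y) \<in> tail (Suc (Suc k))"
      by (rule tail_mono) (use l in linarith)
  qed
  moreover have "sum ?f ?H2 - (1/2) *\<^sub>R br x y \<in> tail (Suc (Suc k))"
  proof (cases "2 \<le> \<iota>")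
    case True
    have "?H2 = ?T"
    proof
      show "?H2 \<subseteq> ?T" using dynkin_degree_2 unfolding higher_indices_def dynkin_indices_def by blast
      show "?T \<subseteq> ?H2" using True by (auto simp: higher_indices_def dynkin_indices_def dynkin_degree_def)
    qed
    then have "sum ?f ?H2 = sum ?f ?T" by simp
    \<comment> \<open>The list (1,1) contributes 1/2; (1,0),(0,1) and (0,1),(1,0) contribute -1/4
      each, the latter with the bracket reversed.\<close>
    also have "\<dots> = (1/2) *\<^sub>R br x y - (1/4) *\<^sub>R br x y - (1/4) *\<^sub>R br y x"
      by (simp add: dynkin_coeff_def dynkin_degree_def dynkin_word_def bracket_alternating numeral_2_eq_2)
    also have "\<dots> = (1/2) *\<^sub>R br x y" by (simp add: bracket_antisym[of y x])
    finally show ?thesis by simp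
  next
    case False
    \<comment> \<open>In step 1 the series stops before degree 2, but then the bracket itself
      vanishes.\<close>
    then have "?H2 = {}" by (auto simp: higher_indices_def dynkin_indices_def)
    then have "sum ?f ?H2 = 0" by (metis sum.empty)
    moreover have "br x y \<in> tail (Suc \<iota>)"
      using False bracket_tail_Suc[of y 1 x] top_layer(1) tail_mono by (metis One_nat_def Suc_le_mono le_refl le_SucE not_less_eq_eq numeral_2_eq_2 tail_1)
    then have "br x y = 0" by (simp add: tail_beyond)
    ultimately show ?thesis by simp
  qed
  ultimately have "(sum ?f ?H2 - (1/2) *\<^sub>R br x y) + sum ?f ?H3 \<in> tail (Suc (Suc k))"
    by (intro tail_add)
  then show ?thesis using \<open>bch_rest x y = sum ?f ?H2 + sum ?f ?H3\<close> by (simp add: gmul_eq algebra_simps)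
qed

text \<open>The products a b and b a differ by the bracket to leading order, and dividing one by the
  other turns the difference into a group commutator. Letting \<open>a\<close> and \<open>b\<close>
  be approximations of \<open>v\<close> and \<open>u\<close> is what allows the commutator to be
  formed from reachable elements.\<close>

lemma commutator_tail:
  assumes k: "1 \<le> k" "u \<in> tail k" and a: "a - v \<in> tail 2" and b: "b - u \<in> tail (Suc k)"
  shows "gmul (gmul a b) (- gmul b a) - br v u \<in> tail (Suc (Suc k))"
proof -
  have bk: "b \<in> tail k" using tail_add[OF tail_mono[OF b] k(2)] by simp
  let ?c = "gmul a b" and ?e = "gmul b a"
  have "(gmul a b - a - b - (1/2) *\<^sub>R br a b) - (gmul b a - b - a - (1/2) *\<^sub>R br b a) \<in> tail (Suc (Suc k))"
    by (rule tail_diff[OF gmul_second_order gmul_second_order]) (use k bk in auto)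
  moreover have "(gmul a b - a - b - (1/2) *\<^sub>R br a b) - (gmul b a - b - a - (1/2) *\<^sub>R br b a) = ?c - ?e - br a b"
    by (simp add: bracket_antisym[of b a] algebra_simps flip: scaleR_add_left)
  ultimately have 1: "?c - ?e - br a b \<in> tail (Suc (Suc k))" by simp
  have "br a b - br v u = br (a - v) b + br v (b - u)"
    by (simp add: bracket_diff_left bracket_diff_right)
  also have "\<dots> \<in> tail (Suc (Suc k))"
    using bracket_tail[of 2 k "a - v" b] bracket_tail_Suc[of "b - u" "Suc k" v] a b bk k
    by (intro tail_add) auto
  finally have 2: "br a b - br v u \<in> tail (Suc (Suc k))" .
  have 3: "?c - ?e - br v u \<in> tail (Suc (Suc k))" using tail_add[OF 1 2] by simp
  have "br v u \<in> tail (Suc k)" using k by (intro bracket_tail_Suc)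
  then have "(?c - ?e - br v u) + br v u \<in> tail (Suc k)"
    by (rule tail_add[rotated]) (rule tail_mono[OF 3], simp)
  then have "?c - ?e \<in> tail (Suc k)" by simp
  \<comment> \<open>Both elements are multiplied on the right by the inverse of \<open>?e\<close>,
    which sends \<open>?e\<close> itself to 0.\<close>
  then have "gmul ?c (- ?e) - gmul ?e (- ?e) - (?c - ?e) - (- ?e - - ?e) \<in> tail (Suc (Suc k))"
    by (intro gmul_tail_diff) auto
  then have "gmul ?c (- ?e) - (?c - ?e) \<in> tail (Suc (Suc k))" by simp
  from tail_add[OF this 3] show ?thesis by simp
qed

subsection \<open>Dilations\<close>

text \<open>The coordinate form of \<open>dilation\<close>; it is continuous in r up to r = 0, where
  it is the zero map.\<close>

definition dil :: "real \<Rightarrow> 'a \<Rightarrow> 'a" where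
  "dil r x = (\<Sum>b\<in>Basis. (r ^ deg b * (x \<bullet> b)) *\<^sub>R b)"

lemma dil_inner [simp]: "b \<in> Basis \<Longrightarrow> dil r x \<bullet> b = r ^ deg b * (x \<bullet> b)"
  by (simp add: dil_def inner_sum_left inner_Basis if_distrib cong: if_cong)

lemma linear_dil: "linear (dil r)"
proof (rule linearI)
  show "dil r (x + y) = dil r x + dil r y" for x y
    by (rule euclidean_eqI) (simp add: inner_add_left distrib_left)
  show "dil r (c *\<^sub>R x) = c *\<^sub>R dil r x" for c x
    by (rule euclidean_eqI) simp
qed

lemma dilation_eq: "dilation V \<iota> r = dil r"
  unfolding dilation_def
proof (rule the_equality)
  have "dil r v = r ^ j *\<^sub>R v" if "j \<in> {1..\<iota>}" "v \<in> V j" for j v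
  proof (rule euclidean_eqI)
    fix b :: 'a assume "b \<in> Basis"
    then show "dil r v \<bullet> b = (r ^ j *\<^sub>R v) \<bullet> b" using that layer_inner[of v j b] by (cases "deg b = j") auto
  qed
  then show "linear (dil r) \<and> (\<forall>j\<in>{1..\<iota>}. \<forall>v\<in>V j. dil r v = r ^ j *\<^sub>R v)" using linear_dil by blast
  fix L assume L: "linear L \<and> (\<forall>j\<in>{1..\<iota>}. \<forall>v\<in>V j. L v = r ^ j *\<^sub>R v)"
  show "L = dil r"
  proof
    fix x
    have "L x = L (\<Sum>b\<in>Basis. (x \<bullet> b) *\<^sub>R b)" by (simp add: euclidean_representation)
    also have "\<dots> = (\<Sum>b\<in>Basis. (x \<bullet> b) *\<^sub>R L b)" using L by (simp add: linear_sum linear_scale)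
    also have "\<dots> = (\<Sum>b\<in>Basis. (x \<bullet> b) *\<^sub>R (r ^ deg b *\<^sub>R b))"
    proof (intro sum.cong refl)
      fix b :: 'a assume "b \<in> Basis"
      then have "L b = r ^ deg b *\<^sub>R b" using L deg by blast
      then show "(x \<bullet> b) *\<^sub>R L b = (x \<bullet> b) *\<^sub>R (r ^ deg b *\<^sub>R b)" by simp
    qed
    finally show "L x = dil r x" by (simp add: dil_def mult.commute)
  qed
qed

lemma dil_layer: assumes "v \<in> V j" "1 \<le> j" shows "dil r v = r ^ j *\<^sub>R v"
proof (rule euclidean_eqI)
  fix b :: 'a assume "b \<in> Basis"
  then show "dil r v \<bullet> b = (r ^ j *\<^sub>R v) \<bullet> b" using assms layer_inner[of v j b] by (cases "deg b = j") auto
qed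

lemma dil_bracket: "br (dil r x) (dil r y) = dil r (br x y)"
proof -
  have "dil r (br b c) = (r ^ deg b * r ^ deg c) *\<^sub>R br b c" if "b \<in> Basis" "c \<in> Basis" for b c
    using dil_layer[OF bracket_layer[OF _ _ deg(2) deg(2)]] deg(3) that by (simp add: power_add)
  then have "dil r (br x y) = (\<Sum>b\<in>Basis. \<Sum>c\<in>Basis. ((x \<bullet> b) * (y \<bullet> c)) *\<^sub>R ((r ^ deg b * r ^ deg c) *\<^sub>R br b c))"
    unfolding bracket_expand[of x y] by (simp add: linear_sum[OF linear_dil] linear_scale[OF linear_dil])
  also have "\<dots> = br (dil r x) (dil r y)"
    unfolding bracket_expand[of "dil r x"] by (intro sum.cong) (auto simp: ac_simps)
  finally show ?thesis ..
qed

lemma dil_gmul: "dil r (gmul x y) = gmul (dil r x) (dil r y)"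
proof -
  have "nested_bracket br (dynkin_word ps (dil r x) (dil r y)) = dil r (nested_bracket br (dynkin_word ps x y))" for ps
    using nested_bracket_map_linear[of "dil r" br "dynkin_word ps x y", OF linear_dil dil_bracket]
    by (simp add: map_dynkin_word)
  then show ?thesis
    by (simp add: gmul_bch bch_eq linear_sum[OF linear_dil] linear_scale[OF linear_dil])
qed

lemma dil_0 [simp]: "dil r 0 = 0" using linear_0[OF linear_dil] by simp
lemma dil_1 [simp]: "dil 1 x = x" by (rule euclidean_eqI) simp
lemma dil_dil: "dil r (dil s x) = dil (r * s) x"
  by (rule euclidean_eqI) (simp add: power_mult_distrib)
lemma dil_inverse: "0 < r \<Longrightarrow> dil r (dil (1 / r) x) = x" "0 < r \<Longrightarrow> dil (1 / r) (dil r x) = x"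
  by (simp_all add: dil_dil)

lemma continuous_on_dil [continuous_intros]:
  assumes "continuous_on S f" "continuous_on S g"
  shows "continuous_on S (\<lambda>x. dil (f x) (g x))"
  unfolding dil_def using assms by (intro continuous_intros)

lemma measurable_dil [measurable]: "f \<in> borel_measurable M \<Longrightarrow> (\<lambda>x. dil r (f x)) \<in> borel_measurable M"
  by (rule measurable_compose[where g="dil r"], assumption, rule borel_measurable_continuous_onI)
     (intro continuous_intros)

lemma tail_inner: "x \<in> tail j \<Longrightarrow> b \<in> Basis \<Longrightarrow> deg b < j \<Longrightarrow> x \<bullet> b = 0"
  by (simp add: tail_def)

lemma layer_1_inner_tail: "v \<in> V 1 \<Longrightarrow> x \<in> tail 2 \<Longrightarrow> x \<bullet> v = 0"
proof -
  assume v: "v \<in> V 1" and x: "x \<in> tail 2"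
  have "x \<bullet> v = (\<Sum>b\<in>Basis. (x \<bullet> b) * (v \<bullet> b))" by (rule euclidean_inner)
  also have "\<dots> = 0"
  proof (rule sum.neutral, rule ballI)
    fix b :: 'a assume b: "b \<in> Basis"
    show "(x \<bullet> b) * (v \<bullet> b) = 0"
      using tail_inner[OF x b] layer_inner[OF v _ b] by (cases "deg b = 1") auto
  qed
  finally show ?thesis .
qed

lemma gmul_inner_layer_1:
  assumes "v \<in> V 1"
  shows "gmul x y \<bullet> v = x \<bullet> v + y \<bullet> v"
proof -
  have "gmul x y - x - y \<in> tail 2" using gmul_tail_diff[of 1 x 0 y 0] by (simp add: numeral_2_eq_2)
  from layer_1_inner_tail[OF assms this] show ?thesis by (simp add: inner_diff_left)
qed

lemma dil_inner_layer_1: "v \<in> V 1 \<Longrightarrow> dil r x \<bullet> v = r * (x \<bullet> v)"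
proof -
  assume v: "v \<in> V 1"
  have "dil r x \<bullet> v = (\<Sum>b\<in>Basis. r * ((x \<bullet> b) * (v \<bullet> b)))"
    unfolding euclidean_inner[of "dil r x" v]
  proof (intro sum.cong refl)
    fix b :: 'a assume b: "b \<in> Basis"
    then show "(dil r x \<bullet> b) * (v \<bullet> b) = r * ((x \<bullet> b) * (v \<bullet> b))"
      using layer_inner[OF v _ b] by (cases "deg b = 1") auto
  qed
  then show ?thesis unfolding euclidean_inner[of x v] by (simp add: sum_distrib_left)
qed

subsection \<open>Left invariant fields\<close>

text \<open>Left translates of one-parameter subgroups are integral curves: the subgroup law moves
  the derivative at t to the parameter 0 of the curve starting at x (t v).\<close>

lemma gmul_curve_derivative:
  "((\<lambda>t. gmul x (t *\<^sub>R v)) has_vector_derivative left_field gmul v (gmul x (t *\<^sub>R v))) (at t)"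
proof -
  have eq: "gmul x (s *\<^sub>R v) = gmul (gmul x (t *\<^sub>R v)) ((s - t) *\<^sub>R v)" for s
    by (simp add: grp.assoc gmul_multiples)
  have "((\<lambda>s. (s - t) *\<^sub>R v) has_derivative (\<lambda>h. h *\<^sub>R v)) (at t)"
    by (auto intro!: derivative_eq_intros)
  from diff_chain_at[OF this, of "gmul (gmul x (t *\<^sub>R v))"] gmul_has_derivative_right[of "gmul x (t *\<^sub>R v)" 0]
  have "((\<lambda>s. gmul (gmul x (t *\<^sub>R v)) ((s - t) *\<^sub>R v)) has_derivative
      (\<lambda>h. gmul_deriv (gmul x (t *\<^sub>R v), 0) (0, h *\<^sub>R v))) (at t)"
    by (simp add: o_def)
  then show ?thesis
    unfolding has_vector_derivative_def left_field_eq eq[symmetric]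
    using linear_scale[OF linear_gmul_deriv, of "(gmul x (t *\<^sub>R v), 0)" _ "(0, v)"] by simp
qed

lemma gmul_curve_inner_derivative:
  "((\<lambda>t. gmul x (t *\<^sub>R v) \<bullet> b) has_real_derivative left_field gmul v x \<bullet> b) (at 0)"
  using bounded_linear.has_vector_derivative[OF bounded_linear_inner_left gmul_curve_derivative[of x v 0]]
  by (simp add: has_real_derivative_iff_has_vector_derivative)

text \<open>In the coordinates of degree at most j the curve through x is affine with direction v,
  and the field is its velocity.\<close>

lemma left_field_tail:
  assumes "v \<in> tail j" "1 \<le> j"
  shows "left_field gmul v x - v \<in> tail (Suc j)"
  unfolding tail_def
proof (intro CollectI ballI impI)
  fix b :: 'a assume b: "b \<in> Basis" "deg b < Suc j"
  have "gmul x (t *\<^sub>R v) \<bullet> b = x \<bullet> b + t * (v \<bullet> b)" for t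
    using tail_inner[OF gmul_tail_diff[OF assms(2), of x x "t *\<^sub>R v" 0] b] assms tail_scale
    by (simp add: inner_diff_left)
  then have "((\<lambda>t. gmul x (t *\<^sub>R v) \<bullet> b) has_real_derivative v \<bullet> b) (at 0)"
    by (auto intro!: derivative_eq_intros)
  then have "left_field gmul v x \<bullet> b = v \<bullet> b"
    using gmul_curve_inner_derivative DERIV_unique by blast
  then show "(left_field gmul v x - v) \<bullet> b = 0" by (simp add: inner_diff_left)
qed

lemma left_field_inner_layer_1: "u \<in> V 1 \<Longrightarrow> left_field gmul v x \<bullet> u = v \<bullet> u"
  using layer_1_inner_tail[of u "left_field gmul v x - v"] left_field_tail[of v 1 x]
  by (simp add: inner_diff_left numeral_2_eq_2)

lemma left_field_tail_diff:
  assumes "p - p' \<in> tail j" "1 \<le> j"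
  shows "left_field gmul v p - left_field gmul v p' \<in> tail (Suc j)"
  unfolding tail_def
proof (intro CollectI ballI impI)
  fix b :: 'a assume b: "b \<in> Basis" "deg b < Suc j"
  have "gmul p (t *\<^sub>R v) \<bullet> b = gmul p' (t *\<^sub>R v) \<bullet> b + (p - p') \<bullet> b" for t
    using tail_inner[OF gmul_tail_diff[OF assms(2,1), of "t *\<^sub>R v" "t *\<^sub>R v"] b]
    by (simp add: inner_diff_left)
  then have "((\<lambda>t. gmul p (t *\<^sub>R v) \<bullet> b) has_real_derivative left_field gmul v p' \<bullet> b) (at 0)"
    using DERIV_add[OF gmul_curve_inner_derivative[of p' v b] DERIV_const] by simp
  then have "left_field gmul v p \<bullet> b = left_field gmul v p' \<bullet> b"
    using gmul_curve_inner_derivative DERIV_unique by blast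
  then show "(left_field gmul v p - left_field gmul v p') \<bullet> b = 0" by (simp add: inner_diff_left)
qed

text \<open>A component of a left invariant field depends only on coordinates of smaller degree. The
  diagonal of the Jacobian therefore vanishes, and left invariant fields are divergence
  free.\<close>

lemma left_field_diagonal_derivative:
  assumes b: "b \<in> Basis" and D: "(left_field gmul v has_derivative D) (at p)"
  shows "D b \<bullet> b = 0"
proof -
  have const: "left_field gmul v (p + t *\<^sub>R b) \<bullet> b = left_field gmul v p \<bullet> b" for t
  proof -
    have "p + t *\<^sub>R b - p \<in> tail (deg b)" using layer_tail[OF deg(2)[OF b], of "deg b"] deg(3)[OF b] by (auto intro: tail_scale)
    from tail_inner[OF left_field_tail_diff[OF this deg(3)[OF b], of v] b] show ?thesis by (simp add: inner_diff_left)
  qed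
  have "((\<lambda>t. p + t *\<^sub>R b) has_derivative (\<lambda>h. h *\<^sub>R b)) (at 0)"
    by (auto intro!: derivative_eq_intros)
  from diff_chain_at[OF this, of "left_field gmul v" D] D
  have "((\<lambda>t. left_field gmul v (p + t *\<^sub>R b)) has_derivative (\<lambda>h. D (h *\<^sub>R b))) (at 0)"
    by (simp add: o_def)
  then have "((\<lambda>t. left_field gmul v (p + t *\<^sub>R b) \<bullet> b) has_derivative (\<lambda>h. D (h *\<^sub>R b) \<bullet> b)) (at 0)"
    by (rule has_derivative_inner_left)
  then have "((\<lambda>t::real. left_field gmul v p \<bullet> b) has_derivative (\<lambda>h. D (h *\<^sub>R b) \<bullet> b)) (at 0)"
    by (simp add: const)
  then have "(\<lambda>h. D (h *\<^sub>R b) \<bullet> b) = (\<lambda>h. 0)"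
    using has_derivative_unique has_derivative_const by blast
  from fun_cong[OF this, of 1] show ?thesis by simp
qed

subsection \<open>Haar measure\<close>

lemma bch_rest_eq: "bch_rest x y = gmul x y - x - y"
  by (simp add: gmul_eq)

lemma borel_measurable_bch_rest [measurable]:
  "f \<in> borel_measurable M \<Longrightarrow> g \<in> borel_measurable M \<Longrightarrow> (\<lambda>x. bch_rest (f x) (g x)) \<in> borel_measurable M"
  unfolding bch_rest_eq by measurable

lemma tail_degI: "(\<And>c. c \<in> Basis \<Longrightarrow> deg c < j \<Longrightarrow> p \<bullet> c = q \<bullet> c) \<Longrightarrow> p - q \<in> tail j"
  by (simp add: tail_def inner_diff_left)

lemma nn_integral_left_translate:
  assumes [measurable]: "F \<in> borel_measurable borel"
  shows "(\<integral>\<^sup>+p. F (gmul x p) \<partial>lborel) = (\<integral>\<^sup>+p. F p \<partial>lborel)"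
proof -
  have "(\<integral>\<^sup>+p. F (p + (x + bch_rest x p)) \<partial>lborel) = (\<integral>\<^sup>+p. F p \<partial>lborel)"
  proof (rule nn_integral_triangular[where deg=deg])
    fix p q b :: 'a assume b: "b \<in> Basis" and pq: "\<And>c. c \<in> Basis \<Longrightarrow> deg c < deg b \<Longrightarrow> p \<bullet> c = q \<bullet> c"
    show "(x + bch_rest x p) \<bullet> b = (x + bch_rest x q) \<bullet> b"
      using tail_inner[OF bch_rest_tail_diff[OF deg(3)[OF b], of x x p q] b] tail_degI[of "deg b" p q, OF pq]
      by (simp add: inner_diff_left inner_add_left)
  qed measurable
  then show ?thesis by (simp add: gmul_eq algebra_simps)
qed

lemma nn_integral_affine:
  assumes [measurable]: "F \<in> borel_measurable borel" and r: "0 < r"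
  shows "(\<integral>\<^sup>+p. F p \<partial>lborel) = ennreal (r ^ hom_dim V \<iota>) * (\<integral>\<^sup>+q. F (gmul x (dil r q)) \<partial>lborel)"
proof -
  have "(\<Prod>b\<in>Basis. \<bar>r ^ deg b\<bar>) = r ^ hom_dim V \<iota>"
    using r by (simp add: hom_dim_eq power_sum)
  moreover have "(\<lambda>x. 0 + (\<Sum>j\<in>Basis. (r ^ deg j * (x \<bullet> j)) *\<^sub>R j)) = dil r"
    by (auto simp: dil_def)
  ultimately have leb: "lborel = density (distr lborel borel (dil r)) (\<lambda>_. ennreal (r ^ hom_dim V \<iota>))"
    using lborel_affine_euclidean[of "\<lambda>b. r ^ deg b" 0] r by simp
  have "(\<integral>\<^sup>+p. F p \<partial>lborel) = (\<integral>\<^sup>+p. F (gmul x p) \<partial>lborel)"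
    by (rule nn_integral_left_translate[symmetric]) measurable
  also have "\<dots> = ennreal (r ^ hom_dim V \<iota>) * (\<integral>\<^sup>+q. F (gmul x (dil r q)) \<partial>lborel)"
    by (subst leb) (simp add: nn_integral_density nn_integral_distr nn_integral_cmult)
  finally show ?thesis .
qed

lemma lborel_eq_affine:
  assumes r: "0 < r"
  shows "lborel = density (distr lborel borel (\<lambda>q. gmul x (dil r q))) (\<lambda>_. ennreal (r ^ hom_dim V \<iota>))"
proof (rule measure_eqI)
  fix A :: "'a set" assume "A \<in> sets lborel"
  then have [measurable]: "A \<in> sets borel" by simp
  show "emeasure lborel A = emeasure (density (distr lborel borel (\<lambda>q. gmul x (dil r q))) (\<lambda>_. ennreal (r ^ hom_dim V \<iota>))) A"
  proof -
    let ?D = "distr lborel borel (\<lambda>q. gmul x (dil r q))"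
    have "emeasure ?D A = (\<integral>\<^sup>+q. indicator A q \<partial>?D)" by simp
    also have "\<dots> = (\<integral>\<^sup>+q. indicator A (gmul x (dil r q)) \<partial>lborel)" by (rule nn_integral_distr) measurable
    finally have "emeasure (density ?D (\<lambda>_. ennreal (r ^ hom_dim V \<iota>))) A =
        ennreal (r ^ hom_dim V \<iota>) * (\<integral>\<^sup>+q. indicator A (gmul x (dil r q)) \<partial>lborel)"
      by (simp add: emeasure_density nn_integral_cmult)
    also have "\<dots> = (\<integral>\<^sup>+p. indicator A p \<partial>lborel)"
      by (rule nn_integral_affine[OF _ r, symmetric]) measurable
    finally show ?thesis by simp
  qed
qed simp

lemma integral_affine:
  fixes F :: "'a \<Rightarrow> real"
  assumes [measurable]: "F \<in> borel_measurable borel" and r: "0 < r"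
  shows "(LINT p|lborel. F p) = r ^ hom_dim V \<iota> * (LINT q|lborel. F (gmul x (dil r q)))"
proof -
  have "(LINT p|lborel. F p) = (LINT p|density (distr lborel borel (\<lambda>q. gmul x (dil r q))) (\<lambda>_. ennreal (r ^ hom_dim V \<iota>)). F p)"
    using lborel_eq_affine[OF r, of x] by metis
  also have "\<dots> = r ^ hom_dim V \<iota> * (LINT q|lborel. F (gmul x (dil r q)))"
    using r by (subst integral_density) (auto simp: integral_distr)
  finally show ?thesis .
qed

text \<open>The map n + t \<nu> \<mapsto> n (t \<nu>) differs from the identity by \<open>G\<close>,
  whose components involve only coordinates of smaller degree. Being triangular, it preserves
  Lebesgue measure, and Fubini for straight lines becomes Fubini for the integral curves of the
  field of \<nu>.\<close>

lemma nn_integral_flow_coordinates: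
  assumes [measurable]: "F \<in> borel_measurable borel" and \<nu>: "norm \<nu> = 1" "\<nu> \<in> V 1"
  shows "(\<integral>\<^sup>+n. (\<integral>\<^sup>+t. F (gmul n (t *\<^sub>R \<nu>)) \<partial>lborel) \<partial>hyperplane_measure \<nu>) = (\<integral>\<^sup>+p. F p \<partial>lborel)"
proof -
  have \<nu>1: "\<nu> \<bullet> \<nu> = 1" using \<nu> by (simp add: norm_eq_1)
  define G where "G p = bch_rest (p - (p \<bullet> \<nu>) *\<^sub>R \<nu>) ((p \<bullet> \<nu>) *\<^sub>R \<nu>)" for p
  have [measurable]: "G \<in> borel_measurable borel" unfolding G_def by measurable
  have "(\<integral>\<^sup>+p. F p \<partial>lborel) = (\<integral>\<^sup>+p. F (p + G p) \<partial>lborel)"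
  proof (rule nn_integral_triangular[where deg=deg, symmetric])
    fix p q b :: 'a assume b: "b \<in> Basis" and pq: "\<And>c. c \<in> Basis \<Longrightarrow> deg c < deg b \<Longrightarrow> p \<bullet> c = q \<bullet> c"
    have t: "p - q \<in> tail (deg b)" by (rule tail_degI[OF pq])
    \<comment> \<open>Splitting off the \<nu>-component mixes coordinates of degree 1. This is
      harmless: in degrees above 1 the two points have the same first layer part, so the
      \<nu>-components agree.\<close>
    have s: "((p - q) \<bullet> \<nu>) *\<^sub>R \<nu> \<in> tail (deg b)"
    proof (cases "deg b = 1")
      case False
      then have "2 \<le> deg b" using deg(3)[OF b] by simp
      then have "(p - q) \<bullet> \<nu> = 0" using layer_1_inner_tail[OF \<nu>(2) tail_mono[OF t]] by simp
      then show ?thesis by simp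
    qed simp
    have "(p - (p \<bullet> \<nu>) *\<^sub>R \<nu>) - (q - (q \<bullet> \<nu>) *\<^sub>R \<nu>) = (p - q) - ((p - q) \<bullet> \<nu>) *\<^sub>R \<nu>"
      "(p \<bullet> \<nu>) *\<^sub>R \<nu> - (q \<bullet> \<nu>) *\<^sub>R \<nu> = ((p - q) \<bullet> \<nu>) *\<^sub>R \<nu>"
      by (auto simp: algebra_simps inner_diff_left)
    then have "(p - (p \<bullet> \<nu>) *\<^sub>R \<nu>) - (q - (q \<bullet> \<nu>) *\<^sub>R \<nu>) \<in> tail (deg b)"
      "(p \<bullet> \<nu>) *\<^sub>R \<nu> - (q \<bullet> \<nu>) *\<^sub>R \<nu> \<in> tail (deg b)"
      using tail_diff[OF t s] s by metis+
    then have "G p - G q \<in> tail (Suc (deg b))"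
      unfolding G_def by (rule bch_rest_tail_diff[OF deg(3)[OF b]])
    then show "G p \<bullet> b = G q \<bullet> b" using tail_inner[of _ "Suc (deg b)", OF _ b] by (fastforce simp: inner_diff_left)
  qed measurable
  also have "\<dots> = (\<integral>\<^sup>+n. (\<integral>\<^sup>+t. F ((n + t *\<^sub>R \<nu>) + G (n + t *\<^sub>R \<nu>)) \<partial>lborel) \<partial>hyperplane_measure \<nu>)"
    by (rule nn_integral_hyperplane_fubini[OF _ \<nu>(1), symmetric]) measurable
  also have "\<dots> = (\<integral>\<^sup>+n. (\<integral>\<^sup>+t. F (gmul n (t *\<^sub>R \<nu>)) \<partial>lborel) \<partial>hyperplane_measure \<nu>)"
  proof (rule nn_integral_cong_AE)
    show "AE n in hyperplane_measure \<nu>. (\<integral>\<^sup>+t. F ((n + t *\<^sub>R \<nu>) + G (n + t *\<^sub>R \<nu>)) \<partial>lborel) =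
        (\<integral>\<^sup>+t. F (gmul n (t *\<^sub>R \<nu>)) \<partial>lborel)"
      using AE_hyperplane_measure[OF \<nu>(1)]
      by eventually_elim (auto simp: G_def inner_add_left \<nu>1 gmul_eq intro!: nn_integral_cong)
  qed
  finally show ?thesis ..
qed

lemma lborel_eq_flow_coordinates:
  assumes \<nu>: "norm \<nu> = 1" "\<nu> \<in> V 1"
  shows "lborel = distr (hyperplane_measure \<nu> \<Otimes>\<^sub>M lborel) borel (\<lambda>(n, t). gmul x (gmul n (t *\<^sub>R \<nu>)))"
proof (rule measure_eqI)
  fix A :: "'a set" assume "A \<in> sets lborel"
  then have A[measurable]: "A \<in> sets borel" by simp
  have "emeasure lborel A = (\<integral>\<^sup>+p. indicator A p \<partial>lborel)" by simp
  also have "\<dots> = (\<integral>\<^sup>+p. indicator A (gmul x p) \<partial>lborel)"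
    by (rule nn_integral_left_translate[symmetric]) measurable
  also have "\<dots> = (\<integral>\<^sup>+n. (\<integral>\<^sup>+t. indicator A (gmul x (gmul n (t *\<^sub>R \<nu>))) \<partial>lborel) \<partial>hyperplane_measure \<nu>)"
    by (rule nn_integral_flow_coordinates[OF _ \<nu>, symmetric]) measurable
  also have "\<dots> = (\<integral>\<^sup>+z. indicator A (case z of (n, t) \<Rightarrow> gmul x (gmul n (t *\<^sub>R \<nu>))) \<partial>(hyperplane_measure \<nu> \<Otimes>\<^sub>M lborel))"
    by (subst lborel.nn_integral_fst[symmetric]) auto
  also have "\<dots> = (\<integral>\<^sup>+z. indicator A z \<partial>distr (hyperplane_measure \<nu> \<Otimes>\<^sub>M lborel) borel (\<lambda>(n, t). gmul x (gmul n (t *\<^sub>R \<nu>))))"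
    by (rule nn_integral_distr[symmetric]) measurable
  also have "\<dots> = emeasure (distr (hyperplane_measure \<nu> \<Otimes>\<^sub>M lborel) borel (\<lambda>(n, t). gmul x (gmul n (t *\<^sub>R \<nu>)))) A"
    by simp
  finally show "emeasure lborel A = emeasure (distr (hyperplane_measure \<nu> \<Otimes>\<^sub>M lborel) borel (\<lambda>(n, t). gmul x (gmul n (t *\<^sub>R \<nu>)))) A" .
qed simp

lemma integral_flow_coordinates:
  fixes F :: "'a \<Rightarrow> real"
  assumes F: "integrable lborel F" and \<nu>: "norm \<nu> = 1" "\<nu> \<in> V 1"
  shows "(LINT p|lborel. F p) = (LINT n|hyperplane_measure \<nu>. LINT t|lborel. F (gmul x (gmul n (t *\<^sub>R \<nu>))))"
proof -
  let ?P = "hyperplane_measure \<nu> \<Otimes>\<^sub>M (lborel :: real measure)"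
  let ?h = "\<lambda>(n, t). gmul x (gmul n (t *\<^sub>R \<nu>))"
  interpret M: sigma_finite_measure "hyperplane_measure \<nu>" by (rule sigma_finite_hyperplane_measure)
  interpret P: pair_sigma_finite "hyperplane_measure \<nu>" "lborel :: real measure" ..
  have F': "integrable (distr ?P borel ?h) F"
    using F lborel_eq_flow_coordinates[OF \<nu>, of x] by simp
  have [measurable]: "F \<in> borel_measurable borel" using F by auto
  have int: "integrable ?P (\<lambda>z. F (?h z))"
    using F' by (subst (asm) integrable_distr_eq) (auto simp: case_prod_beta)
  have "(LINT p|lborel. F p) = (LINT p|distr ?P borel ?h. F p)"
    using lborel_eq_flow_coordinates[OF \<nu>, of x] by simp
  also have "\<dots> = (LINT z|?P. F (?h z))"
    by (subst integral_distr) (auto simp: case_prod_beta)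
  also have "\<dots> = (LINT n|hyperplane_measure \<nu>. LINT t|lborel. F (gmul x (gmul n (t *\<^sub>R \<nu>))))"
    using P.integral_fst'[OF int] by simp
  finally show ?thesis .
qed

lemma hom_dim_pos: "1 \<le> hom_dim V \<iota>"
proof -
  obtain b :: 'a where b: "b \<in> Basis" using nonempty_Basis by blast
  then have "deg b \<le> hom_dim V \<iota>" unfolding hom_dim_eq by (intro member_le_sum) auto
  then show ?thesis using deg(3)[OF b] by simp
qed

text \<open>Thicken the hyperplane to a slab of height r. The dilation has Jacobian r^Q on the whole
  space and maps the unit slab to this one, because \<nu> has degree 1; dividing by the height
  leaves r^(Q-1).\<close>

lemma nn_integral_hyperplane_dil:
  assumes F[measurable]: "F \<in> borel_measurable borel" and \<nu>: "norm \<nu> = 1" "\<nu> \<in> V 1" and r: "0 < r"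
  shows "(\<integral>\<^sup>+n. F n \<partial>hyperplane_measure \<nu>) =
    ennreal (r ^ (hom_dim V \<iota> - 1)) * (\<integral>\<^sup>+n. F (dil r n) \<partial>hyperplane_measure \<nu>)"
proof -
  have \<nu>1: "\<nu> \<bullet> \<nu> = 1" using \<nu> by (simp add: norm_eq_1)
  let ?I = "\<lambda>p. indicator {0..r} (p \<bullet> \<nu>) :: ennreal"
  have "ennreal r * (\<integral>\<^sup>+n. F n \<partial>hyperplane_measure \<nu>) = (\<integral>\<^sup>+p. F (p - (p \<bullet> \<nu>) *\<^sub>R \<nu>) * ?I p \<partial>lborel)"
  proof -
    have "(\<integral>\<^sup>+p. F (p - (p \<bullet> \<nu>) *\<^sub>R \<nu>) * ?I p \<partial>lborel) =
      (\<integral>\<^sup>+n. (\<integral>\<^sup>+t. F ((n + t *\<^sub>R \<nu>) - ((n + t *\<^sub>R \<nu>) \<bullet> \<nu>) *\<^sub>R \<nu>) * ?I (n + t *\<^sub>R \<nu>) \<partial>lborel) \<partial>hyperplane_measure \<nu>)"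
      by (rule nn_integral_hyperplane_fubini[OF _ \<nu>(1), symmetric]) measurable
    also have "\<dots> = (\<integral>\<^sup>+n. F n * ennreal r \<partial>hyperplane_measure \<nu>)"
    proof (rule nn_integral_cong_AE)
      show "AE n in hyperplane_measure \<nu>. (\<integral>\<^sup>+t. F ((n + t *\<^sub>R \<nu>) - ((n + t *\<^sub>R \<nu>) \<bullet> \<nu>) *\<^sub>R \<nu>) * ?I (n + t *\<^sub>R \<nu>) \<partial>lborel) = F n * ennreal r"
        using AE_hyperplane_measure[OF \<nu>(1)]
      proof eventually_elim
        case (elim n)
        have "(\<integral>\<^sup>+t. F ((n + t *\<^sub>R \<nu>) - ((n + t *\<^sub>R \<nu>) \<bullet> \<nu>) *\<^sub>R \<nu>) * ?I (n + t *\<^sub>R \<nu>) \<partial>lborel) =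
          (\<integral>\<^sup>+t. F n * indicator {0..r} t \<partial>lborel)"
          using elim by (intro nn_integral_cong) (simp add: inner_add_left \<nu>1)
        also have "\<dots> = F n * ennreal r" using r by (simp add: nn_integral_cmult)
        finally show ?case .
      qed
    qed
    finally show ?thesis by (simp add: nn_integral_cmult nn_integral_multc mult.commute)
  qed
  also have "\<dots> = ennreal (r ^ hom_dim V \<iota>) *
      (\<integral>\<^sup>+q. F (dil r q - (dil r q \<bullet> \<nu>) *\<^sub>R \<nu>) * ?I (dil r q) \<partial>lborel)"
    using nn_integral_affine[OF _ r, of "\<lambda>p. F (p - (p \<bullet> \<nu>) *\<^sub>R \<nu>) * ?I p" 0] by simp
  also have "(\<integral>\<^sup>+q. F (dil r q - (dil r q \<bullet> \<nu>) *\<^sub>R \<nu>) * ?I (dil r q) \<partial>lborel) = (\<integral>\<^sup>+n. F (dil r n) \<partial>hyperplane_measure \<nu>)"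
  proof (subst nn_integral_hyperplane_measure, measurable, rule nn_integral_cong)
    fix q
    have "dil r (q - (q \<bullet> \<nu>) *\<^sub>R \<nu>) = dil r q - (dil r q \<bullet> \<nu>) *\<^sub>R \<nu>"
      using \<nu>(2) by (simp add: linear_diff[OF linear_dil] linear_scale[OF linear_dil] dil_layer[of \<nu> 1] dil_inner_layer_1 mult.commute)
    moreover have "dil r q \<bullet> \<nu> \<in> {0..r} \<longleftrightarrow> 0 \<le> q \<bullet> \<nu> \<and> q \<bullet> \<nu> \<le> 1"
      using r \<nu>(2) by (simp add: dil_inner_layer_1 zero_le_mult_iff)
    ultimately show "F (dil r q - (dil r q \<bullet> \<nu>) *\<^sub>R \<nu>) * ?I (dil r q) =
       indicator {p. 0 \<le> p \<bullet> \<nu> \<and> p \<bullet> \<nu> \<le> 1} q * F (dil r (q - (q \<bullet> \<nu>) *\<^sub>R \<nu>))"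
      by (simp add: indicator_def)
  qed
  also have "ennreal (r ^ hom_dim V \<iota>) = ennreal r * ennreal (r ^ (hom_dim V \<iota> - 1))"
    using r hom_dim_pos by (simp add: ennreal_mult[symmetric] power_Suc[symmetric] del: power_Suc)
  finally show ?thesis using r by (simp add: mult.assoc ennreal_mult_cancel_left)
qed

lemma emeasure_hyperplane_dil:
  assumes A[measurable]: "A \<in> sets borel" and \<nu>: "norm \<nu> = 1" "\<nu> \<in> V 1" and r: "0 < r"
  shows "emeasure (hyperplane_measure \<nu>) {n. dil (1 / r) n \<in> A} =
    ennreal (r ^ (hom_dim V \<iota> - 1)) * emeasure (hyperplane_measure \<nu>) A"
proof -
  have "{n. dil (1 / r) n \<in> A} \<in> sets borel" by measurable
  then have "emeasure (hyperplane_measure \<nu>) {n. dil (1 / r) n \<in> A} = (\<integral>\<^sup>+n. indicator {n. dil (1 / r) n \<in> A} n \<partial>hyperplane_measure \<nu>)"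
    by simp
  also have "\<dots> = (\<integral>\<^sup>+n. indicator A (dil (1 / r) n) \<partial>hyperplane_measure \<nu>)"
    by (intro nn_integral_cong) (simp split: split_indicator)
  also have "\<dots> = ennreal (r ^ (hom_dim V \<iota> - 1)) * (\<integral>\<^sup>+n. indicator A (dil (1 / r) (dil r n)) \<partial>hyperplane_measure \<nu>)"
    by (rule nn_integral_hyperplane_dil[OF _ \<nu> r]) measurable
  finally show ?thesis using r by (simp add: dil_inverse)
qed

subsection \<open>Products of horizontal elements\<close>

fun path_end :: "(real \<times> 'a) list \<Rightarrow> 'a" where
  "path_end [] = 0"
| "path_end ((c, e) # l) = gmul (c *\<^sub>R e) (path_end l)"

text \<open>Endpoints of paths from 0 made of at most m segments of length at most C along basis
  fields of the first layer. Chow's theorem takes the form that a bounded set is contained in one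
  such set.\<close>

definition reach :: "real \<Rightarrow> nat \<Rightarrow> 'a set" where
  "reach C m = {path_end l | l. length l \<le> m \<and> (\<forall>(c, e)\<in>set l. \<bar>c\<bar> \<le> C \<and> e \<in> Basis \<and> deg e = 1)}"

definition reachable :: "'a set \<Rightarrow> bool" where
  "reachable A \<longleftrightarrow> (\<exists>C m. A \<subseteq> reach C m)"

lemma path_end_append: "path_end (l @ l') = gmul (path_end l) (path_end l')"
  by (induction l rule: path_end.induct) (auto simp: grp.assoc)

lemma minus_gmul: "- gmul x y = gmul (- y) (- x)"
  by (rule grp.inverse_unique) (metis grp.assoc grp.right_inverse grp.right_neutral)

lemma path_end_inverse: "- path_end l = path_end (rev (map (\<lambda>(c, e). (- c, e)) l))"
  by (induction l rule: path_end.induct) (auto simp: path_end_append minus_gmul)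

lemma reach_mono: "C \<le> C' \<Longrightarrow> m \<le> m' \<Longrightarrow> reach C m \<subseteq> reach C' m'"
  unfolding reach_def by fastforce

lemma reach_gmul: "a \<in> reach C m \<Longrightarrow> b \<in> reach C' m' \<Longrightarrow> gmul a b \<in> reach (max C C') (m + m')"
proof -
  assume "a \<in> reach C m" "b \<in> reach C' m'"
  then obtain l l' where "a = path_end l" "length l \<le> m" "\<forall>(c, e)\<in>set l. \<bar>c\<bar> \<le> C \<and> e \<in> Basis \<and> deg e = 1"
    "b = path_end l'" "length l' \<le> m'" "\<forall>(c, e)\<in>set l'. \<bar>c\<bar> \<le> C' \<and> e \<in> Basis \<and> deg e = 1"
    unfolding reach_def by blast
  then show ?thesis unfolding reach_def
    by (intro CollectI exI[of _ "l @ l'"]) (auto simp: path_end_append)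
qed

lemma reach_minus: "a \<in> reach C m \<Longrightarrow> - a \<in> reach C m"
proof -
  assume "a \<in> reach C m"
  then obtain l where "a = path_end l" "length l \<le> m" "\<forall>(c, e)\<in>set l. \<bar>c\<bar> \<le> C \<and> e \<in> Basis \<and> deg e = 1"
    unfolding reach_def by blast
  then show ?thesis unfolding reach_def
    by (intro CollectI exI[of _ "rev (map (\<lambda>(c, e). (- c, e)) l)"]) (auto simp: path_end_inverse)
qed

lemma bounded_gmul:
  assumes "bounded A" "bounded B"
  shows "bounded {gmul a b | a b. a \<in> A \<and> b \<in> B}"
proof -
  have "compact ((\<lambda>p. gmul (fst p) (snd p)) ` (closure A \<times> closure B))"
    using assms by (intro compact_continuous_image compact_Times continuous_intros) (auto simp: compact_closure)
  moreover have "{gmul a b | a b. a \<in> A \<and> b \<in> B} \<subseteq> (\<lambda>p. gmul (fst p) (snd p)) ` (closure A \<times> closure B)"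
  proof clarify
    fix a b assume "a \<in> A" "b \<in> B"
    then have "(a, b) \<in> closure A \<times> closure B" using closure_subset by blast
    then show "gmul a b \<in> (\<lambda>p. gmul (fst p) (snd p)) ` (closure A \<times> closure B)" by (rule rev_image_eqI) simp
  qed
  ultimately show ?thesis by (rule bounded_subset[OF compact_imp_bounded])
qed

lemma bounded_reach: "bounded (reach C m)"
proof (induction m)
  case 0
  have "reach C 0 \<subseteq> {0}" by (auto simp: reach_def)
  then show ?case by (rule bounded_subset[rotated]) simp
next
  case (Suc m)
  have "reach C (Suc m) \<subseteq> {0} \<union> {gmul a b | a b. a \<in> cball 0 C \<and> b \<in> reach C m}"
  proof
    fix p assume "p \<in> reach C (Suc m)"
    then obtain l where l: "p = path_end l" "length l \<le> Suc m" "\<forall>(c, e)\<in>set l. \<bar>c\<bar> \<le> C \<and> e \<in> Basis \<and> deg e = 1"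
      unfolding reach_def by blast
    show "p \<in> {0} \<union> {gmul a b | a b. a \<in> cball 0 C \<and> b \<in> reach C m}"
    proof (cases l)
      case (Cons ce l')
      obtain c e where ce: "ce = (c, e)" by (cases ce)
      have "path_end l' \<in> reach C m" using l Cons unfolding reach_def by auto
      moreover have "c *\<^sub>R e \<in> cball 0 C" using l Cons ce by auto
      moreover have "p = gmul (c *\<^sub>R e) (path_end l')" using l(1) Cons ce by simp
      ultimately show ?thesis by blast
    qed (use l in auto)
  qed
  moreover have "bounded ({0} \<union> {gmul a b | a b. a \<in> cball 0 C \<and> b \<in> reach C m})"
    using bounded_gmul[OF bounded_cball[of 0 C] Suc.IH] by (simp only: bounded_Un bounded_insert bounded_empty simp_thms)
  ultimately show ?case by (rule bounded_subset[rotated])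
qed

lemma reachable_subset: "reachable B \<Longrightarrow> A \<subseteq> B \<Longrightarrow> reachable A"
  unfolding reachable_def by blast

lemma reachable_gmul:
  assumes "reachable A" "reachable B"
  shows "reachable {gmul a b | a b. a \<in> A \<and> b \<in> B}"
proof -
  obtain C m C' m' where "A \<subseteq> reach C m" "B \<subseteq> reach C' m'" using assms unfolding reachable_def by blast
  then have "{gmul a b | a b. a \<in> A \<and> b \<in> B} \<subseteq> reach (max C C') (m + m')" using reach_gmul by blast
  then show ?thesis unfolding reachable_def by blast
qed

lemma reachable_minus: "reachable A \<Longrightarrow> reachable (uminus ` A)"
  unfolding reachable_def using reach_minus by blast

lemma reachable_bounded: "reachable A \<Longrightarrow> bounded A"
  unfolding reachable_def using bounded_subset bounded_reach by blast

text \<open>Sets reachable modulo higher layers. Group commutators lead from one layer to the next, since they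
  realize the brackets that span it.\<close>

definition approx_reachable :: "nat \<Rightarrow> 'a set \<Rightarrow> bool" where
  "approx_reachable k B \<longleftrightarrow> (\<exists>A. reachable A \<and> (\<forall>w\<in>B. \<exists>a\<in>A. a - w \<in> tail (Suc k)))"

text \<open>Leading terms of elements of \<open>tail k\<close> add under multiplication.\<close>

lemma approx_reachable_add:
  assumes "1 \<le> k" "approx_reachable k B" "approx_reachable k B'" "B \<subseteq> tail k" "B' \<subseteq> tail k"
  shows "approx_reachable k {b + b' | b b'. b \<in> B \<and> b' \<in> B'}"
proof -
  obtain A A' where A: "reachable A" "\<And>w. w \<in> B \<Longrightarrow> \<exists>a\<in>A. a - w \<in> tail (Suc k)"
    "reachable A'" "\<And>w. w \<in> B' \<Longrightarrow> \<exists>a\<in>A'. a - w \<in> tail (Suc k)"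
    using assms unfolding approx_reachable_def by metis
  show ?thesis unfolding approx_reachable_def
  proof (intro exI conjI ballI)
    show "reachable {gmul a b | a b. a \<in> A \<and> b \<in> A'}" using A by (intro reachable_gmul)
    fix w assume "w \<in> {b + b' | b b'. b \<in> B \<and> b' \<in> B'}"
    then obtain b b' where w: "w = b + b'" "b \<in> B" "b' \<in> B'" by blast
    obtain a a' where a: "a \<in> A" "a - b \<in> tail (Suc k)" "a' \<in> A'" "a' - b' \<in> tail (Suc k)"
      using A w by metis
    have "a \<in> tail k" "a' \<in> tail k"
      using tail_add[OF tail_mono[OF a(2), of k], of b] tail_add[OF tail_mono[OF a(4), of k], of b'] w assms(4,5) by auto
    then have "gmul a a' - gmul 0 0 - (a - 0) - (a' - 0) \<in> tail (Suc k)"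
      by (intro gmul_tail_diff[OF assms(1)]) auto
    from tail_add[OF this tail_add[OF a(2) a(4)]]
    have "gmul a a' - w \<in> tail (Suc k)" by (simp add: w algebra_simps)
    then show "\<exists>x\<in>{gmul a b | a b. a \<in> A \<and> b \<in> A'}. x - w \<in> tail (Suc k)" using a by blast
  qed
qed

lemma approx_reachable_subset: "approx_reachable k B \<Longrightarrow> B' \<subseteq> B \<Longrightarrow> approx_reachable k B'"
  unfolding approx_reachable_def by blast

lemma approx_reachable_sum:
  assumes k: "1 \<le> k" and "finite I" and "\<And>i. i \<in> I \<Longrightarrow> approx_reachable k (B i)" "\<And>i. i \<in> I \<Longrightarrow> B i \<subseteq> tail k"
  shows "approx_reachable k {\<Sum>i\<in>I. f i | f. \<forall>i\<in>I. f i \<in> B i}"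
  using assms(2-4)
proof (induction I)
  case empty
  have "reachable {0}" unfolding reachable_def reach_def
    by (intro exI[of _ 0]) (auto intro!: exI[of _ "[]"])
  then show ?case unfolding approx_reachable_def by (intro exI[of _ "{0}"]) auto
next
  case (insert j I)
  have "approx_reachable k {b + b' | b b'. b \<in> B j \<and> b' \<in> {\<Sum>i\<in>I. f i | f. \<forall>i\<in>I. f i \<in> B i}}"
    using insert by (intro approx_reachable_add[OF k]) (auto intro!: tail_sum)
  then show ?case
    by (rule approx_reachable_subset) (use insert in \<open>auto\<close>)
qed

lemma approx_reachable_commutator:
  assumes k: "1 \<le> k" and B: "approx_reachable k B" "B \<subseteq> tail k" and v: "approx_reachable 1 {v}"
  shows "approx_reachable (Suc k) ((\<lambda>u. br v u) ` B)"
proof -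
  obtain A A' where A: "reachable A" "\<And>w. w \<in> B \<Longrightarrow> \<exists>a\<in>A. a - w \<in> tail (Suc k)"
    "reachable A'" "\<exists>a\<in>A'. a - v \<in> tail 2"
    using B(1) v unfolding approx_reachable_def by (auto simp: numeral_2_eq_2)
  let ?P = "{gmul a b | a b. a \<in> A' \<and> b \<in> A}" and ?P' = "{gmul b a | b a. b \<in> A \<and> a \<in> A'}"
  let ?R = "{gmul p q | p q. p \<in> ?P \<and> q \<in> uminus ` ?P'}"
  have "reachable ?R" using A by (intro reachable_gmul reachable_minus)
  moreover have "\<exists>r\<in>?R. r - br v u \<in> tail (Suc (Suc k))" if "u \<in> B" for u
  proof -
    obtain a where a: "a \<in> A'" "a - v \<in> tail 2" using A(4) by blast
    obtain b where "b \<in> A" "b - u \<in> tail (Suc k)" using A(2)[OF \<open>u \<in> B\<close>] by blast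
    note ab = a this
    have "gmul (gmul a b) (- gmul b a) \<in> ?R" using ab by blast
    moreover have "gmul (gmul a b) (- gmul b a) - br v u \<in> tail (Suc (Suc k))"
      using ab that B(2) by (intro commutator_tail[OF k]) auto
    ultimately show ?thesis by blast
  qed
  ultimately show ?thesis unfolding approx_reachable_def by blast
qed

lemma approx_reachable_layer_1:
  assumes "bounded B" "B \<subseteq> V 1"
  shows "approx_reachable 1 B"
proof -
  obtain C where C: "\<And>x. x \<in> B \<Longrightarrow> norm x \<le> C" using assms(1) by (auto simp: bounded_iff)
  let ?I = "{b\<in>Basis. deg b = 1}"
  let ?B = "\<lambda>b. {c *\<^sub>R b | c. \<bar>c\<bar> \<le> C}"
  have "approx_reachable 1 {\<Sum>b\<in>?I. f b | f. \<forall>b\<in>?I. f b \<in> ?B b}"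
  proof (rule approx_reachable_sum)
    fix b assume b: "b \<in> ?I"
    have "gmul (c *\<^sub>R b) 0 \<in> reach C 1" if "\<bar>c\<bar> \<le> C" for c
      unfolding reach_def using b that by (intro CollectI exI[of _ "[(c, b)]"]) auto
    then have "?B b \<subseteq> reach C 1" by auto
    then have "reachable (?B b)" unfolding reachable_def by blast
    then show "approx_reachable 1 (?B b)" unfolding approx_reachable_def by (intro exI[of _ "?B b"]) auto
  qed auto
  then show ?thesis
  proof (rule approx_reachable_subset, intro subsetI CollectI)
    fix w assume w: "w \<in> B"
    have "w = (\<Sum>b\<in>Basis. (w \<bullet> b) *\<^sub>R b)" by (simp add: euclidean_representation)
    also have "\<dots> = (\<Sum>b\<in>?I. (w \<bullet> b) *\<^sub>R b)"
      using layer_inner[of w 1] w assms(2) by (intro sum.mono_neutral_right) auto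
    finally have "w = (\<Sum>b\<in>?I. (w \<bullet> b) *\<^sub>R b)" .
    moreover have "\<bar>w \<bullet> b\<bar> \<le> C" if "b \<in> ?I" for b using C[OF w] Basis_le_norm[of b w] that by auto
    ultimately show "\<exists>f. w = (\<Sum>b\<in>?I. f b) \<and> (\<forall>b\<in>?I. f b \<in> ?B b)"
      by (intro exI[of _ "\<lambda>b. (w \<bullet> b) *\<^sub>R b"]) auto
  qed
qed

text \<open>Every basis vector of the next layer is a fixed finite sum of brackets of V 1 with V k.
  A bounded coefficient can be absorbed in the second entry, whose bounded multiples are
  approximately reachable by induction, and commutators then produce the brackets. Finitely many
  commutators serve for the whole set, so the number of segments stays bounded.\<close>

lemma approx_reachable_layer:
  assumes "1 \<le> k" "bounded B" "B \<subseteq> V k"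
  shows "approx_reachable k B"
  using assms
proof (induction k arbitrary: B rule: nat_induct_at_least)
  case base then show ?case by (rule approx_reachable_layer_1)
next
  case (Suc k)
  let ?E = "{e\<in>Basis. deg e = Suc k}"
  \<comment> \<open>The number of brackets and both sequences of entries form one triple, so that a
    single choice fixes them for all basis vectors.\<close>
  have "\<forall>e\<in>?E. \<exists>z :: nat \<times> (nat \<Rightarrow> 'a) \<times> (nat \<Rightarrow> 'a).
      (\<forall>i<fst z. fst (snd z) i \<in> V 1 \<and> snd (snd z) i \<in> V k) \<and>
      e = (\<Sum>i<fst z. br (fst (snd z) i) (snd (snd z) i))"
  proof
    fix e assume "e \<in> ?E"
    then have "e \<in> V (k + 1)" using deg(2)[of e] by auto
    then obtain m :: nat and a c where "\<And>i. i < m \<Longrightarrow> a i \<in> V 1" "\<And>i. i < m \<Longrightarrow> c i \<in> V k"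
      "e = (\<Sum>i<m. br (a i) (c i))" using layer_Suc_brackets[of e k] Suc.hyps by metis
    then show "\<exists>z :: nat \<times> (nat \<Rightarrow> 'a) \<times> (nat \<Rightarrow> 'a).
        (\<forall>i<fst z. fst (snd z) i \<in> V 1 \<and> snd (snd z) i \<in> V k) \<and>
        e = (\<Sum>i<fst z. br (fst (snd z) i) (snd (snd z) i))"
      by (intro exI[of _ "(m, a, c)"]) simp
  qed
  from bchoice[OF this] obtain F :: "'a \<Rightarrow> nat \<times> (nat \<Rightarrow> 'a) \<times> (nat \<Rightarrow> 'a)" where
    F: "\<forall>e\<in>?E. (\<forall>i<fst (F e). fst (snd (F e)) i \<in> V 1 \<and> snd (snd (F e)) i \<in> V k) \<and>
      e = (\<Sum>i<fst (F e). br (fst (snd (F e)) i) (snd (snd (F e)) i))" ..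
  define m a c where "m e = fst (F e)" and "a e = fst (snd (F e))" and "c e = snd (snd (F e))" for e
  have ac: "a e i \<in> V 1" "c e i \<in> V k" if "e \<in> ?E" "i < m e" for e i
    using F[rule_format, OF that(1)] that(2) unfolding m_def a_def c_def by blast+
  have ace: "e = (\<Sum>i<m e. br (a e i) (c e i))" if "e \<in> ?E" for e
    using F[rule_format, OF that] unfolding m_def a_def c_def by (rule conjunct2)
  obtain C where C: "\<And>x. x \<in> B \<Longrightarrow> norm x \<le> C" using Suc.prems(1) by (auto simp: bounded_iff)
  let ?I = "Sigma ?E (\<lambda>e. {..<m e})"
  let ?D = "\<lambda>(e, i). (\<lambda>u. br (a e i) u) ` {t *\<^sub>R c e i | t. \<bar>t\<bar> \<le> C}"
  have "approx_reachable (Suc k) {\<Sum>z\<in>?I. f z | f. \<forall>z\<in>?I. f z \<in> ?D z}"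
  proof (rule approx_reachable_sum)
    fix z assume "z \<in> ?I"
    then obtain e i where z: "z = (e, i)" "e \<in> ?E" "i < m e" by blast
    have sub: "{t *\<^sub>R c e i | t. \<bar>t\<bar> \<le> C} \<subseteq> V k"
      using ac(2)[OF z(2,3)] subspace_scale[OF layer_subspace[OF Suc.hyps]] by auto
    have "bounded {t *\<^sub>R c e i | t. \<bar>t\<bar> \<le> C}"
      unfolding bounded_iff by (intro exI[of _ "C * norm (c e i)"]) (auto intro!: mult_right_mono)
    then have B1: "approx_reachable k {t *\<^sub>R c e i | t. \<bar>t\<bar> \<le> C}" using sub by (rule Suc.IH)
    have B2: "{t *\<^sub>R c e i | t. \<bar>t\<bar> \<le> C} \<subseteq> tail k" using sub layer_tail[OF _ Suc.hyps order_refl] by blast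
    have B3: "approx_reachable 1 {a e i}" by (rule approx_reachable_layer_1) (use ac(1)[OF z(2,3)] in auto)
    show "approx_reachable (Suc k) (?D z)"
      using approx_reachable_commutator[OF Suc.hyps B1 B2 B3] z(1) by simp
    show "?D z \<subseteq> tail (Suc k)"
      using B2 Suc.hyps z(1) by (auto intro!: bracket_tail_Suc)
  qed auto
  then show ?case
  proof (rule approx_reachable_subset, intro subsetI CollectI)
    fix w assume w: "w \<in> B"
    have "w = (\<Sum>b\<in>Basis. (w \<bullet> b) *\<^sub>R b)" by (simp add: euclidean_representation)
    also have "\<dots> = (\<Sum>b\<in>?E. (w \<bullet> b) *\<^sub>R b)"
      using layer_inner[of w "Suc k"] w Suc.prems(2) by (intro sum.mono_neutral_right) auto
    also have "\<dots> = (\<Sum>e\<in>?E. \<Sum>i<m e. br (a e i) ((w \<bullet> e) *\<^sub>R c e i))"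
    proof (intro sum.cong refl)
      fix e assume "e \<in> ?E"
      from ace[OF this] have "(w \<bullet> e) *\<^sub>R e = (w \<bullet> e) *\<^sub>R (\<Sum>i<m e. br (a e i) (c e i))" by simp
      then show "(w \<bullet> e) *\<^sub>R e = (\<Sum>i<m e. br (a e i) ((w \<bullet> e) *\<^sub>R c e i))"
        by (simp add: scaleR_sum_right bracket_scale_right)
    qed
    also have "\<dots> = (\<Sum>z\<in>?I. case z of (e, i) \<Rightarrow> br (a e i) ((w \<bullet> e) *\<^sub>R c e i))"
      by (rule sum.Sigma) auto
    finally have "w = (\<Sum>z\<in>?I. case z of (e, i) \<Rightarrow> br (a e i) ((w \<bullet> e) *\<^sub>R c e i))" .
    moreover have "\<bar>w \<bullet> e\<bar> \<le> C" if "e \<in> ?E" for e using C[OF w] Basis_le_norm[of e w] that by auto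
    then have "\<forall>z\<in>?I. (case z of (e, i) \<Rightarrow> br (a e i) ((w \<bullet> e) *\<^sub>R c e i)) \<in> ?D z"
      by (intro ballI) (clarsimp, blast)
    ultimately show "\<exists>f. w = (\<Sum>z\<in>?I. f z) \<and> (\<forall>z\<in>?I. f z \<in> ?D z)" by blast
  qed
qed

text \<open>Induction from the top layer downwards: \<open>tail (Suc \<iota>)\<close> is 0, and a
  point of \<open>tail k\<close> is divided by a reachable element with the same component in layer
  k, which leaves a remainder in \<open>tail (Suc k)\<close>.\<close>

lemma reachable_tail:
  assumes "bounded B" "B \<subseteq> tail (Suc \<iota> - j)" "j \<le> \<iota>"
  shows "reachable B"
  using assms
proof (induction j arbitrary: B)
  case 0
  then have "B \<subseteq> reach 0 0" unfolding reach_def by (auto simp: tail_beyond)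
  then show ?case unfolding reachable_def by blast
next
  case (Suc j)
  define k where "k = \<iota> - j"
  have k: "1 \<le> k" "k \<le> \<iota>" "Suc \<iota> - Suc j = k" "Suc \<iota> - j = Suc k" using Suc.prems by (auto simp: k_def)
  define proj where "proj p = (\<Sum>b\<in>{b\<in>Basis. deg b = k}. (p \<bullet> b) *\<^sub>R b)" for p :: 'a
  have proj_inner: "proj p \<bullet> b = (if deg b = k then p \<bullet> b else 0)" if "b \<in> Basis" for p b
    using that unfolding proj_def inner_sum_left
    by (subst sum.cong[OF refl, where h="\<lambda>c. if c = b then p \<bullet> b else 0"]) (auto simp: inner_Basis)
  have projV: "proj p \<in> V k" for p unfolding layer_iff[OF k(1,2)] by (auto simp: proj_inner)
  have "linear proj" unfolding proj_def
    by (intro linear_compose_sum ballI) (auto simp: linear_iff inner_add_left scaleR_add_left)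
  then have "bounded (proj ` B)" using Suc.prems(1) by (intro bounded_linear_image) (auto simp: linear_conv_bounded_linear)
  then obtain A where A: "reachable A" "\<And>p. p \<in> B \<Longrightarrow> \<exists>a\<in>A. a - proj p \<in> tail (Suc k)"
    using approx_reachable_layer[OF k(1), of "proj ` B"] projV unfolding approx_reachable_def by blast
  have pt: "p - proj p \<in> tail (Suc k)" if "p \<in> B" for p
    using that Suc.prems(2) unfolding k(3) by (auto simp: tail_def inner_diff_left proj_inner less_Suc_eq)
  \<comment> \<open>All remainders are collected in one bounded set, so that the induction
    hypothesis gives a path length valid for every point of \<open>B\<close>.\<close>
  let ?R = "{gmul a b | a b. a \<in> uminus ` A \<and> b \<in> B} \<inter> tail (Suc k)"
  have "bounded ?R" using bounded_gmul[OF reachable_bounded[OF reachable_minus[OF A(1)]] Suc.prems(1)] by (rule bounded_subset) auto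
  then have R: "reachable ?R" using Suc.IH[of ?R] k Suc.prems(3) by auto
  have "B \<subseteq> {gmul a b | a b. a \<in> A \<and> b \<in> ?R}"
  proof
    fix p assume p: "p \<in> B"
    obtain a where a: "a \<in> A" "a - proj p \<in> tail (Suc k)" using A(2)[OF p] by blast
    have pa: "p - a \<in> tail (Suc k)" using tail_diff[OF pt[OF p] a(2)] by simp
    have "gmul (- a) p - gmul (- a) a - (- a - - a) - (p - a) \<in> tail (Suc (Suc k))"
      by (rule gmul_tail_diff) (use pa in auto)
    then have "gmul (- a) p - (p - a) \<in> tail (Suc k)" using tail_mono by fastforce
    from tail_add[OF this pa] have "gmul (- a) p \<in> ?R" using a p by auto
    moreover have "p = gmul a (gmul (- a) p)" by (simp add: grp.assoc[symmetric])
    ultimately show "p \<in> {gmul a b | a b. a \<in> A \<and> b \<in> ?R}" using a by blast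
  qed
  then show ?case using reachable_gmul[OF A(1) R] reachable_subset by blast
qed

theorem bounded_reachable:
  assumes "bounded B"
  obtains C m where "0 \<le> C" "B \<subseteq> reach C m"
proof -
  have "reachable B" using assms by (rule reachable_tail[of _ \<iota>]) auto
  then obtain C m where "B \<subseteq> reach C m" unfolding reachable_def by blast
  moreover have "reach C m \<subseteq> reach (max 0 C) m" by (rule reach_mono) auto
  ultimately show thesis by (intro that[of "max 0 C" m]) auto
qed

subsection \<open>Flows and horizontal derivatives\<close>

text \<open>The integral curve through \<open>x\<close> is unique because \<open>c(s) (-s v)\<close> is constant along every
  integral curve \<open>c\<close>.\<close>

lemma flow_left_field: "flow (left_field gmul v) t x = gmul x (t *\<^sub>R v)"
proof -
  have "(THE c. c 0 = x \<and> (\<forall>s. (c has_vector_derivative left_field gmul v (c s)) (at s))) = (\<lambda>t. gmul x (t *\<^sub>R v))"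
  proof (rule the_equality)
    show "gmul x (0 *\<^sub>R v) = x \<and> (\<forall>s. ((\<lambda>t. gmul x (t *\<^sub>R v)) has_vector_derivative left_field gmul v (gmul x (s *\<^sub>R v))) (at s))"
      using gmul_curve_derivative by simp
    fix c assume c: "c 0 = x \<and> (\<forall>s. (c has_vector_derivative left_field gmul v (c s)) (at s))"
    let ?h = "\<lambda>s. gmul (c s) ((- s) *\<^sub>R v)"
    have "(?h has_vector_derivative 0) (at s)" for s
    proof -
      have zero: "gmul_deriv (c s, (- s) *\<^sub>R v) (h *\<^sub>R left_field gmul v (c s), (- h) *\<^sub>R v) = 0" for h :: real
      proof -
        let ?p = "\<lambda>\<tau>::real. (gmul (c s) (\<tau> *\<^sub>R v), (- s - \<tau>) *\<^sub>R v)"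
        have "((\<lambda>\<tau>. gmul (c s) (\<tau> *\<^sub>R v)) has_derivative (\<lambda>h. h *\<^sub>R left_field gmul v (c s))) (at 0)"
          using gmul_curve_derivative[of "c s" v 0] by (simp add: has_vector_derivative_def)
        then have "(?p has_derivative (\<lambda>h. (h *\<^sub>R left_field gmul v (c s), (- h) *\<^sub>R v))) (at 0)"
          by (auto intro!: derivative_eq_intros)
        from diff_chain_at[OF this, of "\<lambda>q. gmul (fst q) (snd q)"] gmul_deriv[of "(c s, (- s) *\<^sub>R v)"]
        have "((\<lambda>\<tau>. gmul (gmul (c s) (\<tau> *\<^sub>R v)) ((- s - \<tau>) *\<^sub>R v)) has_derivative
            (\<lambda>h. gmul_deriv (c s, (- s) *\<^sub>R v) (h *\<^sub>R left_field gmul v (c s), (- h) *\<^sub>R v))) (at 0)"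
          by (simp add: o_def)
        moreover have "gmul (gmul (c s) (\<tau> *\<^sub>R v)) ((- s - \<tau>) *\<^sub>R v) = gmul (c s) ((- s) *\<^sub>R v)" for \<tau>
          by (simp only: grp.assoc gmul_multiples) simp
        ultimately have "((\<lambda>\<tau>::real. gmul (c s) ((- s) *\<^sub>R v)) has_derivative
            (\<lambda>h. gmul_deriv (c s, (- s) *\<^sub>R v) (h *\<^sub>R left_field gmul v (c s), (- h) *\<^sub>R v))) (at 0)"
          by simp
        then have "(\<lambda>h. gmul_deriv (c s, (- s) *\<^sub>R v) (h *\<^sub>R left_field gmul v (c s), (- h) *\<^sub>R v)) = (\<lambda>h. 0)"
          using has_derivative_unique has_derivative_const by blast
        then show ?thesis by (rule fun_cong)
      qed
      have "(c has_derivative (\<lambda>h. h *\<^sub>R left_field gmul v (c s))) (at s)"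
        using c by (simp add: has_vector_derivative_def)
      then have "((\<lambda>s. (c s, (- s) *\<^sub>R v)) has_derivative (\<lambda>h. (h *\<^sub>R left_field gmul v (c s), (- h) *\<^sub>R v))) (at s)"
        by (auto intro!: derivative_eq_intros)
      from diff_chain_at[OF this, of "\<lambda>q. gmul (fst q) (snd q)"] gmul_deriv[of "(c s, (- s) *\<^sub>R v)"]
      have "(?h has_derivative (\<lambda>h. gmul_deriv (c s, (- s) *\<^sub>R v) (h *\<^sub>R left_field gmul v (c s), (- h) *\<^sub>R v))) (at s)"
        by (simp add: o_def)
      then have "(?h has_derivative (\<lambda>h. 0)) (at s)" unfolding zero .
      then show ?thesis by (simp add: has_vector_derivative_def)
    qed
    then have "(?h has_derivative (\<lambda>_. 0)) (at s within UNIV)" for s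
      by (simp add: has_vector_derivative_def)
    then have "\<exists>k. \<forall>s\<in>UNIV. ?h s = k"
      by (intro has_derivative_zero_constant) auto
    then have hs: "?h s = ?h 0" for s by (metis UNIV_I)
    show "c = (\<lambda>t. gmul x (t *\<^sub>R v))"
    proof
      fix s
      have "c s = gmul (gmul (c s) ((- s) *\<^sub>R v)) (s *\<^sub>R v)"
        by (simp only: grp.assoc gmul_multiples) simp
      also have "gmul (c s) ((- s) *\<^sub>R v) = x" using hs[of s] c by simp
      finally show "c s = gmul x (s *\<^sub>R v)" .
    qed
  qed
  then show ?thesis by (simp add: flow_def)
qed

abbreviation hderiv :: "'a \<Rightarrow> ('a \<Rightarrow> real) \<Rightarrow> 'a \<Rightarrow> real" where
  "hderiv v \<equiv> deriv_along (left_field gmul v)"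

lemma C1h_tendsto:
  assumes "f \<in> C1h gmul (V 1) \<Omega>" "v \<in> V 1" "x \<in> \<Omega>"
  shows "((\<lambda>t. (f (gmul x (t *\<^sub>R v)) - f x) / t) \<longlongrightarrow> hderiv v f x) (at 0)"
proof -
  obtain l where l: "((\<lambda>t. (f (flow (left_field gmul v) t x) - f x) / t) \<longlongrightarrow> l) (at 0)"
    using assms unfolding C1h_def fields_eq by blast
  then have "hderiv v f x = l" unfolding deriv_along_def by (intro tendsto_Lim) auto
  then show ?thesis using l by (simp add: flow_left_field)
qed

lemma C1h_continuous:
  assumes "f \<in> C1h gmul (V 1) \<Omega>" "v \<in> V 1"
  shows "continuous_on \<Omega> (hderiv v f)"
  using assms unfolding C1h_def fields_eq by blast

lemma C1h_DERIV:
  assumes "f \<in> C1h gmul (V 1) \<Omega>" "v \<in> V 1" "gmul x (t *\<^sub>R v) \<in> \<Omega>"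
  shows "((\<lambda>s. f (gmul x (s *\<^sub>R v))) has_real_derivative hderiv v f (gmul x (t *\<^sub>R v))) (at t)"
  unfolding DERIV_def using C1h_tendsto[OF assms]
  by (simp add: grp.assoc gmul_multiples)

lemma norm_dil_le:
  assumes "0 \<le> r" "r \<le> 1"
  shows "norm (dil r p) \<le> r * norm p"
proof -
  have "norm (dil r p) \<le> norm (r *\<^sub>R p)"
  proof (rule norm_le_componentwise)
    fix b :: 'a assume b: "b \<in> Basis"
    have "r ^ deg b \<le> r ^ 1" using assms deg(3)[OF b] by (intro power_decreasing) auto
    then show "\<bar>dil r p \<bullet> b\<bar> \<le> \<bar>(r *\<^sub>R p) \<bullet> b\<bar>"
      using b assms by (auto simp: abs_mult intro!: mult_right_mono)
  qed
  then show ?thesis using assms by simp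
qed

lemma small_dilations:
  assumes "open U" "x \<in> U" "bounded K"
  obtains r0 where "0 < r0" "\<And>r p. 0 < r \<Longrightarrow> r < r0 \<Longrightarrow> p \<in> K \<Longrightarrow> gmul x (dil r p) \<in> U"
proof -
  obtain R where R: "\<And>p. p \<in> K \<Longrightarrow> norm p \<le> R" using assms(3) by (auto simp: bounded_iff)
  have "isCont (gmul x) 0" using gmul_has_derivative_right has_derivative_continuous by blast
  then have "\<forall>\<^sub>F y in at 0. gmul x y \<in> U"
    using assms(1,2) by (auto simp: isCont_def dest!: topological_tendstoD[of _ _ _ U])
  then obtain \<delta> where \<delta>: "0 < \<delta>" "\<And>y. y \<noteq> 0 \<Longrightarrow> norm y < \<delta> \<Longrightarrow> gmul x y \<in> U"
    by (auto simp: eventually_at)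
  have *: "gmul x y \<in> U" if "norm y < \<delta>" for y using \<delta>(2)[of y] that assms(2) by (cases "y = 0") auto
  show thesis
  proof (rule that[of "min 1 (\<delta> / (\<bar>R\<bar> + 1))"])
    fix r p assume r: "0 < r" "r < min 1 (\<delta> / (\<bar>R\<bar> + 1))" and p: "p \<in> K"
    have "norm (dil r p) \<le> r * norm p" using r by (intro norm_dil_le) auto
    also have "\<dots> \<le> r * (\<bar>R\<bar> + 1)" using r R[OF p] by (intro mult_left_mono) auto
    also have "\<dots> < \<delta>" using r by (simp add: pos_less_divide_eq)
    finally show "gmul x (dil r p) \<in> U" by (rule *)
  qed (use \<delta> in auto)
qed

lemma Basis_layer_1: "b \<in> Basis \<inter> V 1 \<longleftrightarrow> b \<in> Basis \<and> deg b = 1"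
  using Basis_layer_iff[of b 1] by auto

lemma horizontal_gradient_layer: "horizontal_gradient gmul (V 1) f x \<in> V 1"
  unfolding horizontal_gradient_def
  by (intro subspace_sum subspace_scale layer_subspace) auto

lemma horizontal_gradient_inner_Basis:
  assumes "e \<in> Basis" "deg e = 1"
  shows "horizontal_gradient gmul (V 1) f x \<bullet> e = hderiv e f x"
proof -
  have "horizontal_gradient gmul (V 1) f x \<bullet> e = (\<Sum>b\<in>Basis \<inter> V 1. if b = e then hderiv e f x else 0)"
    unfolding horizontal_gradient_def inner_sum_left using assms by (intro sum.cong) (auto simp: inner_Basis)
  then show ?thesis using assms Basis_layer_1[of e] by simp
qed

text \<open>The mean value inequality; the interval is symmetric since the coefficients of
  horizontal segments may have either sign.\<close>

lemma deriv_bound_symmetric_interval: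
  fixes g :: "real \<Rightarrow> real"
  assumes "\<And>t. \<bar>t\<bar> \<le> \<bar>T\<bar> \<Longrightarrow> (g has_real_derivative g' t) (at t)" "\<And>t. \<bar>t\<bar> \<le> \<bar>T\<bar> \<Longrightarrow> \<bar>g' t - D\<bar> \<le> e"
  shows "\<bar>g T - g 0 - T * D\<bar> \<le> e * \<bar>T\<bar>"
proof -
  let ?S = "{- \<bar>T\<bar>..\<bar>T\<bar>}"
  have "norm ((g T - T * D) - (g 0 - 0 * D)) \<le> e * norm (T - 0)"
  proof (rule field_differentiable_bound[of ?S])
    fix t assume "t \<in> ?S"
    then have "\<bar>t\<bar> \<le> \<bar>T\<bar>" by auto
    then have d: "(g has_real_derivative g' t) (at t)" and e: "\<bar>g' t - D\<bar> \<le> e" using assms by auto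
    show "((\<lambda>t. g t - t * D) has_field_derivative g' t - D) (at t within ?S)"
      using has_field_derivative_at_within[OF DERIV_diff[OF d DERIV_cmult_right[OF DERIV_ident, of D]]] by simp
    show "norm (g' t - D) \<le> e" using e by simp
  qed auto
  then show ?thesis by simp
qed

text \<open>Join \<open>x\<close> and \<open>x \<delta>\<^sub>r p\<close> by boundedly many horizontal
  segments of length \<open>O(r)\<close>.\<close>

theorem horizontal_expansion:
  assumes f: "f \<in> C1h gmul (V 1) \<Omega>" and \<Omega>: "open \<Omega>" "x \<in> \<Omega>" and B: "bounded B" and \<epsilon>: "0 < \<epsilon>"
  obtains r0 where "0 < r0" "\<And>r p. 0 < r \<Longrightarrow> r < r0 \<Longrightarrow> p \<in> B \<Longrightarrow> gmul x (dil r p) \<in> \<Omega>"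
    "\<And>r p. 0 < r \<Longrightarrow> r < r0 \<Longrightarrow> p \<in> B \<Longrightarrow>
      \<bar>f (gmul x (dil r p)) - f x - r * (horizontal_gradient gmul (V 1) f x \<bullet> p)\<bar> \<le> \<epsilon> * r"
proof -
  let ?G = "horizontal_gradient gmul (V 1) f x"
  let ?ok = "\<lambda>C l. \<forall>(c, e)\<in>set l. \<bar>c\<bar> \<le> C \<and> e \<in> Basis \<and> deg e = 1"
  obtain C m where Cm: "0 \<le> C" "B \<subseteq> reach C m" using bounded_reachable[OF B] by metis
  \<comment> \<open>Each of at most m segments has length at most C r and costs C r \<epsilon>'; the
    summand 1 prevents a division by 0.\<close>
  define \<epsilon>' where "\<epsilon>' = \<epsilon> / (C * m + 1)"
  have Cm0: "0 < C * real m + 1" using Cm(1) by (simp add: add_nonneg_pos)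
  have \<epsilon>': "0 < \<epsilon>'" "\<epsilon>' * (C * m) \<le> \<epsilon>" using \<epsilon> Cm0 by (auto simp: \<epsilon>'_def field_simps)
  let ?E = "{b\<in>Basis. deg b = 1}"
  have "\<forall>b\<in>?E. \<exists>U. open U \<and> x \<in> U \<and> (\<forall>y\<in>U. \<bar>hderiv b f y - hderiv b f x\<bar> \<le> \<epsilon>')"
  proof
    fix b assume "b \<in> ?E"
    then have "b \<in> V 1" using Basis_layer_1 by blast
    then have "continuous_on \<Omega> (hderiv b f)" by (rule C1h_continuous[OF f])
    then have "open (\<Omega> \<inter> hderiv b f -` ball (hderiv b f x) \<epsilon>')"
      by (rule continuous_open_preimage[OF _ \<Omega>(1) open_ball])
    then show "\<exists>U. open U \<and> x \<in> U \<and> (\<forall>y\<in>U. \<bar>hderiv b f y - hderiv b f x\<bar> \<le> \<epsilon>')" using \<Omega> \<epsilon>'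
      by (intro exI[of _ "\<Omega> \<inter> hderiv b f -` ball (hderiv b f x) \<epsilon>'"]) (auto simp: dist_real_def abs_minus_commute)
  qed
  from bchoice[OF this] obtain UU where
    "\<forall>b\<in>?E. open (UU b) \<and> x \<in> UU b \<and> (\<forall>y\<in>UU b. \<bar>hderiv b f y - hderiv b f x\<bar> \<le> \<epsilon>')" ..
  then have UU: "\<And>b. b \<in> ?E \<Longrightarrow> open (UU b)" "\<And>b. b \<in> ?E \<Longrightarrow> x \<in> UU b"
    "\<And>b y. b \<in> ?E \<Longrightarrow> y \<in> UU b \<Longrightarrow> \<bar>hderiv b f y - hderiv b f x\<bar> \<le> \<epsilon>'" by blast+
  define U where "U = \<Omega> \<inter> (\<Inter>b\<in>?E. UU b)"
  have U: "open U" "x \<in> U" "U \<subseteq> \<Omega>"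
    unfolding U_def using UU(1,2) \<Omega> by (auto intro!: open_Int open_INT)
  have UE: "\<bar>hderiv b f y - hderiv b f x\<bar> \<le> \<epsilon>'" if "b \<in> ?E" "y \<in> U" for b y
    using UU(3)[OF that(1)] that by (auto simp: U_def)
  \<comment> \<open>The radius serves all intermediate points as well: an initial piece of a path
    with its last segment shortened or reversed is again a path with the same bounds.\<close>
  obtain r0 where r0: "0 < r0" "\<And>r p. 0 < r \<Longrightarrow> r < r0 \<Longrightarrow> p \<in> reach C m \<Longrightarrow> gmul x (dil r p) \<in> U"
    using small_dilations[OF U(1,2) bounded_reach] by metis
  have main: "\<bar>f (gmul x (dil r (path_end l))) - f x - r * (?G \<bullet> path_end l)\<bar> \<le> length l * (r * C * \<epsilon>')"
    if r: "0 < r" "r < r0" and l: "length l \<le> m" "?ok C l" for r l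
    using l
  proof (induction l rule: rev_induct)
    case Nil then show ?case by simp
  next
    \<comment> \<open>A path is extended on the right, as right multiplication by t e is the flow of
      the left invariant field of e, along which \<open>f\<close> is differentiable.\<close>
    case (snoc ce l)
    obtain c e where ce: "ce = (c, e)" by (cases ce)
    have e: "\<bar>c\<bar> \<le> C" "e \<in> Basis" "deg e = 1" using snoc.prems ce by auto
    have eV: "e \<in> V 1" using e Basis_layer_1 by blast
    let ?y = "gmul x (dil r (path_end l))"
    let ?g = "\<lambda>t. f (gmul ?y (t *\<^sub>R e))"
    have pt: "gmul ?y (t *\<^sub>R e) \<in> U" if "\<bar>t\<bar> \<le> \<bar>r * c\<bar>" for t
    proof -
      have "\<bar>t / r\<bar> \<le> C"
      proof -
        have "\<bar>t\<bar> \<le> r * \<bar>c\<bar>" using that r by (simp add: abs_mult)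
        also have "\<dots> \<le> r * C" using r e(1) by simp
        finally show ?thesis using r by (simp add: pos_divide_le_eq mult.commute)
      qed
      then have "path_end (l @ [(t / r, e)]) \<in> reach C m"
        unfolding reach_def using snoc.prems e by (intro CollectI exI[of _ "l @ [(t / r, e)]"]) auto
      then have "gmul x (dil r (path_end (l @ [(t / r, e)]))) \<in> U" using r0 r by blast
      moreover have "dil r ((t / r) *\<^sub>R e) = t *\<^sub>R e"
        using r eV by (simp add: linear_scale[OF linear_dil] dil_layer[of e 1])
      ultimately show ?thesis by (simp add: path_end_append dil_gmul grp.assoc)
    qed
    have "\<bar>?g (r * c) - ?g 0 - (r * c) * hderiv e f x\<bar> \<le> \<epsilon>' * \<bar>r * c\<bar>"
    proof (rule deriv_bound_symmetric_interval)
      fix t assume t: "\<bar>t\<bar> \<le> \<bar>r * c\<bar>"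
      show "(?g has_real_derivative hderiv e f (gmul ?y (t *\<^sub>R e))) (at t)"
        using pt[OF t] U(3) by (intro C1h_DERIV[OF f eV]) auto
      show "\<bar>hderiv e f (gmul ?y (t *\<^sub>R e)) - hderiv e f x\<bar> \<le> \<epsilon>'"
        using pt[OF t] e by (intro UE) auto
    qed
    also have "\<epsilon>' * \<bar>r * c\<bar> \<le> r * C * \<epsilon>'"
      using r e(1) \<epsilon>'(1) by (simp add: abs_mult mult.commute mult_left_mono)
    finally have 1: "\<bar>?g (r * c) - ?g 0 - (r * c) * hderiv e f x\<bar> \<le> r * C * \<epsilon>'" .
    have 2: "?g (r * c) = f (gmul x (dil r (path_end (l @ [ce]))))"
    proof -
      have "dil r (c *\<^sub>R e) = (r * c) *\<^sub>R e"
        using eV by (simp add: linear_scale[OF linear_dil] dil_layer[of e 1] mult.commute)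
      then show ?thesis by (simp add: ce path_end_append dil_gmul grp.assoc)
    qed
    have 3: "?G \<bullet> path_end (l @ [ce]) = ?G \<bullet> path_end l + c * hderiv e f x"
      using gmul_inner_layer_1[OF horizontal_gradient_layer, of "path_end l" "c *\<^sub>R e" f x]
        horizontal_gradient_inner_Basis[OF e(2,3), of f x]
      by (simp add: ce path_end_append inner_commute)
    have 4: "?g 0 = f ?y" by simp
    have IH: "\<bar>f ?y - f x - r * (?G \<bullet> path_end l)\<bar> \<le> length l * (r * C * \<epsilon>')"
      using snoc by auto
    have 5: "real (length (l @ [ce])) * (r * C * \<epsilon>') = length l * (r * C * \<epsilon>') + r * C * \<epsilon>'"
      by (simp add: algebra_simps)
    have 6: "r * (?G \<bullet> path_end (l @ [ce])) = r * (?G \<bullet> path_end l) + (r * c) * hderiv e f x"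
      unfolding 3 by (simp add: algebra_simps)
    show ?case using 1 IH unfolding 2 4 5 6 by linarith
  qed
  show thesis
  proof (rule that[OF r0(1)])
    fix r p assume r: "0 < r" "r < r0" and p: "p \<in> B"
    show "gmul x (dil r p) \<in> \<Omega>" using r0(2)[OF r] p Cm U by blast
    obtain l where l: "p = path_end l" "length l \<le> m" "?ok C l" using p Cm(2) unfolding reach_def by blast
    have "\<bar>f (gmul x (dil r p)) - f x - r * (?G \<bullet> p)\<bar> \<le> length l * (r * C * \<epsilon>')"
      unfolding l(1) by (rule main[OF r l(2,3)])
    also have "\<dots> \<le> m * (r * C * \<epsilon>')" using l(2) r Cm \<epsilon>' by (intro mult_right_mono) auto
    also have "\<dots> = r * (\<epsilon>' * (C * m))" by simp
    also have "\<dots> \<le> r * \<epsilon>" using r \<epsilon>' by (intro mult_left_mono) auto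
    finally show "\<bar>f (gmul x (dil r p)) - f x - r * (?G \<bullet> p)\<bar> \<le> \<epsilon> * r" by (simp add: mult.commute)
  qed
qed

text \<open>The definition of \<open>C1h\<close> controls \<open>f\<close> only along single curves.
  The expansion is uniform over p in the unit ball, and for fixed small r the points x
  \<open>\<delta>\<^sub>r\<close> p fill a neighbourhood of x.\<close>

lemma C1h_continuous_on:
  assumes f: "f \<in> C1h gmul (V 1) \<Omega>" and \<Omega>: "open \<Omega>"
  shows "continuous_on \<Omega> f"
  unfolding continuous_on_eq_continuous_at[OF \<Omega>]
proof
  fix x assume x: "x \<in> \<Omega>"
  let ?G = "horizontal_gradient gmul (V 1) f x"
  show "isCont f x" unfolding isCont_def tendsto_iff
  proof (intro allI impI)
    fix e :: real assume e: "0 < e"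
    obtain r0 where r0: "0 < r0" "\<And>r p. 0 < r \<Longrightarrow> r < r0 \<Longrightarrow> p \<in> cball 0 1 \<Longrightarrow>
      \<bar>f (gmul x (dil r p)) - f x - r * (?G \<bullet> p)\<bar> \<le> 1 * r"
      using horizontal_expansion[OF f \<Omega> x bounded_cball zero_less_one] by metis
    define M where "M = norm ?G + 2"
    define r where "r = min (r0 / 2) (e / (2 * M))"
    have G2: "0 < M" by (simp add: M_def add_nonneg_pos)
    have r: "0 < r" "r < r0" using r0 e G2 by (auto simp: r_def)
    have re: "r * M < e"
    proof -
      have "r * M \<le> (e / (2 * M)) * M"
        using G2 by (intro mult_right_mono) (auto simp: r_def)
      also have "\<dots> = e / 2" using G2 by simp
      finally show ?thesis using e by simp
    qed
    have "isCont (\<lambda>y. dil (1 / r) (gmul (- x) y)) x"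
      by (rule continuous_on_interior[of UNIV]) (auto intro!: continuous_intros)
    then have "((\<lambda>y. dil (1 / r) (gmul (- x) y)) \<longlongrightarrow> 0) (at x)" by (simp add: isCont_def)
    then have "\<forall>\<^sub>F y in at x. dil (1 / r) (gmul (- x) y) \<in> ball 0 1"
      by (rule topological_tendstoD) auto
    then show "\<forall>\<^sub>F y in at x. dist (f y) (f x) < e"
    proof eventually_elim
      case (elim y)
      let ?p = "dil (1 / r) (gmul (- x) y)"
      have y: "gmul x (dil r ?p) = y" using r by (simp add: dil_inverse grp.assoc[symmetric])
      have "\<bar>f y - f x - r * (?G \<bullet> ?p)\<bar> \<le> r" using r0(2)[OF r, of ?p] elim y by simp
      moreover have "\<bar>r * (?G \<bullet> ?p)\<bar> \<le> r * norm ?G"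
      proof -
        have "\<bar>?G \<bullet> ?p\<bar> \<le> norm ?G * norm ?p" by (rule Cauchy_Schwarz_ineq2)
        also have "\<dots> \<le> norm ?G * 1" using elim by (intro mult_left_mono) auto
        finally show ?thesis using r by (simp add: abs_mult)
      qed
      ultimately have "\<bar>f y - f x\<bar> \<le> r + r * norm ?G" by linarith
      also have "\<dots> \<le> r * M" using r by (simp add: M_def algebra_simps)
      finally show ?case using re by (simp add: dist_real_def)
    qed
  qed
qed

text \<open>Linearity in v has to be proved, since the derivatives along different fields are
  unrelated by definition. It is read off from the expansion, whose paths use only basis fields. A
  limit from the right suffices, matching the positive dilations.\<close>

lemma hderiv_eq_gradient:
  assumes f: "f \<in> C1h gmul (V 1) \<Omega>" and \<Omega>: "open \<Omega>" "x \<in> \<Omega>" and v: "v \<in> V 1"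
  shows "hderiv v f x = horizontal_gradient gmul (V 1) f x \<bullet> v"
proof -
  let ?G = "horizontal_gradient gmul (V 1) f x"
  have "((\<lambda>t. (f (gmul x (t *\<^sub>R v)) - f x) / t) \<longlongrightarrow> hderiv v f x) (at_right 0)"
    using C1h_tendsto[OF f v \<Omega>(2)] by (rule filterlim_mono) (auto simp: at_le)
  moreover have "((\<lambda>t. (f (gmul x (t *\<^sub>R v)) - f x) / t) \<longlongrightarrow> ?G \<bullet> v) (at_right 0)"
    unfolding tendsto_iff
  proof (intro allI impI)
    fix e :: real assume e: "0 < e"
    obtain r0 where r0: "0 < r0" "\<And>r p. 0 < r \<Longrightarrow> r < r0 \<Longrightarrow> p \<in> {v} \<Longrightarrow>
      \<bar>f (gmul x (dil r p)) - f x - r * (?G \<bullet> p)\<bar> \<le> (e / 2) * r"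
      using horizontal_expansion[OF f \<Omega>, of "{v}" "e / 2"] e by (metis bounded_insert bounded_empty half_gt_zero)
    have "dist ((f (gmul x (r *\<^sub>R v)) - f x) / r) (?G \<bullet> v) < e" if r: "0 < r" "r < r0" for r
    proof -
      have "\<bar>f (gmul x (r *\<^sub>R v)) - f x - r * (?G \<bullet> v)\<bar> \<le> (e / 2) * r"
        using r0(2)[OF r, of v] v by (simp add: dil_layer[of v 1])
      moreover have "(f (gmul x (r *\<^sub>R v)) - f x) / r - ?G \<bullet> v = (f (gmul x (r *\<^sub>R v)) - f x - r * (?G \<bullet> v)) / r"
        using r by (simp add: field_simps)
      ultimately have "\<bar>(f (gmul x (r *\<^sub>R v)) - f x) / r - ?G \<bullet> v\<bar> \<le> e / 2"
        using r by (simp add: pos_divide_le_eq)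
      then show ?thesis using e by (simp add: dist_real_def)
    qed
    then show "\<forall>\<^sub>F t in at_right 0. dist ((f (gmul x (t *\<^sub>R v)) - f x) / t) (?G \<bullet> v) < e"
      using r0(1) by (auto simp: eventually_at_right_field intro!: exI[of _ r0])
  qed
  ultimately show ?thesis by (rule tendsto_unique[rotated]) simp
qed

lemma continuous_on_horizontal_gradient:
  assumes "f \<in> C1h gmul (V 1) \<Omega>"
  shows "continuous_on \<Omega> (horizontal_gradient gmul (V 1) f)"
  unfolding horizontal_gradient_def
  by (intro continuous_intros C1h_continuous[OF assms]) auto

text \<open>The first layer part of a left invariant field is constant. This gives the definite
  descriptions in \<open>horizontal_norm\<close> and \<open>horizontal_differential\<close> their
  meaning.\<close>

lemma left_field_layer_1_inj:
  assumes "v \<in> V 1" "w \<in> V 1" "left_field gmul v x = left_field gmul w x"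
  shows "v = w"
proof (rule euclidean_eqI)
  fix b :: 'a assume b: "b \<in> Basis"
  show "v \<bullet> b = w \<bullet> b"
  proof (cases "deg b = 1")
    case True
    then have "b \<in> V 1" using b Basis_layer_1 by blast
    then show ?thesis using left_field_inner_layer_1[of b v x] left_field_inner_layer_1[of b w x] assms(3) by simp
  qed (use layer_inner[of _ 1 b] assms b in auto)
qed

lemma regular_gradient_nonzero:
  assumes "regular_hypersurface gmul (V 1) \<Omega> f S" "x \<in> \<Omega>"
  shows "horizontal_gradient gmul (V 1) f x \<noteq> 0"
proof -
  have \<Omega>: "open \<Omega>" "f \<in> C1h gmul (V 1) \<Omega>" using assms by (auto simp: regular_hypersurface_def)
  obtain w where w: "w \<in> horizontal_fiber gmul (V 1) x" "horizontal_differential gmul (V 1) f x w \<noteq> 0"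
    using assms unfolding regular_hypersurface_def by blast
  obtain v where v: "v \<in> V 1" "w = left_field gmul v x" using w(1) unfolding horizontal_fiber_def fields_eq by blast
  have "(THE X. X \<in> fields gmul (V 1) \<and> X x = w) = left_field gmul v"
    unfolding fields_eq using v left_field_layer_1_inj by (intro the_equality) auto
  then have "hderiv v f x \<noteq> 0" using w(2) by (simp add: horizontal_differential_def)
  then show ?thesis using hderiv_eq_gradient[OF \<Omega>(2,1) assms(2) v(1)] by auto
qed

lemma horizontal_normal:
  assumes "horizontal_gradient gmul (V 1) f x \<noteq> 0"
  shows "norm (horizontal_normal gmul (V 1) f x) = 1" "horizontal_normal gmul (V 1) f x \<in> V 1"
    "horizontal_gradient gmul (V 1) f x = norm (horizontal_gradient gmul (V 1) f x) *\<^sub>R horizontal_normal gmul (V 1) f x"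
  using assms horizontal_gradient_layer by (auto simp: horizontal_normal_def intro!: subspace_scale layer_subspace)

end

section \<open>A continuously differentiable step from 0 to 1, and auxiliary calculus\<close>

definition smooth_step :: "real \<Rightarrow> real" where
  "smooth_step u = (max 0 u)\<^sup>2 / ((max 0 u)\<^sup>2 + (max 0 (1 - u))\<^sup>2)"

definition smooth_step' :: "real \<Rightarrow> real" where
  "smooth_step' u = 2 * (max 0 u * (max 0 (1 - u))\<^sup>2 + (max 0 u)\<^sup>2 * max 0 (1 - u)) /
     ((max 0 u)\<^sup>2 + (max 0 (1 - u))\<^sup>2)\<^sup>2"

lemma smooth_step_denominator: "(max 0 u)\<^sup>2 + (max 0 (1 - u))\<^sup>2 \<noteq> (0::real)"
  by (cases "0 < u") (auto simp: max_def sum_power2_eq_zero_iff)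

lemma smooth_step_derivative: "(smooth_step has_real_derivative smooth_step' u) (at u)"
proof -
  let ?d = "(max 0 u)\<^sup>2 + (max 0 (1 - u))\<^sup>2"
  have a: "((\<lambda>u. (max 0 u)\<^sup>2) has_real_derivative 2 * max 0 u) (at u)" by (rule has_derivative_max_square)
  have b: "((\<lambda>u. (max 0 (1 - u))\<^sup>2) has_real_derivative 2 * max 0 (1 - u) * (0 - 1)) (at u)"
    by (rule DERIV_chain2[OF has_derivative_max_square DERIV_diff[OF DERIV_const DERIV_ident]])
  have "(smooth_step has_real_derivative ((2 * max 0 u) * ?d - (max 0 u)\<^sup>2 * (2 * max 0 u + 2 * max 0 (1 - u) * (0 - 1))) / (?d * ?d)) (at u)"
    unfolding smooth_step_def[abs_def] by (rule DERIV_divide[OF a DERIV_add[OF a b] smooth_step_denominator])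
  moreover have "((2 * max 0 u) * ?d - (max 0 u)\<^sup>2 * (2 * max 0 u + 2 * max 0 (1 - u) * (0 - 1))) / (?d * ?d) = smooth_step' u"
    unfolding smooth_step'_def power2_eq_square[of ?d] by (rule arg_cong[where f="\<lambda>z. z / (?d * ?d)"]) (simp add: power2_eq_square algebra_simps)
  ultimately show ?thesis by simp
qed

lemma smooth_step_simps:
  "u \<le> 0 \<Longrightarrow> smooth_step u = 0" "1 \<le> u \<Longrightarrow> smooth_step u = 1"
  "u \<le> 0 \<Longrightarrow> smooth_step' u = 0" "1 \<le> u \<Longrightarrow> smooth_step' u = 0"
  by (auto simp: smooth_step_def smooth_step'_def max_def)

lemma smooth_step_bounds: "0 \<le> smooth_step u" "smooth_step u \<le> 1" "0 \<le> smooth_step' u"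
proof -
  show "0 \<le> smooth_step u" by (simp add: smooth_step_def)
  have "0 < (max 0 u)\<^sup>2 + (max 0 (1 - u))\<^sup>2"
    using smooth_step_denominator[of u] by (metis add_nonneg_nonneg less_eq_real_def zero_le_power2)
  then show "smooth_step u \<le> 1" by (simp add: smooth_step_def divide_le_eq_1)
  show "0 \<le> smooth_step' u" by (simp add: smooth_step'_def)
qed

lemma continuous_smooth_step: "continuous_on UNIV smooth_step" "continuous_on UNIV smooth_step'"
proof -
  show "continuous_on UNIV smooth_step"
    using smooth_step_derivative by (intro continuous_at_imp_continuous_on ballI) (blast intro: DERIV_isCont)
  show "continuous_on UNIV smooth_step'"
    unfolding smooth_step'_def using smooth_step_denominator by (intro continuous_intros) auto
qed

lemma C1_real_polynomial_compose:
  fixes P :: "'a::euclidean_space \<Rightarrow> 'a"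
  assumes \<phi>: "C1_real \<phi>" and P: "polynomial_function P"
  shows "C1_real (\<lambda>x. \<phi> (P x))"
proof -
  obtain D where D: "\<And>x. (\<phi> has_derivative (\<lambda>h. D x \<bullet> h)) (at x)" "continuous_on UNIV D"
    using C1_realE[OF \<phi>] by metis
  obtain E where E: "\<And>x. (P has_derivative E x) (at x)" "\<And>h. polynomial_function (\<lambda>x. E x h)"
    using polynomial_function_derivative[OF P] by metis
  let ?G = "\<lambda>x. \<Sum>b\<in>Basis. (D (P x) \<bullet> E x b) *\<^sub>R b"
  have G: "?G x \<bullet> h = D (P x) \<bullet> E x h" for x h
  proof -
    have lin: "linear (E x)" using E(1) has_derivative_linear by blast
    have "D (P x) \<bullet> E x h = D (P x) \<bullet> E x (\<Sum>b\<in>Basis. (h \<bullet> b) *\<^sub>R b)" by (simp add: euclidean_representation)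
    also have "\<dots> = ?G x \<bullet> h"
      by (simp add: linear_sum[OF lin] linear_scale[OF lin] inner_sum_right inner_sum_left inner_commute[of h] mult.commute)
    finally show ?thesis ..
  qed
  show ?thesis
  proof (rule C1_realI[where D="?G"])
    show "((\<lambda>x. \<phi> (P x)) has_derivative (\<lambda>h. ?G x \<bullet> h)) (at x)" for x
      unfolding G using diff_chain_at[OF E(1)[of x] D(1)[of "P x"]] by (simp add: o_def)
    have "continuous_on UNIV (\<lambda>x. D (P x))"
      using continuous_on_compose2[OF D(2) continuous_on_polymonial_function[OF P, of UNIV]] by simp
    then show "continuous_on UNIV ?G"
      using continuous_on_polymonial_function[OF E(2), of UNIV] by (intro continuous_intros) auto
  qed
qed

lemma divergence_sum:
  fixes X :: "'i \<Rightarrow> 'a::euclidean_space \<Rightarrow> 'a"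
  assumes "finite I" "\<And>i. i \<in> I \<Longrightarrow> X i differentiable (at p)"
  shows "divergence (\<lambda>q. \<Sum>i\<in>I. X i q) p = (\<Sum>i\<in>I. divergence (X i) p)"
proof -
  have "((\<lambda>q. \<Sum>i\<in>I. X i q) has_derivative (\<lambda>h. \<Sum>i\<in>I. frechet_derivative (X i) (at p) h)) (at p)"
    using assms by (intro has_derivative_sum) (simp add: frechet_derivative_works)
  then have "frechet_derivative (\<lambda>q. \<Sum>i\<in>I. X i q) (at p) = (\<lambda>h. \<Sum>i\<in>I. frechet_derivative (X i) (at p) h)"
    using frechet_derivative_at by metis
  then show ?thesis unfolding divergence_def by (simp add: inner_sum_left sum.swap[of _ I])
qed

lemma integrable_compact_support:
  fixes F :: "'a::euclidean_space \<Rightarrow> real"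
  assumes "compact K" "continuous_on UNIV F" "\<And>p. p \<notin> K \<Longrightarrow> F p = 0"
  shows "integrable lborel F"
proof -
  have "integrable lborel (\<lambda>x. indicator K x *\<^sub>R F x)"
    using assms by (intro borel_integrable_compact) (auto intro: continuous_on_subset)
  also have "(\<lambda>x. indicator K x *\<^sub>R F x) = F" using assms(3) by (auto split: split_indicator)
  finally show ?thesis .
qed

context stratified_group
begin

subsection \<open>Integration by parts along horizontal fields\<close>

lemma C1_real_hderiv:
  assumes D: "\<And>x. (\<phi> has_derivative (\<lambda>h. D x \<bullet> h)) (at x)"
  shows "((\<lambda>t. \<phi> (gmul p (t *\<^sub>R v))) has_real_derivative D (gmul p (t *\<^sub>R v)) \<bullet> left_field gmul v (gmul p (t *\<^sub>R v))) (at t)"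
    and "hderiv v \<phi> p = D p \<bullet> left_field gmul v p"
proof -
  show d: "((\<lambda>t. \<phi> (gmul p (t *\<^sub>R v))) has_real_derivative D (gmul p (t *\<^sub>R v)) \<bullet> left_field gmul v (gmul p (t *\<^sub>R v))) (at t)" for t
    using diff_chain_at[OF gmul_curve_derivative[of p v t, unfolded has_vector_derivative_def] D]
    by (simp add: o_def has_field_derivative_def mult_commute_abs)
  have "((\<lambda>t. (\<phi> (flow (left_field gmul v) t p) - \<phi> p) / t) \<longlongrightarrow> D p \<bullet> left_field gmul v p) (at 0)"
    using d[of 0] unfolding DERIV_def by (simp add: flow_left_field)
  then show "hderiv v \<phi> p = D p \<bullet> left_field gmul v p" unfolding deriv_along_def by (intro tendsto_Lim) auto
qed

lemma continuous_left_field: "continuous_on S (left_field gmul v)"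
  by (rule continuous_on_polymonial_function[OF polynomial_left_field])

lemma C1_real_C1h:
  assumes "C1_real \<phi>"
  shows "\<phi> \<in> C1h gmul (V 1) UNIV"
    and "((\<lambda>t. \<phi> (gmul p (t *\<^sub>R v))) has_real_derivative hderiv v \<phi> (gmul p (t *\<^sub>R v))) (at t)"
    and "continuous_on UNIV (hderiv v \<phi>)"
proof -
  obtain D where D: "\<And>x. (\<phi> has_derivative (\<lambda>h. D x \<bullet> h)) (at x)" "continuous_on UNIV D"
    using C1_realE[OF assms] by metis
  note h = C1_real_hderiv[OF D(1)]
  show c: "continuous_on UNIV (hderiv v \<phi>)" for v
    unfolding h(2)[abs_def] using D(2) by (intro continuous_intros continuous_left_field)
  show d: "((\<lambda>t. \<phi> (gmul p (t *\<^sub>R v))) has_real_derivative hderiv v \<phi> (gmul p (t *\<^sub>R v))) (at t)" for p v t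
    unfolding h(2) by (rule h(1))
  show "\<phi> \<in> C1h gmul (V 1) UNIV"
    unfolding C1h_def fields_eq
  proof (intro CollectI ballI conjI)
    fix X x assume "X \<in> left_field gmul ` V 1"
    then obtain v where v: "X = left_field gmul v" by blast
    show "\<exists>l. ((\<lambda>t. (\<phi> (flow X t x) - \<phi> x) / t) \<longlongrightarrow> l) (at 0)"
      using d[of x v 0] unfolding DERIV_def v by (auto simp: flow_left_field)
    show "continuous_on UNIV (deriv_along X \<phi>)" unfolding v by (rule c)
  qed
qed

lemma DERIV_outside_support:
  assumes K: "closed K" "\<And>p. p \<notin> K \<Longrightarrow> \<phi> p = 0" and p: "gmul p (t *\<^sub>R v) \<notin> K"
  shows "((\<lambda>t. \<phi> (gmul p (t *\<^sub>R v))) has_real_derivative 0) (at t)"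
proof -
  have "open ((\<lambda>t. gmul p (t *\<^sub>R v)) -` (- K))"
    using K(1) by (intro open_vimage continuous_intros) auto
  then have ev: "\<forall>\<^sub>F t in nhds t. gmul p (t *\<^sub>R v) \<in> - K"
    unfolding eventually_nhds using p by (intro exI[of _ "(\<lambda>t. gmul p (t *\<^sub>R v)) -` (- K)"]) auto
  show ?thesis
    by (subst DERIV_cong_ev[OF refl _ refl, of _ "\<lambda>t. 0"])
       (use ev K(2) in \<open>auto elim!: eventually_mono\<close>)
qed

lemma hderiv_outside_support:
  assumes \<phi>: "C1_real \<phi>" and K: "closed K" "\<And>p. p \<notin> K \<Longrightarrow> \<phi> p = 0" and p: "p \<notin> K"
  shows "hderiv v \<phi> p = 0"
proof -
  have "((\<lambda>t. \<phi> (gmul p (t *\<^sub>R v))) has_real_derivative hderiv v \<phi> p) (at 0)"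
    using C1_real_C1h(2)[OF \<phi>, of p v 0] by simp
  moreover have "((\<lambda>t. \<phi> (gmul p (t *\<^sub>R v))) has_real_derivative 0) (at 0)"
    using K p by (intro DERIV_outside_support[where K=K]) auto
  ultimately show ?thesis by (rule DERIV_unique)
qed

text \<open>The product rule has one surviving term, because the left invariant field is divergence
  free.\<close>

lemma divergence_scaled_field:
  assumes "C1_real \<phi>"
  shows "(\<lambda>q. \<phi> q *\<^sub>R left_field gmul v q) differentiable (at p)"
    and "divergence (\<lambda>q. \<phi> q *\<^sub>R left_field gmul v q) p = hderiv v \<phi> p"
proof -
  obtain D where D: "\<And>x. (\<phi> has_derivative (\<lambda>h. D x \<bullet> h)) (at x)"
    using C1_realE[OF assms] by metis
  obtain E where E: "\<And>x. (left_field gmul v has_derivative E x) (at x)"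
    using polynomial_function_derivative[OF polynomial_left_field] by metis
  have d: "((\<lambda>q. \<phi> q *\<^sub>R left_field gmul v q) has_derivative
      (\<lambda>h. \<phi> p *\<^sub>R E p h + (D p \<bullet> h) *\<^sub>R left_field gmul v p)) (at p)"
    by (rule has_derivative_scaleR[OF D E])
  then show "(\<lambda>q. \<phi> q *\<^sub>R left_field gmul v q) differentiable (at p)" by (rule differentiableI)
  have "divergence (\<lambda>q. \<phi> q *\<^sub>R left_field gmul v q) p =
      (\<Sum>b\<in>Basis. \<phi> p * (E p b \<bullet> b) + (D p \<bullet> b) * (left_field gmul v p \<bullet> b))"
    unfolding divergence_def frechet_derivative_at[OF d, symmetric] by (simp add: inner_add_left)
  also have "\<dots> = (\<Sum>b\<in>Basis. (D p \<bullet> b) * (left_field gmul v p \<bullet> b))"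
    using left_field_diagonal_derivative[OF _ E] by simp
  also have "\<dots> = hderiv v \<phi> p"
    unfolding C1_real_hderiv(2)[OF D] by (rule euclidean_inner[symmetric])
  finally show "divergence (\<lambda>q. \<phi> q *\<^sub>R left_field gmul v q) p = hderiv v \<phi> p" .
qed

lemma integral_along_line_bounds:
  fixes g G :: "real \<Rightarrow> real"
  assumes T: "0 \<le> T" and d: "\<And>t. (G has_real_derivative g t) (at t)" and c: "continuous_on UNIV g"
    and z: "\<And>t. T \<le> \<bar>t\<bar> \<Longrightarrow> G t = 0" "\<And>t. T < \<bar>t\<bar> \<Longrightarrow> g t = 0"
  shows "(LINT t|lborel. g t) = 0" and "(LINT t|lborel. indicator {..<0} t * g t) = G 0"
proof -
  have "(LINT t|lborel. g t * indicator {- T..T} t) = G T - G (- T)"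
    using T d c by (intro integral_FTC_Icc_real) (auto simp: continuous_on_eq_continuous_at)
  moreover have "g t * indicator {- T..T} t = g t" for t
    using z(2)[of t] by (cases "\<bar>t\<bar> \<le> T") (auto simp: indicator_def abs_le_iff)
  ultimately show "(LINT t|lborel. g t) = 0" using z(1)[of T] z(1)[of "- T"] T by simp
  have "(LINT t|lborel. g t * indicator {- T..0} t) = G 0 - G (- T)"
    using T d c by (intro integral_FTC_Icc_real) (auto simp: continuous_on_eq_continuous_at)
  \<comment> \<open>The two integrands differ at most at t = 0, as g vanishes below - T.\<close>
  moreover have "(LINT t|lborel. indicator {..<0} t * g t) = (LINT t|lborel. g t * indicator {- T..0} t)"
  proof (rule integral_cong_AE)
    have "AE t in lborel. t \<noteq> (0::real)" by (rule AE_lborel_singleton)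
    then show "AE t in lborel. indicator {..<0} t * g t = g t * indicator {- T..0} t"
    proof eventually_elim
      case (elim t)
      show ?case using z(2)[of t] elim by (auto simp: indicator_def)
    qed
    show "(\<lambda>t. indicator {..<0} t * g t) \<in> borel_measurable lborel" "(\<lambda>t. g t * indicator {- T..0} t) \<in> borel_measurable lborel"
      using borel_measurable_continuous_onI[OF c] by measurable
  qed
  ultimately show "(LINT t|lborel. indicator {..<0} t * g t) = G 0" using z(1)[of "- T"] T by simp
qed

text \<open>The second part is the Gauss-Green formula on a half space: starting on the hyperplane,
  each integral curve of the field of v is in the half space exactly for t < 0. Differentiability is
  assumed along these curves only, which admits functions built from \<open>f\<close>.\<close>

lemma integral_horizontal_derivative:
  assumes K: "compact K" and v: "norm v = 1" "v \<in> V 1" and G': "continuous_on UNIV G'"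
    and z: "\<And>p. p \<notin> K \<Longrightarrow> G p = 0" "\<And>p. p \<notin> K \<Longrightarrow> G' p = 0"
    and d: "\<And>p t. ((\<lambda>t. G (gmul p (t *\<^sub>R v))) has_real_derivative G' (gmul p (t *\<^sub>R v))) (at t)"
  shows "(LINT p|lborel. G' p) = 0"
    and "(LINT p|lborel. indicator {p. p \<bullet> v < 0} p * G' p) = (LINT n|hyperplane_measure v. G n)"
proof -
  have v1: "v \<bullet> v = 1" using v by (simp add: norm_eq_1)
  obtain R where R: "0 < R" "\<And>p. p \<in> K \<Longrightarrow> norm p \<le> R"
    using compact_imp_bounded[OF K] by (auto simp: bounded_pos)
  have inner: "gmul n (t *\<^sub>R v) \<bullet> v = n \<bullet> v + t" for n t
    using v(2) v1 by (simp add: gmul_inner_layer_1)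
  \<comment> \<open>The component along v grows at unit speed on the curve, which forces the curve
    out of the bounded set \<open>K\<close>.\<close>
  have out: "gmul n (t *\<^sub>R v) \<notin> K" if "R + \<bar>n \<bullet> v\<bar> + 1 \<le> \<bar>t\<bar>" for n t
  proof
    assume "gmul n (t *\<^sub>R v) \<in> K"
    then have "\<bar>gmul n (t *\<^sub>R v) \<bullet> v\<bar> \<le> R * 1"
      using Cauchy_Schwarz_ineq2[of "gmul n (t *\<^sub>R v)" v] R(2)[of "gmul n (t *\<^sub>R v)"] v(1) by simp
    then show False using that unfolding inner by linarith
  qed
  have int: "integrable lborel G'" by (rule integrable_compact_support[OF K G' z(2)])
  have c: "continuous_on UNIV (\<lambda>t. G' (gmul n (t *\<^sub>R v)))" for n
    by (rule continuous_on_compose2[OF G']) (auto intro!: continuous_intros)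
  have line: "(LINT t|lborel. G' (gmul n (t *\<^sub>R v))) = 0"
    "(LINT t|lborel. indicator {..<0} t * G' (gmul n (t *\<^sub>R v))) = G n" for n
    using integral_along_line_bounds[of "R + \<bar>n \<bullet> v\<bar> + 1" "\<lambda>t. G (gmul n (t *\<^sub>R v))" "\<lambda>t. G' (gmul n (t *\<^sub>R v))", OF _ d c]
      z out R(1) by auto
  show "(LINT p|lborel. G' p) = 0"
    using integral_flow_coordinates[OF int v, of 0] line(1) by simp
  have "integrable lborel (\<lambda>p. indicator {p. p \<bullet> v < 0} p *\<^sub>R G' p)"
    using int by (intro integrable_mult_indicator) (auto intro!: borel_open open_Collect_less continuous_intros)
  then have "(LINT p|lborel. indicator {p. p \<bullet> v < 0} p * G' p) =
     (LINT n|hyperplane_measure v. LINT t|lborel. indicator {p. p \<bullet> v < 0} (gmul n (t *\<^sub>R v)) * G' (gmul n (t *\<^sub>R v)))"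
    using integral_flow_coordinates[OF _ v, of "\<lambda>p. indicator {p. p \<bullet> v < 0} p * G' p" 0] by simp
  also have "\<dots> = (LINT n|hyperplane_measure v. G n)"
  proof (rule integral_cong_AE)
    show "AE n in hyperplane_measure v. (LINT t|lborel. indicator {p. p \<bullet> v < 0} (gmul n (t *\<^sub>R v)) * G' (gmul n (t *\<^sub>R v))) = G n"
      using AE_hyperplane_measure[OF v(1)]
    proof eventually_elim
      case (elim n)
      have "indicator {p. p \<bullet> v < 0} (gmul n (t *\<^sub>R v)) = (indicator {..<0} t :: real)" for t
        using elim by (simp add: inner indicator_def)
      then show ?case using line(2) by simp
    qed
    have Gm: "G' \<in> borel_measurable borel" using G' by (rule borel_measurable_continuous_onI)
    then show "(\<lambda>n. LINT t|lborel. indicator {p. p \<bullet> v < 0} (gmul n (t *\<^sub>R v)) * G' (gmul n (t *\<^sub>R v))) \<in> borel_measurable (hyperplane_measure v)"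
      by measurable
    have "G = (\<lambda>n. LINT t|lborel. indicator {..<0} t * G' (gmul n (t *\<^sub>R v)))" using line(2) by auto
    moreover have "(\<lambda>n. LINT t|lborel. indicator {..<0} t * G' (gmul n (t *\<^sub>R v))) \<in> borel_measurable (hyperplane_measure v)"
      using Gm by measurable
    ultimately show "G \<in> borel_measurable (hyperplane_measure v)" by metis
  qed
  finally show "(LINT p|lborel. indicator {p. p \<bullet> v < 0} p * G' p) = (LINT n|hyperplane_measure v. G n)" .
qed

end

lemma ennreal_integral_le_nn_integral:
  fixes Z :: "'a \<Rightarrow> real"
  assumes "integrable M Z"
  shows "ennreal (LINT x|M. Z x) \<le> (\<integral>\<^sup>+x. ennreal (Z x) \<partial>M)"
proof -
  have i: "integrable M (\<lambda>x. max 0 (Z x))" using assms by auto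
  have "(LINT x|M. Z x) \<le> (LINT x|M. max 0 (Z x))"
    by (rule integral_mono[OF assms i]) simp
  then have "ennreal (LINT x|M. Z x) \<le> ennreal (LINT x|M. max 0 (Z x))" by (rule ennreal_leI)
  also have "\<dots> = (\<integral>\<^sup>+x. ennreal (max 0 (Z x)) \<partial>M)"
    by (rule nn_integral_eq_integral[OF i, symmetric]) simp
  also have "\<dots> = (\<integral>\<^sup>+x. ennreal (Z x) \<partial>M)" by (intro nn_integral_cong) (simp add: max_def ennreal_neg)
  finally show ?thesis .
qed

context stratified_group
begin

subsection \<open>Upper bound for the perimeter\<close>

abbreviation E1 :: "'a set" where "E1 \<equiv> {b\<in>Basis. deg b = 1}"

lemma layer_1_expand: "w \<in> V 1 \<Longrightarrow> w = (\<Sum>e\<in>E1. (w \<bullet> e) *\<^sub>R e)"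
proof -
  assume w: "w \<in> V 1"
  have "w = (\<Sum>b\<in>Basis. (w \<bullet> b) *\<^sub>R b)" by (simp add: euclidean_representation)
  also have "\<dots> = (\<Sum>e\<in>E1. (w \<bullet> e) *\<^sub>R e)"
    using layer_inner[OF w] by (intro sum.mono_neutral_right) auto
  finally show ?thesis .
qed

lemma E1_layer: "e \<in> E1 \<Longrightarrow> e \<in> V 1" using Basis_layer_1 by blast

text \<open>The coefficients in the left invariant frame coincide with the Euclidean components
  along first layer basis vectors, hence are continuously differentiable. The last clause expresses
  the norm bound on the field by Cauchy-Schwarz, ready to be applied to a gradient.\<close>

lemma C1c_horizontal_structure:
  assumes X: "X \<in> C1c_horizontal gmul (V 1) U" and n: "\<And>p. horizontal_norm gmul (V 1) p (X p) \<le> 1"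
  obtains K \<phi> where "compact K" "K \<subseteq> U" "\<And>e. C1_real (\<phi> e)" "\<And>e p. p \<notin> K \<Longrightarrow> \<phi> e p = 0"
    "\<And>p. divergence X p = (\<Sum>e\<in>E1. hderiv e (\<phi> e) p)"
    "\<And>p w. (\<Sum>e\<in>E1. \<phi> e p * (w \<bullet> e)) \<le> norm w"
proof -
  let ?\<phi> = "\<lambda>e p. X p \<bullet> e"
  have ex: "\<exists>w. w \<in> V 1 \<and> X p = left_field gmul w p" for p
    using X unfolding C1c_horizontal_def horizontal_fiber_def fields_eq by blast
  obtain W where W: "\<And>p. W p \<in> V 1" "\<And>p. X p = left_field gmul (W p) p"
    using ex by metis
  have We: "W p \<bullet> e = X p \<bullet> e" if "e \<in> E1" for p e
    using left_field_inner_layer_1[OF E1_layer[OF that], of "W p" p] W(2) by simp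
  have "horizontal_norm gmul (V 1) p (X p) = norm (W p)" for p
  proof -
    have "(THE v. v \<in> V 1 \<and> left_field gmul v p = X p) = W p"
      by (rule the_equality) (use W left_field_layer_1_inj in auto)
    then show ?thesis by (simp add: horizontal_norm_def)
  qed
  then have Wn: "norm (W p) \<le> 1" for p using n by metis
  have C1: "C1_real (?\<phi> e)" for e using X C1_map_inner unfolding C1c_horizontal_def by blast
  have "X = (\<lambda>p. \<Sum>e\<in>E1. ?\<phi> e p *\<^sub>R left_field gmul e p)"
  proof
    fix p
    have "X p = left_field gmul (\<Sum>e\<in>E1. (W p \<bullet> e) *\<^sub>R e) p"
      using W(2)[of p] layer_1_expand[OF W(1)[of p]] by simp
    also have "\<dots> = (\<Sum>e\<in>E1. (W p \<bullet> e) *\<^sub>R left_field gmul e p)"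
      by (simp only: linear_sum[OF left_field_linear] linear_scale[OF left_field_linear])
    also have "\<dots> = (\<Sum>e\<in>E1. ?\<phi> e p *\<^sub>R left_field gmul e p)"
      by (intro sum.cong refl) (simp only: We)
    finally show "X p = (\<Sum>e\<in>E1. ?\<phi> e p *\<^sub>R left_field gmul e p)" .
  qed
  then have "divergence X p = divergence (\<lambda>p. \<Sum>e\<in>E1. ?\<phi> e p *\<^sub>R left_field gmul e p) p" for p by simp
  then have div: "divergence X p = (\<Sum>e\<in>E1. hderiv e (?\<phi> e) p)" for p
    using divergence_sum[of E1 "\<lambda>e q. ?\<phi> e q *\<^sub>R left_field gmul e q" p] divergence_scaled_field[OF C1] by simp
  show thesis
  proof (rule that[of "closure {x. X x \<noteq> 0}" ?\<phi>])
    show "compact (closure {x. X x \<noteq> 0})" "closure {x. X x \<noteq> 0} \<subseteq> U"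
      using X by (auto simp: C1c_horizontal_def)
    show "?\<phi> e p = 0" if "p \<notin> closure {x. X x \<noteq> 0}" for e p
    proof -
      have "X p = 0" using that closure_subset[of "{x. X x \<noteq> 0}"] by blast
      then show ?thesis by simp
    qed
    fix p w
    have "(\<Sum>e\<in>E1. ?\<phi> e p * (w \<bullet> e)) = (\<Sum>e\<in>E1. (W p \<bullet> e) * (w \<bullet> e))"
      by (intro sum.cong refl) (simp only: We)
    also have "\<dots> = (\<Sum>e\<in>E1. (W p \<bullet> e) *\<^sub>R e) \<bullet> w"
      by (simp add: inner_sum_left inner_commute[of w])
    also have "\<dots> = W p \<bullet> w" using layer_1_expand[OF W(1)[of p]] by simp
    also have "\<dots> \<le> norm (W p) * norm w" by (rule norm_cauchy_schwarz)
    also have "\<dots> \<le> 1 * norm w" using Wn[of p] by (intro mult_right_mono) auto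
    finally show "(\<Sum>e\<in>E1. ?\<phi> e p * (w \<bullet> e)) \<le> norm w" by simp
  qed (use C1 div in auto)
qed

text \<open>Replacing the indicator function of \<open>{f < 0}\<close> by a smooth monotone function of \<open>f\<close>, the derivative
  of this function along each line \<open>t \<mapsto> x n (t \<nu>)\<close> integrates to at most \<open>1\<close>.\<close>

theorem perimeter_le:
  assumes f: "f \<in> C1h gmul (V 1) \<Omega>" and \<Omega>: "open \<Omega>" and U: "open U" "U \<subseteq> \<Omega>"
    and \<nu>: "norm \<nu> = 1" "\<nu> \<in> V 1" and A[measurable]: "A \<in> sets borel"
    and pos: "0 < m" "0 \<le> M" "0 < \<epsilon>0" "0 \<le> T"
    and grad: "\<And>p. p \<in> U \<Longrightarrow> norm (horizontal_gradient gmul (V 1) f p) \<le> M"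
    and loc: "\<And>n t. n \<bullet> \<nu> = 0 \<Longrightarrow> gmul x (gmul n (t *\<^sub>R \<nu>)) \<in> U \<Longrightarrow>
      - \<epsilon>0 \<le> f (gmul x (gmul n (t *\<^sub>R \<nu>))) \<Longrightarrow> f (gmul x (gmul n (t *\<^sub>R \<nu>))) \<le> 0 \<Longrightarrow> n \<in> A \<and> \<bar>t\<bar> \<le> T"
    and mono: "\<And>n t. n \<in> A \<Longrightarrow> n \<bullet> \<nu> = 0 \<Longrightarrow> \<bar>t\<bar> \<le> T \<Longrightarrow>
      gmul x (gmul n (t *\<^sub>R \<nu>)) \<in> \<Omega> \<and> m \<le> hderiv \<nu> f (gmul x (gmul n (t *\<^sub>R \<nu>)))"
  shows "perimeter gmul (V 1) {p \<in> \<Omega>. f p < 0} U \<le> ennreal (M / m) * emeasure (hyperplane_measure \<nu>) A"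
  unfolding perimeter_def
proof (rule SUP_least)
  fix X assume "X \<in> {X \<in> C1c_horizontal gmul (V 1) U. \<forall>x. horizontal_norm gmul (V 1) x (X x) \<le> 1}"
  then have X: "X \<in> C1c_horizontal gmul (V 1) U" "\<And>p. horizontal_norm gmul (V 1) p (X p) \<le> 1" by auto
  obtain K \<phi> where K: "compact K" "K \<subseteq> U" "\<And>e. C1_real (\<phi> e)" "\<And>e p. p \<notin> K \<Longrightarrow> \<phi> e p = 0"
    "\<And>p. divergence X p = (\<Sum>e\<in>E1. hderiv e (\<phi> e) p)" "\<And>p w. (\<Sum>e\<in>E1. \<phi> e p * (w \<bullet> e)) \<le> norm w"
    by (fact C1c_horizontal_structure[OF X])
  have Kc: "closed K" using K(1) compact_imp_closed by blast
  have cov: "\<Omega> \<union> - K = UNIV" using K(2) U(2) by blast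
  have h0: "hderiv e (\<phi> e) p = 0" if "p \<notin> K" for e p
    using hderiv_outside_support[OF K(3) Kc K(4) that] by blast
  have fc: "continuous_on \<Omega> f" by (rule C1h_continuous_on[OF f \<Omega>])
  let ?B = "ennreal (M / m) * emeasure (hyperplane_measure \<nu>) A"
  \<comment> \<open>\<open>h k\<close> is 1 where f \<le> -1/k and 0 where f \<ge> 0, so it
    increases to the indicator of f < 0. \<open>h'\<close> is minus its derivative with respect to
    the value of \<open>f\<close>, hence nonnegative.\<close>
  define h where "h k p = smooth_step (- (real k * f p))" for k p
  define h' where "h' k p = real k * smooth_step' (- (real k * f p))" for k p
  have hc: "continuous_on \<Omega> (h k)" "continuous_on \<Omega> (h' k)" for k
    unfolding h_def h'_def
    by (intro continuous_on_compose2[OF continuous_smooth_step(1)] continuous_intros fc subset_UNIV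
        continuous_on_compose2[OF continuous_smooth_step(2)])+
  \<comment> \<open>The values of \<open>f\<close> outside \<Omega> are arbitrary; every product
    that is integrated contains a factor supported in \<open>K\<close>.\<close>
  have ext: "continuous_on UNIV F" if "continuous_on \<Omega> F" "\<And>p. p \<notin> K \<Longrightarrow> F p = 0" for F :: "'a \<Rightarrow> real"
  proof -
    have "continuous_on (- K) F" using that(2) by (subst continuous_on_cong[OF refl, of _ _ "\<lambda>p. 0"]) auto
    from continuous_on_open_Un[OF \<Omega> open_Compl[OF Kc] that(1) this] show ?thesis by (simp add: cov)
  qed
  have hd: "continuous_on \<Omega> (hderiv e (\<phi> e))" for e
    using C1_real_C1h(3)[OF K(3)] continuous_on_subset by blast
  have \<phi>c: "continuous_on \<Omega> (\<phi> e)" for e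
    using C1_real_continuous[OF K(3)] continuous_on_subset by blast
  have hf: "continuous_on \<Omega> (hderiv e f)" if "e \<in> E1" for e
    using C1h_continuous[OF f E1_layer[OF that]] .
  have int1: "integrable lborel (\<lambda>p. h k p * hderiv e (\<phi> e) p)" for k e
    by (rule integrable_compact_support[OF K(1) ext]) (auto intro!: continuous_intros hc hd simp: h0)
  have int2: "integrable lborel (\<lambda>p. h' k p * hderiv e f p * \<phi> e p)" if "e \<in> E1" for k e
    by (rule integrable_compact_support[OF K(1) ext]) (auto intro!: continuous_intros hc hf[OF that] \<phi>c simp: K(4))
  \<comment> \<open>The integral over the whole space of the derivative of \<open>h k\<close> times
    the coefficient vanishes, separately for each basis field.\<close>
  have parts: "(LINT p|lborel. h k p * hderiv e (\<phi> e) p) = (LINT p|lborel. h' k p * hderiv e f p * \<phi> e p)"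
    if e: "e \<in> E1" for k e
  proof -
    let ?G = "\<lambda>p. h k p * \<phi> e p"
    let ?G' = "\<lambda>p. h k p * hderiv e (\<phi> e) p - h' k p * hderiv e f p * \<phi> e p"
    have z: "?G p = 0" "?G' p = 0" if "p \<notin> K" for p using that by (simp_all add: K(4) h0)
    have d: "((\<lambda>t. ?G (gmul p (t *\<^sub>R e))) has_real_derivative ?G' (gmul p (t *\<^sub>R e))) (at t)" for p t
    proof (cases "gmul p (t *\<^sub>R e) \<in> \<Omega>")
      case True
      have "((\<lambda>t. - (real k * f (gmul p (t *\<^sub>R e)))) has_real_derivative - (real k * hderiv e f (gmul p (t *\<^sub>R e)))) (at t)"
        by (rule DERIV_minus[OF DERIV_cmult[OF C1h_DERIV[OF f E1_layer[OF e] True]]])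
      from DERIV_chain2[OF smooth_step_derivative this]
      have "((\<lambda>t. h k (gmul p (t *\<^sub>R e))) has_real_derivative
          smooth_step' (- (real k * f (gmul p (t *\<^sub>R e)))) * - (real k * hderiv e f (gmul p (t *\<^sub>R e)))) (at t)"
        unfolding h_def .
      from DERIV_mult[OF this C1_real_C1h(2)[OF K(3)]] show ?thesis
        by (rule DERIV_cong) (simp add: h'_def algebra_simps)
    next
      case False
      then have "gmul p (t *\<^sub>R e) \<notin> K" using cov by blast
      then show ?thesis using DERIV_outside_support[OF Kc, of ?G p t e] z by simp
    qed
    have "(LINT p|lborel. ?G' p) = 0"
    proof (rule integral_horizontal_derivative(1)[OF K(1) _ E1_layer[OF e] _ z d])
      show "continuous_on UNIV ?G'"
        by (rule ext) (auto intro!: continuous_intros hc hd hf[OF e] \<phi>c simp: h0 K(4))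
    qed (use e in auto)
    then show ?thesis using int1 int2[OF e] by simp
  qed
  let ?Z = "\<lambda>k p. \<Sum>e\<in>E1. h' k p * hderiv e f p * \<phi> e p"
  have intZ: "integrable lborel (?Z k)" for k using int2 by (intro Bochner_Integration.integrable_sum) auto
  have I: "(LINT p|lborel. h k p * divergence X p) = (LINT p|lborel. ?Z k p)" for k
  proof -
    have "(LINT p|lborel. h k p * divergence X p) = (LINT p|lborel. (\<Sum>e\<in>E1. h k p * hderiv e (\<phi> e) p))"
      by (simp add: K(5) sum_distrib_left)
    also have "\<dots> = (\<Sum>e\<in>E1. (LINT p|lborel. h k p * hderiv e (\<phi> e) p))"
      by (rule Bochner_Integration.integral_sum) (rule int1)
    also have "\<dots> = (\<Sum>e\<in>E1. (LINT p|lborel. h' k p * hderiv e f p * \<phi> e p))"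
      by (intro sum.cong refl parts)
    also have "\<dots> = (LINT p|lborel. ?Z k p)"
      by (rule Bochner_Integration.integral_sum[symmetric]) (rule int2)
    finally show ?thesis .
  qed
  define F where "F k p = ennreal (indicator U p *\<^sub>R (M * h' k p))" for k p
  have Fm[measurable]: "F k \<in> borel_measurable borel" for k
    unfolding F_def using U hc(2)
    by (intro measurable_compose[OF _ measurable_ennreal] borel_measurable_continuous_on_indicator continuous_intros)
       (auto intro: continuous_on_subset)
  have h'0: "0 \<le> h' k p" for k p using smooth_step_bounds(3) by (simp add: h'_def)
  \<comment> \<open>Cauchy-Schwarz for a field of norm at most 1 against a gradient of norm at most
    M on U.\<close>
  have ZF: "ennreal (?Z k p) \<le> F k p" for k p
  proof (cases "p \<in> K")
    case False then show ?thesis by (simp add: K(4))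
  next
    case True
    then have p: "p \<in> U" using K(2) by blast
    have "?Z k p = h' k p * (\<Sum>e\<in>E1. \<phi> e p * (horizontal_gradient gmul (V 1) f p \<bullet> e))"
      unfolding sum_distrib_left
    proof (intro sum.cong refl)
      fix e assume "e \<in> E1"
      then have "horizontal_gradient gmul (V 1) f p \<bullet> e = hderiv e f p" by (intro horizontal_gradient_inner_Basis) auto
      then show "h' k p * hderiv e f p * \<phi> e p = h' k p * (\<phi> e p * (horizontal_gradient gmul (V 1) f p \<bullet> e))"
        by (simp only: ac_simps)
    qed
    also have "\<dots> \<le> h' k p * M"
      using K(6)[of p "horizontal_gradient gmul (V 1) f p"] grad[OF p] h'0 by (intro mult_left_mono) auto
    finally show ?thesis using p by (simp add: F_def mult.commute ennreal_leI)
  qed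
  \<comment> \<open>On the curve \<open>f\<close> increases with speed at least m, so M
    \<open>h'\<close> is at most M / m times the derivative of - \<open>h k\<close>, whose total
    increase is at most 1. For k \<ge> 1 / \<epsilon>0 the support of \<open>h'\<close> lies where
    -\<epsilon>0 \<le> f \<le> 0, and \<open>loc\<close> confines the parameter to [-T, T].\<close>
  have line: "(\<integral>\<^sup>+t. F k (gmul x (gmul n (t *\<^sub>R \<nu>))) \<partial>lborel) \<le> ennreal (M / m) * indicator A n"
    if n: "n \<bullet> \<nu> = 0" and k: "1 / \<epsilon>0 \<le> real k" for n k
  proof -
    let ?p = "\<lambda>t. gmul x (gmul n (t *\<^sub>R \<nu>))"
    have k0: "0 < real k" using k pos(3) by (metis divide_pos_pos less_le_trans zero_less_one)
    have nz: "n \<in> A \<and> \<bar>t\<bar> \<le> T" if F: "F k (?p t) \<noteq> 0" for t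
    proof -
      have pU: "?p t \<in> U" using F by (rule contrapos_np) (simp add: F_def)
      have s: "smooth_step' (- (real k * f (?p t))) \<noteq> 0" using F by (rule contrapos_nn) (simp add: F_def h'_def)
      have "0 < - (real k * f (?p t))" "- (real k * f (?p t)) < 1"
        using s smooth_step_simps(3,4) by (meson not_less)+
      then have "real k * f (?p t) < 0" "- f (?p t) < 1 / real k"
        using k0 by (simp_all add: pos_less_divide_eq mult.commute)
      moreover from this(1) have f1: "f (?p t) \<le> 0" using k0 by (simp add: mult_less_0_iff)
      moreover have "1 / real k \<le> \<epsilon>0" using k k0 pos(3) by (simp add: field_simps)
      ultimately have "- \<epsilon>0 \<le> f (?p t)" by linarith
      then show ?thesis using loc[OF n pU] f1 by blast
    qed
    show ?thesis
    proof (cases "n \<in> A")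
      case False
      then have "F k (?p t) = 0" for t using nz by blast
      then show ?thesis by simp
    next
      case True
      have on: "?p t \<in> \<Omega>" "m \<le> hderiv \<nu> f (?p t)" if "t \<in> {-T..T}" for t
        using mono[OF True n, of t] that by auto
      let ?g = "\<lambda>t. h' k (?p t) * hderiv \<nu> f (?p t)"
      let ?q = "\<lambda>t. indicator {-T..T} t *\<^sub>R ?g t"
      have assoc: "?p t = gmul (gmul x n) (t *\<^sub>R \<nu>)" for t by (simp add: grp.assoc)
      have pc: "continuous_on {-T..T} ?p" by (intro continuous_intros)
      have gc: "continuous_on {-T..T} ?g"
        using on(1) by (intro continuous_intros continuous_on_compose2[OF hc(2) pc] continuous_on_compose2[OF C1h_continuous[OF f \<nu>(2)] pc]) auto
      have qm[measurable]: "?q \<in> borel_measurable borel"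
        using gc by (intro borel_measurable_continuous_on_indicator) auto
      have DH: "((\<lambda>t. - h k (?p t)) has_real_derivative ?q t) (at t)" if t: "t \<in> {-T..T}" for t
      proof -
        have "((\<lambda>t. - (real k * f (?p t))) has_real_derivative - (real k * hderiv \<nu> f (?p t))) (at t)"
          unfolding assoc using on(1)[OF t] unfolding assoc
          by (intro DERIV_minus DERIV_cmult C1h_DERIV[OF f \<nu>(2)])
        from DERIV_minus[OF DERIV_chain2[OF smooth_step_derivative this]]
        have "((\<lambda>t. - h k (?p t)) has_real_derivative
            - (smooth_step' (- (real k * f (?p t))) * - (real k * hderiv \<nu> f (?p t)))) (at t)"
          unfolding h_def .
        then show ?thesis by (rule DERIV_cong) (use t in \<open>simp add: h'_def\<close>)
      qed
      have q0: "0 \<le> ?q t" if "t \<in> {-T..T}" for t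
        using on(2)[OF that] h'0[of k "?p t"] pos(1) by (auto simp: indicator_def)
      have "(\<integral>\<^sup>+t. F k (?p t) \<partial>lborel) \<le> (\<integral>\<^sup>+t. ennreal (M / m) * (ennreal (?q t) * indicator {-T..T} t) \<partial>lborel)"
      proof (rule nn_integral_mono)
        fix t
        show "F k (?p t) \<le> ennreal (M / m) * (ennreal (?q t) * indicator {-T..T} t)"
        proof (cases "F k (?p t) = 0")
          case False
          then have t: "t \<in> {-T..T}" using nz[of t] by auto
          have "M * h' k (?p t) * 1 \<le> M * h' k (?p t) * (hderiv \<nu> f (?p t) / m)"
            using on(2)[OF t] pos h'0[of k "?p t"] by (intro mult_left_mono) auto
          then have "M * h' k (?p t) \<le> M / m * ?g t" by simp
          moreover have "F k (?p t) \<le> ennreal (M * h' k (?p t))" by (auto simp: F_def indicator_def)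
          ultimately have "F k (?p t) \<le> ennreal (M / m * ?g t)" by (meson ennreal_leI order_trans)
          also have "\<dots> = ennreal (M / m) * ennreal (?g t)"
            using pos q0[OF t] t by (intro ennreal_mult) auto
          finally show ?thesis using t by simp
        qed simp
      qed
      also have "\<dots> = ennreal (M / m) * (\<integral>\<^sup>+t. ennreal (?q t) * indicator {-T..T} t \<partial>lborel)"
        by (rule nn_integral_cmult) measurable
      also have "(\<integral>\<^sup>+t. ennreal (?q t) * indicator {-T..T} t \<partial>lborel) = ennreal (- h k (?p T) - - h k (?p (- T)))"
        using pos(4) DH q0 by (intro nn_integral_FTC_Icc) (auto simp del: real_scaleR_def)
      also have "\<dots> \<le> 1"
        using smooth_step_bounds(1)[of "- (real k * f (?p T))"] smooth_step_bounds(2)[of "- (real k * f (?p (- T)))"]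
        by (simp add: h_def)
      finally show ?thesis using True by (simp add: mult_left_mono)
    qed
  qed
  have bound: "ennreal (LINT p|lborel. h k p * divergence X p) \<le> ?B" if k: "1 / \<epsilon>0 \<le> real k" for k
  proof -
    have "ennreal (LINT p|lborel. h k p * divergence X p) \<le> (\<integral>\<^sup>+p. ennreal (?Z k p) \<partial>lborel)"
      unfolding I by (rule ennreal_integral_le_nn_integral[OF intZ])
    also have "\<dots> \<le> (\<integral>\<^sup>+p. F k p \<partial>lborel)" by (rule nn_integral_mono) (rule ZF)
    also have "\<dots> = (\<integral>\<^sup>+p. F k (gmul x p) \<partial>lborel)" by (rule nn_integral_left_translate[symmetric]) measurable
    also have "\<dots> = (\<integral>\<^sup>+n. (\<integral>\<^sup>+t. F k (gmul x (gmul n (t *\<^sub>R \<nu>))) \<partial>lborel) \<partial>hyperplane_measure \<nu>)"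
      by (rule nn_integral_flow_coordinates[OF _ \<nu>, symmetric]) measurable
    also have "\<dots> \<le> (\<integral>\<^sup>+n. ennreal (M / m) * indicator A n \<partial>hyperplane_measure \<nu>)"
    proof (rule nn_integral_mono_AE)
      show "AE n in hyperplane_measure \<nu>. (\<integral>\<^sup>+t. F k (gmul x (gmul n (t *\<^sub>R \<nu>))) \<partial>lborel) \<le> ennreal (M / m) * indicator A n"
        using AE_hyperplane_measure[OF \<nu>(1)] by eventually_elim (rule line[OF _ k])
    qed
    also have "\<dots> = ?B" by (simp add: nn_integral_cmult)
    finally show ?thesis .
  qed
  have divint: "integrable lborel (divergence X)"
    unfolding K(5)[abs_def]
    by (rule integrable_compact_support[OF K(1) ext]) (auto intro!: continuous_intros hd simp: h0)
  \<comment> \<open>At every point of \<Omega> the sequence \<open>h k\<close> is eventually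
    constant with the value of the indicator; off \<open>K\<close> the divergence is 0.\<close>
  have lim: "(\<lambda>k. LINT p|lborel. h k p * divergence X p) \<longlonglongrightarrow>
      (LINT p|lborel. indicator {p \<in> \<Omega>. f p < 0} p *\<^sub>R divergence X p)"
  proof (rule integral_dominated_convergence[where w="\<lambda>p. norm (divergence X p)"])
    have "open (\<Omega> \<inter> f -` {..<0})" by (rule continuous_open_preimage[OF fc \<Omega> open_lessThan])
    also have "\<Omega> \<inter> f -` {..<0} = {p \<in> \<Omega>. f p < 0}" by auto
    finally have "{p \<in> \<Omega>. f p < 0} \<in> sets lborel" by simp
    then show "(\<lambda>p. indicator {p \<in> \<Omega>. f p < 0} p *\<^sub>R divergence X p) \<in> borel_measurable lborel"
      using divint by (intro borel_measurable_scaleR borel_measurable_indicator) auto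
    show "(\<lambda>p. h k p * divergence X p) \<in> borel_measurable lborel" for k
    proof -
      have "integrable lborel (\<lambda>p. \<Sum>e\<in>E1. h k p * hderiv e (\<phi> e) p)"
        using int1 by (intro Bochner_Integration.integrable_sum) auto
      then show ?thesis by (simp add: K(5) sum_distrib_left borel_measurable_integrable)
    qed
    show "AE p in lborel. (\<lambda>k. h k p * divergence X p) \<longlonglongrightarrow> indicator {p \<in> \<Omega>. f p < 0} p *\<^sub>R divergence X p"
    proof (rule AE_I2)
      fix p
      show "(\<lambda>k. h k p * divergence X p) \<longlonglongrightarrow> indicator {p \<in> \<Omega>. f p < 0} p *\<^sub>R divergence X p"
      proof (cases "p \<in> K")
        case False then show ?thesis by (simp add: K(5) h0)
      next
        case True
        then have p: "p \<in> \<Omega>" using K(2) U(2) by blast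
        show ?thesis
        proof (cases "f p < 0")
          case True
          obtain N :: nat where N: "1 / (- f p) \<le> real N" using real_arch_simple by blast
          have "h k p = 1" if "N \<le> k" for k
          proof -
            have "1 / (- f p) \<le> real k" using N that by linarith
            then have "1 \<le> - (real k * f p)" using True by (simp add: pos_divide_le_eq neg_divide_le_eq field_simps)
            then show ?thesis by (simp add: h_def smooth_step_simps)
          qed
          then have "\<forall>\<^sub>F k in sequentially. h k p * divergence X p = indicator {p \<in> \<Omega>. f p < 0} p *\<^sub>R divergence X p"
            using True p by (intro eventually_sequentiallyI[of N]) auto
          then show ?thesis by (rule tendsto_eventually)
        next
          case False
          then have "h k p = 0" for k unfolding h_def by (intro smooth_step_simps) simp
          then show ?thesis using False by simp
        qed
      qed
    qed
    show "AE p in lborel. norm (h k p * divergence X p) \<le> norm (divergence X p)" for k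
      using smooth_step_bounds by (intro AE_I2) (auto simp: h_def abs_mult intro!: mult_left_le_one_le)
  qed (use divint in auto)
  have "ennreal (LINT p|lborel. indicator {p \<in> \<Omega>. f p < 0} p *\<^sub>R divergence X p) \<le> ?B"
  proof (rule tendsto_upperbound[OF tendsto_ennrealI[OF lim]])
    obtain N :: nat where "1 / \<epsilon>0 \<le> real N" using real_arch_simple by blast
    then show "\<forall>\<^sub>F k in sequentially. ennreal (LINT p|lborel. h k p * divergence X p) \<le> ?B"
      by (intro eventually_sequentiallyI[of N] bound) linarith
  qed simp
  then show "ennreal (set_lebesgue_integral lborel {p \<in> \<Omega>. f p < 0} (divergence X)) \<le> ?B"
    by (simp add: set_lebesgue_integral_def)
qed

subsection \<open>Blow-up of the perimeter\<close>

definition scaled :: "'a \<Rightarrow> real \<Rightarrow> 'a set \<Rightarrow> 'a set" where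
  "scaled x r S = (\<lambda>q. gmul x (dil r q)) ` S"

lemma unscale: "0 < r \<Longrightarrow> dil (1 / r) (gmul (- x) (gmul x (dil r q))) = q"
  by (simp add: grp.assoc[symmetric] dil_inverse)

lemma rescale: "0 < r \<Longrightarrow> gmul x (dil r (dil (1 / r) (gmul (- x) p))) = p"
  by (simp add: dil_inverse grp.assoc[symmetric])

lemma mem_scaled: "0 < r \<Longrightarrow> p \<in> scaled x r S \<longleftrightarrow> dil (1 / r) (gmul (- x) p) \<in> S"
  unfolding scaled_def using unscale[of r x] rescale[of r x p] by (auto simp: image_iff) (metis rescale)

lemma open_scaled:
  assumes "0 < r" "open S" shows "open (scaled x r S)"
proof -
  have "scaled x r S = (\<lambda>p. dil (1 / r) (gmul (- x) p)) -` S"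
    using mem_scaled[OF assms(1)] by auto
  then show ?thesis using assms(2) by (simp, intro open_vimage continuous_intros)
qed

lemma dil_gmul_line:
  assumes "\<nu> \<in> V 1" "0 < r"
  shows "gmul n (t *\<^sub>R \<nu>) = dil r (gmul (dil (1 / r) n) ((t / r) *\<^sub>R \<nu>))"
  using assms by (simp add: dil_gmul dil_inverse linear_scale[OF linear_dil] dil_layer[of \<nu> 1])

text \<open>This is \<open>perimeter_le\<close> with m = (1 - \<eta>) g and M = (1 + \<eta>) g,
  where g is the norm of the gradient at x. The expansion shows that f is small only where the flow
  parameter is at most 2 \<eta> r; after rescaling, \<open>A\<close> contains the points of
  \<open>B\<close> moved by at most 2 \<eta> along \<nu>, hence the relevant part of the
  hyperplane.\<close>

theorem perimeter_scaled_le: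
  assumes f: "f \<in> C1h gmul (V 1) \<Omega>" and \<Omega>: "open \<Omega>" "x \<in> \<Omega>" and fx: "f x = 0"
    and G: "horizontal_gradient gmul (V 1) f x \<noteq> 0" and \<nu>: "\<nu> = horizontal_normal gmul (V 1) f x"
    and B: "open B" "bounded B" and A: "A \<in> sets borel" "bounded A" and \<eta>: "0 < \<eta>" "\<eta> < 1"
    and BA: "\<And>q \<tau>. q \<in> B \<Longrightarrow> \<bar>\<tau>\<bar> \<le> 2 * \<eta> \<Longrightarrow> gmul q (\<tau> *\<^sub>R \<nu>) \<in> A"
  obtains r0 where "0 < r0" "\<And>r. 0 < r \<Longrightarrow> r < r0 \<Longrightarrow> scaled x r B \<subseteq> \<Omega>"
    "\<And>r. 0 < r \<Longrightarrow> r < r0 \<Longrightarrow> perimeter gmul (V 1) {p \<in> \<Omega>. f p < 0} (scaled x r B) \<le>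
      ennreal ((1 + \<eta>) / (1 - \<eta>)) * (ennreal (r ^ (hom_dim V \<iota> - 1)) * emeasure (hyperplane_measure \<nu>) A)"
proof -
  let ?G = "horizontal_gradient gmul (V 1) f"
  define g where "g = norm (?G x)"
  have g: "0 < g" using G by (simp add: g_def)
  note nn = horizontal_normal[OF G, folded \<nu>, folded g_def]
  have \<nu>1: "\<nu> \<bullet> \<nu> = 1" using nn(1) by (simp add: norm_eq_1)
  \<comment> \<open>Here the gradient deviates from its value at x by less than \<eta> g, which
    yields both the norm bound and the lower bound on the derivative along \<nu>.\<close>
  define U0 where "U0 = \<Omega> \<inter> ?G -` ball (?G x) (\<eta> * g)"
  have U0: "open U0" "x \<in> U0"
    unfolding U0_def using continuous_on_horizontal_gradient[OF f] \<Omega> \<eta> g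
    by (auto intro!: continuous_open_preimage)
  have U0M: "norm (?G p) \<le> (1 + \<eta>) * g" and U0m: "(1 - \<eta>) * g \<le> hderiv \<nu> f p" if "p \<in> U0" for p
  proof -
    have p: "p \<in> \<Omega>" "norm (?G p - ?G x) \<le> \<eta> * g" using that by (auto simp: U0_def dist_norm norm_minus_commute)
    show "norm (?G p) \<le> (1 + \<eta>) * g"
      using norm_triangle_ineq[of "?G p - ?G x" "?G x"] p(2) by (simp add: g_def algebra_simps)
    have "?G p \<bullet> \<nu> = ?G x \<bullet> \<nu> + (?G p - ?G x) \<bullet> \<nu>" by (simp add: inner_diff_left)
    moreover have "?G x \<bullet> \<nu> = g" by (subst nn(3)) (simp add: \<nu>1)
    moreover have "\<bar>(?G p - ?G x) \<bullet> \<nu>\<bar> \<le> \<eta> * g"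
      using Cauchy_Schwarz_ineq2[of "?G p - ?G x" \<nu>] p(2) nn(1) by simp
    ultimately show "(1 - \<eta>) * g \<le> hderiv \<nu> f p"
      using hderiv_eq_gradient[OF f \<Omega>(1) p(1) nn(2)] by (simp add: algebra_simps)
  qed
  let ?L = "{\<sigma> *\<^sub>R \<nu> | \<sigma>. \<bar>\<sigma>\<bar> \<le> 2 * \<eta>}"
  have "bounded ?L" unfolding bounded_iff using nn(1) by (intro exI[of _ "2 * \<eta>"]) auto
  then have bnd: "bounded (B \<union> {gmul a b | a b. a \<in> A \<and> b \<in> ?L})"
    using B(2) by (intro iffD2[OF bounded_Un] conjI bounded_gmul[OF A(2)])
  obtain r1 where r1: "0 < r1" "\<And>r p. 0 < r \<Longrightarrow> r < r1 \<Longrightarrow>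
      p \<in> B \<union> {gmul a b | a b. a \<in> A \<and> b \<in> ?L} \<Longrightarrow> gmul x (dil r p) \<in> U0"
    by (fact small_dilations[OF U0 bnd])
  have "0 < \<eta> * g" using \<eta> g by simp
  then obtain r2 where r2: "0 < r2" "\<And>r p. 0 < r \<Longrightarrow> r < r2 \<Longrightarrow> p \<in> B \<Longrightarrow>
      \<bar>f (gmul x (dil r p)) - f x - r * (?G x \<bullet> p)\<bar> \<le> (\<eta> * g) * r"
    using horizontal_expansion[OF f \<Omega> B(2)] by metis
  show thesis
  proof (rule that[of "min r1 r2"])
    fix r :: real assume r: "0 < r" "r < min r1 r2"
    show sub: "scaled x r B \<subseteq> \<Omega>" using r1(2)[of r] r by (auto simp: scaled_def U0_def)
    let ?A = "{n. dil (1 / r) n \<in> A}"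
    have "perimeter gmul (V 1) {p \<in> \<Omega>. f p < 0} (scaled x r B) \<le>
        ennreal ((1 + \<eta>) * g / ((1 - \<eta>) * g)) * emeasure (hyperplane_measure \<nu>) ?A"
    proof (rule perimeter_le[OF f \<Omega>(1) open_scaled[OF r(1) B(1)] sub nn(1,2), of ?A _ _ "\<eta> * g * r" "2 * \<eta> * r" x])
      show "?A \<in> sets borel" using A(1) by measurable
      show "0 < (1 - \<eta>) * g" "0 \<le> (1 + \<eta>) * g" "0 < \<eta> * g * r" "0 \<le> 2 * \<eta> * r" using \<eta> g r by auto
      show "norm (?G p) \<le> (1 + \<eta>) * g" if "p \<in> scaled x r B" for p
        using that r1(2)[of r] r by (intro U0M) (auto simp: scaled_def)
    next
      fix n t assume n: "n \<bullet> \<nu> = 0" and U: "gmul x (gmul n (t *\<^sub>R \<nu>)) \<in> scaled x r B"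
        and lo: "- (\<eta> * g * r) \<le> f (gmul x (gmul n (t *\<^sub>R \<nu>)))" and hi: "f (gmul x (gmul n (t *\<^sub>R \<nu>))) \<le> 0"
      define q where "q = gmul (dil (1 / r) n) ((t / r) *\<^sub>R \<nu>)"
      have line: "gmul n (t *\<^sub>R \<nu>) = dil r q" unfolding q_def by (rule dil_gmul_line[OF nn(2) r(1)])
      have qB: "q \<in> B" using U unfolding line mem_scaled[OF r(1)] unscale[OF r(1)] .
      have q\<nu>: "q \<bullet> \<nu> = t / r"
        using n nn(2) \<nu>1 by (simp add: q_def gmul_inner_layer_1 dil_inner_layer_1)
      have "?G x \<bullet> q = g * (t / r)" by (subst nn(3)) (simp add: inner_commute[of \<nu> q] q\<nu>)
      \<comment> \<open>The value of f is g t up to \<eta> g r and lies in [-\<eta> g r, 0], so g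
        |t| is at most 2 \<eta> g r; this is the origin of the constant 2 \<eta>.\<close>
      then have "\<bar>f (gmul x (dil r q)) - g * t\<bar> \<le> \<eta> * g * r"
        using r2(2)[of r q] r qB fx by simp
      moreover have "g * (2 * \<eta> * r) = 2 * (\<eta> * g * r)" by simp
      ultimately have "\<bar>g * t\<bar> \<le> g * (2 * \<eta> * r)" using lo hi unfolding line by linarith
      then have t: "\<bar>t\<bar> \<le> 2 * \<eta> * r" using g by (simp add: abs_mult)
      then have "\<bar>- (t / r)\<bar> \<le> 2 * \<eta>" using r by (simp add: pos_divide_le_eq)
      \<comment> \<open>Following the field of \<nu> from q for time - t / r leads back to the
        rescaled point of the hyperplane.\<close>
      from BA[OF qB this] have "dil (1 / r) n \<in> A" by (simp add: q_def grp.assoc gmul_multiples del: scaleR_minus_left)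
      then show "n \<in> ?A \<and> \<bar>t\<bar> \<le> 2 * \<eta> * r" using t by simp
    next
      fix n t assume n: "n \<in> ?A" and t: "\<bar>t\<bar> \<le> 2 * \<eta> * r"
      have "\<bar>t / r\<bar> \<le> 2 * \<eta>" using t r by (simp add: pos_divide_le_eq)
      then have "gmul (dil (1 / r) n) ((t / r) *\<^sub>R \<nu>) \<in> {gmul a b | a b. a \<in> A \<and> b \<in> ?L}" using n by blast
      then have "gmul x (dil r (gmul (dil (1 / r) n) ((t / r) *\<^sub>R \<nu>))) \<in> U0" using r1(2)[of r] r by auto
      then have "gmul x (gmul n (t *\<^sub>R \<nu>)) \<in> U0" unfolding dil_gmul_line[OF nn(2) r(1), symmetric] .
      then show "gmul x (gmul n (t *\<^sub>R \<nu>)) \<in> \<Omega> \<and> (1 - \<eta>) * g \<le> hderiv \<nu> f (gmul x (gmul n (t *\<^sub>R \<nu>)))"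
        using U0m by (auto simp: U0_def)
    qed
    also have "(1 + \<eta>) * g / ((1 - \<eta>) * g) = (1 + \<eta>) / (1 - \<eta>)" using g by simp
    finally show "perimeter gmul (V 1) {p \<in> \<Omega>. f p < 0} (scaled x r B) \<le>
      ennreal ((1 + \<eta>) / (1 - \<eta>)) * (ennreal (r ^ (hom_dim V \<iota> - 1)) * emeasure (hyperplane_measure \<nu>) A)"
      by (simp only: emeasure_hyperplane_dil[OF A(1) nn(1,2) r(1)])
  qed (use r1 r2 in auto)
qed

lemma polynomial_unscale: "polynomial_function (\<lambda>p. dil (1 / r) (gmul y p))"
proof -
  have "(\<lambda>p::'a. (y, p)) = (\<lambda>p. (y, 0) + (0::'a, p))" by (rule ext) simp
  moreover have "polynomial_function (\<lambda>p::'a. (y, 0) + (0::'a, p))"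
    by (intro polynomial_function_add polynomial_function_const polynomial_function_bounded_linear bounded_linear_Pair
        bounded_linear_zero bounded_linear_ident)
  ultimately have "polynomial_function (\<lambda>p::'a. (y, p))" by simp
  from polynomial_function_compose[OF this polynomial_gmul]
  have "polynomial_function (gmul y)" by (simp add: o_def)
  from polynomial_function_compose[OF this, of "dil (1 / r)"] linear_dil show ?thesis
    by (simp add: o_def polynomial_function_bounded_linear linear_conv_bounded_linear)
qed

lemma AE_lborel_hyperplane:
  assumes "norm \<nu> = 1"
  shows "AE q in lborel. (q::'a) \<bullet> \<nu> \<noteq> 0"
proof -
  have m: "{q::'a. q \<bullet> \<nu> = 0} \<in> sets borel" by (intro borel_closed closed_Collect_eq continuous_intros)
  have "emeasure lborel {q. q \<bullet> \<nu> = 0} = (\<integral>\<^sup>+q. indicator {q. q \<bullet> \<nu> = 0} q \<partial>lborel)" using m by simp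
  also have "\<dots> = (\<integral>\<^sup>+n. (\<integral>\<^sup>+t. indicator {q. q \<bullet> \<nu> = 0} (n + t *\<^sub>R \<nu>) \<partial>lborel) \<partial>hyperplane_measure \<nu>)"
    using m by (intro nn_integral_hyperplane_fubini[OF _ assms, symmetric]) auto
  also have "\<dots> = (\<integral>\<^sup>+n. 0 \<partial>hyperplane_measure \<nu>)"
  proof (rule nn_integral_cong)
    fix n :: 'a
    have "(\<integral>\<^sup>+t. indicator {q. q \<bullet> \<nu> = 0} (n + t *\<^sub>R \<nu>) \<partial>lborel) = (\<integral>\<^sup>+t. indicator {- (n \<bullet> \<nu>)} t \<partial>lborel)"
      using assms by (intro nn_integral_cong) (auto simp: inner_add_left norm_eq_1 indicator_def)
    also have "\<dots> = 0" by simp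
    finally show "(\<integral>\<^sup>+t. indicator {q. q \<bullet> \<nu> = 0} (n + t *\<^sub>R \<nu>) \<partial>lborel) = 0" .
  qed
  finally have "emeasure lborel {q::'a. q \<bullet> \<nu> = 0} = 0" by simp
  then show ?thesis using m by (intro AE_I[where N="{q. q \<bullet> \<nu> = 0}"]) auto
qed

text \<open>The test field is the field of \<nu> times a cut-off of \<open>B\<close>, transported to
  scale r. Its flux is r^(Q-1) times the integral of the \<nu>-derivative of the cut-off over the
  rescaled set f < 0. These sets converge to the half space below the hyperplane, where the integral
  equals that of the cut-off over the hyperplane, close to the measure of \<open>B\<close>.\<close>

theorem perimeter_scaled_ge:
  assumes f: "f \<in> C1h gmul (V 1) \<Omega>" and \<Omega>: "open \<Omega>" "x \<in> \<Omega>" and fx: "f x = 0"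
    and G: "horizontal_gradient gmul (V 1) f x \<noteq> 0" and \<nu>: "\<nu> = horizontal_normal gmul (V 1) f x"
    and B: "open B" "bounded B" and c: "ennreal c < emeasure (hyperplane_measure \<nu>) B"
    and r: "\<And>k. 0 < r k" "r \<longlonglongrightarrow> 0"
  shows "\<forall>\<^sub>F k in sequentially. ennreal (r k ^ (hom_dim V \<iota> - 1)) * ennreal c \<le>
      perimeter gmul (V 1) {p \<in> \<Omega>. f p < 0} (scaled x (r k) B)"
proof -
  let ?G = "horizontal_gradient gmul (V 1) f"
  define g where "g = norm (?G x)"
  have g: "0 < g" using G by (simp add: g_def)
  note nn = horizontal_normal[OF G, folded \<nu>, folded g_def]
  define E where "E = {p \<in> \<Omega>. f p < 0}"
  have Em[measurable]: "E \<in> sets borel"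
  proof -
    have "open (\<Omega> \<inter> f -` {..<0})" by (rule continuous_open_preimage[OF C1h_continuous_on[OF f \<Omega>(1)] \<Omega>(1) open_lessThan])
    also have "\<Omega> \<inter> f -` {..<0} = E" by (auto simp: E_def)
    finally show ?thesis by simp
  qed
  let ?M = "hyperplane_measure \<nu>"
  obtain \<psi> :: "nat \<Rightarrow> 'a \<Rightarrow> real" where \<psi>: "\<And>k. C1_real (\<psi> k)" "\<And>k x. 0 \<le> \<psi> k x" "\<And>k x. \<psi> k x \<le> 1"
    "\<And>k. \<exists>K. compact K \<and> K \<subseteq> B \<and> (\<forall>x. x \<notin> K \<longrightarrow> \<psi> k x = 0)"
    "\<And>x. x \<in> B \<Longrightarrow> (\<lambda>k. \<psi> k x) \<longlonglongrightarrow> 1"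
    by (fact C1_exhausting_functions[OF B(1)])
  have \<psi>m[measurable]: "\<psi> k \<in> borel_measurable borel" for k
    using C1_real_continuous[OF \<psi>(1)] by (rule borel_measurable_continuous_onI)
  have \<psi>0: "\<psi> k p = 0" if "p \<notin> B" for k p using \<psi>(4)[of k] that by blast
  have fin: "emeasure ?M B < \<infinity>" using B by (intro emeasure_hyperplane_measure_bounded) auto
  have Bm: "B \<in> sets borel" using B(1) by simp
  have "(\<lambda>k. \<integral>\<^sup>+n. ennreal (\<psi> k n) \<partial>?M) \<longlonglongrightarrow> (\<integral>\<^sup>+n. indicator B n \<partial>?M)"
  proof (rule nn_integral_dominated_convergence[where w="indicator B"])
    show "AE n in ?M. ennreal (\<psi> k n) \<le> indicator B n" for k
      using \<psi>(3) \<psi>0 by (intro AE_I2) (auto simp: indicator_def)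
    show "AE n in ?M. (\<lambda>k. ennreal (\<psi> k n)) \<longlonglongrightarrow> indicator B n"
    proof (rule AE_I2)
      fix n show "(\<lambda>k. ennreal (\<psi> k n)) \<longlonglongrightarrow> indicator B n"
        using tendsto_ennrealI[OF \<psi>(5)[of n]] \<psi>0 by (cases "n \<in> B") auto
    qed
  qed (use fin Bm in auto)
  then have "(\<lambda>k. \<integral>\<^sup>+n. ennreal (\<psi> k n) \<partial>?M) \<longlonglongrightarrow> emeasure ?M B" using Bm by simp
  \<comment> \<open>The cut-off is fixed before r tends to 0, so that a single integrable function
    dominates at all scales.\<close>
  from order_tendstoD(1)[OF this c] obtain j where j: "ennreal c < (\<integral>\<^sup>+n. ennreal (\<psi> j n) \<partial>?M)"
    using eventually_happens'[OF sequentially_bot] by blast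
  obtain K where K: "compact K" "K \<subseteq> B" "\<And>p. p \<notin> K \<Longrightarrow> \<psi> j p = 0" using \<psi>(4)[of j] by blast
  have Kc: "closed K" using K(1) compact_imp_closed by blast
  have "(\<integral>\<^sup>+n. ennreal (\<psi> j n) \<partial>?M) \<le> (\<integral>\<^sup>+n. indicator B n \<partial>?M)"
    using \<psi>(3) \<psi>0 by (intro nn_integral_mono) (auto simp: indicator_def)
  then have "(\<integral>\<^sup>+n. ennreal (\<psi> j n) \<partial>?M) < \<infinity>" using fin Bm by (simp add: le_less_trans)
  then have "integrable ?M (\<psi> j)" using \<psi>(2) by (intro integrableI_nonneg) auto
  then have "(\<integral>\<^sup>+n. ennreal (\<psi> j n) \<partial>?M) = ennreal (LINT n|?M. \<psi> j n)"
    using \<psi>(2) by (intro nn_integral_eq_integral) auto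
  then have cj: "c < (LINT n|?M. \<psi> j n)" using j by (metis ennreal_leI leD leI)
  let ?\<psi>' = "hderiv \<nu> (\<psi> j)"
  have \<psi>'c: "continuous_on UNIV ?\<psi>'" by (rule C1_real_C1h(3)[OF \<psi>(1)])
  have \<psi>'0: "?\<psi>' p = 0" if "p \<notin> K" for p by (rule hderiv_outside_support[OF \<psi>(1) Kc K(3) that])
  have \<psi>'m[measurable]: "?\<psi>' \<in> borel_measurable borel" using \<psi>'c by (rule borel_measurable_continuous_onI)
  have half: "(LINT q|lborel. indicator {q. q \<bullet> \<nu> < 0} q * ?\<psi>' q) = (LINT n|?M. \<psi> j n)"
    by (rule integral_horizontal_derivative(2)[OF K(1) nn(1,2) \<psi>'c K(3) \<psi>'0 C1_real_C1h(2)[OF \<psi>(1)]])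
  let ?J = "\<lambda>s. LINT q|lborel. indicator E (gmul x (dil s q)) * ?\<psi>' q"
  have "(\<lambda>k. ?J (r k)) \<longlonglongrightarrow> (LINT q|lborel. indicator {q. q \<bullet> \<nu> < 0} q * ?\<psi>' q)"
  proof (rule integral_dominated_convergence[where w="\<lambda>q. norm (?\<psi>' q)"])
    have [measurable]: "{q. q \<bullet> \<nu> < 0} \<in> sets (borel :: 'a measure)"
      by (intro borel_open open_Collect_less continuous_intros)
    show "(\<lambda>q. indicator {q. q \<bullet> \<nu> < 0} q * ?\<psi>' q) \<in> borel_measurable lborel"
      "(\<lambda>q. indicator E (gmul x (dil (r k) q)) * ?\<psi>' q) \<in> borel_measurable lborel" for k by measurable
    show "integrable lborel (\<lambda>q. norm (?\<psi>' q))"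
      using integrable_compact_support[OF K(1) \<psi>'c \<psi>'0] by simp
    show "AE q in lborel. norm (indicator E (gmul x (dil (r k) q)) * ?\<psi>' q) \<le> norm (?\<psi>' q)" for k
      by (intro AE_I2) (auto simp: indicator_def)
    \<comment> \<open>On the hyperplane itself the first order term does not decide the sign of f,
      but the hyperplane is a null set.\<close>
    show "AE q in lborel. (\<lambda>k. indicator E (gmul x (dil (r k) q)) * ?\<psi>' q) \<longlonglongrightarrow> indicator {q. q \<bullet> \<nu> < 0} q * ?\<psi>' q"
      using AE_lborel_hyperplane[OF nn(1)]
    proof eventually_elim
      case (elim q)
      \<comment> \<open>An error of half the linear term leaves the sign of f to the linear
        term.\<close>
      define \<epsilon> where "\<epsilon> = g * \<bar>q \<bullet> \<nu>\<bar> / 2"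
      have \<epsilon>: "0 < \<epsilon>" using g elim by (simp add: \<epsilon>_def)
      have "bounded {q}" by simp
      then obtain r0 where r0: "0 < r0" "\<And>s p. 0 < s \<Longrightarrow> s < r0 \<Longrightarrow> p \<in> {q} \<Longrightarrow> gmul x (dil s p) \<in> \<Omega>"
        "\<And>s p. 0 < s \<Longrightarrow> s < r0 \<Longrightarrow> p \<in> {q} \<Longrightarrow> \<bar>f (gmul x (dil s p)) - f x - s * (?G x \<bullet> p)\<bar> \<le> \<epsilon> * s"
        using horizontal_expansion[OF f \<Omega> _ \<epsilon>] by metis
      have Gq: "?G x \<bullet> q = g * (q \<bullet> \<nu>)" by (subst nn(3)) (simp add: inner_commute[of \<nu> q])
      have eq: "gmul x (dil s q) \<in> E \<longleftrightarrow> q \<bullet> \<nu> < 0" if s: "0 < s" "s < r0" for s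
      proof -
        have b: "\<bar>f (gmul x (dil s q)) - s * (g * (q \<bullet> \<nu>))\<bar> \<le> (s * (g * \<bar>q \<bullet> \<nu>\<bar>)) / 2"
          using r0(3)[OF s, of q, unfolded Gq fx \<epsilon>_def] by (simp add: mult.commute)
        have p: "0 < s * (g * \<bar>q \<bullet> \<nu>\<bar>)" using s g elim by simp
        have "f (gmul x (dil s q)) < 0 \<longleftrightarrow> q \<bullet> \<nu> < 0"
        proof (cases "q \<bullet> \<nu> < 0")
          case True
          then have "s * (g * \<bar>q \<bullet> \<nu>\<bar>) = - (s * (g * (q \<bullet> \<nu>)))" by simp
          then show ?thesis using b p True by linarith
        next
          case False
          then have "s * (g * \<bar>q \<bullet> \<nu>\<bar>) = s * (g * (q \<bullet> \<nu>))" by simp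
          then show ?thesis using b p False by linarith
        qed
        then show ?thesis using r0(2)[OF s] by (simp add: E_def)
      qed
      have "\<forall>\<^sub>F k in sequentially. r k < r0" using r(2) r0(1) by (rule order_tendstoD)
      then have "\<forall>\<^sub>F k in sequentially. indicator E (gmul x (dil (r k) q)) * ?\<psi>' q = indicator {q. q \<bullet> \<nu> < 0} q * ?\<psi>' q"
        by eventually_elim (use eq[OF r(1)] in \<open>simp add: indicator_def\<close>)
      then show ?case by (rule tendsto_eventually)
    qed
  qed
  from order_tendstoD(1)[OF this, of c] have "\<forall>\<^sub>F k in sequentially. c < ?J (r k)" using cj unfolding half by blast
  then show ?thesis
  proof eventually_elim
    case (elim k)
    let ?P = "\<lambda>p. dil (1 / r k) (gmul (- x) p)"
    let ?\<phi> = "\<lambda>p. \<psi> j (?P p)"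
    let ?X = "\<lambda>p. ?\<phi> p *\<^sub>R left_field gmul \<nu> p"
    have \<phi>: "C1_real ?\<phi>" by (rule C1_real_polynomial_compose[OF \<psi>(1) polynomial_unscale])
    have X_eq: "?X p = left_field gmul (?\<phi> p *\<^sub>R \<nu>) p" for p by (simp add: linear_scale[OF left_field_linear])
    have \<phi>V: "?\<phi> p *\<^sub>R \<nu> \<in> V 1" for p using nn(2) by (intro subspace_scale layer_subspace) auto
    have supp: "{p. ?X p \<noteq> 0} \<subseteq> scaled x (r k) K"
    proof
      fix p assume "p \<in> {p. ?X p \<noteq> 0}"
      then have "?\<phi> p \<noteq> 0" by auto
      then have "?P p \<in> K" using K(3) by blast
      then show "p \<in> scaled x (r k) K" by (simp add: mem_scaled[OF r(1)])
    qed
    have comp: "compact (scaled x (r k) K)"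
      unfolding scaled_def using K(1) by (intro compact_continuous_image continuous_intros)
    have "?X \<in> C1c_horizontal gmul (V 1) (scaled x (r k) B)"
      unfolding C1c_horizontal_def
    proof (intro CollectI conjI allI)
      show "C1_map ?X"
      proof (rule C1_map_components)
        fix b :: 'a
        have "real_polynomial_function ((\<lambda>a. a \<bullet> b) \<circ> left_field gmul \<nu>)"
          using polynomial_left_field[of \<nu>] bounded_linear_inner_left unfolding polynomial_function_def by blast
        then have "real_polynomial_function (\<lambda>p. left_field gmul \<nu> p \<bullet> b)" by (simp add: o_def)
        then show "C1_real (\<lambda>p. ?X p \<bullet> b)" using C1_real_mult[OF \<phi> C1_real_polynomial] by simp
      qed
      show "?X p \<in> horizontal_fiber gmul (V 1) p" for p
        unfolding X_eq horizontal_fiber_def fields_eq using \<phi>V by blast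
      have cl: "closure {p. ?X p \<noteq> 0} \<subseteq> scaled x (r k) K"
        by (rule closure_minimal[OF supp compact_imp_closed[OF comp]])
      then show "closure {p. ?X p \<noteq> 0} \<subseteq> scaled x (r k) B" using K(2) by (auto simp: scaled_def)
      show "compact (closure {p. ?X p \<noteq> 0})"
        using bounded_subset[OF compact_imp_bounded[OF comp] supp] by (simp only: compact_closure)
    qed
    moreover have "horizontal_norm gmul (V 1) p (?X p) \<le> 1" for p
    proof -
      have "(THE v. v \<in> V 1 \<and> left_field gmul v p = ?X p) = ?\<phi> p *\<^sub>R \<nu>"
        unfolding X_eq using \<phi>V left_field_layer_1_inj by (intro the_equality) auto
      then show ?thesis using \<psi>(2,3) nn(1) by (simp add: horizontal_norm_def)
    qed
    ultimately have A1: "ennreal (set_lebesgue_integral lborel E (divergence ?X)) \<le> perimeter gmul (V 1) E (scaled x (r k) B)"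
      unfolding perimeter_def by (intro SUP_upper) auto
    have A2: "set_lebesgue_integral lborel E (divergence ?X) = r k ^ (hom_dim V \<iota> - 1) * ?J (r k)"
    proof -
      have div: "divergence ?X p = hderiv \<nu> ?\<phi> p" for p by (rule divergence_scaled_field(2)[OF \<phi>])
      \<comment> \<open>Rescaling turns the flow time t into t / r; the factor 1 / r lowers the
        Jacobian r^Q to r^(Q-1).\<close>
      have at: "hderiv \<nu> ?\<phi> (gmul x (dil (r k) q)) = (1 / r k) * ?\<psi>' q" for q
      proof -
        have "((\<lambda>t. t / r k) has_real_derivative 1 / r k) (at 0)"
          by (rule DERIV_cdivide[OF DERIV_ident])
        from DERIV_chain2[OF _ this, of "\<lambda>t. \<psi> j (gmul q (t *\<^sub>R \<nu>))"] C1_real_C1h(2)[OF \<psi>(1), of j q \<nu> 0]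
        have "((\<lambda>t. \<psi> j (gmul q ((t / r k) *\<^sub>R \<nu>))) has_real_derivative ?\<psi>' q * (1 / r k)) (at 0)"
          by simp
        moreover have "?\<phi> (gmul (gmul x (dil (r k) q)) (t *\<^sub>R \<nu>)) = \<psi> j (gmul q ((t / r k) *\<^sub>R \<nu>))" for t
        proof -
          have "gmul (dil (r k) q) (t *\<^sub>R \<nu>) = dil (r k) (gmul q ((t / r k) *\<^sub>R \<nu>))"
            using dil_gmul_line[OF nn(2) r(1), of "dil (r k) q" t k] by (simp only: dil_inverse(2)[OF r(1)])
          then show ?thesis by (simp only: grp.assoc[of x] unscale[OF r(1)])
        qed
        ultimately have "((\<lambda>t. ?\<phi> (gmul (gmul x (dil (r k) q)) (t *\<^sub>R \<nu>))) has_real_derivative ?\<psi>' q * (1 / r k)) (at 0)"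
          by simp
        moreover have "((\<lambda>t. ?\<phi> (gmul (gmul x (dil (r k) q)) (t *\<^sub>R \<nu>))) has_real_derivative
            hderiv \<nu> ?\<phi> (gmul x (dil (r k) q))) (at 0)"
          using C1_real_C1h(2)[OF \<phi>, of "gmul x (dil (r k) q)" \<nu> 0] by simp
        ultimately have "?\<psi>' q * (1 / r k) = hderiv \<nu> ?\<phi> (gmul x (dil (r k) q))" by (rule DERIV_unique)
        then show ?thesis unfolding mult.commute[of "1 / r k"] by (rule sym)
      qed
      have [measurable]: "hderiv \<nu> ?\<phi> \<in> borel_measurable borel"
        using C1_real_C1h(3)[OF \<phi>] by (rule borel_measurable_continuous_onI)
      have "set_lebesgue_integral lborel E (divergence ?X) = (LINT p|lborel. indicator E p * hderiv \<nu> ?\<phi> p)"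
        by (simp add: set_lebesgue_integral_def div)
      also have "\<dots> = r k ^ hom_dim V \<iota> * (LINT q|lborel. indicator E (gmul x (dil (r k) q)) * hderiv \<nu> ?\<phi> (gmul x (dil (r k) q)))"
        by (rule integral_affine[OF _ r(1)]) measurable
      also have "\<dots> = r k ^ hom_dim V \<iota> * ((1 / r k) * ?J (r k))"
        unfolding at by (subst integral_mult_right_zero[symmetric]) (simp add: ac_simps)
      also have "r k ^ hom_dim V \<iota> = r k ^ (hom_dim V \<iota> - 1) * r k"
        using hom_dim_pos by (simp add: power_Suc2[symmetric] del: power_Suc2)
      finally show ?thesis using r(1)[of k] by simp
    qed
    have A3: "ennreal (r k ^ (hom_dim V \<iota> - 1)) * ennreal c \<le> ennreal (r k ^ (hom_dim V \<iota> - 1) * ?J (r k))"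
    \<comment> \<open>For negative c the left-hand side is 0, as \<open>ennreal\<close>
      truncates.\<close>
    proof (cases "0 \<le> c")
      case True
      have "ennreal (r k ^ (hom_dim V \<iota> - 1)) * ennreal c = ennreal (r k ^ (hom_dim V \<iota> - 1) * c)"
        using r(1)[of k] True by (intro ennreal_mult[symmetric]) auto
      also have "\<dots> \<le> ennreal (r k ^ (hom_dim V \<iota> - 1) * ?J (r k))"
        using r(1)[of k] elim by (intro ennreal_leI mult_left_mono) auto
      finally show ?thesis .
    qed (simp add: ennreal_neg)
    show ?case unfolding E_def[symmetric] by (rule order_trans[OF A3 A1[unfolded A2]])
  qed
qed

end

locale homogeneous_group = stratified_group V \<iota> gmul + homogeneous_distance V \<iota> gmul d
  for V :: "nat \<Rightarrow> 'a::euclidean_space set" and \<iota> :: nat and gmul :: "'a \<Rightarrow> 'a \<Rightarrow> 'a"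
    and d :: "'a \<Rightarrow> 'a \<Rightarrow> real"
begin

subsection \<open>Balls of a homogeneous distance\<close>

sublocale dm: Metric_space UNIV d by (rule metric)

lemma dball_iff: "q \<in> dball d z r \<longleftrightarrow> d z q \<le> r"
  by (simp add: dm.in_mcball)

lemma dist_dil: "0 < r \<Longrightarrow> d (dil r x) (dil r y) = r * d x y"
  using dist_homogeneous[of r x y] by (simp add: dilation_eq)

lemma continuous_on_homogeneous_dist [continuous_intros]:
  assumes "continuous_on S f" "continuous_on S g"
  shows "continuous_on S (\<lambda>x. d (f x) (g x))"
  using continuous_on_compose2[OF dist_continuous continuous_on_Pair[OF assms]] by simp

lemma dist_scaled: "0 < r \<Longrightarrow> d (gmul x (dil r z)) (gmul x (dil r q)) = r * d z q"
  by (simp add: dist_left_invariant dist_dil)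

lemma dball_scaled:
  assumes "0 < r"
  shows "dball d (gmul x (dil r z)) (r * s) = scaled x r {q. d z q \<le> s}"
proof (intro set_eqI)
  fix p
  have "d (gmul x (dil r z)) p = r * d z (dil (1 / r) (gmul (- x) p))"
    using dist_scaled[OF assms, of x z "dil (1 / r) (gmul (- x) p)"] by (simp only: rescale[OF assms])
  then show "p \<in> dball d (gmul x (dil r z)) (r * s) \<longleftrightarrow> p \<in> scaled x r {q. d z q \<le> s}"
    using assms by (simp add: dball_iff mem_scaled)
qed

text \<open>On the Euclidean unit sphere the distance from 0 has a positive minimum c. A point
  outside the Euclidean unit ball is brought to the sphere by a dilation with factor r \<le> 1,
  found by the intermediate value theorem, and homogeneity gives 1 / r \<le> R / c.\<close>

lemma bounded_dist_ball_0: "bounded {q. d 0 q \<le> R}"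
proof -
  have "compact (sphere (0::'a) 1)" "sphere (0::'a) 1 \<noteq> {}" by auto
  moreover have "continuous_on (sphere 0 1) (d 0)" by (intro continuous_intros)
  ultimately have "\<exists>p0\<in>sphere 0 1. \<forall>p\<in>sphere 0 1. d 0 p0 \<le> d 0 p" by (rule continuous_attains_inf)
  then obtain p0 where p0: "p0 \<in> sphere 0 1" "\<And>p. p \<in> sphere 0 1 \<Longrightarrow> d 0 p0 \<le> d 0 p" by blast
  define c where "c = d 0 p0"
  have c: "0 < c" using p0(1) dm.mdist_pos_less[of 0 p0] by (auto simp: c_def)
  have "{q. d 0 q \<le> R} \<subseteq> cball 0 1 \<union> (\<lambda>(s, u). dil s u) ` ({0..R / c} \<times> sphere 0 1)"
  proof
    fix q assume q: "q \<in> {q. d 0 q \<le> R}"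
    show "q \<in> cball 0 1 \<union> (\<lambda>(s, u). dil s u) ` ({0..R / c} \<times> sphere 0 1)"
    proof (cases "norm q \<le> 1")
      case False
      have "dil 0 q = 0"
      proof (rule euclidean_eqI)
        fix b :: 'a assume b: "b \<in> Basis"
        then show "dil 0 q \<bullet> b = 0 \<bullet> b" using deg(3)[OF b] by simp
      qed
      then have "norm (dil 0 q) \<le> 1" "1 \<le> norm (dil 1 q)" using False by auto
      moreover have "continuous_on {0..1} (\<lambda>r. norm (dil r q))" by (intro continuous_intros)
      ultimately obtain r where r: "0 \<le> r" "r \<le> 1" "norm (dil r q) = 1"
        using IVT'[of "\<lambda>r. norm (dil r q)" 0 1 1] by auto
      then have r0: "0 < r" using \<open>dil 0 q = 0\<close> by (cases "r = 0") auto
      have "c \<le> d 0 (dil r q)" using p0(2)[of "dil r q"] r(3) by (simp add: c_def)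
      also have "\<dots> = r * d 0 q" using dist_dil[OF r0, of 0 q] by simp
      also have "\<dots> \<le> r * R" using q r0 by simp
      finally have "1 / r \<le> R / c" using r0 c by (simp add: field_simps)
      moreover have "q = dil (1 / r) (dil r q)" using r0 by (simp add: dil_inverse)
      ultimately have "q \<in> (\<lambda>(s, u). dil s u) ` ({0..R / c} \<times> sphere 0 1)"
        using r0 r(3) by (intro image_eqI[of _ _ "(1 / r, dil r q)"]) auto
      then show ?thesis by blast
    qed auto
  qed
  moreover have "compact ((\<lambda>(s, u). dil s u) ` ({0..R / c} \<times> sphere 0 1))"
    by (intro compact_continuous_image compact_Times) (auto simp: case_prod_beta intro!: continuous_intros)
  then have "bounded (cball 0 1 \<union> (\<lambda>(s, u). dil s u) ` ({0..R / c} \<times> sphere 0 1))"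
    by (simp only: bounded_Un bounded_cball compact_imp_bounded simp_thms)
  ultimately show ?thesis by (rule bounded_subset[rotated])
qed

lemma bounded_dist_ball: "bounded {q. d z q \<le> R}"
proof (rule bounded_subset[OF bounded_dist_ball_0[of "d 0 z + R"]])
  show "{q. d z q \<le> R} \<subseteq> {q. d 0 q \<le> d 0 z + R}"
  proof clarify
    fix q assume "d z q \<le> R"
    then show "d 0 q \<le> d 0 z + R" using dm.triangle[of 0 z q] by simp
  qed
qed

lemma closed_dist_ball: "closed {q. d z q \<le> R}"
  by (intro closed_Collect_le continuous_intros)

lemma open_dist_ball: "open {q. d z q < R}"
  by (intro open_Collect_less continuous_intros)

lemma dball_eq: "dball d z r = {q. d z q \<le> r}"
  using dball_iff by auto

text \<open>Without first layer basis vectors the only path would be the empty one, and nothing but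
  0 would be reachable.\<close>

lemma horizontal_vector_exists: obtains e where "e \<in> E1"
proof -
  obtain b :: 'a where b: "b \<in> Basis" using nonempty_Basis by blast
  obtain C m where "{b} \<subseteq> reach C m" by (rule bounded_reachable[of "{b}"]) auto
  then obtain l where l: "b = path_end l" "\<forall>(c, e)\<in>set l. \<bar>c\<bar> \<le> C \<and> e \<in> Basis \<and> deg e = 1"
    unfolding reach_def by auto
  have "l \<noteq> []" using l(1) b by auto
  then obtain ce where "ce \<in> set l" by (meson hd_in_set)
  then have "snd ce \<in> E1" using l(2) by (auto simp: case_prod_beta)
  then show thesis by (rule that)
qed

text \<open>The triangle inequality gives one direction. For the other, the distance is linear along
  the one-parameter subgroup of a first layer vector, so two opposite points on its translate
  through the centre are 2 r apart.\<close>

lemma ddiam_dball: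
  assumes r: "0 < r"
  shows "ddiam d (dball d y r) = 2 * r"
proof -
  obtain e where e: "e \<in> E1" by (rule horizontal_vector_exists)
  then have e0: "e \<noteq> 0" and eV: "e \<in> V 1" using E1_layer by auto
  define s where "s = r / d 0 e"
  have de: "0 < d 0 e" using e0 dm.mdist_pos_less[of 0 e] by auto
  have s: "0 < s" using r de by (simp add: s_def)
  have n: "d 0 (t *\<^sub>R e) = t * d 0 e" if "0 < t" for t
    using dist_dil[OF that, of 0 e] dil_layer[OF eV, of t] by simp
  have 1: "d y (gmul y (s *\<^sub>R e)) = r"
    using dist_left_invariant[of y 0 "s *\<^sub>R e"] n[OF s] de by (simp add: s_def)
  have "d y (gmul y ((- s) *\<^sub>R e)) = d 0 ((- s) *\<^sub>R e)"
    using dist_left_invariant[of y 0 "(- s) *\<^sub>R e"] by simp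
  also have "\<dots> = d (gmul (s *\<^sub>R e) 0) (gmul (s *\<^sub>R e) ((- s) *\<^sub>R e))"
    by (rule dist_left_invariant[symmetric])
  also have "\<dots> = d (s *\<^sub>R e) 0" by (simp only: gmul_multiples) simp
  also have "\<dots> = r" using n[OF s] de dm.commute[of 0 "s *\<^sub>R e"] by (simp add: s_def)
  finally have 2: "d y (gmul y ((- s) *\<^sub>R e)) = r" .
  have "d (gmul y ((- s) *\<^sub>R e)) (gmul y (s *\<^sub>R e)) = d ((- s) *\<^sub>R e) (s *\<^sub>R e)"
    by (rule dist_left_invariant)
  also have "\<dots> = d (gmul (s *\<^sub>R e) ((- s) *\<^sub>R e)) (gmul (s *\<^sub>R e) (s *\<^sub>R e))"
    by (rule dist_left_invariant[symmetric])
  also have "\<dots> = d 0 ((s + s) *\<^sub>R e)" by (simp only: gmul_multiples) simp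
  also have "\<dots> = 2 * r" using n[of "s + s"] s de by (simp add: s_def)
  finally have 3: "d (gmul y ((- s) *\<^sub>R e)) (gmul y (s *\<^sub>R e)) = 2 * r" .
  show ?thesis unfolding ddiam_def
  proof (rule cSup_eq_maximum)
    show "2 * r \<in> (\<lambda>(x, y). d x y) ` (dball d y r \<times> dball d y r)"
      using 1 2 3 by (intro image_eqI[of _ _ "(gmul y ((- s) *\<^sub>R e), gmul y (s *\<^sub>R e))"]) (auto simp: dball_iff simp del: scaleR_minus_left)
    fix t assume "t \<in> (\<lambda>(x, y). d x y) ` (dball d y r \<times> dball d y r)"
    then obtain a b where ab: "t = d a b" "d y a \<le> r" "d y b \<le> r" by (auto simp: dball_iff)
    then show "t \<le> 2 * r" using dm.triangle[of a y b] dm.commute[of a y] by auto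
  qed
qed

lemma vertical_subgroup_eq:
  assumes \<nu>: "\<nu> \<in> V 1"
  shows "vertical_subgroup V \<iota> \<nu> = {p. p \<bullet> \<nu> = 0}"
proof
  have "subspace {p. p \<bullet> \<nu> = 0}" by (auto simp: subspace_def inner_add_left)
  moreover have "p \<bullet> \<nu> = 0" if "p \<in> V j" "j \<in> {2..\<iota>}" for p j
    using that by (intro layer_1_inner_tail[OF \<nu>] layer_tail) auto
  ultimately show "vertical_subgroup V \<iota> \<nu> \<subseteq> {p. p \<bullet> \<nu> = 0}"
    unfolding vertical_subgroup_def by (intro span_minimal) auto
  show "{p. p \<bullet> \<nu> = 0} \<subseteq> vertical_subgroup V \<iota> \<nu>"
  proof
    fix p assume p: "p \<in> {p. p \<bullet> \<nu> = 0}"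
    let ?S = "{v \<in> V 1. v \<bullet> \<nu> = 0} \<union> (\<Union>j\<in>{2..\<iota>}. V j)"
    let ?h = "\<Sum>b\<in>E1. (p \<bullet> b) *\<^sub>R b" and ?t = "\<Sum>b\<in>Basis - E1. (p \<bullet> b) *\<^sub>R b"
    have sum: "p = ?h + ?t"
    proof -
      have "(\<Sum>b\<in>Basis. (p \<bullet> b) *\<^sub>R b) = ?t + ?h" by (rule sum.subset_diff) auto
      then show ?thesis by (simp add: euclidean_representation add.commute)
    qed
    have t: "?t \<in> tail 2"
    proof (intro tail_sum tail_scale)
      fix b assume "b \<in> Basis - E1"
      then show "b \<in> tail 2" using deg(2,3)[of b] by (intro layer_tail[of b "deg b"]) auto
    qed
    have hV: "?h \<in> V 1" using E1_layer by (intro subspace_sum subspace_scale layer_subspace) auto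
    have "p \<bullet> \<nu> = (?h + ?t) \<bullet> \<nu>" using arg_cong[OF sum, of "\<lambda>p. p \<bullet> \<nu>"] .
    then have "?h \<bullet> \<nu> = p \<bullet> \<nu>" unfolding inner_add_left layer_1_inner_tail[OF \<nu> t] by simp
    then have "?h \<in> span ?S" using hV p by (intro span_base) auto
    moreover have "?t \<in> span ?S"
    proof (intro span_sum span_scale span_base UnI2)
      fix b assume b: "b \<in> Basis - E1"
      then have "deg b \<in> {2..\<iota>}" using deg(1)[of b] by (auto simp: numeral_2_eq_2)
      then show "b \<in> (\<Union>j\<in>{2..\<iota>}. V j)" using deg(2)[of b] b by blast
    qed
    ultimately show "p \<in> vertical_subgroup V \<iota> \<nu>"
      unfolding vertical_subgroup_def by (subst sum) (rule span_add)
  qed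
qed

section \<open>Measures of ball sections and the maximum in \<open>beta\<close>\<close>

definition ball_section :: "'a \<Rightarrow> 'a \<Rightarrow> real \<Rightarrow> ennreal" where
  "ball_section \<nu> z s = emeasure (hyperplane_measure \<nu>) {q. d z q \<le> s}"

lemma hausdorff_ball_section:
  assumes \<nu>: "norm \<nu> = 1" "\<nu> \<in> V 1"
  shows "hausdorff (DIM('a) - 1) (dball d z 1 \<inter> vertical_subgroup V \<iota> \<nu>) = ball_section \<nu> z 1"
proof -
  let ?N = "{p. p \<bullet> \<nu> = 0}"
  have N: "closed ?N" by (intro closed_Collect_eq continuous_intros)
  have "hausdorff (DIM('a) - 1) ({q. d z q \<le> 1} \<inter> ?N) = emeasure (hyperplane_measure \<nu>) ({q. d z q \<le> 1} \<inter> ?N)"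
    using N closed_dist_ball[of z 1] bounded_dist_ball[of z 1]
    by (intro hausdorff_eq_hyperplane_measure[OF \<nu>(1)]) (auto intro: bounded_subset)
  also have "\<dots> = emeasure (hyperplane_measure \<nu>) {q. d z q \<le> 1}"
    using N closed_dist_ball[of z 1] AE_hyperplane_measure[OF \<nu>(1)]
    by (intro emeasure_eq_AE) auto
  finally show ?thesis by (simp add: vertical_subgroup_eq[OF \<nu>(2)] dball_eq ball_section_def)
qed

lemma ball_section_subset:
  assumes "d z w \<le> \<eta>"
  shows "ball_section \<nu> w s \<le> ball_section \<nu> z (s + \<eta>)"
  unfolding ball_section_def
proof (rule emeasure_mono)
  show "{q. d w q \<le> s} \<subseteq> {q. d z q \<le> s + \<eta>}"
    using dm.triangle[of z w] assms by (auto, smt (verit) UNIV_I)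
qed (use closed_dist_ball in auto)

lemma ball_section_finite: "ball_section \<nu> z s < \<infinity>"
  unfolding ball_section_def
  by (rule emeasure_hyperplane_measure_bounded[OF bounded_dist_ball]) (use closed_dist_ball in auto)

text \<open>A closed ball is the decreasing intersection of larger concentric ones, and sections
  have finite measure. Together with \<open>ball_section_subset\<close> this amounts to upper
  semicontinuity in the centre.\<close>

lemma ball_section_right_continuous:
  assumes "ball_section \<nu> z s < c"
  obtains \<eta> where "0 < \<eta>" "ball_section \<nu> z (s + \<eta>) < c"
proof -
  let ?A = "\<lambda>n::nat. {q. d z q \<le> s + 1 / real (Suc n)}"
  have "(\<lambda>n. emeasure (hyperplane_measure \<nu>) (?A n)) \<longlonglongrightarrow> emeasure (hyperplane_measure \<nu>) (\<Inter>n. ?A n)"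
  proof (rule Lim_emeasure_decseq)
    show "range ?A \<subseteq> sets (hyperplane_measure \<nu>)" using closed_dist_ball by auto
    have "1 / real (Suc n) \<le> 1 / real (Suc m)" if "m \<le> n" for m n using that by (simp add: frac_le)
    then show "decseq ?A" unfolding decseq_def by (fastforce intro: order_trans)
    show "emeasure (hyperplane_measure \<nu>) (?A n) \<noteq> \<infinity>" for n
      using ball_section_finite[of \<nu> z "s + 1 / real (Suc n)"] by (simp add: ball_section_def)
  qed
  moreover have "(\<Inter>n. ?A n) = {q. d z q \<le> s}"
  proof (intro equalityI subsetI CollectI)
    fix q assume q: "q \<in> (\<Inter>n. ?A n)"
    show "d z q \<le> s"
    proof (rule field_le_epsilon)
      fix e :: real assume "0 < e"
      then obtain n where "1 / real (Suc n) < e" using nat_approx_posE by blast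
      moreover have "d z q \<le> s + 1 / real (Suc n)" using q by blast
      ultimately show "d z q \<le> s + e" by linarith
    qed
  next
    fix q assume "q \<in> {q. d z q \<le> s}"
    moreover have "0 \<le> 1 / real (Suc n)" for n by simp
    ultimately show "q \<in> (\<Inter>n. ?A n)" by (auto intro: order_trans)
  qed
  ultimately have "(\<lambda>n. emeasure (hyperplane_measure \<nu>) (?A n)) \<longlonglongrightarrow> ball_section \<nu> z s"
    by (simp add: ball_section_def)
  from order_tendstoD(2)[OF this assms] obtain n where "emeasure (hyperplane_measure \<nu>) (?A n) < c"
    using eventually_happens'[OF sequentially_bot] by blast
  then show thesis by (intro that[of "1 / real (Suc n)"]) (auto simp: ball_section_def)
qed

lemma compact_unit_ball: "compact {q. d 0 q \<le> R}"
  using bounded_dist_ball closed_dist_ball by (simp add: compact_eq_bounded_closed)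

text \<open>Upper semicontinuity on a compact ball: let z be a limit of a maximizing sequence. If
  the section at z fell short of the supremum, so would that of a slightly larger ball at z, which
  contains the unit balls of the later terms.\<close>

lemma ball_section_attains_max:
  obtains z where "d 0 z \<le> 1" "\<And>w. d 0 w \<le> 1 \<Longrightarrow> ball_section \<nu> w 1 \<le> ball_section \<nu> z 1"
proof -
  let ?D = "{q. d 0 q \<le> 1}"
  let ?b = "\<lambda>w. ball_section \<nu> w 1"
  define s where "s = Sup (?b ` ?D)"
  have "0 \<in> ?D" by simp
  then have "?b ` ?D \<noteq> {}" by blast
  from ennreal_Sup_countable_SUP[OF this] obtain h :: "nat \<Rightarrow> ennreal" where
    h: "incseq h" "range h \<subseteq> ?b ` ?D" "s = (SUP i. h i)" unfolding s_def by metis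
  have "\<forall>i. \<exists>u. u \<in> ?D \<and> h i = ?b u" using h(2) by blast
  then obtain u where u: "\<And>i. u i \<in> ?D" "\<And>i. h i = ?b (u i)" by metis
  obtain z r where z: "z \<in> ?D" and r: "strict_mono (r :: nat \<Rightarrow> nat)" "(u \<circ> r) \<longlonglongrightarrow> z"
    using compact_unit_ball[of 1] u(1) unfolding compact_def by blast
  have "s \<le> ?b z"
  proof (rule ccontr)
    assume "\<not> s \<le> ?b z"
    then have lt: "ball_section \<nu> z 1 < s" by simp
    obtain \<eta> where \<eta>: "0 < \<eta>" "ball_section \<nu> z (1 + \<eta>) < s"
      by (fact ball_section_right_continuous[OF lt])
    have "continuous_on UNIV (d z)" by (intro continuous_intros)
    from continuous_on_tendsto_compose[OF this r(2)] have "(\<lambda>i. d z (u (r i))) \<longlonglongrightarrow> 0" by simp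
    from order_tendstoD(2)[OF this \<eta>(1)] have "\<forall>\<^sub>F i in sequentially. h (r i) \<le> ball_section \<nu> z (1 + \<eta>)"
      by eventually_elim (auto simp: u(2) intro!: ball_section_subset)
    moreover have "(\<lambda>i. h (r i)) \<longlonglongrightarrow> s"
      using LIMSEQ_subseq_LIMSEQ[OF LIMSEQ_SUP[OF h(1)] r(1)] by (simp add: h(3) o_def)
    ultimately have "s \<le> ball_section \<nu> z (1 + \<eta>)"
      using tendsto_upperbound[of "\<lambda>i. h (r i)" s sequentially] by auto
    then show False using \<eta>(2) by simp
  qed
  moreover have "?b w \<le> s" if "d 0 w \<le> 1" for w
    unfolding s_def using that by (intro Sup_upper imageI) simp
  ultimately show thesis using z by (intro that[of z]) (auto intro: order_trans)
qed

text \<open>\<open>GREATEST\<close> denotes a maximum only once one is known to exist.\<close>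

lemma beta_eq_max:
  assumes \<nu>: "norm \<nu> = 1" "\<nu> \<in> V 1"
  obtains z where "d 0 z \<le> 1" "beta V \<iota> d \<nu> = ball_section \<nu> z 1"
    "\<And>w. d 0 w \<le> 1 \<Longrightarrow> ball_section \<nu> w 1 \<le> ball_section \<nu> z 1"
proof -
  obtain z where z: "d 0 z \<le> 1" "\<And>w. d 0 w \<le> 1 \<Longrightarrow> ball_section \<nu> w 1 \<le> ball_section \<nu> z 1"
    using ball_section_attains_max[of \<nu>] by metis
  have "beta V \<iota> d \<nu> = ball_section \<nu> z 1"
    unfolding beta_def hausdorff_ball_section[OF \<nu>]
    by (rule Greatest_equality) (use z in \<open>auto simp: dball_iff\<close>)
  then show thesis using z by (intro that)
qed

end

context homogeneous_group
begin

subsection \<open>The spherical density\<close>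

context
  fixes \<Omega> S :: "'a set" and f :: "'a \<Rightarrow> real" and \<sigma> :: "'a measure" and x :: 'a
  assumes reg: "regular_hypersurface gmul (V 1) \<Omega> f S"
    and per: "perimeter_measure gmul (V 1) \<Omega> f \<sigma>"
    and xS: "x \<in> S"
begin

lemma hypersurface_facts:
  shows "f \<in> C1h gmul (V 1) \<Omega>" "open \<Omega>" "x \<in> \<Omega>" "f x = 0" "horizontal_gradient gmul (V 1) f x \<noteq> 0"
  using reg xS regular_gradient_nonzero[OF reg] by (auto simp: regular_hypersurface_def)

abbreviation \<nu> :: 'a where "\<nu> \<equiv> horizontal_normal gmul (V 1) f x"

lemma unit_normal: "norm \<nu> = 1" "\<nu> \<in> V 1"
  using horizontal_normal[OF hypersurface_facts(5)] by auto

lemma space_\<sigma>: "space \<sigma> = \<Omega>"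
  and sets_\<sigma>: "A \<in> sets \<sigma> \<longleftrightarrow> A \<in> sets borel \<and> A \<subseteq> \<Omega>"
  and \<sigma>_open: "open U \<Longrightarrow> U \<subseteq> \<Omega> \<Longrightarrow> emeasure \<sigma> U = perimeter gmul (V 1) {p \<in> \<Omega>. f p < 0} U"
proof -
  have s: "sets \<sigma> = sets (restrict_space borel \<Omega>)" using per by (simp add: perimeter_measure_def)
  from sets_eq_imp_space_eq[OF s] show "space \<sigma> = \<Omega>" by (simp add: space_restrict_space)
  show "A \<in> sets \<sigma> \<longleftrightarrow> A \<in> sets borel \<and> A \<subseteq> \<Omega>"
    unfolding s using hypersurface_facts(2) by (subst sets_restrict_space_iff) auto
  show "open U \<Longrightarrow> U \<subseteq> \<Omega> \<Longrightarrow> emeasure \<sigma> U = perimeter gmul (V 1) {p \<in> \<Omega>. f p < 0} U"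
    using per by (simp add: perimeter_measure_def)
qed

abbreviation Qm1 :: nat where "Qm1 \<equiv> hom_dim V \<iota> - 1"

lemma ddiam_power: "0 < r \<Longrightarrow> ddiam d (dball d y r) ^ Qm1 / 2 ^ Qm1 = r ^ Qm1"
  by (simp add: ddiam_dball power_mult_distrib)

text \<open>The radius \<eta>1 is taken from right continuity. Unit balls centred near z lie in the
  open ball of radius 1 + \<eta>1 / 2, and short moves along \<nu> keep that ball inside the closed
  one of radius 1 + \<eta>1; these two are the sets \<open>B\<close> and \<open>A\<close> of
  \<open>perimeter_scaled_le\<close>. The bound thus holds for all nearby centres at once.\<close>

lemma local_upper_bound:
  assumes c: "ball_section \<nu> z 1 < c"
  obtains \<eta> r0 where "0 < \<eta>" "0 < r0"
    "\<And>r w. 0 < r \<Longrightarrow> r < r0 \<Longrightarrow> d z w < \<eta> \<Longrightarrow>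
      emeasure \<sigma> (dball d (gmul x (dil r w)) r \<inter> space \<sigma>) \<le> ennreal (r ^ Qm1) * c"
proof -
  obtain \<eta>1 where \<eta>1: "0 < \<eta>1" "ball_section \<nu> z (1 + \<eta>1) < c"
    using ball_section_right_continuous[OF c] by metis
  have "((\<lambda>\<eta>. ennreal ((1 + \<eta>) / (1 - \<eta>)) * ball_section \<nu> z (1 + \<eta>1)) \<longlongrightarrow>
      ennreal ((1 + 0) / (1 - 0)) * ball_section \<nu> z (1 + \<eta>1)) (at_right 0)"
    unfolding mult.commute[of _ "ball_section \<nu> z (1 + \<eta>1)"]
    using ball_section_finite[of \<nu> z "1 + \<eta>1"]
    by (intro ennreal_tendsto_cmult tendsto_ennrealI tendsto_intros) auto
  then have "\<forall>\<^sub>F \<eta> in at_right 0. ennreal ((1 + \<eta>) / (1 - \<eta>)) * ball_section \<nu> z (1 + \<eta>1) < c"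
    using \<eta>1(2) by (intro order_tendstoD(2)) auto
  then obtain \<eta>2 where \<eta>2: "0 < \<eta>2" "\<And>\<eta>. 0 < \<eta> \<Longrightarrow> \<eta> < \<eta>2 \<Longrightarrow> ennreal ((1 + \<eta>) / (1 - \<eta>)) * ball_section \<nu> z (1 + \<eta>1) < c"
    by (auto simp: eventually_at_right_field)
  have "\<forall>\<^sub>F t in nhds (0::real). d 0 (t *\<^sub>R \<nu>) < \<eta>1 / 2"
  proof -
    have "open {t. d 0 (t *\<^sub>R \<nu>) < \<eta>1 / 2}" by (intro open_Collect_less continuous_intros)
    then show ?thesis unfolding eventually_nhds using \<eta>1(1)
      by (intro exI[of _ "{t. d 0 (t *\<^sub>R \<nu>) < \<eta>1 / 2}"]) auto
  qed
  then obtain \<delta> where \<delta>: "0 < \<delta>" "\<And>t. \<bar>t\<bar> < \<delta> \<Longrightarrow> d 0 (t *\<^sub>R \<nu>) < \<eta>1 / 2"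
    unfolding eventually_nhds_metric by (auto simp: dist_real_def)
  \<comment> \<open>Small enough for the factor (1 + \<eta>) / (1 - \<eta>) to keep the bound below
    c, and for moves of size 2 \<eta> along \<nu> to have d-length below \<eta>1 / 2.\<close>
  define \<eta> where "\<eta> = Min {1 / 2, \<eta>2 / 2, \<delta> / 3}"
  have \<eta>: "0 < \<eta>" "\<eta> < 1" "\<eta> < \<eta>2" "2 * \<eta> < \<delta>" using \<eta>2(1) \<delta>(1) by (auto simp: \<eta>_def min_def)
  let ?B = "{p. d z p < 1 + \<eta>1 / 2}" and ?A = "{p. d z p \<le> 1 + \<eta>1}"
  have Bb: "bounded ?B" by (rule bounded_subset[OF bounded_dist_ball[of z "1 + \<eta>1 / 2"]]) auto
  have BA: "gmul p (\<tau> *\<^sub>R \<nu>) \<in> ?A" if p: "p \<in> ?B" and \<tau>: "\<bar>\<tau>\<bar> \<le> 2 * \<eta>" for p \<tau>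
  proof -
    have "d p (gmul p (\<tau> *\<^sub>R \<nu>)) = d 0 (\<tau> *\<^sub>R \<nu>)" using dist_left_invariant[of p 0 "\<tau> *\<^sub>R \<nu>"] by simp
    then have "d p (gmul p (\<tau> *\<^sub>R \<nu>)) < \<eta>1 / 2" using \<delta>(2)[of \<tau>] \<tau> \<eta>(4) by simp
    then show ?thesis using p dm.triangle[of z p "gmul p (\<tau> *\<^sub>R \<nu>)"] by simp
  qed
  have Am: "?A \<in> sets borel" using closed_dist_ball by (rule borel_closed)
  obtain r0 where r0: "0 < r0" "\<And>r. 0 < r \<Longrightarrow> r < r0 \<Longrightarrow> scaled x r ?B \<subseteq> \<Omega>"
    "\<And>r. 0 < r \<Longrightarrow> r < r0 \<Longrightarrow> perimeter gmul (V 1) {p \<in> \<Omega>. f p < 0} (scaled x r ?B) \<le>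
      ennreal ((1 + \<eta>) / (1 - \<eta>)) * (ennreal (r ^ Qm1) * emeasure (hyperplane_measure \<nu>) ?A)"
    by (rule perimeter_scaled_le[OF hypersurface_facts refl open_dist_ball[of z "1 + \<eta>1 / 2"] Bb Am
        bounded_dist_ball[of z "1 + \<eta>1"] \<eta>(1,2) BA]) blast+
  show thesis
  proof (rule that[of "\<eta>1 / 2" r0])
    fix r w assume r: "0 < r" "r < r0" and w: "d z w < \<eta>1 / 2"
    have "dball d (gmul x (dil r w)) r \<subseteq> scaled x r ?B"
    proof -
      have "{p. d w p \<le> 1} \<subseteq> ?B"
      proof clarify
        fix p assume "d w p \<le> 1"
        then show "d z p < 1 + \<eta>1 / 2" using w dm.triangle[of z w p] by simp
      qed
      then show ?thesis using dball_scaled[OF r(1), of x w 1] by (auto simp: scaled_def)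
    qed
    then have "emeasure \<sigma> (dball d (gmul x (dil r w)) r \<inter> space \<sigma>) \<le> emeasure \<sigma> (scaled x r ?B)"
      using r0(2)[OF r] open_scaled[OF r(1) open_dist_ball] by (intro emeasure_mono) (auto simp: sets_\<sigma>)
    also have "\<dots> = perimeter gmul (V 1) {p \<in> \<Omega>. f p < 0} (scaled x r ?B)"
      by (rule \<sigma>_open[OF open_scaled[OF r(1) open_dist_ball] r0(2)[OF r]])
    also have "\<dots> \<le> ennreal ((1 + \<eta>) / (1 - \<eta>)) * (ennreal (r ^ Qm1) * emeasure (hyperplane_measure \<nu>) ?A)"
      by (rule r0(3)[OF r])
    also have "\<dots> = ennreal (r ^ Qm1) * (ennreal ((1 + \<eta>) / (1 - \<eta>)) * ball_section \<nu> z (1 + \<eta>1))"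
      by (simp only: ball_section_def ac_simps)
    also have "\<dots> \<le> ennreal (r ^ Qm1) * c"
      using \<eta>2(2)[OF \<eta>(1,3)] by (intro mult_left_mono) auto
    finally show "emeasure \<sigma> (dball d (gmul x (dil r w)) r \<inter> space \<sigma>) \<le> ennreal (r ^ Qm1) * c" .
  qed (use \<eta>1 r0 in auto)
qed

text \<open>After rescaling, the centres of all balls containing x lie in the compact unit ball.
  Finitely many of the neighbourhoods from \<open>local_upper_bound\<close> cover it, which gives
  one radius below which the estimate holds for every centre.\<close>

lemma spherical_density_le:
  assumes c: "\<And>z. d 0 z \<le> 1 \<Longrightarrow> ball_section \<nu> z 1 < c"
  shows "spherical_density d Qm1 \<sigma> x \<le> c"
proof -
  let ?D = "{z. d 0 z \<le> 1}"
  have "\<forall>z\<in>?D. \<exists>er. 0 < fst er \<and> 0 < snd er \<and> (\<forall>r w. 0 < r \<longrightarrow> r < snd er \<longrightarrow> d z w < fst er \<longrightarrow>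
      emeasure \<sigma> (dball d (gmul x (dil r w)) r \<inter> space \<sigma>) \<le> ennreal (r ^ Qm1) * c)"
  proof
    fix z assume "z \<in> ?D"
    then obtain \<eta> r0 where "0 < \<eta>" "0 < r0" "\<And>r w. 0 < r \<Longrightarrow> r < r0 \<Longrightarrow> d z w < \<eta> \<Longrightarrow>
      emeasure \<sigma> (dball d (gmul x (dil r w)) r \<inter> space \<sigma>) \<le> ennreal (r ^ Qm1) * c"
      using local_upper_bound[OF c, of z] by blast
    then show "\<exists>er. 0 < fst er \<and> 0 < snd er \<and> (\<forall>r w. 0 < r \<longrightarrow> r < snd er \<longrightarrow> d z w < fst er \<longrightarrow>
      emeasure \<sigma> (dball d (gmul x (dil r w)) r \<inter> space \<sigma>) \<le> ennreal (r ^ Qm1) * c)"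
      by (intro exI[of _ "(\<eta>, r0)"]) simp
  qed
  from bchoice[OF this] obtain er where er: "\<forall>z\<in>?D. 0 < fst (er z) \<and> 0 < snd (er z) \<and>
      (\<forall>r w. 0 < r \<longrightarrow> r < snd (er z) \<longrightarrow> d z w < fst (er z) \<longrightarrow>
      emeasure \<sigma> (dball d (gmul x (dil r w)) r \<inter> space \<sigma>) \<le> ennreal (r ^ Qm1) * c)" ..
  have "?D \<subseteq> (\<Union>z\<in>?D. {w. d z w < fst (er z)})"
  proof
    fix z assume z: "z \<in> ?D"
    then have "z \<in> {w. d z w < fst (er z)}" using er by simp
    then show "z \<in> (\<Union>z\<in>?D. {w. d z w < fst (er z)})" using z by blast
  qed
  then obtain C where C: "C \<subseteq> ?D" "finite C" "?D \<subseteq> (\<Union>z\<in>C. {w. d z w < fst (er z)})"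
    by (rule compactE_image[OF compact_unit_ball[of 1] open_dist_ball])
  have "0 \<in> ?D" by simp
  then have ne: "C \<noteq> {}" using C(3) by blast
  define r0 where "r0 = Min ((snd \<circ> er) ` C)"
  have r0: "0 < r0" "\<And>z. z \<in> C \<Longrightarrow> r0 \<le> snd (er z)"
    using C ne er by (auto simp: r0_def)
  have "(SUP B\<in>{B. x \<in> B \<and> (\<exists>y r. 0 < r \<and> B = dball d y r) \<and> ddiam d B < 2 * r0}.
        emeasure \<sigma> (B \<inter> space \<sigma>) / ennreal (ddiam d B ^ Qm1 / 2 ^ Qm1)) \<le> c"
  proof (rule SUP_least, clarify)
    fix y r assume xy: "x \<in> dball d y r" and r: "0 < r" and dd: "ddiam d (dball d y r) < 2 * r0"
    have rr: "r < r0" using dd by (simp add: ddiam_dball[OF r])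
    \<comment> \<open>The rescaled centre; that the ball of radius r contains x means that w has
      distance at most 1 from 0.\<close>
    define w where "w = dil (1 / r) (gmul (- x) y)"
    have y: "y = gmul x (dil r w)" unfolding w_def using rescale[OF r] by simp
    have "r * d 0 w \<le> r"
      using dist_scaled[OF r, of x 0 w] xy dm.commute[of x y] by (simp add: dball_iff y)
    then have "w \<in> ?D" using r by simp
    then obtain z where z: "z \<in> C" "d z w < fst (er z)" using C(3) by blast
    then have "emeasure \<sigma> (dball d y r \<inter> space \<sigma>) \<le> ennreal (r ^ Qm1) * c"
      using er C(1) r rr r0(2)[OF z(1)] unfolding y by fastforce
    then show "emeasure \<sigma> (dball d y r \<inter> space \<sigma>) / ennreal (ddiam d (dball d y r) ^ Qm1 / 2 ^ Qm1) \<le> c"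
      unfolding ddiam_power[OF r] using r by (intro divide_le_posI_ennreal) auto
  qed
  then show ?thesis unfolding spherical_density_def
    using r0(1) by (intro INF_lower2[of "2 * r0"]) auto
qed

text \<open>The competitor is the ball of radius r (1 + \<eta>) centred at x
  \<open>\<delta>\<^sub>r\<close> z. It contains the scaled open ball of radius 1 + \<eta>, whose
  section is at least the closed unit section, and it contains x because d 0 z \<le> 1. Its larger
  radius accounts for the divisor (1 + \<eta>)^(Q-1).\<close>

lemma spherical_density_ge:
  assumes z: "d 0 z \<le> 1" and c: "0 \<le> c" "ennreal c < ball_section \<nu> z 1" and \<eta>: "0 < \<eta>"
  shows "ennreal (c / (1 + \<eta>) ^ Qm1) \<le> spherical_density d Qm1 \<sigma> x"
  unfolding spherical_density_def
proof (rule INF_greatest)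
  fix \<epsilon> :: real assume "\<epsilon> \<in> {0<..}"
  then have \<epsilon>: "0 < \<epsilon>" by simp
  let ?B = "{p. d z p < 1 + \<eta>}"
  have Bb: "bounded ?B" by (rule bounded_subset[OF bounded_dist_ball[of z "1 + \<eta>"]]) auto
  have "ball_section \<nu> z 1 \<le> emeasure (hyperplane_measure \<nu>) ?B"
    unfolding ball_section_def using \<eta> open_dist_ball[of z "1 + \<eta>"] by (intro emeasure_mono) auto
  with c(2) have cB: "ennreal c < emeasure (hyperplane_measure \<nu>) ?B" by (rule less_le_trans)
  let ?r = "\<lambda>k. inverse (real (Suc k))"
  have rlim: "?r \<longlonglongrightarrow> 0" by (rule LIMSEQ_inverse_real_of_nat)
  obtain r1 where r1: "0 < r1" "\<And>r p. 0 < r \<Longrightarrow> r < r1 \<Longrightarrow> p \<in> ?B \<Longrightarrow> gmul x (dil r p) \<in> \<Omega>"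
    by (fact small_dilations[OF hypersurface_facts(2,3) Bb])
  have "\<forall>\<^sub>F k in sequentially. ennreal (?r k ^ Qm1) * ennreal c \<le> perimeter gmul (V 1) {p \<in> \<Omega>. f p < 0} (scaled x (?r k) ?B)"
    by (rule perimeter_scaled_ge[OF hypersurface_facts refl open_dist_ball Bb cB _ rlim]) simp
  \<comment> \<open>The first bound keeps the scaled ball inside \<Omega>, the second makes the
    diameter 2 r (1 + \<eta>) smaller than \<epsilon>.\<close>
  moreover have "\<forall>\<^sub>F k in sequentially. ?r k < min r1 (\<epsilon> / (2 * (1 + \<eta>)))"
    using r1(1) \<epsilon> \<eta> by (intro order_tendstoD(2)[OF rlim]) auto
  ultimately have "\<forall>\<^sub>F k in sequentially. ?r k < min r1 (\<epsilon> / (2 * (1 + \<eta>))) \<and>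
      ennreal (?r k ^ Qm1) * ennreal c \<le> perimeter gmul (V 1) {p \<in> \<Omega>. f p < 0} (scaled x (?r k) ?B)"
    by eventually_elim simp
  then obtain k where k: "?r k < min r1 (\<epsilon> / (2 * (1 + \<eta>)))"
      "ennreal (?r k ^ Qm1) * ennreal c \<le> perimeter gmul (V 1) {p \<in> \<Omega>. f p < 0} (scaled x (?r k) ?B)"
    using eventually_happens'[OF sequentially_bot] by blast
  define r where "r = ?r k"
  have r: "0 < r" "r < r1" "r * (2 * (1 + \<eta>)) < \<epsilon>"
    using k(1) \<eta> by (auto simp: r_def pos_less_divide_eq)
  define y where "y = gmul x (dil r z)"
  define s where "s = r * (1 + \<eta>)"
  have s: "0 < s" using r \<eta> by (simp add: s_def)
  have sub: "scaled x r ?B \<subseteq> \<Omega>" using r1(2)[OF r(1,2)] by (auto simp: scaled_def)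
  have "d y x = r * d z 0" using dist_scaled[OF r(1), of x z 0] by (simp add: y_def)
  also have "\<dots> \<le> r * (1 + \<eta>)" using z \<eta> r dm.commute[of 0 z] by (intro mult_left_mono) auto
  finally have xb: "x \<in> dball d y s" by (simp add: dball_iff s_def)
  have "scaled x r ?B \<subseteq> dball d y s"
    unfolding y_def s_def dball_scaled[OF r(1)] by (auto simp: scaled_def)
  then have mono: "emeasure \<sigma> (scaled x r ?B) \<le> emeasure \<sigma> (dball d y s \<inter> space \<sigma>)"
    using sub closed_dist_ball[of y s] hypersurface_facts(2) by (intro emeasure_mono) (auto simp: sets_\<sigma> space_\<sigma> dball_eq)
  have "ennreal (c / (1 + \<eta>) ^ Qm1) = ennreal (r ^ Qm1 * c / s ^ Qm1)"
    using r(1) by (simp add: s_def power_mult_distrib)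
  also have "\<dots> = ennreal (r ^ Qm1 * c) / ennreal (s ^ Qm1)"
    using r(1) c(1) s by (intro divide_ennreal[symmetric]) auto
  also have "ennreal (r ^ Qm1 * c) = ennreal (r ^ Qm1) * ennreal c" using r(1) c(1) by (simp add: ennreal_mult)
  also have "ennreal (r ^ Qm1) * ennreal c \<le> emeasure \<sigma> (dball d y s \<inter> space \<sigma>)"
    by (rule order_trans[OF k(2)[folded r_def, folded \<sigma>_open[OF open_scaled[OF r(1) open_dist_ball] sub]] mono])
  finally have le: "ennreal (c / (1 + \<eta>) ^ Qm1) \<le> emeasure \<sigma> (dball d y s \<inter> space \<sigma>) / ennreal (ddiam d (dball d y s) ^ Qm1 / 2 ^ Qm1)"
    unfolding ddiam_power[OF s] by (auto intro: divide_right_mono_ennreal)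
  have "2 * s < \<epsilon>" using r(3) by (simp add: s_def algebra_simps)
  then have "ddiam d (dball d y s) < \<epsilon>" unfolding ddiam_dball[OF s] .
  then have mem: "dball d y s \<in> {B. x \<in> B \<and> (\<exists>y r. 0 < r \<and> B = dball d y r) \<and> ddiam d B < \<epsilon>}"
    using xb s by blast
  show "ennreal (c / (1 + \<eta>) ^ Qm1) \<le>
      (SUP B\<in>{B. x \<in> B \<and> (\<exists>y r. 0 < r \<and> B = dball d y r) \<and> ddiam d B < \<epsilon>}.
        emeasure \<sigma> (B \<inter> space \<sigma>) / ennreal (ddiam d B ^ Qm1 / 2 ^ Qm1))"
    by (rule order_trans[OF le]) (rule SUP_upper[OF mem])
qed

theorem spherical_density_eq_beta: "spherical_density d Qm1 \<sigma> x = beta V \<iota> d \<nu>"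
proof -
  obtain z where z: "d 0 z \<le> 1" "beta V \<iota> d \<nu> = ball_section \<nu> z 1"
    "\<And>w. d 0 w \<le> 1 \<Longrightarrow> ball_section \<nu> w 1 \<le> ball_section \<nu> z 1"
    by (fact beta_eq_max[OF unit_normal])
  show ?thesis
  proof (rule antisym)
    show "spherical_density d Qm1 \<sigma> x \<le> beta V \<iota> d \<nu>"
    \<comment> \<open>A strictly larger c is what the local bounds require, since they hold for
      neighbouring centres as well.\<close>
    proof (rule dense_ge)
      fix c assume c: "beta V \<iota> d \<nu> < c"
      then show "spherical_density d Qm1 \<sigma> x \<le> c"
        using z(2,3) by (intro spherical_density_le) (metis le_less_trans)
    qed
    show "beta V \<iota> d \<nu> \<le> spherical_density d Qm1 \<sigma> x"
    proof (rule dense_le)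
      fix c assume c: "c < beta V \<iota> d \<nu>"
      then have "c \<noteq> top" by auto
      then obtain c' where c': "c = ennreal c'" "0 \<le> c'" by (cases c) auto
      \<comment> \<open>With c fixed below the maximum, \<eta> = 1 / (n + 1) tends to 0 and the
        divisor tends to 1.\<close>
      have "(\<lambda>n. ennreal (c' / (1 + inverse (real (Suc n))) ^ Qm1)) \<longlonglongrightarrow> ennreal (c' / (1 + 0) ^ Qm1)"
        by (intro tendsto_ennrealI tendsto_intros LIMSEQ_inverse_real_of_nat) auto
      moreover have "ennreal (c' / (1 + inverse (real (Suc n))) ^ Qm1) \<le> spherical_density d Qm1 \<sigma> x" for n
        using c c' z by (intro spherical_density_ge[OF z(1)]) auto
      ultimately have "ennreal (c' / (1 + 0) ^ Qm1) \<le> spherical_density d Qm1 \<sigma> x"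
        by (intro LIMSEQ_le_const2) auto
      then show "c \<le> spherical_density d Qm1 \<sigma> x" using c' by simp
    qed
  qed
qed

end

end

theorem theorem3p1:
  fixes V :: "nat \<Rightarrow> 'a::euclidean_space set"
    and \<iota> :: nat
    and gmul :: "'a \<Rightarrow> 'a \<Rightarrow> 'a"
    and d :: "'a \<Rightarrow> 'a \<Rightarrow> real"
    and \<Omega> S :: "'a set"
    and f :: "'a \<Rightarrow> real"
    and \<sigma> :: "'a measure"
    and x :: 'a
  assumes "stratified_group V \<iota> gmul"
    and "homogeneous_distance V \<iota> gmul d"
    and "regular_hypersurface gmul (V 1) \<Omega> f S"
    and "perimeter_measure gmul (V 1) \<Omega> f \<sigma>"
    and "x \<in> S"
  shows "spherical_density d (hom_dim V \<iota> - 1) \<sigma> x =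
    beta V \<iota> d (horizontal_normal gmul (V 1) f x)"
proof -
  interpret stratified_group V \<iota> gmul by fact
  interpret homogeneous_distance V \<iota> gmul d by fact
  interpret homogeneous_group V \<iota> gmul d ..
  show ?thesis using assms(3-5) by (rule spherical_density_eq_beta)
qed

end
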